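(* Let $q$ be an odd prime power, $n\ge1$, and let $M$ be chosen uniformly at random from $\mathrm{Sp}(2n,q)$. Then for every integer $0\le h<2n-1$ and every monic $f\in\mathbb{F}_q[T]$ of degree $2n$, $$\left|\mathbb{P}_{M\in\mathrm{Sp}(2n,q)}\big(\det(T-M)\in I(f;h)\big)-\frac{q^{h+1}}{q^{2n}}\right|\le q^{-\frac{n^2}{4n-2h-2}}\,q^{\frac n2}\Big(1+\frac1{q^2-1}\Big)^n\binom{5n-2h-3}{n}.$$
   Context: $\mathrm{Sp}(2n,q)=\{g\in\mathrm{GL}(2n,\mathbb{F}_q):g^tJg=J\}$ for a fixed invertible antisymmetric $2n\times2n$ matrix $J$ over $\mathbb{F}_q$ (different choices give conjugate groups), with uniform probability measure. For a monic $f$ of degree $m$ and $0\le h\le m-1$, $I(f;h)=\{g\in\mathbb{F}_q[T]\text{ monic}:\deg(f-g)\le h\}$ (with $\deg0=-\infty$). *)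

theory Defs
  imports "Jordan_Normal_Form.Char_Poly" "HOL-Computational_Algebra.Polynomial"
begin

definition Sp :: "nat \<Rightarrow> 'a::field mat \<Rightarrow> 'a mat set" where
  "Sp m J = {g \<in> carrier_mat m m. det g \<noteq> 0 \<and> transpose_mat g * J * g = J}"

text \<open>I(f;h): monic g with deg(f - g) \<le> h (deg 0 = -infinity, so g = f is included).\<close>
definition I_int :: "'a::field poly \<Rightarrow> nat \<Rightarrow> 'a poly set" where
  "I_int f h = {g. lead_coeff g = 1 \<and> (f - g = 0 \<or> degree (f - g) \<le> h)}"

end

theory Submission
  imports Defs "HOL-Computational_Algebra.Formal_Power_Series"
begin

text \<open>The characteristic polynomial of a symplectic \<open>M\<close> is palindromic, that is of the form
  \<open>z^n * Q (z + 1/z)\<close> with \<open>Q\<close> monic of degree \<open>n\<close>, and for \<open>k = 2 * n - 1 - h < n\<close> the condition on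
  \<open>M\<close> prescribes the \<open>k\<close> coefficients of \<open>Q\<close> below the leading one. (For \<open>k \<ge> n\<close> the right-hand side is at
  least \<open>1\<close>.) A uniformly random vector generates under \<open>M\<close> a cyclic subspace \<open>W\<close>; the flag of \<open>W\<close> and its
  radical splits \<open>M\<close> into blocks, and by Witt's theorem the remaining symplectic block is equidistributed.
  This yields for the mean \<open>W n \<psi>\<close> of \<open>\<psi> Q\<close> the recursion
  \<open>q^(2n) * W n \<psi> = (\<Sum>A B. q^(deg A) * \<eta> B * W (n - deg A - deg B) (\<lambda>Q. \<psi> (A * B * Q)))\<close>
  over monic \<open>A\<close>, \<open>B\<close>, where \<open>\<eta> B\<close> is the product of the quadratic characters of \<open>B 2\<close> and \<open>B (- 2)\<close>.
  If \<open>\<psi>\<close> is the centred indicator of the prescribed coefficients, the sum over \<open>A\<close> vanishes for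
  \<open>deg A \<ge> k\<close> and the sum over \<open>B\<close> for \<open>deg B \<ge> k + 2\<close>. Hence \<open>\<bar>W n \<psi>\<bar>\<close> is at most the coefficient of a
  product of \<open>2 * k\<close> \<open>q\<close>-exponential series, which decays like \<open>q^(- n^2 / (2 * k))\<close>.\<close>

section \<open>Gram matrices and extension of isometric embeddings\<close>

text \<open>A pair of an isometry \<open>M\<close> and a vector \<open>v\<close> is classified by
  the sequence of form values of \<open>v\<close> and \<open>M^k v\<close>, by the monic generator
  \<open>s\<close> of the annihilator of that sequence, and by the cofactor \<open>t\<close> in the
  minimal polynomial \<open>s * t\<close> of \<open>v\<close>. Witt's theorem makes the number of
  pairs of each admissible type equal to the order of the isometry group, so no group order is ever
  computed. The weight \<open>q^(deg A) * \<eta> B\<close> comes from two counts: odd sequences with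
  given annihilator, and \<open>t\<close> with given norm \<open>t * dual_poly t\<close>. The second
  is a divisor sum of \<open>\<eta>\<close>, the character of the quadratic extension generated by
  \<open>z\<close> over the rational functions in \<open>u = z + 1/z\<close>, of discriminant
  \<open>u^2 - 4\<close>. Finding it directly would require the splitting of primes, hence quadratic
  reciprocity; instead an inequality is proved whose two sides have the same total. The vector
  \<open>v = 0\<close> reproduces the unknown mean for the standard form; this is why the factor
  \<open>q^(2 * n) - 1\<close>, and with it the denominators of the \<open>q\<close>-exponential
  series, appear.\<close>

definition append_col :: "'a mat \<Rightarrow> 'a vec \<Rightarrow> 'a mat" where
  "append_col Y x = mat (dim_row Y) (Suc (dim_col Y)) (\<lambda>(i,j). if j < dim_col Y then Y $$ (i,j) else x $ i)"

lemma append_col_carrier[simp]: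
  "Y \<in> carrier_mat d w \<Longrightarrow> append_col Y x \<in> carrier_mat d (Suc w)"
  unfolding append_col_def by auto

lemma col_append_col:
  assumes "Y \<in> carrier_mat d w" "x \<in> carrier_vec d"
  shows "b < w \<Longrightarrow> col (append_col Y x) b = col Y b" "col (append_col Y x) w = x"
  using assms unfolding append_col_def by (auto intro!: eq_vecI)

lemma mult_append_col:
  assumes "A \<in> carrier_mat r d" "Y \<in> carrier_mat d w" "x \<in> carrier_vec d"
  shows "A * append_col Y x = append_col (A * Y) (A *\<^sub>v x)"
proof (rule eq_matI)
  fix i j assume "i < dim_row (append_col (A * Y) (A *\<^sub>v x))" "j < dim_col (append_col (A * Y) (A *\<^sub>v x))"
  then have ij: "i < r" "j < Suc w" using assms by (auto simp: append_col_def)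
  show "(A * append_col Y x) $$ (i,j) = append_col (A * Y) (A *\<^sub>v x) $$ (i,j)"
  proof (cases "j < w")
    case True
    then show ?thesis using ij assms col_append_col(1)[OF assms(2,3) True]
      by (auto simp: append_col_def)
  next
    case False
    then have "j = w" using ij by auto
    then show ?thesis using ij assms col_append_col(2)[OF assms(2,3)]
      by (auto simp: append_col_def)
  qed
qed (use assms in \<open>auto simp: append_col_def\<close>)

text \<open>\<open>Y * L\<close> projects onto the column span of \<open>Y\<close>, so
  \<open>ne\<close> says that \<open>x\<close> lies outside that span. The new row is a functional
  that kills the span and takes the value 1 at \<open>x\<close>; the old rows are corrected by
  multiples of it.\<close>

lemma left_inverse_append_col:
  fixes Y :: "'a::field mat"
  assumes Y: "Y \<in> carrier_mat d w" and L: "L \<in> carrier_mat w d" and LY: "L * Y = 1\<^sub>m w"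
    and x: "x \<in> carrier_vec d" and ne: "x \<noteq> Y *\<^sub>v (L *\<^sub>v x)"
  shows "\<exists>L' \<in> carrier_mat (Suc w) d. L' * append_col Y x = 1\<^sub>m (Suc w)"
proof -
  obtain i where i: "i < d" and xi: "x $ i \<noteq> (Y *\<^sub>v (L *\<^sub>v x)) $ i"
    using ne x Y by (metis (no_types, lifting) eq_vecI carrier_vecD dim_mult_mat_vec carrier_matD(1))
  define \<delta> where "\<delta> = x $ i - (Y *\<^sub>v (L *\<^sub>v x)) $ i"
  have \<delta>: "\<delta> \<noteq> 0" using xi by (simp add: \<delta>_def)
  \<comment> \<open>A coordinate of the defect \<open>y - Y (L y)\<close> in which \<open>x\<close>
    has a nonzero defect, scaled and written as a row vector.\<close>
  define r where "r = inverse \<delta> \<cdot>\<^sub>v (unit_vec d i - L\<^sup>T *\<^sub>v row Y i)"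
  have r: "r \<in> carrier_vec d" using L Y i unfolding r_def by auto
  have rdot: "r \<bullet> y = inverse \<delta> * (y $ i - (Y *\<^sub>v (L *\<^sub>v y)) $ i)" if y: "y \<in> carrier_vec d" for y
  proof -
    have rY: "row Y i \<in> carrier_vec w" using Y i by auto
    have "(L\<^sup>T *\<^sub>v row Y i) \<bullet> y = row Y i \<bullet> (L *\<^sub>v y)"
      using transpose_vec_mult_scalar[OF L y rY] .
    also have "\<dots> = (Y *\<^sub>v (L *\<^sub>v y)) $ i" using Y i by auto
    finally have 1: "(L\<^sup>T *\<^sub>v row Y i) \<bullet> y = (Y *\<^sub>v (L *\<^sub>v y)) $ i" .
    have "(unit_vec d i - L\<^sup>T *\<^sub>v row Y i) \<bullet> y = unit_vec d i \<bullet> y - (L\<^sup>T *\<^sub>v row Y i) \<bullet> y"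
      by (rule minus_scalar_prod_distrib[of _ d]) (use L y rY in \<open>auto intro!: mult_mat_vec_carrier[of _ _ w]\<close>)
    then show ?thesis unfolding r_def using y i 1 L by (subst scalar_prod_smult_left) auto
  qed
  have rx: "r \<bullet> x = 1" using rdot[OF x] \<delta> by (simp add: \<delta>_def)
  have Lcol: "L *\<^sub>v col Y b = unit_vec w b" if "b < w" for b
  proof -
    have "L *\<^sub>v col Y b = col (L * Y) b" using col_mult2[OF L Y that] by simp
    then show ?thesis using LY that by simp
  qed
  have ry: "r \<bullet> col Y b = 0" if b: "b < w" for b
  proof -
    have "Y *\<^sub>v (L *\<^sub>v col Y b) = col Y b" using Lcol[OF b] Y b
      by (auto intro!: eq_vecI)
    then show ?thesis using rdot[of "col Y b"] Y b by simp
  qed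
  define L' where "L' = mat\<^sub>r (Suc w) d (\<lambda>a. if a < w then row L a - (row L a \<bullet> x) \<cdot>\<^sub>v r else r)"
  have L': "L' \<in> carrier_mat (Suc w) d" unfolding L'_def by auto
  have rowL': "row L' a = (if a < w then row L a - (row L a \<bullet> x) \<cdot>\<^sub>v r else r)" if "a < Suc w" for a
    unfolding L'_def using that r L by (auto intro!: eq_vecI)
  have dotL': "row L' a \<bullet> y = (if a < w then row L a \<bullet> y - (row L a \<bullet> x) * (r \<bullet> y) else r \<bullet> y)"
    if a: "a < Suc w" and y: "y \<in> carrier_vec d" for a y
  proof (cases "a < w")
    case True
    have "(row L a - (row L a \<bullet> x) \<cdot>\<^sub>v r) \<bullet> y = row L a \<bullet> y - ((row L a \<bullet> x) \<cdot>\<^sub>v r) \<bullet> y"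
      by (rule minus_scalar_prod_distrib[of _ d]) (use True L r y in auto)
    then show ?thesis using True rowL'[OF a] r y by (simp add: scalar_prod_smult_left)
  qed (use rowL'[OF a] in simp)
  have "L' * append_col Y x = 1\<^sub>m (Suc w)"
  proof (rule eq_matI)
    fix a b assume "a < dim_row (1\<^sub>m (Suc w))" "b < dim_col (1\<^sub>m (Suc w))"
    then have ab: "a < Suc w" "b < Suc w" by auto
    have e: "(L' * append_col Y x) $$ (a,b) = row L' a \<bullet> col (append_col Y x) b"
      using ab L' append_col_carrier[OF Y, of x] by auto
    have rowcol: "row L a \<bullet> col Y b = (if a = b then 1 else 0)" if "a < w" "b < w"
    proof -
      have "(L * Y) $$ (a,b) = (if a = b then 1 else 0)" using LY that by simp
      then show ?thesis using that L Y by simp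
    qed
    show "(L' * append_col Y x) $$ (a,b) = 1\<^sub>m (Suc w) $$ (a,b)"
    proof (cases "b < w")
      case True
      then show ?thesis unfolding e col_append_col(1)[OF Y x True]
        using dotL'[OF ab(1), of "col Y b"] Y True ry rowcol ab by (auto simp: less_Suc_eq)
    next
      case False
      then have [simp]: "b = w" using ab by auto
      show ?thesis unfolding e using col_append_col(2)[OF Y x] dotL'[OF ab(1) x] ab rx by (auto simp: less_Suc_eq)
    qed
  qed (use L' append_col_carrier[OF Y, of x] in auto)
  then show ?thesis using L' by blast
qed

text \<open>The left inverse is built column by column. If the last column \<open>x\<close> were in
  the span of the others, the vector with entries \<open>L x\<close> followed by \<open>-1\<close>
  would lie in the kernel.\<close>

lemma inj_imp_left_inverse:
  fixes Y :: "'a::field mat"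
  assumes Y: "Y \<in> carrier_mat d w"
    and inj: "\<And>a. a \<in> carrier_vec w \<Longrightarrow> Y *\<^sub>v a = 0\<^sub>v d \<Longrightarrow> a = 0\<^sub>v w"
  shows "\<exists>L \<in> carrier_mat w d. L * Y = 1\<^sub>m w"
  using assms
proof (induction w arbitrary: Y)
  case 0
  show ?case by (rule bexI[of _ "0\<^sub>m 0 d"]) (use 0 in auto)
next
  case (Suc w)
  define Z where "Z = mat d w (\<lambda>(i,j). Y $$ (i,j))"
  define x where "x = col Y w"
  have Z: "Z \<in> carrier_mat d w" and x: "x \<in> carrier_vec d" using Suc.prems by (auto simp: Z_def x_def)
  have Yeq: "Y = append_col Z x" unfolding append_col_def Z_def x_def
    using Suc.prems(1) by (auto intro!: eq_matI simp: less_Suc_eq)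
  have ext: "Y *\<^sub>v vec (Suc w) (\<lambda>i. if i < w then a $ i else c) = Z *\<^sub>v a + c \<cdot>\<^sub>v x"
    if a: "a \<in> carrier_vec w" for a c
  proof (rule eq_vecI)
    fix i assume "i < dim_vec (Z *\<^sub>v a + c \<cdot>\<^sub>v x)"
    then have i: "i < d" using x by auto
    show "(Y *\<^sub>v vec (Suc w) (\<lambda>i. if i < w then a $ i else c)) $ i = (Z *\<^sub>v a + c \<cdot>\<^sub>v x) $ i"
      using i a Suc.prems(1) Z x by (simp add: scalar_prod_def Z_def x_def)
  qed (use Suc.prems(1) Z x in auto)
  have "\<exists>L \<in> carrier_mat w d. L * Z = 1\<^sub>m w"
  proof (rule Suc.IH[OF Z])
    fix a assume a: "a \<in> carrier_vec w" and "Z *\<^sub>v a = 0\<^sub>v d"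
    then have "Y *\<^sub>v vec (Suc w) (\<lambda>i. if i < w then a $ i else 0) = 0\<^sub>v d" using ext[OF a, of 0] x by auto
    then have "vec (Suc w) (\<lambda>i. if i < w then a $ i else 0) = 0\<^sub>v (Suc w)" by (intro Suc.prems(2)) auto
    then have "vec (Suc w) (\<lambda>i. if i < w then a $ i else 0) $ i = 0" if "i < w" for i using that by simp
    then show "a = 0\<^sub>v w" using a by (auto intro!: eq_vecI)
  qed
  then obtain L where L: "L \<in> carrier_mat w d" "L * Z = 1\<^sub>m w" by blast
  have "x \<noteq> Z *\<^sub>v (L *\<^sub>v x)"
  proof
    assume h: "x = Z *\<^sub>v (L *\<^sub>v x)"
    have "Z *\<^sub>v (L *\<^sub>v x) + (-1) \<cdot>\<^sub>v x = x + (-1) \<cdot>\<^sub>v x" using h by simp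
    also have "\<dots> = 0\<^sub>v d" using x by (auto intro!: eq_vecI)
    finally have "Y *\<^sub>v vec (Suc w) (\<lambda>i. if i < w then (L *\<^sub>v x) $ i else -1) = 0\<^sub>v d"
      using ext[of "L *\<^sub>v x" "-1"] L x by auto
    then have "vec (Suc w) (\<lambda>i. if i < w then (L *\<^sub>v x) $ i else -1) = 0\<^sub>v (Suc w)" by (intro Suc.prems(2)) auto
    then have "vec (Suc w) (\<lambda>i. if i < w then (L *\<^sub>v x) $ i else -1) $ w = 0" by simp
    then show False by simp
  qed
  then show ?case unfolding Yeq using left_inverse_append_col[OF Z L x] by blast
qed

section \<open>Counting vectors over a finite field\<close>

lemma carrier_vec_bij:
  "bij_betw (\<lambda>f. vec n f) (PiE {..<n} (\<lambda>_. UNIV)) (carrier_vec n :: 'a vec set)"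
  by (rule bij_betwI[where g="\<lambda>v. restrict (\<lambda>i. v $ i) {..<n}"])
    (auto intro!: eq_vecI ext simp: PiE_def extensional_def)

lemma finite_carrier_vec: "finite (carrier_vec n :: 'a::finite vec set)"
  using bij_betw_finite[OF carrier_vec_bij[of n, where 'a='a]] by (auto intro!: finite_PiE)

lemma card_carrier_vec: "card (carrier_vec n :: 'a::finite vec set) = card (UNIV :: 'a set) ^ n"
  using bij_betw_same_card[OF carrier_vec_bij[of n, where 'a='a]] by (simp add: card_PiE)

lemma finite_carrier_mat: "finite (carrier_mat n m :: 'a::finite mat set)"
proof -
  have "inj_on (\<lambda>A. map (\<lambda>i. row A i) [0..<n]) (carrier_mat n m :: 'a mat set)"
  proof (rule inj_onI)
    fix A B :: "'a mat" assume A: "A \<in> carrier_mat n m" "B \<in> carrier_mat n m"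
      and "map (\<lambda>i. row A i) [0..<n] = map (\<lambda>i. row B i) [0..<n]"
    then have "row A i = row B i" if "i < n" for i using that by auto
    then show "A = B" using A by (intro eq_rowI) auto
  qed
  moreover have "(\<lambda>A. map (\<lambda>i. row A i) [0..<n]) ` (carrier_mat n m :: 'a mat set)
      \<subseteq> {xs. set xs \<subseteq> carrier_vec m \<and> length xs = n}" by auto
  ultimately show ?thesis
    by (rule inj_on_finite) (use finite_lists_length_eq[OF finite_carrier_vec[of m], of n] in simp)
qed

lemma det_nonzero_inverse:
  fixes J :: "'a::field mat"
  assumes J: "J \<in> carrier_mat d d" and "det J \<noteq> 0"
  obtains K where "K \<in> carrier_mat d d" "J * K = 1\<^sub>m d" "K * J = 1\<^sub>m d"
proof -
  have "J \<in> Units (ring_mat TYPE('a) d ())" by (rule det_non_zero_imp_unit[OF assms])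
  then obtain K where "K \<in> carrier_mat d d" "K * J = 1\<^sub>m d" "J * K = 1\<^sub>m d"
    unfolding Units_def ring_mat_def by auto
  then show ?thesis using that by blast
qed

lemma inverse_det_nonzero:
  fixes J :: "'a::field mat"
  assumes "J \<in> carrier_mat d d" "K \<in> carrier_mat d d" "J * K = 1\<^sub>m d"
  shows "det J \<noteq> 0"
  using det_mult[OF assms(1,2)] assms(3) by auto

text \<open>The right inverse makes \<open>A\<close> surjective, so its fibres are translates of the
  kernel, and \<open>q^w\<close> fibres of equal size exhaust the \<open>q^d\<close> vectors. The
  product form avoids a division in the natural numbers.\<close>

lemma card_fibre_right_invertible:
  fixes A :: "'a::{finite,field} mat"
  assumes A: "A \<in> carrier_mat w d" and R: "R \<in> carrier_mat d w" and AR: "A * R = 1\<^sub>m w"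
    and c: "c \<in> carrier_vec w"
  shows "card {x \<in> carrier_vec d. A *\<^sub>v x = c} * card (UNIV :: 'a set) ^ w = card (UNIV :: 'a set) ^ d"
proof -
  define S where "S c = {x \<in> carrier_vec d. A *\<^sub>v x = c}" for c
  have cards: "card (S c) = card (S (0\<^sub>v w))" if c: "c \<in> carrier_vec w" for c
  proof (rule bij_betw_same_card[symmetric])
    have ARc: "A *\<^sub>v (R *\<^sub>v c) = c" using c AR assoc_mult_mat_vec[OF A R c] by simp
    have Rc: "R *\<^sub>v c \<in> carrier_vec d" using R c by simp
    show "bij_betw (\<lambda>x. x + R *\<^sub>v c) (S (0\<^sub>v w)) (S c)"
    proof (rule bij_betwI[where g="\<lambda>x. x - R *\<^sub>v c"])
      show "(\<lambda>x. x + R *\<^sub>v c) \<in> S (0\<^sub>v w) \<rightarrow> S c"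
        unfolding S_def using Rc by (auto simp: mult_add_distrib_mat_vec[OF A _ Rc] ARc c)
      show "(\<lambda>x. x - R *\<^sub>v c) \<in> S c \<rightarrow> S (0\<^sub>v w)"
      proof
        fix x assume "x \<in> S c"
        then have x: "x \<in> carrier_vec d" "A *\<^sub>v x = c" by (auto simp: S_def)
        have "A *\<^sub>v (x - R *\<^sub>v c) = c - c"
          using mult_minus_distrib_mat_vec[OF A x(1) Rc] ARc x(2) by simp
        then show "x - R *\<^sub>v c \<in> S (0\<^sub>v w)" using x(1) Rc c by (simp add: S_def)
      qed
      have cancel: "x + R *\<^sub>v c - R *\<^sub>v c = x" "x - R *\<^sub>v c + R *\<^sub>v c = x" if "x \<in> carrier_vec d" for x
      proof -
        have d: "dim_vec x = d" "dim_vec (R *\<^sub>v c) = d" using that Rc carrier_vecD by blast+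
        show "x + R *\<^sub>v c - R *\<^sub>v c = x" "x - R *\<^sub>v c + R *\<^sub>v c = x"
          by (rule eq_vecI; simp only: index_add_vec index_minus_vec d add_diff_cancel_right' diff_add_cancel)+
      qed
      show "(x + R *\<^sub>v c) - R *\<^sub>v c = x" if "x \<in> S (0\<^sub>v w)" for x
        using that cancel(1) by (simp add: S_def)
      show "(x - R *\<^sub>v c) + R *\<^sub>v c = x" if "x \<in> S c" for x
        using that cancel(2) by (simp add: S_def)
    qed
  qed
  have "card (carrier_vec d :: 'a vec set) = card (\<Union>c\<in>carrier_vec w. S c)"
    using A by (intro arg_cong[where f=card]) (auto simp: S_def)
  also have "\<dots> = (\<Sum>c\<in>carrier_vec w. card (S c))"
    by (rule card_UN_disjoint) (auto simp: S_def finite_carrier_vec intro: finite_subset[OF _ finite_carrier_vec[of d]])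
  also have "\<dots> = card (carrier_vec w :: 'a vec set) * card (S (0\<^sub>v w))"
    using sum.cong[OF refl cards, of "carrier_vec w" "\<lambda>c. c"] by (simp only: sum_constant of_nat_id)
  also have "card (S (0\<^sub>v w)) = card (S c)" by (rule cards[OF c, symmetric])
  finally show ?thesis unfolding card_carrier_vec S_def by (simp only: mult.commute)
qed

section \<open>Gram matrices with respect to an antisymmetric form\<close>

lemma gram_index:
  assumes "Y \<in> carrier_mat d w" "J \<in> carrier_mat d d" "a < w" "b < w"
  shows "(Y\<^sup>T * J * Y) $$ (a,b) = col Y a \<bullet> (J *\<^sub>v col Y b)"
proof -
  have 1: "Y\<^sup>T * J * Y = Y\<^sup>T * (J * Y)"
    by (rule assoc_mult_mat[of _ w d _ d _ w]) (use assms in auto)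
  have 2: "col (J * Y) b = J *\<^sub>v col Y b"
    by (rule col_mult2[OF assms(2,1,4)])
  have "(Y\<^sup>T * (J * Y)) $$ (a,b) = row (Y\<^sup>T) a \<bullet> col (J * Y) b"
    by (rule index_mult_mat(1)) (use assms in auto)
  then show ?thesis unfolding 1 2 using assms by simp
qed

lemma alternating_self:
  fixes J :: "'a::field mat"
  assumes "(2::'a) \<noteq> 0" "J \<in> carrier_mat d d" "J\<^sup>T = - J" "x \<in> carrier_vec d"
  shows "x \<bullet> (J *\<^sub>v x) = 0"
proof -
  have "x \<bullet> (J *\<^sub>v x) = (J\<^sup>T *\<^sub>v x) \<bullet> x"
    using transpose_vec_mult_scalar[OF assms(2,4,4)] by simp
  also have "\<dots> = - ((J *\<^sub>v x) \<bullet> x)" using assms by (simp add: uminus_mult_mat_vec)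
  also have "(J *\<^sub>v x) \<bullet> x = x \<bullet> (J *\<^sub>v x)" using assms by (intro comm_scalar_prod[of _ d]) auto
  finally have "2 * (x \<bullet> (J *\<^sub>v x)) = 0" by simp
  then show ?thesis using assms(1) by simp
qed

lemma antisymmetric_swap:
  fixes J :: "'a::field mat"
  assumes "J \<in> carrier_mat d d" "J\<^sup>T = - J" "x \<in> carrier_vec d" "y \<in> carrier_vec d"
  shows "x \<bullet> (J *\<^sub>v y) = - (y \<bullet> (J *\<^sub>v x))"
proof -
  have "x \<bullet> (J *\<^sub>v y) = (J\<^sup>T *\<^sub>v x) \<bullet> y"
    using transpose_vec_mult_scalar[OF assms(1,4,3)] by simp
  also have "\<dots> = - ((J *\<^sub>v x) \<bullet> y)" using assms by (simp add: uminus_mult_mat_vec)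
  also have "(J *\<^sub>v x) \<bullet> y = y \<bullet> (J *\<^sub>v x)" using assms by (intro comm_scalar_prod[of _ d]) auto
  finally show ?thesis .
qed

text \<open>The standard frame. A Witt extension of it sends the first unit vectors to given
  columns, and a matrix that respects it can be read off in blocks.\<close>

definition first_cols :: "nat \<Rightarrow> nat \<Rightarrow> 'a::{zero,one} mat" where
  "first_cols d w = mat d w (\<lambda>(i,j). if i = j then 1 else 0)"

lemma first_cols_carrier[simp]: "first_cols d w \<in> carrier_mat d w"
  unfolding first_cols_def by auto

lemma col_first_cols: "b < w \<Longrightarrow> col (first_cols d w) b = unit_vec d b"
  unfolding first_cols_def by (auto intro!: eq_vecI simp: unit_vec_def)

lemma first_cols_Suc: "w < d \<Longrightarrow> first_cols d (Suc w) = append_col (first_cols d w) (unit_vec d w)"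
  unfolding first_cols_def append_col_def by (auto intro!: eq_matI simp: less_Suc_eq)

lemma first_cols_left_inverse: "w \<le> d \<Longrightarrow> (first_cols d w)\<^sup>T * first_cols d w = (1\<^sub>m w :: 'a::field mat)"
proof (rule eq_matI)
  fix a b assume "w \<le> d" "a < dim_row (1\<^sub>m w :: 'a mat)" "b < dim_col (1\<^sub>m w :: 'a mat)"
  then have ab: "a < w" "b < w" "a < d" "b < d" by auto
  have "((first_cols d w)\<^sup>T * first_cols d w) $$ (a,b) = row ((first_cols d w)\<^sup>T) a \<bullet> (col (first_cols d w) b :: 'a vec)"
    by (rule index_mult_mat(1)) (use ab in \<open>auto simp: first_cols_def\<close>)
  also have "row ((first_cols d w)\<^sup>T) a = (col (first_cols d w) a :: 'a vec)"
    by (rule row_transpose) (use ab in \<open>auto simp: first_cols_def\<close>)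
  finally show "((first_cols d w)\<^sup>T * first_cols d w) $$ (a,b) = (1\<^sub>m w :: 'a mat) $$ (a,b)"
    using ab by (auto simp: col_first_cols)
qed (auto simp: first_cols_def)

context
  fixes J :: "'a::{finite,field} mat" and d :: nat
  assumes J: "J \<in> carrier_mat d d" and detJ: "det J \<noteq> 0"
begin

text \<open>Non-degeneracy of \<open>J\<close> turns independent columns into independent linear
  conditions: with \<open>K\<close> the inverse of \<open>J\<close>, a right inverse of
  \<open>Y\<^sup>T * J\<close> is \<open>K * L\<^sup>T\<close>.\<close>

lemma card_gram_fibre:
  assumes Y: "Y \<in> carrier_mat d w" and L: "L \<in> carrier_mat w d" and LY: "L * Y = 1\<^sub>m w"
    and c: "c \<in> carrier_vec w"
  shows "card {x \<in> carrier_vec d. Y\<^sup>T *\<^sub>v (J *\<^sub>v x) = c} * card (UNIV :: 'a set) ^ w = card (UNIV :: 'a set) ^ d"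
proof -
  obtain K where K: "K \<in> carrier_mat d d" "J * K = 1\<^sub>m d" using det_nonzero_inverse[OF J detJ] .
  have "(Y\<^sup>T * J) * (K * L\<^sup>T) = Y\<^sup>T * (J * (K * L\<^sup>T))"
    by (rule assoc_mult_mat[of _ w d _ d _ w]) (use Y L J K in auto)
  also have "J * (K * L\<^sup>T) = (J * K) * L\<^sup>T"
    by (rule assoc_mult_mat[symmetric, of _ d d _ d _ w]) (use Y L J K in auto)
  also have "Y\<^sup>T * ((J * K) * L\<^sup>T) = (L * Y)\<^sup>T" using K Y L by (simp add: transpose_mult[OF L Y])
  finally have "(Y\<^sup>T * J) * (K * L\<^sup>T) = 1\<^sub>m w" using LY by simp
  moreover have "Y\<^sup>T * J \<in> carrier_mat w d" "K * L\<^sup>T \<in> carrier_mat d w" using Y L J K by auto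
  moreover have "(Y\<^sup>T * J) *\<^sub>v x = Y\<^sup>T *\<^sub>v (J *\<^sub>v x)" if "x \<in> carrier_vec d" for x
    using that Y J by (intro assoc_mult_mat_vec) auto
  ultimately show ?thesis using card_fibre_right_invertible[of "Y\<^sup>T * J" w d "K * L\<^sup>T" c] c
    by (simp cong: conj_cong)
qed

text \<open>A solution inside the span is determined by its coordinates \<open>L x\<close>, and the
  condition on the coordinates sees only the Gram matrix.\<close>

lemma card_gram_fibre_span:
  assumes Y: "Y \<in> carrier_mat d w" and L: "L \<in> carrier_mat w d" and LY: "L * Y = 1\<^sub>m w"
  shows "card {x \<in> carrier_vec d. Y\<^sup>T *\<^sub>v (J *\<^sub>v x) = c \<and> x = Y *\<^sub>v (L *\<^sub>v x)}
    = card {a \<in> carrier_vec w. (Y\<^sup>T * J * Y) *\<^sub>v a = c}"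
proof (rule bij_betw_same_card[symmetric], rule bij_betwI[where f="\<lambda>a. Y *\<^sub>v a" and g="\<lambda>x. L *\<^sub>v x"])
  have LYa: "L *\<^sub>v (Y *\<^sub>v a) = a" if "a \<in> carrier_vec w" for a
    using that LY assoc_mult_mat_vec[OF L Y that] by simp
  have gram: "(Y\<^sup>T * J * Y) *\<^sub>v a = Y\<^sup>T *\<^sub>v (J *\<^sub>v (Y *\<^sub>v a))" if "a \<in> carrier_vec w" for a
    using that Y J by (simp add: assoc_mult_mat_vec[of _ w d _ w] assoc_mult_mat_vec[of _ w d _ d])
  show "(\<lambda>a. Y *\<^sub>v a) \<in> {a \<in> carrier_vec w. (Y\<^sup>T * J * Y) *\<^sub>v a = c} \<rightarrow>
    {x \<in> carrier_vec d. Y\<^sup>T *\<^sub>v (J *\<^sub>v x) = c \<and> x = Y *\<^sub>v (L *\<^sub>v x)}"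
    using Y by (auto simp: LYa gram)
  show "(\<lambda>x. L *\<^sub>v x) \<in> {x \<in> carrier_vec d. Y\<^sup>T *\<^sub>v (J *\<^sub>v x) = c \<and> x = Y *\<^sub>v (L *\<^sub>v x)} \<rightarrow>
    {a \<in> carrier_vec w. (Y\<^sup>T * J * Y) *\<^sub>v a = c}"
    using L by (auto simp: gram)
qed (use LY in \<open>auto simp: assoc_mult_mat_vec[OF L Y, symmetric]\<close>)

end

text \<open>The number of solutions \<open>x\<close> outside the span of \<open>Y\<close> depends only on the Gram matrix of \<open>Y\<close>
  and on \<open>c\<close>, so a solution exists because one exists for the first columns of the identity
  with respect to \<open>G\<close>.\<close>
lemma witt_extension:
  fixes J G Y :: "'a::{finite,field} mat"
  assumes two: "(2::'a) \<noteq> 0"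
    and J: "J \<in> carrier_mat d d" "J\<^sup>T = - J" "det J \<noteq> 0"
    and G: "G \<in> carrier_mat d d" "G\<^sup>T = - G" "det G \<noteq> 0"
    and w: "w \<le> d"
    and Y: "Y \<in> carrier_mat d w" and L: "L \<in> carrier_mat w d" "L * Y = 1\<^sub>m w"
    and gram: "Y\<^sup>T * J * Y = (first_cols d w)\<^sup>T * G * first_cols d w"
  shows "\<exists>P \<in> carrier_mat d d. P\<^sup>T * J * P = G \<and> P * first_cols d w = Y"
  using w Y L gram
proof (induction "d - w" arbitrary: w Y L)
  case 0
  then have [simp]: "w = d" by simp
  have "first_cols d d = (1\<^sub>m d :: 'a mat)" unfolding first_cols_def by (auto intro!: eq_matI)
  then show ?case using 0 G by (intro bexI[of _ Y]) auto
next
  case (Suc k)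
  have wd: "w < d" using Suc.hyps(2) by simp
  define E :: "'a mat" where "E = first_cols d w"
  have E: "E \<in> carrier_mat d w" "E\<^sup>T \<in> carrier_mat w d" "E\<^sup>T * E = 1\<^sub>m w"
    using first_cols_left_inverse[of w d, where 'a='a] wd by (auto simp: E_def)
  \<comment> \<open>The pairings under \<open>G\<close> of the earlier unit vectors with the next
    one. That next vector is a solution for the frame \<open>E\<close> outside its span, because row
    \<open>w\<close> of \<open>E\<close> is zero.\<close>
  define c where "c = E\<^sup>T *\<^sub>v (G *\<^sub>v unit_vec d w)"
  have c: "c \<in> carrier_vec w" unfolding c_def using E G by auto
  let ?S = "\<lambda>J Y. {x \<in> carrier_vec d. Y\<^sup>T *\<^sub>v (J *\<^sub>v x) = c}"
  let ?T = "\<lambda>J Y L. {x \<in> carrier_vec d. Y\<^sup>T *\<^sub>v (J *\<^sub>v x) = c \<and> x = Y *\<^sub>v (L *\<^sub>v x)}"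
  have fin: "finite (?S J Y)" "finite (?T J Y L)" for J Y L
    by (auto intro: finite_subset[OF _ finite_carrier_vec[of d]])
  have "unit_vec d w \<noteq> E *\<^sub>v (E\<^sup>T *\<^sub>v unit_vec d w)"
  proof
    assume "unit_vec d w = E *\<^sub>v (E\<^sup>T *\<^sub>v unit_vec d w)"
    then have "unit_vec d w $ w = (E *\<^sub>v (E\<^sup>T *\<^sub>v unit_vec d w)) $ w" by simp
    moreover have "row E w = 0\<^sub>v w" using wd unfolding E_def first_cols_def by (auto intro!: eq_vecI)
    ultimately show False using wd E by (simp add: scalar_prod_left_zero)
  qed
  then have "?T G E E\<^sup>T \<subset> ?S G E" 
  proof (intro psubsetI)
    have "unit_vec d w \<in> ?S G E" "unit_vec d w \<notin> ?T G E E\<^sup>T"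
      using \<open>unit_vec d w \<noteq> E *\<^sub>v (E\<^sup>T *\<^sub>v unit_vec d w)\<close> by (simp_all add: c_def)
    then show "?T G E E\<^sup>T \<noteq> ?S G E" by metis
  qed blast
  then have "card (?T G E E\<^sup>T) < card (?S G E)" by (rule psubset_card_mono[OF fin(1)])
  moreover have "card (?S G E) = card (?S J Y)"
  proof -
    have "card (?S G E) * card (UNIV :: 'a set) ^ w = card (?S J Y) * card (UNIV :: 'a set) ^ w"
      by (rule trans[OF card_gram_fibre[OF G(1,3) E c] card_gram_fibre[OF J(1,3) Suc.prems(2,3,4) c, symmetric]])
    moreover have "card (UNIV :: 'a set) ^ w \<noteq> 0" by (simp add: card_eq_0_iff)
    ultimately show ?thesis by (meson mult_right_cancel)
  qed
  moreover have "card (?T G E E\<^sup>T) = card (?T J Y L)"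
    unfolding card_gram_fibre_span[OF G(1,3) E] card_gram_fibre_span[OF J(1,3) Suc.prems(2,3,4)] Suc.prems(5)
    by (simp only: E_def)
  ultimately have "card (?T J Y L) < card (?S J Y)" by (simp only:)
  note lt = this
  have "\<not> ?S J Y \<subseteq> ?T J Y L"
  proof
    assume "?S J Y \<subseteq> ?T J Y L"
    from card_mono[OF fin(2) this] lt show False by (rule leD[THEN notE])
  qed
  then obtain x where "x \<in> ?S J Y" "x \<notin> ?T J Y L" unfolding subset_iff not_all not_imp by (elim exE conjE)
  then have x: "x \<in> carrier_vec d" "Y\<^sup>T *\<^sub>v (J *\<^sub>v x) = c" "x \<noteq> Y *\<^sub>v (L *\<^sub>v x)" by simp_all
  obtain L' where L': "L' \<in> carrier_mat (Suc w) d" "L' * append_col Y x = 1\<^sub>m (Suc w)"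
    using left_inverse_append_col[OF Suc.prems(2-4) x(1,3)] by blast
  have Ycol: "col Y a \<bullet> (J *\<^sub>v x) = unit_vec d a \<bullet> (G *\<^sub>v unit_vec d w)" if "a < w" for a
  proof -
    have "col Y a \<bullet> (J *\<^sub>v x) = (Y\<^sup>T *\<^sub>v (J *\<^sub>v x)) $ a" using that Suc.prems(2) by simp
    also have "\<dots> = (E\<^sup>T *\<^sub>v (G *\<^sub>v unit_vec d w)) $ a" by (simp only: x(2) c_def)
    also have "\<dots> = col E a \<bullet> (G *\<^sub>v unit_vec d w)" using that E(1) by simp
    also have "col E a = unit_vec d a" unfolding E_def by (rule col_first_cols[OF that])
    finally show ?thesis .
  qed
  have gram': "(append_col Y x)\<^sup>T * J * append_col Y x = (first_cols d (Suc w))\<^sup>T * G * first_cols d (Suc w)"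
  proof (rule eq_matI)
    fix a b assume "a < dim_row ((first_cols d (Suc w))\<^sup>T * G * first_cols d (Suc w))"
      "b < dim_col ((first_cols d (Suc w))\<^sup>T * G * first_cols d (Suc w))"
    then have ab: "a < Suc w" "b < Suc w" by (auto simp: first_cols_def)
    have lhs: "((append_col Y x)\<^sup>T * J * append_col Y x) $$ (a,b) = col (append_col Y x) a \<bullet> (J *\<^sub>v col (append_col Y x) b)"
      by (rule gram_index[OF append_col_carrier[OF Suc.prems(2)] J(1) ab])
    have rhs: "((first_cols d (Suc w))\<^sup>T * G * first_cols d (Suc w)) $$ (a,b) = unit_vec d a \<bullet> (G *\<^sub>v unit_vec d b)"
      using gram_index[OF first_cols_carrier G(1) ab] ab by (simp add: col_first_cols)
    \<comment> \<open>Only the new row and column need an argument: they agree by the choice of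
      \<open>x\<close> and antisymmetry, and the corner vanishes on both sides because the forms are
      alternating.\<close>
    consider "a < w" "b < w" | "a < w" "b = w" | "a = w" "b < w" | "a = w" "b = w" using ab by linarith
    then show "((append_col Y x)\<^sup>T * J * append_col Y x) $$ (a,b)
      = ((first_cols d (Suc w))\<^sup>T * G * first_cols d (Suc w)) $$ (a,b)"
    proof cases
      case 1
      have "col Y a \<bullet> (J *\<^sub>v col Y b) = ((first_cols d w)\<^sup>T * G * first_cols d w) $$ (a,b)"
        using gram_index[OF Suc.prems(2) J(1) 1] Suc.prems(5) by simp
      also have "\<dots> = unit_vec d a \<bullet> (G *\<^sub>v unit_vec d b)"
        using gram_index[OF first_cols_carrier G(1) 1] 1 by (simp add: col_first_cols)
      finally show ?thesis unfolding lhs rhs using 1 col_append_col(1)[OF Suc.prems(2) x(1)] by simp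
    next
      case 2
      then show ?thesis unfolding lhs rhs using col_append_col[OF Suc.prems(2) x(1)] Ycol by simp
    next
      case 3
      have "x \<bullet> (J *\<^sub>v col Y b) = - (col Y b \<bullet> (J *\<^sub>v x))"
        using antisymmetric_swap[OF J(1,2) x(1)] Suc.prems(2) 3 by simp
      also have "\<dots> = unit_vec d w \<bullet> (G *\<^sub>v unit_vec d b)"
        using Ycol[of b] antisymmetric_swap[OF G(1,2), of "unit_vec d b" "unit_vec d w"] 3 by simp
      finally show ?thesis unfolding lhs rhs using 3 col_append_col[OF Suc.prems(2) x(1)] by simp
    next
      case 4
      then show ?thesis unfolding lhs rhs using col_append_col(2)[OF Suc.prems(2) x(1)]
          alternating_self[OF two J(1,2) x(1)] alternating_self[OF two G(1,2), of "unit_vec d w"] by simp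
    qed
  qed (use append_col_carrier[OF Suc.prems(2), of x] in \<open>auto simp: first_cols_def\<close>)
  have kd: "k = d - Suc w" using Suc.hyps(2) by linarith
  obtain P where P: "P \<in> carrier_mat d d" "P\<^sup>T * J * P = G" "P * first_cols d (Suc w) = append_col Y x"
    using Suc.hyps(1)[OF kd _ append_col_carrier[OF Suc.prems(2)] L' gram'] wd by auto
  have "append_col (P * first_cols d w) (P *\<^sub>v unit_vec d w) = append_col Y x"
    using P(3) wd by (simp add: first_cols_Suc mult_append_col[OF P(1) first_cols_carrier])
  then have cols: "col (P * first_cols d w) b = col Y b" if "b < w" for b
    using that col_append_col(1)[OF Suc.prems(2) x(1) that]
      col_append_col(1)[of "P * first_cols d w" d w "P *\<^sub>v unit_vec d w" b] P(1) by auto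
  have "P * first_cols d w = Y"
  proof (rule mat_col_eqI)
    show "col (P * first_cols d w) i = col Y i" if "i < dim_col Y" for i
      using that Suc.prems(2) by (intro cols) auto
    show "dim_row (P * first_cols d w) = dim_row Y" "dim_col (P * first_cols d w) = dim_col Y"
      using Suc.prems(2) P(1) by (simp_all add: first_cols_def)
  qed
  then show ?case using P by blast
qed

section \<open>Characteristic polynomials of block matrices\<close>

lemma four_block_mat_eqD:
  assumes "A \<in> carrier_mat n1 m1" "B \<in> carrier_mat n1 m2" "C \<in> carrier_mat n2 m1" "D \<in> carrier_mat n2 m2"
    and "A' \<in> carrier_mat n1 m1" "B' \<in> carrier_mat n1 m2" "C' \<in> carrier_mat n2 m1" "D' \<in> carrier_mat n2 m2"
    and eq: "four_block_mat A B C D = four_block_mat A' B' C' D'"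
  shows "A = A'" "B = B'" "C = C'" "D = D'"
proof -
  have *: "four_block_mat A B C D $$ (i,j) = four_block_mat A' B' C' D' $$ (i,j)" for i j using eq by simp
  show "A = A'"
  proof (rule eq_matI)
    show "A $$ (i,j) = A' $$ (i,j)" if "i < dim_row A'" "j < dim_col A'" for i j
      using *[of i j] that assms(1-8) by simp
  qed (use assms in auto)
  show "B = B'"
  proof (rule eq_matI)
    show "B $$ (i,j) = B' $$ (i,j)" if "i < dim_row B'" "j < dim_col B'" for i j
      using *[of i "m1 + j"] that assms(1-8) by simp
  qed (use assms in auto)
  show "C = C'"
  proof (rule eq_matI)
    show "C $$ (i,j) = C' $$ (i,j)" if "i < dim_row C'" "j < dim_col C'" for i j
      using *[of "n1 + i" j] that assms(1-8) by simp
  qed (use assms in auto)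
  show "D = D'"
  proof (rule eq_matI)
    show "D $$ (i,j) = D' $$ (i,j)" if "i < dim_row D'" "j < dim_col D'" for i j
      using *[of "n1 + i" "m1 + j"] that assms(1-8) by simp
  qed (use assms in auto)
qed

lemma four_block_mat_decompose:
  assumes "M \<in> carrier_mat (n1 + n2) (m1 + m2)"
  obtains A B C D where "M = four_block_mat A B C D" "A \<in> carrier_mat n1 m1" "B \<in> carrier_mat n1 m2"
    "C \<in> carrier_mat n2 m1" "D \<in> carrier_mat n2 m2"
proof -
  obtain A B C D where *: "split_block M n1 m1 = (A, B, C, D)" by (metis prod_cases4)
  show ?thesis
    by (rule that[OF split_block(5,1-4)[OF *]]) (use assms in auto)
qed

lemma char_poly_four_block_upper:
  fixes A :: "'a::field mat"
  assumes A: "A \<in> carrier_mat n n" and B: "B \<in> carrier_mat n m" and D: "D \<in> carrier_mat m m"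
  shows "char_poly (four_block_mat A B (0\<^sub>m m n) D) = char_poly A * char_poly D"
proof -
  let ?cm = "\<lambda> A. [:0, 1:] \<cdot>\<^sub>m 1\<^sub>m (dim_row A) + map_mat (\<lambda>a. [:- a:]) A"
  have "char_poly (four_block_mat A B (0\<^sub>m m n) D) = det (?cm (four_block_mat A B (0\<^sub>m m n) D))"
    unfolding char_poly_defs using A D by simp
  also have "?cm (four_block_mat A B (0\<^sub>m m n) D) = four_block_mat (?cm A) (map_mat (\<lambda>a. [:- a:]) B) (0\<^sub>m m n) (?cm D)"
    by (rule eq_matI) (use A B D in \<open>auto simp: one_poly_def\<close>)
  also have "det \<dots> = det (?cm A) * det (?cm D)"
    by (rule det_four_block_mat_lower_left_zero[OF _ _ refl]) (use A B D in auto)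
  finally show ?thesis unfolding char_poly_defs .
qed

text \<open>Reversal with respect to a formal degree \<open>n\<close>. Unlike
  \<open>reflect_poly\<close> it is additive, as the Leibniz expansion of a determinant
  requires.\<close>

definition rev_poly :: "nat \<Rightarrow> 'a::comm_ring_1 poly \<Rightarrow> 'a poly" where
  "rev_poly n f = (\<Sum>i\<le>n. monom (coeff f (n - i)) i)"

lemma coeff_rev_poly: "coeff (rev_poly n f) i = (if i \<le> n then coeff f (n - i) else 0)"
proof -
  have "coeff (rev_poly n f) i = (\<Sum>l\<le>n. if l = i then coeff f (n - l) else 0)"
    unfolding rev_poly_def by (simp add: coeff_sum)
  then show ?thesis by simp
qed

lemma rev_poly_sum: "rev_poly n (\<Sum>x\<in>A. f x) = (\<Sum>x\<in>A. rev_poly n (f x))"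
  by (rule poly_eqI) (simp add: coeff_rev_poly coeff_sum)

lemma rev_poly_of_int_mult: "rev_poly n (of_int s * f) = of_int s * rev_poly n f"
  by (rule poly_eqI) (simp add: coeff_rev_poly of_int_poly)

lemma rev_poly_mult_linear:
  assumes "degree f \<le> n"
  shows "rev_poly (Suc n) (f * [:a, b:]) = rev_poly n f * [:b, a:]"
proof (rule poly_eqI)
  fix i
  have "coeff f (Suc n) = 0" using assms by (simp add: coeff_eq_0)
  then show "coeff (rev_poly (Suc n) (f * [:a, b:])) i = coeff (rev_poly n f * [:b, a:]) i"
  proof (cases i)
    case (Suc m)
    show ?thesis
    proof (cases "m < n")
      case True
      then have "n - m = Suc (n - Suc m)" by simp
      then show ?thesis using True by (simp add: Suc coeff_rev_poly coeff_pCons)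
    qed (use \<open>coeff f (Suc n) = 0\<close> in \<open>auto simp: Suc coeff_rev_poly coeff_pCons split: nat.splits\<close>)
  qed (simp add: coeff_rev_poly coeff_pCons)
qed

lemma rev_poly_prod_linear:
  "degree (\<Prod>i<n. [:a i, b i:]) \<le> n \<and> rev_poly n (\<Prod>i<n. [:a i, b i:]) = (\<Prod>i<n. [:b i, a i:])"
proof (induction n)
  case 0
  show ?case by (auto intro!: poly_eqI simp: coeff_rev_poly)
next
  case (Suc n)
  have "degree ((\<Prod>i<n. [:a i, b i:]) * [:a n, b n:]) \<le> n + 1"
    by (rule order.trans[OF degree_mult_le add_mono]) (use Suc in auto)
  then show ?case using rev_poly_mult_linear[of "\<Prod>i<n. [:a i, b i:]" n "a n" "b n"] Suc by simp
qed

text \<open>Every summand of the Leibniz formula for \<open>det (z - A)\<close> is, up to sign, a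
  product of \<open>n\<close> polynomials of formal degree 1, and reversal swaps the two
  coefficients of each. The result is \<open>det (1 - z * A)\<close>.\<close>

lemma rev_poly_char_poly:
  fixes A :: "'a::field mat"
  assumes A: "A \<in> carrier_mat n n"
  shows "rev_poly n (char_poly A) = det (mat n n (\<lambda>(i,j). [:if i = j then 1 else 0, - (A $$ (i,j)):]))"
    (is "_ = det ?B")
proof -
  have cm: "char_poly_matrix A \<in> carrier_mat n n" using A by simp
  have B: "?B \<in> carrier_mat n n" by simp
  have ent: "char_poly_matrix A $$ (i, j) = [:- (A $$ (i,j)), if i = j then 1 else 0:]" if "i < n" "j < n" for i j
    unfolding char_poly_matrix_def using A that by auto
  have perm: "\<And>p i. p permutes {0..<n} \<Longrightarrow> i < n \<Longrightarrow> p i < n"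
    using permutes_in_image by fastforce
  have "rev_poly n (char_poly A) = (\<Sum>p | p permutes {0..<n}. rev_poly n (signof p * (\<Prod>i = 0..<n. char_poly_matrix A $$ (i, p i))))"
    unfolding char_poly_def det_def'[OF cm] rev_poly_sum by simp
  also have "\<dots> = (\<Sum>p | p permutes {0..<n}. signof p * (\<Prod>i = 0..<n. ?B $$ (i, p i)))"
  proof (rule sum.cong[OF refl], goal_cases)
    case (1 p)
    then have p: "p permutes {0..<n}" by simp
    have "(\<Prod>i = 0..<n. char_poly_matrix A $$ (i, p i)) = (\<Prod>i<n. [:- (A $$ (i,p i)), if i = p i then 1 else 0:])"
      unfolding atLeast0LessThan by (rule prod.cong[OF refl]) (simp add: ent perm[OF p])
    moreover have "(\<Prod>i = 0..<n. ?B $$ (i, p i)) = (\<Prod>i<n. [:if i = p i then 1 else 0, - (A $$ (i,p i)):])"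
      unfolding atLeast0LessThan by (rule prod.cong[OF refl]) (simp add: perm[OF p])
    ultimately show ?case
      using rev_poly_prod_linear[where n = n and a = "\<lambda>i. - (A $$ (i,p i))" and b = "\<lambda>i. if i = p i then 1 else 0"]
      by (simp only: rev_poly_of_int_mult)
  qed
  also have "\<dots> = det ?B" by (rule det_def'[OF B, symmetric])
  finally show ?thesis .
qed

lemma coeff_0_char_poly:
  fixes A :: "'a::field mat"
  assumes A: "A \<in> carrier_mat n n"
  shows "coeff (char_poly A) 0 = (-1) ^ n * det A"
proof -
  have "coeff (char_poly A) 0 = poly (char_poly A) 0" by (simp add: poly_0_coeff_0)
  also have "\<dots> = det (- (char_matrix A 0))" by (rule char_poly_matrix[OF A])
  also have "- (char_matrix A 0) = (-1) \<cdot>\<^sub>m A" unfolding char_matrix_def using A by (intro eq_matI) auto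
  finally show ?thesis using A by simp
qed

text \<open>Taking determinants in \<open>A * (z - D) = - (1 - z * A)\<close> over the polynomial
  ring gives the reversed polynomial up to a scalar; the sign \<open>(-1)^n\<close> cancels against
  that of the constant coefficient.\<close>

lemma char_poly_inverse:
  fixes A :: "'a::field mat"
  assumes A: "A \<in> carrier_mat n n" and D: "D \<in> carrier_mat n n" and AD: "A * D = 1\<^sub>m n"
  shows "char_poly D = Polynomial.smult (inverse (coeff (char_poly A) 0)) (reflect_poly (char_poly A))"
proof -
  let ?p = "char_poly A"
  have deg: "degree ?p = n" "lead_coeff ?p = 1" using degree_monic_char_poly[OF A] by auto
  let ?c = "\<lambda>a::'a. [:a:]"
  interpret c: comm_ring_hom ?c
    by unfold_locales (auto simp: one_pCons)
  let ?A = "map_mat ?c A" and ?D = "map_mat ?c D"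
  have cA: "?A \<in> carrier_mat n n" "?D \<in> carrier_mat n n" using A D by auto
  have AD': "?A * ?D = 1\<^sub>m n" using c.mat_hom_mult[OF A D] AD c.mat_hom_one[of n] by simp
  have cmD: "char_poly_matrix D \<in> carrier_mat n n" using D by simp
  let ?B = "mat n n (\<lambda>(i,j). [:if i = j then 1 else 0, - (A $$ (i,j)):])"
  have "?A * char_poly_matrix D = (-1) \<cdot>\<^sub>m ?B"
  proof -
    have "char_poly_matrix D = [:0,1:] \<cdot>\<^sub>m 1\<^sub>m n + (-1) \<cdot>\<^sub>m ?D"
      unfolding char_poly_matrix_def using D by (intro eq_matI) auto
    then have "?A * char_poly_matrix D = ?A * ([:0,1:] \<cdot>\<^sub>m 1\<^sub>m n + (-1) \<cdot>\<^sub>m ?D)" by (simp only:)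
    also have "\<dots> = ?A * ([:0,1:] \<cdot>\<^sub>m 1\<^sub>m n) + ?A * ((-1) \<cdot>\<^sub>m ?D)"
      by (rule mult_add_distrib_mat[OF cA(1)]) (use cA in auto)
    also have "?A * ([:0,1:] \<cdot>\<^sub>m 1\<^sub>m n) = [:0,1:] \<cdot>\<^sub>m (?A * 1\<^sub>m n)"
      by (rule mult_smult_distrib[OF cA(1) one_carrier_mat])
    also have "?A * 1\<^sub>m n = ?A" by (rule right_mult_one_mat[OF cA(1)])
    also have "?A * ((-1) \<cdot>\<^sub>m ?D) = (-1) \<cdot>\<^sub>m 1\<^sub>m n"
      unfolding mult_smult_distrib[OF cA(1,2)] AD' ..
    also have "[:0,1:] \<cdot>\<^sub>m ?A + (-1) \<cdot>\<^sub>m 1\<^sub>m n = (-1) \<cdot>\<^sub>m ?B"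
    proof (rule eq_matI)
      fix i j assume "i < dim_row ((-1) \<cdot>\<^sub>m ?B)" "j < dim_col ((-1) \<cdot>\<^sub>m ?B)"
      then have ij: "i < n" "j < n" by auto
      show "([:0,1:] \<cdot>\<^sub>m ?A + (-1) \<cdot>\<^sub>m 1\<^sub>m n) $$ (i,j) = ((-1) \<cdot>\<^sub>m ?B) $$ (i,j)"
        using ij A by (cases "i = j") (simp_all add: one_poly_def)
    qed (use A in auto)
    finally show ?thesis .
  qed
  then have "det ?A * char_poly D = (-1) ^ n * det ?B"
    unfolding char_poly_def using det_mult[OF cA(1) cmD] det_smult[of "-1" ?B] by simp
  moreover have "det ?A = [:det A:]" using c.hom_det[of A] by simp
  moreover have "det ?B = reflect_poly ?p"
  proof -
    have "reflect_poly ?p = rev_poly n ?p"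
      by (rule poly_eqI) (simp add: coeff_reflect_poly coeff_rev_poly deg(1))
    then show ?thesis by (simp only: rev_poly_char_poly[OF A])
  qed
  ultimately have e: "Polynomial.smult (det A) (char_poly D) = (-1) ^ n * reflect_poly ?p" by simp
  have "det A \<noteq> 0" using inverse_det_nonzero[OF A D AD] .
  then have "char_poly D = Polynomial.smult (inverse (det A)) (Polynomial.smult (det A) (char_poly D))" by simp
  also have "\<dots> = Polynomial.smult (inverse (coeff ?p 0)) (reflect_poly ?p)"
    unfolding e coeff_0_char_poly[OF A] by (cases "even n") auto
  finally show ?thesis .
qed

text \<open>Multiplication by \<open>z\<close> modulo \<open>g\<close> in the basis
  \<open>1, z, z^2, ...\<close>, with images as columns.\<close>

definition companion :: "'a::comm_ring_1 poly \<Rightarrow> 'a mat" where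
  "companion g = mat (degree g) (degree g)
     (\<lambda>(i,l). if Suc l < degree g then (if i = Suc l then 1 else 0) else - coeff g i)"

lemma companion_carrier[simp]: "companion g \<in> carrier_mat (degree g) (degree g)"
  unfolding companion_def by simp

text \<open>In the first row of \<open>z - companion g\<close> only the two end entries can be
  nonzero. With \<open>g = a + z * h\<close>, removing that row and the first column leaves the
  matrix for \<open>h\<close>; removing the last column instead leaves a triangular matrix with
  diagonal \<open>-1\<close>, whose sign cancels that of the cofactor.\<close>

lemma char_poly_companion:
  fixes g :: "'a::field poly"
  assumes "lead_coeff g = 1"
  shows "char_poly (companion g) = g"
  using assms
proof (induction "degree g" arbitrary: g)
  case 0
  then have "g = 1" by (metis lead_coeff_pCons(2) degree_eq_zeroE one_pCons lead_coeff_1 coeff_pCons_0)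
  moreover have "char_poly (companion (1::'a poly)) = 1"
    using degree_monic_char_poly[OF companion_carrier[of "1::'a poly"]]
    by (metis degree_1 degree_eq_zeroE one_pCons lead_coeff_pCons(2) coeff_pCons_0)
  ultimately show ?case by simp
next
  case (Suc w)
  obtain a h where g: "g = pCons a h" by (cases g)
  have h0: "h \<noteq> 0" using Suc.hyps(2) by (auto simp: g)
  have dh: "degree h = w" and dg: "degree g = Suc w" using Suc.hyps(2) h0 by (auto simp: g)
  have lh: "lead_coeff h = 1" using Suc.prems h0 by (simp add: g)
  let ?A = "char_poly_matrix (companion g)"
  have A: "?A \<in> carrier_mat (Suc w) (Suc w)" using companion_carrier[of g] dg by simp
  have ent: "?A $$ (i,l) = (if i = l then [:0,1:] else 0) + (if l < w then (if i = Suc l then -1 else 0) else [:coeff g i:])"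
    if "i < Suc w" "l < Suc w" for i l
    using that unfolding char_poly_matrix_def companion_def dg by (auto simp: one_pCons)
  have e0: "?A $$ (0, l) = 0" if "l < Suc w" "l \<noteq> 0" "l \<noteq> w" for l
    using that ent[of 0 l] by auto
  have d0: "mat_delete ?A 0 0 = char_poly_matrix (companion h)"
  proof (rule eq_matI)
    fix i l assume "i < dim_row (char_poly_matrix (companion h))" "l < dim_col (char_poly_matrix (companion h))"
    then have il: "i < w" "l < w" using companion_carrier[of h] dh by (auto simp: char_poly_matrix_def)
    have "mat_delete ?A 0 0 $$ (i,l) = ?A $$ (Suc i, Suc l)"
      using mat_delete_index[OF A, of 0 0 i l] il by (simp add: insert_index_def)
    also have "\<dots> = char_poly_matrix (companion h) $$ (i,l)"
      using il unfolding ent[OF Suc_mono[OF il(1)] Suc_mono[OF il(2)]]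
      by (auto simp: char_poly_matrix_def companion_def dh g one_pCons)
    finally show "mat_delete ?A 0 0 $$ (i,l) = char_poly_matrix (companion h) $$ (i,l)" .
  qed (use A companion_carrier[of h] dh in \<open>auto simp: mat_delete_def char_poly_matrix_def\<close>)
  have dw: "det (mat_delete ?A 0 w) = (-1) ^ w"
  proof -
    let ?D = "mat_delete ?A 0 w"
    have D: "?D \<in> carrier_mat w w" using mat_delete_carrier[OF A, of 0 w] by simp
    have De: "?D $$ (i,l) = (if Suc i = l then [:0,1:] else 0) + (if i = l then -1 else 0)" if "i < w" "l < w" for i l
    proof -
      have "?D $$ (i,l) = ?A $$ (Suc i, l)"
        using mat_delete_index[OF A, of 0 w i l] that by (simp add: insert_index_def)
      then show ?thesis using that by (simp add: ent)
    qed
    have "upper_triangular ?D" using D De by (intro upper_triangularI) auto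
    then have "det ?D = prod_list (diag_mat ?D)" by (rule det_upper_triangular[OF _ D])
    also have "diag_mat ?D = map (\<lambda>i. -1) [0..<w]" unfolding diag_mat_def using D De by auto
    also have "prod_list (map (\<lambda>i. -1 :: 'a poly) [0..<w]) = (-1) ^ w" by (induction w) auto
    finally show ?thesis .
  qed
  have "det ?A = (\<Sum>l<Suc w. ?A $$ (0,l) * cofactor ?A 0 l)"
    by (rule laplace_expansion_row[OF A]) simp
  also have "\<dots> = (\<Sum>l\<in>{0,w}. ?A $$ (0,l) * cofactor ?A 0 l)"
    by (rule sum.mono_neutral_right) (use e0 in auto)
  also have "\<dots> = [:0,1:] * h + [:a:]"
  \<comment> \<open>For \<open>w = 0\<close> the two end entries coincide in the single entry
    \<open>z + a\<close>, so the sum has one term.\<close>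
  proof (cases "w = 0")
    case True
    then have "h = 1" using dh lh by (metis degree_eq_zeroE one_pCons lead_coeff_pCons(2) coeff_pCons_0)
    have "mat_delete ?A 0 0 \<in> carrier_mat 0 0" using mat_delete_carrier[OF A, of 0 0] True by simp
    then have "det (mat_delete ?A 0 0) = 1" by (rule det_dim_zero)
    then show ?thesis using True ent[of 0 0] g \<open>h = 1\<close> by (simp add: cofactor_def)
  next
    case False
    have "cofactor ?A 0 0 = h" using Suc.hyps(1)[of h] dh lh by (simp add: cofactor_def d0 char_poly_def)
    moreover have "cofactor ?A 0 w = 1" unfolding cofactor_def dw by (simp flip: power_mult_distrib)
    ultimately show ?thesis using False ent[of 0 0] ent[of 0 w] g by simp
  qed
  also have "\<dots> = g" by (simp add: g)
  finally show ?case by (simp add: char_poly_def)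
qed

section \<open>The form adapted to a subspace and its radical\<close>

lemma uminus_zero_mat[simp]: "- 0\<^sub>m a b = (0\<^sub>m a b :: 'a::group_add mat)"
  by (intro eq_matI) auto

text \<open>Coordinates are ordered as: the radical of \<open>W\<close> (size \<open>j\<close>), the
  rest of \<open>W\<close> (size \<open>e\<close>), a complement of the radical in the orthogonal
  space of \<open>W\<close> (size \<open>p\<close>), and a dual of the radical (size
  \<open>j\<close>). \<open>A\<close> and \<open>H\<close> are the forms induced on the two middle
  parts.\<close>

definition flag_form :: "nat \<Rightarrow> nat \<Rightarrow> nat \<Rightarrow> 'a::comm_ring_1 mat \<Rightarrow> 'a mat \<Rightarrow> 'a mat" where
  "flag_form j e p A H = four_block_mat
     (four_block_mat (0\<^sub>m j j) (0\<^sub>m j e) (0\<^sub>m e j) A)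
     (four_block_mat (0\<^sub>m j p) (1\<^sub>m j) (0\<^sub>m e p) (0\<^sub>m e j))
     (four_block_mat (0\<^sub>m p j) (0\<^sub>m p e) (- 1\<^sub>m j) (0\<^sub>m j e))
     (four_block_mat H (0\<^sub>m p j) (0\<^sub>m j p) (0\<^sub>m j j))"

context
  fixes j e p :: nat and A H :: "'a::field mat"
  assumes A: "A \<in> carrier_mat e e" and H: "H \<in> carrier_mat p p"
begin

lemma flag_form_carrier: "flag_form j e p A H \<in> carrier_mat ((j + e) + (p + j)) ((j + e) + (p + j))"
  unfolding flag_form_def using A H by (intro four_block_carrier_mat) auto

lemma flag_form_antisym:
  assumes "A\<^sup>T = - A" "H\<^sup>T = - H"
  shows "(flag_form j e p A H)\<^sup>T = - flag_form j e p A H"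
proof -
  let ?F = "flag_form j e p A H"
  have "?F\<^sup>T = four_block_mat
     (four_block_mat (0\<^sub>m j j) (0\<^sub>m j e) (0\<^sub>m e j) (- A))
     (four_block_mat (0\<^sub>m j p) (- 1\<^sub>m j) (0\<^sub>m e p) (0\<^sub>m e j))
     (four_block_mat (0\<^sub>m p j) (0\<^sub>m p e) (1\<^sub>m j) (0\<^sub>m j e))
     (four_block_mat (- H) (0\<^sub>m p j) (0\<^sub>m j p) (0\<^sub>m j j))"
    unfolding flag_form_def using A H assms
    by (subst transpose_four_block_mat[of _ "j + e" "j + e" _ "p + j" _ "p + j"],
        auto simp: transpose_four_block_mat[of _ j j _ e _ e] transpose_four_block_mat[of _ j p _ j _ e]
          transpose_four_block_mat[of _ p j _ e _ j] transpose_four_block_mat[of _ p p _ j _ j] transpose_uminus)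
  also have "\<dots> = - ?F"
    unfolding flag_form_def using A H by (intro eq_matI) auto
  finally show ?thesis .
qed

text \<open>The inverse is explicit: invert \<open>A\<close> and \<open>H\<close> and exchange the
  signs of the two identity blocks.\<close>

lemma flag_form_inverse:
  assumes A': "A' \<in> carrier_mat e e" "A * A' = 1\<^sub>m e" and H': "H' \<in> carrier_mat p p" "H * H' = 1\<^sub>m p"
  shows "det (flag_form j e p A H) \<noteq> 0"
proof -
  let ?G = "four_block_mat
     (four_block_mat (0\<^sub>m j j) (0\<^sub>m j e) (0\<^sub>m e j) A')
     (four_block_mat (0\<^sub>m j p) (- 1\<^sub>m j) (0\<^sub>m e p) (0\<^sub>m e j))
     (four_block_mat (0\<^sub>m p j) (0\<^sub>m p e) (1\<^sub>m j) (0\<^sub>m j e))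
     (four_block_mat H' (0\<^sub>m p j) (0\<^sub>m j p) (0\<^sub>m j j))"
  have G: "?G \<in> carrier_mat ((j + e) + (p + j)) ((j + e) + (p + j))"
    using A' H' by (intro four_block_carrier_mat) auto
  have 1: "four_block_mat (0\<^sub>m j j) (0\<^sub>m j e) (0\<^sub>m e j) A * four_block_mat (0\<^sub>m j j) (0\<^sub>m j e) (0\<^sub>m e j) A'
     + four_block_mat (0\<^sub>m j p) (1\<^sub>m j) (0\<^sub>m e p) (0\<^sub>m e j) * four_block_mat (0\<^sub>m p j) (0\<^sub>m p e) (1\<^sub>m j) (0\<^sub>m j e)
     = 1\<^sub>m (j + e)"
    using A A'
    by (simp add: mult_four_block_mat[of _ j j _ e _ e _ _ j _ e] mult_four_block_mat[of _ j p _ j _ e _ _ j _ e]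
      add_four_block_mat[of _ j j _ e _ e])
  have 2: "four_block_mat (0\<^sub>m j j) (0\<^sub>m j e) (0\<^sub>m e j) A * four_block_mat (0\<^sub>m j p) (- 1\<^sub>m j) (0\<^sub>m e p) (0\<^sub>m e j)
     + four_block_mat (0\<^sub>m j p) (1\<^sub>m j) (0\<^sub>m e p) (0\<^sub>m e j) * four_block_mat H' (0\<^sub>m p j) (0\<^sub>m j p) (0\<^sub>m j j)
     = 0\<^sub>m (j + e) (p + j)"
    using A H'
    by (simp add: mult_four_block_mat[of _ j j _ e _ e _ _ p _ j] mult_four_block_mat[of _ j p _ j _ e _ _ p _ j]
      add_four_block_mat[of _ j p _ j _ e])
  have 3: "four_block_mat (0\<^sub>m p j) (0\<^sub>m p e) (- 1\<^sub>m j) (0\<^sub>m j e) * four_block_mat (0\<^sub>m j j) (0\<^sub>m j e) (0\<^sub>m e j) A'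
     + four_block_mat H (0\<^sub>m p j) (0\<^sub>m j p) (0\<^sub>m j j) * four_block_mat (0\<^sub>m p j) (0\<^sub>m p e) (1\<^sub>m j) (0\<^sub>m j e)
     = 0\<^sub>m (p + j) (j + e)"
    using H A'
    by (simp add: mult_four_block_mat[of _ p j _ e _ j _ _ j _ e] mult_four_block_mat[of _ p p _ j _ j _ _ j _ e]
      add_four_block_mat[of _ p j _ e _ j])
  have 4: "four_block_mat (0\<^sub>m p j) (0\<^sub>m p e) (- 1\<^sub>m j) (0\<^sub>m j e) * four_block_mat (0\<^sub>m j p) (- 1\<^sub>m j) (0\<^sub>m e p) (0\<^sub>m e j)
     + four_block_mat H (0\<^sub>m p j) (0\<^sub>m j p) (0\<^sub>m j j) * four_block_mat H' (0\<^sub>m p j) (0\<^sub>m j p) (0\<^sub>m j j)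
     = 1\<^sub>m (p + j)"
    using H H'
    by (simp add: mult_four_block_mat[of _ p j _ e _ j _ _ p _ j] mult_four_block_mat[of _ p p _ j _ j _ _ p _ j]
      add_four_block_mat[of _ p p _ j _ j])
  have "flag_form j e p A H * ?G = 1\<^sub>m ((j + e) + (p + j))"
    unfolding flag_form_def
    by (subst mult_four_block_mat[of _ "j + e" "j + e" _ "p + j" _ "p + j" _ _ "j + e" _ "p + j"])
      (use A H A' H' in \<open>auto simp: 1 2 3 4 intro!: four_block_carrier_mat\<close>)
  then show ?thesis by (rule inverse_det_nonzero[OF flag_form_carrier G])
qed

text \<open>Isometries of the form that preserve the flag \<open>rad \<subseteq> W\<close> spanned by the first \<open>j\<close> and the
  first \<open>j + e\<close> coordinates act on \<open>W\<^sup>\<bottom> / rad\<close> through the block \<open>N\<close>.\<close>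
lemma flag_isometry_blocks:
  assumes C: "C \<in> carrier_mat j j" and X: "X \<in> carrier_mat j e" and S: "S \<in> carrier_mat e e"
    and K: "K \<in> carrier_mat j p" and L: "L \<in> carrier_mat j j" and K': "K' \<in> carrier_mat e p" and L': "L' \<in> carrier_mat e j"
    and N: "N \<in> carrier_mat p p" and N': "N' \<in> carrier_mat p j" and Z: "Z \<in> carrier_mat j p" and D: "D \<in> carrier_mat j j"
    and detC: "det C \<noteq> 0" and detS: "det S \<noteq> 0" and detA: "det A \<noteq> 0"
    and M: "M = four_block_mat (four_block_mat C X (0\<^sub>m e j) S) (four_block_mat K L K' L')
       (0\<^sub>m (p + j) (j + e)) (four_block_mat N N' Z D)"
    and iso: "M\<^sup>T * flag_form j e p A H * M = flag_form j e p A H"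
  shows "Z = 0\<^sub>m j p" "C\<^sup>T * D = 1\<^sub>m j" "N\<^sup>T * H * N = H"
proof -
  let ?w = "j + e" and ?r = "p + j"
  let ?B = "four_block_mat C X (0\<^sub>m e j) S" and ?Q = "four_block_mat K L K' L'" and ?T = "four_block_mat N N' Z D"
  let ?G11 = "four_block_mat (0\<^sub>m j j) (0\<^sub>m j e) (0\<^sub>m e j) A"
  let ?G12 = "four_block_mat (0\<^sub>m j p) (1\<^sub>m j) (0\<^sub>m e p) (0\<^sub>m e j) :: 'a mat"
  let ?G21 = "four_block_mat (0\<^sub>m p j) (0\<^sub>m p e) (- 1\<^sub>m j) (0\<^sub>m j e) :: 'a mat"
  let ?G22 = "four_block_mat H (0\<^sub>m p j) (0\<^sub>m j p) (0\<^sub>m j j)"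
  have cB: "?B \<in> carrier_mat ?w ?w" and cQ: "?Q \<in> carrier_mat ?w ?r" and cT: "?T \<in> carrier_mat ?r ?r"
    using assms by (auto intro!: four_block_carrier_mat)
  have c11: "?G11 \<in> carrier_mat ?w ?w" and c12: "?G12 \<in> carrier_mat ?w ?r"
    and c21: "?G21 \<in> carrier_mat ?r ?w" and c22: "?G22 \<in> carrier_mat ?r ?r"
    using A H by (auto intro!: four_block_carrier_mat)
  have cM: "M \<in> carrier_mat (?w + ?r) (?w + ?r)" unfolding M by (rule four_block_carrier_mat[OF cB cT])
  let ?U = "four_block_mat Z D (A * K') (A * L')" and ?V = "four_block_mat (H * N) (H * N') (- K) (- L)"
  have U: "?G11 * ?Q + ?G12 * ?T = ?U"
    using A K K' L L' N N' Z D
    by (simp add: mult_four_block_mat[of _ j j _ e _ e _ _ p _ j] mult_four_block_mat[of _ j p _ j _ e _ _ p _ j]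
      add_four_block_mat[of _ j p _ j _ e])
  have V: "?G21 * ?Q + ?G22 * ?T = ?V"
    using H K K' L L' N N' Z D
    by (simp add: mult_four_block_mat[of _ p j _ e _ j _ _ p _ j] mult_four_block_mat[of _ p p _ j _ j _ _ p _ j]
      add_four_block_mat[of _ p p _ j _ j])
  have cU: "?U \<in> carrier_mat ?w ?r" and cV: "?V \<in> carrier_mat ?r ?r"
    using assms A H by (auto intro!: four_block_carrier_mat)
  have FM: "flag_form j e p A H * M = four_block_mat (?G11 * ?B) ?U (?G21 * ?B) ?V"
    unfolding flag_form_def M
    by (subst mult_four_block_mat[OF c11 c12 c21 c22 cB cQ _ cT])
      (use right_add_zero_mat[OF mult_carrier_mat[OF c11 cB]] right_add_zero_mat[OF mult_carrier_mat[OF c21 cB]]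
        right_mult_zero_mat[OF c12] right_mult_zero_mat[OF c22] in \<open>simp_all add: U V\<close>)
  have MT: "M\<^sup>T = four_block_mat (?B\<^sup>T) (0\<^sub>m ?w ?r) (?Q\<^sup>T) (?T\<^sup>T)"
    unfolding M by (subst transpose_four_block_mat[OF cB cQ _ cT]) auto
  have "M\<^sup>T * (flag_form j e p A H * M) = flag_form j e p A H"
    using iso assoc_mult_mat[OF _ flag_form_carrier cM, of "M\<^sup>T" "?w + ?r"] cM by simp
  then have "four_block_mat (?B\<^sup>T) (0\<^sub>m ?w ?r) (?Q\<^sup>T) (?T\<^sup>T) * four_block_mat (?G11 * ?B) ?U (?G21 * ?B) ?V
     = four_block_mat ?G11 ?G12 ?G21 ?G22" unfolding FM MT unfolding flag_form_def .
  then have eq: "four_block_mat (?B\<^sup>T * (?G11 * ?B) + 0\<^sub>m ?w ?r * (?G21 * ?B)) (?B\<^sup>T * ?U + 0\<^sub>m ?w ?r * ?V)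
      (?Q\<^sup>T * (?G11 * ?B) + ?T\<^sup>T * (?G21 * ?B)) (?Q\<^sup>T * ?U + ?T\<^sup>T * ?V) = four_block_mat ?G11 ?G12 ?G21 ?G22"
    by (subst (asm) mult_four_block_mat[of _ ?w ?w _ ?r _ ?r _ _ ?w _ ?r])
      (use cB cQ cT c11 c21 cU cV mult_carrier_mat[OF c11 cB] mult_carrier_mat[OF c21 cB] in auto)
  have t: "?B\<^sup>T \<in> carrier_mat ?w ?w" "?Q\<^sup>T \<in> carrier_mat ?r ?w" "?T\<^sup>T \<in> carrier_mat ?r ?r"
    using cB cQ cT by (simp_all only: transpose_carrier_mat)
  note GB = mult_carrier_mat[OF c11 cB] mult_carrier_mat[OF c21 cB]
  note prods = add_carrier_mat[OF mult_carrier_mat[OF zero_carrier_mat GB(2)]] add_carrier_mat[OF mult_carrier_mat[OF zero_carrier_mat cV]]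
    add_carrier_mat[OF mult_carrier_mat[OF t(3) GB(2)]] add_carrier_mat[OF mult_carrier_mat[OF t(3) cV]]
  note blocks = four_block_mat_eqD[OF _ _ _ _ c11 c12 c21 c22 eq]
  have "?B\<^sup>T * ?U + 0\<^sub>m ?w ?r * ?V = ?G12"
    by (rule blocks) (rule prods)+
  then have BU: "?B\<^sup>T * ?U = ?G12" using cB cU cV by (simp add: left_mult_zero_mat)
  have QT: "?Q\<^sup>T * ?U + ?T\<^sup>T * ?V = ?G22"
    by (rule blocks) (rule prods)+
  have BT: "?B\<^sup>T = four_block_mat (C\<^sup>T) (0\<^sub>m j e) (X\<^sup>T) (S\<^sup>T)"
    by (subst transpose_four_block_mat[OF C X _ S]) auto
  have "four_block_mat (C\<^sup>T * Z + 0\<^sub>m j e * (A * K')) (C\<^sup>T * D + 0\<^sub>m j e * (A * L'))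
     (X\<^sup>T * Z + S\<^sup>T * (A * K')) (X\<^sup>T * D + S\<^sup>T * (A * L')) = ?G12"
    using BU unfolding BT
    by (subst (asm) mult_four_block_mat[of _ j j _ e _ e _ _ p _ j]) (use C X S Z D A K' L' in auto)
  note blocks1 = four_block_mat_eqD[OF _ _ _ _ zero_carrier_mat one_carrier_mat zero_carrier_mat zero_carrier_mat this]
  have 1: "C\<^sup>T * Z + 0\<^sub>m j e * (A * K') = 0\<^sub>m j p" "C\<^sup>T * D + 0\<^sub>m j e * (A * L') = 1\<^sub>m j"
    "X\<^sup>T * Z + S\<^sup>T * (A * K') = 0\<^sub>m e p"
    by (rule blocks1; use C X S Z D A K' L' in auto)+
  have CZ: "C\<^sup>T * Z = 0\<^sub>m j p" and CD: "C\<^sup>T * D = 1\<^sub>m j"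
    using 1(1,2) C Z D A K' L' by (simp_all add: left_mult_zero_mat)
  show "C\<^sup>T * D = 1\<^sub>m j" by (rule CD)
  \<comment> \<open>Cancelling invertible factors in the upper right block of the isometry equation
    gives first \<open>Z = 0\<close> and then \<open>A * K' = 0\<close>. These are exactly the terms
    that disturb the equation for \<open>N\<close> in the lower right block.\<close>
  have kill: "Y = 0\<^sub>m a b" if R: "R \<in> carrier_mat a a" "det R \<noteq> 0" and Y: "Y \<in> carrier_mat a b" "R * Y = 0\<^sub>m a b" for R Y :: "'a mat" and a b
  proof -
    obtain R' where R': "R' \<in> carrier_mat a a" "R' * R = 1\<^sub>m a" using det_nonzero_inverse[OF R] by metis
    have "Y = (R' * R) * Y" using R' Y by simp
    also have "\<dots> = R' * (R * Y)" by (rule assoc_mult_mat[OF R'(1) R(1) Y(1)])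
    finally show ?thesis using R' Y by simp
  qed
  have Z0: "Z = 0\<^sub>m j p" by (rule kill[OF _ _ Z CZ]) (use C detC det_transpose[OF C] in auto)
  then show "Z = 0\<^sub>m j p" .
  have SAK: "S\<^sup>T * (A * K') = 0\<^sub>m e p" using 1(3) X S A K' by (simp add: Z0)
  have AK: "A * K' = 0\<^sub>m e p" by (rule kill[OF _ _ _ SAK]) (use S detS det_transpose[OF S] A K' in auto)
  have QTt: "?Q\<^sup>T = four_block_mat (K\<^sup>T) (K'\<^sup>T) (L\<^sup>T) (L'\<^sup>T)" "?T\<^sup>T = four_block_mat (N\<^sup>T) (Z\<^sup>T) (N'\<^sup>T) (D\<^sup>T)"
    by (subst transpose_four_block_mat[OF K L K' L'], simp, subst transpose_four_block_mat[OF N N' Z D], simp)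
  have "four_block_mat ((K\<^sup>T * Z + K'\<^sup>T * (A * K')) + (N\<^sup>T * (H * N) + Z\<^sup>T * (- K)))
     ((K\<^sup>T * D + K'\<^sup>T * (A * L')) + (N\<^sup>T * (H * N') + Z\<^sup>T * (- L)))
     ((L\<^sup>T * Z + L'\<^sup>T * (A * K')) + (N'\<^sup>T * (H * N) + D\<^sup>T * (- K)))
     ((L\<^sup>T * D + L'\<^sup>T * (A * L')) + (N'\<^sup>T * (H * N') + D\<^sup>T * (- L))) = ?G22" (is "four_block_mat ?a ?b ?c ?d = _")
  proof -
    have "?Q\<^sup>T * ?U = four_block_mat (K\<^sup>T * Z + K'\<^sup>T * (A * K')) (K\<^sup>T * D + K'\<^sup>T * (A * L'))
       (L\<^sup>T * Z + L'\<^sup>T * (A * K')) (L\<^sup>T * D + L'\<^sup>T * (A * L'))"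
      unfolding QTt by (rule mult_four_block_mat[of _ p j _ e _ j _ _ p _ j]) (use K K' L L' Z D A in auto)
    moreover have "?T\<^sup>T * ?V = four_block_mat (N\<^sup>T * (H * N) + Z\<^sup>T * (- K)) (N\<^sup>T * (H * N') + Z\<^sup>T * (- L))
       (N'\<^sup>T * (H * N) + D\<^sup>T * (- K)) (N'\<^sup>T * (H * N') + D\<^sup>T * (- L))"
      unfolding QTt by (rule mult_four_block_mat[of _ p p _ j _ j _ _ p _ j]) (use K L N N' Z D H in auto)
    ultimately show ?thesis using QT
      by (simp only:) (subst (asm) add_four_block_mat[of _ p p _ j _ j], use K K' L L' Z D A N N' H in auto)
  qed
  then have "?a = H"
    by (rule four_block_mat_eqD(1)[of _ p p _ j _ j _ H "0\<^sub>m p j" "0\<^sub>m j p" "0\<^sub>m j j", rotated 8])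
      (use K K' L L' Z D A N N' H in auto)
  moreover have "?a = N\<^sup>T * (H * N)" using K K' N H unfolding Z0 AK by simp
  moreover have "N\<^sup>T * (H * N) = N\<^sup>T * H * N" using N H by (intro assoc_mult_mat[symmetric]) auto
  ultimately show "N\<^sup>T * H * N = H" by simp
qed

end

section \<open>Linear recurring sequences\<close>

text \<open>The polynomial ring acts on sequences with \<open>z\<close> as the shift; the index runs
  over all integers so that the shift is invertible.\<close>

definition seq_act :: "'a::comm_ring_1 poly \<Rightarrow> (int \<Rightarrow> 'a) \<Rightarrow> int \<Rightarrow> 'a" where
  "seq_act p c i = (\<Sum>l\<le>degree p. coeff p l * c (i + int l))"

abbreviation kills :: "'a::comm_ring_1 poly \<Rightarrow> (int \<Rightarrow> 'a) \<Rightarrow> bool" where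
  "kills p c \<equiv> (\<forall>i. seq_act p c i = 0)"

definition min_annihilator :: "(int \<Rightarrow> 'a::field) \<Rightarrow> 'a poly \<Rightarrow> bool" where
  "min_annihilator c s \<longleftrightarrow> lead_coeff s = 1 \<and> kills s c \<and> (\<forall>p. kills p c \<longrightarrow> s dvd p)"

lemma seq_act_ge: "degree p \<le> n \<Longrightarrow> seq_act p c i = (\<Sum>l\<le>n. coeff p l * c (i + int l))"
  unfolding seq_act_def by (rule sum.mono_neutral_left) (auto simp: coeff_eq_0)

lemma seq_act_0[simp]: "seq_act 0 c i = 0"
  by (simp add: seq_act_def)

lemma seq_act_zero_seq[simp]: "seq_act p (\<lambda>i. 0) i = 0"
  by (simp add: seq_act_def)

lemma seq_act_add: "seq_act (p + q) c i = seq_act p c i + seq_act q c i"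
proof -
  let ?n = "max (degree p) (degree q)"
  have "degree (p + q) \<le> ?n" by (rule degree_add_le) auto
  then show ?thesis
    using seq_act_ge[of "p + q" ?n c i] seq_act_ge[of p ?n c i] seq_act_ge[of q ?n c i]
    by (simp add: sum.distrib distrib_right)
qed

lemma seq_act_smult: "seq_act (Polynomial.smult a p) c i = a * seq_act p c i"
  using seq_act_ge[OF degree_smult_le, of a p c i]
  by (simp add: seq_act_def[of p] sum_distrib_left mult.assoc)

lemma seq_act_pCons: "seq_act (pCons a p) c i = a * c i + seq_act p c (i + 1)"
proof -
  have "seq_act (pCons a p) c i = (\<Sum>l\<le>Suc (degree p). coeff (pCons a p) l * c (i + int l))"
    by (rule seq_act_ge) (simp add: degree_pCons_le)
  also have "\<dots> = a * c i + (\<Sum>l\<le>degree p. coeff p l * c (i + 1 + int l))"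
    by (subst sum.atMost_Suc_shift) (simp add: algebra_simps)
  finally show ?thesis by (simp add: seq_act_def)
qed

lemma seq_act_mult: "seq_act (p * q) c i = seq_act p (seq_act q c) i"
proof (induction p arbitrary: i rule: pCons_induct)
  case (pCons a p)
  have "seq_act (pCons a p * q) c i = a * seq_act q c i + seq_act (p * q) c (i + 1)"
    by (simp add: mult_pCons_left seq_act_add seq_act_smult seq_act_pCons)
  then show ?case using pCons.IH by (simp add: seq_act_pCons)
qed simp

lemma seq_act_diff: "seq_act p (\<lambda>i. c i - c' i) i = seq_act p c i - seq_act p c' i"
  by (simp add: seq_act_def sum_subtractf right_diff_distrib)

lemma kills_dvd: "s dvd p \<Longrightarrow> kills s c \<Longrightarrow> kills p c"
proof -
  assume "s dvd p" "kills s c"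
  then obtain r where "p = r * s" by (metis dvdE mult.commute)
  moreover have "seq_act s c = (\<lambda>i. 0)" using \<open>kills s c\<close> by auto
  ultimately show ?thesis by (simp add: seq_act_mult)
qed

text \<open>Division with remainder by an element of least degree. It supplies annihilators of
  sequences, minimal polynomials of vectors, and later a Bezout relation.\<close>

lemma poly_ideal_generator:
  fixes I :: "'a::field poly set"
  assumes add: "\<And>p q. p \<in> I \<Longrightarrow> q \<in> I \<Longrightarrow> p + q \<in> I" and mult: "\<And>p q. p \<in> I \<Longrightarrow> q * p \<in> I"
    and p: "p \<in> I" "p \<noteq> 0"
  shows "\<exists>s. s \<in> I \<and> lead_coeff s = 1 \<and> (\<forall>p\<in>I. s dvd p)"
proof -
  obtain s0 where s0: "s0 \<in> I" "s0 \<noteq> 0" and least: "\<And>p. p \<in> I \<Longrightarrow> p \<noteq> 0 \<Longrightarrow> degree s0 \<le> degree p"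
    using ex_has_least_nat[of "\<lambda>p. p \<in> I \<and> p \<noteq> 0" p degree] p by auto
  define s where "s = [:inverse (lead_coeff s0):] * s0"
  have s: "s \<in> I" "lead_coeff s = 1" "degree s = degree s0"
    using s0 mult[OF s0(1)] unfolding s_def by (blast, simp_all)
  have "s dvd q" if q: "q \<in> I" for q
  proof -
    have "q mod s = q + (- (q div s)) * s" using div_mult_mod_eq[of q s] by (simp add: algebra_simps)
    then have "q mod s \<in> I" using add[OF q mult[OF s(1), of "- (q div s)"]] by simp
    have s_nz: "s \<noteq> 0" using s(2) by auto
    have "q mod s = 0"
      using degree_mod_less[OF s_nz, of q] least[OF \<open>q mod s \<in> I\<close>] s(3) by force
    then show ?thesis by (simp add: dvd_eq_mod_eq_0)
  qed
  then show ?thesis using s by blast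
qed

lemma min_annihilator_exists:
  assumes "kills p c" "p \<noteq> 0"
  shows "\<exists>s. min_annihilator c s"
proof -
  have "\<exists>s. s \<in> {p. kills p c} \<and> lead_coeff s = 1 \<and> (\<forall>p\<in>{p. kills p c}. s dvd p)"
  proof (rule poly_ideal_generator)
    show "q * p \<in> {p. kills p c}" if "p \<in> {p. kills p c}" for p q
      using that kills_dvd[of p "q * p" c] by simp
  qed (use assms in \<open>auto simp: seq_act_add\<close>)
  then show ?thesis by (auto simp: min_annihilator_def)
qed

lemma monic_dvd_antisym:
  fixes p q :: "'a::field poly"
  assumes "p dvd q" "q dvd p" "lead_coeff p = 1" "lead_coeff q = 1"
  shows "p = q"
proof -
  obtain r where r: "q = p * r" using assms(1) by blast
  have "p \<noteq> 0" "q \<noteq> 0" using assms by auto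
  have "degree p = degree q" using assms \<open>p \<noteq> 0\<close> \<open>q \<noteq> 0\<close> by (simp add: dvd_imp_degree_le le_antisym)
  then have "degree r = 0" using r \<open>p \<noteq> 0\<close> \<open>q \<noteq> 0\<close> by (auto simp: degree_mult_eq)
  moreover have "lead_coeff r = 1" using r assms(3,4) by (simp add: lead_coeff_mult)
  ultimately have "r = 1" by (metis degree_eq_zeroE lead_coeff_pCons(2) one_pCons coeff_pCons_0)
  then show ?thesis using r by simp
qed

lemma min_annihilator_unique: "min_annihilator c s \<Longrightarrow> min_annihilator c s' \<Longrightarrow> s = s'"
  unfolding min_annihilator_def by (intro monic_dvd_antisym) auto

text \<open>The shift on two-sided sequences is injective, so a factor \<open>z\<close> of an
  annihilator could be dropped, against minimality.\<close>

lemma min_annihilator_coeff_0: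
  assumes "min_annihilator c s"
  shows "coeff s 0 \<noteq> 0"
proof
  assume "coeff s 0 = 0"
  then obtain s' where s: "s = pCons 0 s'" by (metis coeff_pCons_0 pCons_cases)
  have nz: "s' \<noteq> 0" using assms s by (auto simp: min_annihilator_def)
  have "seq_act s' c i = 0" for i
    using assms seq_act_pCons[of 0 s' c "i - 1"] by (simp add: min_annihilator_def flip: s)
  then have "s dvd s'" using assms by (auto simp: min_annihilator_def)
  then have "degree s \<le> degree s'" using nz dvd_imp_degree_le by blast
  then show False using nz by (simp add: s)
qed

text \<open>The leading coefficient propagates the zeros of a window of length
  \<open>degree s\<close> upwards, the constant coefficient downwards.\<close>

lemma killed_zero_window:
  fixes c :: "int \<Rightarrow> 'a::field"
  assumes s: "s \<noteq> 0" "coeff s 0 \<noteq> 0" "kills s c" and win: "\<And>l. l < degree s \<Longrightarrow> c (i0 + int l) = 0"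
  shows "c i = 0"
proof -
  let ?e = "degree s"
  have rec: "(\<Sum>l\<le>?e. coeff s l * c (k + int l)) = 0" for k using s(3) by (simp add: seq_act_def)
  have up: "(\<forall>l<?e. c (i0 + int n + int l) = 0)" for n
  proof (induction n)
    case (Suc n)
    have "c (i0 + int n + int l) = 0" if "l \<le> ?e" for l
    proof (cases "l = ?e")
      case True
      have "(\<Sum>l\<le>?e. coeff s l * c (i0 + int n + int l)) = (\<Sum>l\<in>{?e}. coeff s l * c (i0 + int n + int l))"
        by (rule sum.mono_neutral_right) (use Suc in auto)
      then show ?thesis using rec[of "i0 + int n"] s(1) True by simp
    qed (use Suc that in auto)
    from this[of "Suc _"] show ?case by (auto simp: algebra_simps)
  qed (use win in simp)
  have down: "(\<forall>l<?e. c (i0 - int n + int l) = 0)" for n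
  proof (induction n)
    case (Suc n)
    have "c (i0 - int (Suc n) + int l) = 0" if l: "l \<le> ?e" for l
    proof (cases "l = 0")
      case True
      have z: "c (i0 - int (Suc n) + int l) = 0" if l: "l \<le> ?e" "l \<noteq> 0" for l
      proof -
        obtain m where "l = Suc m" using l(2) by (cases l) auto
        then show ?thesis using Suc[rule_format, of m] l(1) by (simp add: algebra_simps)
      qed
      have "(\<Sum>l\<le>?e. coeff s l * c (i0 - int (Suc n) + int l)) = (\<Sum>l\<in>{0}. coeff s l * c (i0 - int (Suc n) + int l))"
        by (rule sum.mono_neutral_right) (use z in auto)
      then show ?thesis using rec[of "i0 - int (Suc n)"] s(2) True by simp
    next
      case False
      then obtain m where "l = Suc m" by (cases l) auto
      then show ?thesis using Suc[rule_format, of m] l by (simp add: algebra_simps)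
    qed
    then show ?case by simp
  qed (use win in simp)
  show ?thesis
  proof (cases "?e = 0")
    case True
    then show ?thesis using rec[of i] s(2) by simp
  next
    case False
    show ?thesis
    proof (cases "i \<ge> i0")
      case True
      then show ?thesis using up[of "nat (i - i0)"] False by (auto dest!: spec[of _ 0])
    next
      case False
      then show ?thesis using down[of "nat (i0 - i)"] \<open>?e \<noteq> 0\<close> by (auto dest!: spec[of _ 0])
    qed
  qed
qed

lemma killed_eq_window:
  fixes c c' :: "int \<Rightarrow> 'a::field"
  assumes "s \<noteq> 0" "coeff s 0 \<noteq> 0" "kills s c" "kills s c'" "\<And>l. l < degree s \<Longrightarrow> c (i0 + int l) = c' (i0 + int l)"
  shows "c = c'"
proof
  fix i
  have "c i - c' i = 0"
    by (rule killed_zero_window[of s "\<lambda>i. c i - c' i" i0]) (use assms in \<open>auto simp: seq_act_diff\<close>)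
  then show "c i = c' i" by simp
qed

definition odd_seq :: "(int \<Rightarrow> 'a::comm_ring_1) \<Rightarrow> bool" where
  "odd_seq c \<longleftrightarrow> (\<forall>i. c (- i) = - c i)"

lemma seq_act_reflect:
  fixes c :: "int \<Rightarrow> 'a::field"
  assumes "odd_seq c" "coeff p 0 \<noteq> 0"
  shows "seq_act (reflect_poly p) c i = - seq_act p c (- i - int (degree p))"
proof -
  let ?e = "degree p"
  have de: "degree (reflect_poly p) = ?e" using assms(2) by (simp add: degree_reflect_poly_eq)
  have "seq_act (reflect_poly p) c i = (\<Sum>l\<le>?e. coeff p (?e - l) * c (i + int l))"
    unfolding seq_act_def de by (intro sum.cong refl) (simp add: coeff_reflect_poly)
  also have "\<dots> = (\<Sum>l\<le>?e. coeff p l * c (i + int (?e - l)))"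
    by (rule sum.reindex_bij_witness[of _ "\<lambda>l. ?e - l" "\<lambda>l. ?e - l"]) auto
  also have "\<dots> = (\<Sum>l\<le>?e. - (coeff p l * c (- i - int ?e + int l)))"
  proof (rule sum.cong[OF refl])
    fix l assume "l \<in> {..?e}"
    then have "i + int (?e - l) = - (- i - int ?e + int l)" by (simp add: of_nat_diff)
    then show "coeff p l * c (i + int (?e - l)) = - (coeff p l * c (- i - int ?e + int l))"
      using assms(1) unfolding odd_seq_def by (metis mult_minus_right)
  qed
  finally show ?thesis by (simp add: sum_negf seq_act_def)
qed

lemma poly_reflect_one:
  fixes p :: "'a::field poly"
  shows "poly (reflect_poly p) 1 = poly p 1"
  using poly_reflect_poly_nz[of "1::'a" p] by simp

text \<open>\<open>s\<close> divides its own reflection, so the two agree up to a sign. The sign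
  \<open>-1\<close> would force the root \<open>1\<close>, and an odd degree the root
  \<open>-1\<close>; either root leads to a proper divisor of \<open>s\<close> that still kills
  \<open>c\<close>.\<close>

lemma odd_min_annihilator_palindromic:
  fixes c :: "int \<Rightarrow> 'a::field"
  assumes two: "(2::'a) \<noteq> 0" and odd: "odd_seq c" and s: "min_annihilator c s"
  shows "reflect_poly s = s" "even (degree s)"
proof -
  have s0: "coeff s 0 \<noteq> 0" by (rule min_annihilator_coeff_0[OF s])
  have ls: "lead_coeff s = 1" and ks: "kills s c" and ms: "\<And>p. kills p c \<Longrightarrow> s dvd p"
    using s by (auto simp: min_annihilator_def)
  have s_nz: "s \<noteq> 0" using ls by auto
  have "kills (reflect_poly s) c" using seq_act_reflect[OF odd s0] ks by simp
  then have "s dvd reflect_poly s" by (rule ms)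
  then obtain r where r: "reflect_poly s = s * r" by blast
  have "degree r = 0"
    using r s_nz s0 degree_mult_eq[of s r] degree_reflect_poly_eq[OF s0]
    by (cases "r = 0") auto
  then obtain a where a: "reflect_poly s = Polynomial.smult a s"
    using r by (metis degree_eq_zeroE mult.commute mult_pCons_left mult_zero_left pCons_0_0 add_0_right)
  have "coeff (reflect_poly s) 0 = 1" using ls by (simp add: coeff_reflect_poly)
  then have as: "a * coeff s 0 = 1" using a by simp
  have "lead_coeff (reflect_poly s) = coeff s 0" using s0 by (simp add: coeff_reflect_poly degree_reflect_poly_eq)
  then have "a = coeff s 0" using a ls degree_reflect_poly_eq[OF s0] by simp
  then have "a * a = 1" using as by simp
  then have a1: "a = 1 \<or> a = -1" by (simp add: square_eq_1_iff)
  \<comment> \<open>For \<open>d\<close>, the action of \<open>s'\<close> on \<open>c\<close>, the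
    recurrence reads \<open>d (i + 1) = b * d i\<close>, while oddness of \<open>c\<close> gives
    \<open>d i = - d (- i - degree s')\<close>. For \<open>b = -1\<close> these two indices must
    differ by an even number, hence the parity condition on \<open>degree s'\<close>; then
    \<open>d = - d\<close>.\<close>
  have quot: False if fac: "s = [:- b, 1:] * s'" and b: "b = 1 \<or> (b = -1 \<and> even (degree s'))" and pal: "reflect_poly s' = s'" for s' b
  proof -
    have s'0: "coeff s' 0 \<noteq> 0" using s0 fac by (auto simp: coeff_mult)
    have s'nz: "s' \<noteq> 0" using s'0 by auto
    define d where "d = seq_act s' c"
    have d1: "d (i + 1) = b * d i" for i
      using ks[rule_format, of i] unfolding fac seq_act_mult d_def[symmetric] by (simp add: seq_act_pCons)
    have dodd: "d i = - d (- i - int (degree s'))" for i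
      using seq_act_reflect[OF odd s'0, of i] unfolding pal d_def .
    have d1': "d (i - 1) = b * d i" for i using d1[of "i - 1"] b by auto
    have up: "d (i + int k) = b ^ k * d i" for i k
    proof (induction k)
      case (Suc k)
      have "d (i + int (Suc k)) = d ((i + int k) + 1)" by (simp add: algebra_simps)
      then show ?case using d1 Suc by simp
    qed simp
    have down: "d (i - int k) = b ^ k * d i" for i k
    proof (induction k)
      case (Suc k)
      have "d (i - int (Suc k)) = d ((i - int k) - 1)" by (simp add: algebra_simps)
      then show ?case using d1' Suc by simp
    qed simp
    have dk: "d (i + k) = b ^ nat \<bar>k\<bar> * d i" for i k
      using up[of i "nat k"] down[of i "nat (- k)"] by (cases "k \<ge> 0") auto
    have "d i = 0" for i
    proof -
      have "d (- i - int (degree s')) = d (i + (- 2 * i - int (degree s')))" by (simp add: algebra_simps)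
      also have "\<dots> = b ^ nat \<bar>- 2 * i - int (degree s')\<bar> * d i" by (rule dk)
      also have "b ^ nat \<bar>- 2 * i - int (degree s')\<bar> = 1"
      proof (cases "b = 1")
        case False
        then have "even (degree s')" "b = -1" using b by auto
        then have "even (nat \<bar>- 2 * i - int (degree s')\<bar>)" by (simp add: even_nat_iff)
        then show ?thesis using \<open>b = -1\<close> by simp
      qed simp
      finally have "2 * d i = 0" using dodd[of i] by simp
      then show ?thesis using two by simp
    qed
    then have "s dvd s'" by (intro ms) (simp add: d_def)
    then have "degree s \<le> degree s'" using s'nz by (rule dvd_imp_degree_le)
    moreover have "degree s = Suc (degree s')" unfolding fac using s'nz by (subst degree_mult_eq) auto
    ultimately show False by simp
  qed
  have "a \<noteq> -1"
  proof
    assume a: "a = -1"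
    then have "poly s 1 = - poly s 1" using poly_reflect_one[of s] \<open>reflect_poly s = Polynomial.smult a s\<close> by simp
    then have "2 * poly s 1 = 0" by (simp only: mult_2 add_eq_0_iff2)
    then have "poly s 1 = 0" using two by simp
    then obtain s' where s': "s = [:-1, 1:] * s'" by (auto simp: poly_eq_0_iff_dvd)
    have rl: "reflect_poly [:-1,1:] = - [:-1,1::'a:]" by (rule poly_eqI) (simp add: reflect_poly_def)
    have "- [:-1,1:] * reflect_poly s' = - ([:-1,1:] * s')"
      using \<open>reflect_poly s = Polynomial.smult a s\<close> a rl unfolding s' reflect_poly_mult
      by (simp only: smult_minus_left smult_1_left)
    then have "[:-1,1:] * reflect_poly s' = [:-1,1:] * s'" by (simp only: mult_minus_left neg_equal_iff_equal)
    moreover have "[:-1,1:] \<noteq> (0::'a poly)" by simp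
    ultimately have "reflect_poly s' = s'" using mult_left_cancel by blast
    then show False using quot[of 1 s'] s' by simp
  qed
  then show rs: "reflect_poly s = s" using a a1 by simp
  show "even (degree s)"
  proof (rule ccontr)
    assume oe: "odd (degree s)"
    have "poly s (-1) = - poly s (-1)"
    proof -
      have "poly (reflect_poly s) (-1) = (-1) ^ degree s * poly s (inverse (-1))"
        by (rule poly_reflect_poly_nz) simp
      then show ?thesis using rs oe by (simp add: inverse_minus_eq)
    qed
    then have "2 * poly s (-1) = 0" by (simp only: mult_2 add_eq_0_iff2)
    then have "poly s (-1) = 0" using two by simp
    then obtain s' where s': "s = [:1, 1:] * s'" by (auto simp: poly_eq_0_iff_dvd)
    have s'nz: "s' \<noteq> 0" using s' s_nz by auto
    have rl: "reflect_poly [:1,1:] = [:1,1::'a:]" by (rule poly_eqI) (simp add: reflect_poly_def)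
    have "[:1,1:] * reflect_poly s' = [:1,1:] * s'"
      using rs rl unfolding s' reflect_poly_mult by (simp only:)
    moreover have "[:1,1:] \<noteq> (0::'a poly)" by simp
    ultimately have pal: "reflect_poly s' = s'" using mult_left_cancel by blast
    have "degree s = Suc (degree s')" unfolding s' using s'nz by (subst degree_mult_eq) auto
    then have "even (degree s')" using oe by simp
    then show False using quot[of "-1" s'] s' pal by simp
  qed
qed

section \<open>Cyclic flags of an isometry\<close>

definition mat_iter :: "'a::comm_ring_1 mat \<Rightarrow> nat \<Rightarrow> 'a vec \<Rightarrow> 'a vec" where
  "mat_iter M k = ((\<lambda>x. M *\<^sub>v x) ^^ k)"

definition poly_act :: "'a::comm_ring_1 mat \<Rightarrow> 'a poly \<Rightarrow> 'a vec \<Rightarrow> 'a vec" where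
  "poly_act M p v = vec (dim_vec v) (\<lambda>a. \<Sum>l\<le>degree p. coeff p l * (mat_iter M l v $ a))"

lemma mat_iter_simps[simp]: "mat_iter M 0 v = v" "mat_iter M (Suc k) v = M *\<^sub>v mat_iter M k v"
  by (simp_all add: mat_iter_def)

lemma mat_iter_add: "mat_iter M (a + b) v = mat_iter M a (mat_iter M b v)"
  by (simp add: mat_iter_def funpow_add)

context
  fixes M :: "'a::field mat" and d :: nat
  assumes M: "M \<in> carrier_mat d d"
begin

lemma mat_iter_carrier[simp]: "v \<in> carrier_vec d \<Longrightarrow> mat_iter M k v \<in> carrier_vec d"
  by (induction k) (use M in auto)

lemma poly_act_carrier[simp]: "v \<in> carrier_vec d \<Longrightarrow> poly_act M p v \<in> carrier_vec d"
  by (simp add: poly_act_def)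

lemma poly_act_index:
  assumes "v \<in> carrier_vec d" "a < d" "degree p \<le> n"
  shows "poly_act M p v $ a = (\<Sum>l\<le>n. coeff p l * (mat_iter M l v $ a))"
  using assms unfolding poly_act_def
  by (auto intro!: sum.mono_neutral_left simp: coeff_eq_0 le_degree)

lemma poly_act_0[simp]: "v \<in> carrier_vec d \<Longrightarrow> poly_act M 0 v = 0\<^sub>v d"
  unfolding poly_act_def by (auto intro!: eq_vecI)

lemma poly_act_add:
  assumes v: "v \<in> carrier_vec d"
  shows "poly_act M (p + q) v = poly_act M p v + poly_act M q v"
proof (rule eq_vecI)
  fix a assume "a < dim_vec (poly_act M p v + poly_act M q v)"
  then have a: "a < d" using v by (simp add: poly_act_def)
  let ?n = "max (degree p) (degree q)"
  have "degree (p + q) \<le> ?n" by (rule degree_add_le) auto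
  then show "poly_act M (p + q) v $ a = (poly_act M p v + poly_act M q v) $ a"
    using poly_act_index[OF v a, of "p + q" ?n] poly_act_index[OF v a, of p ?n] poly_act_index[OF v a, of q ?n] a
      carrier_vecD[OF poly_act_carrier[OF v, of q]]
    by (simp add: sum.distrib distrib_right)
qed (use v in \<open>simp add: poly_act_def\<close>)

lemma poly_act_smult:
  assumes v: "v \<in> carrier_vec d"
  shows "poly_act M (Polynomial.smult c p) v = c \<cdot>\<^sub>v poly_act M p v"
proof (rule eq_vecI)
  fix a assume "a < dim_vec (c \<cdot>\<^sub>v poly_act M p v)"
  then have a: "a < d" using v by (simp add: poly_act_def)
  show "poly_act M (Polynomial.smult c p) v $ a = (c \<cdot>\<^sub>v poly_act M p v) $ a"
    using poly_act_index[OF v a degree_smult_le, of c p] poly_act_index[OF v a, of p "degree p"] a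
      carrier_vecD[OF poly_act_carrier[OF v, of p]]
    by (simp add: sum_distrib_left mult.assoc)
qed (use v in \<open>simp add: poly_act_def\<close>)

lemma poly_act_pCons:
  assumes v: "v \<in> carrier_vec d"
  shows "poly_act M (pCons c p) v = c \<cdot>\<^sub>v v + M *\<^sub>v poly_act M p v"
proof (rule eq_vecI)
  fix a assume "a < dim_vec (c \<cdot>\<^sub>v v + M *\<^sub>v poly_act M p v)"
  then have a: "a < d" using v M by simp
  have "poly_act M (pCons c p) v $ a = (\<Sum>l\<le>Suc (degree p). coeff (pCons c p) l * (mat_iter M l v $ a))"
    by (rule poly_act_index[OF v a]) (simp add: degree_pCons_le)
  also have "\<dots> = c * v $ a + (\<Sum>l\<le>degree p. coeff p l * ((M *\<^sub>v mat_iter M l v) $ a))"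
    by (subst sum.atMost_Suc_shift) simp
  also have "(\<Sum>l\<le>degree p. coeff p l * ((M *\<^sub>v mat_iter M l v) $ a)) = (M *\<^sub>v poly_act M p v) $ a"
  proof -
    have di: "dim_vec (mat_iter M l v) = d" for l using mat_iter_carrier[OF v, of l] by simp
    have dp: "dim_vec (poly_act M p v) = d" using poly_act_carrier[OF v, of p] by simp
    have "(M *\<^sub>v poly_act M p v) $ a = (\<Sum>i<d. M $$ (a,i) * (\<Sum>l\<le>degree p. coeff p l * (mat_iter M l v $ i)))"
      using a M by (auto simp: scalar_prod_def dp poly_act_index[OF v _ order.refl] atLeast0LessThan intro!: sum.cong)
    also have "\<dots> = (\<Sum>l\<le>degree p. coeff p l * (\<Sum>i<d. M $$ (a,i) * (mat_iter M l v $ i)))"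
      unfolding sum_distrib_left by (subst sum.swap) (simp add: mult_ac)
    also have "\<dots> = (\<Sum>l\<le>degree p. coeff p l * ((M *\<^sub>v mat_iter M l v) $ a))"
      using a M by (auto simp: scalar_prod_def di atLeast0LessThan intro!: sum.cong)
    finally show ?thesis by simp
  qed
  finally show "poly_act M (pCons c p) v $ a = (c \<cdot>\<^sub>v v + M *\<^sub>v poly_act M p v) $ a" using a v M by simp
qed (use v M in \<open>simp add: poly_act_def\<close>)

lemma poly_act_1[simp]: "v \<in> carrier_vec d \<Longrightarrow> poly_act M 1 v = v"
  unfolding poly_act_def by (auto intro!: eq_vecI)

lemma poly_act_monom: "v \<in> carrier_vec d \<Longrightarrow> poly_act M (monom 1 k) v = mat_iter M k v"
proof (induction k)
  case (Suc k)
  have "0 \<cdot>\<^sub>v v + M *\<^sub>v mat_iter M k v = M *\<^sub>v mat_iter M k v"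
    using mat_iter_carrier[OF Suc.prems, of "Suc k"] M Suc.prems by (intro eq_vecI) auto
  then show ?case using Suc by (simp add: monom_Suc poly_act_pCons)
qed (simp add: monom_0 flip: one_pCons)

lemma poly_act_mult:
  assumes v: "v \<in> carrier_vec d"
  shows "poly_act M (p * q) v = poly_act M p (poly_act M q v)"
proof (induction p rule: pCons_induct)
  case (pCons a p)
  have "poly_act M (pCons a p * q) v = poly_act M (Polynomial.smult a q) v + poly_act M (pCons 0 (p * q)) v"
    using v by (simp add: mult_pCons_left poly_act_add)
  also have "poly_act M (pCons 0 (p * q)) v = M *\<^sub>v poly_act M (p * q) v"
    using v M by (simp add: poly_act_pCons) (intro eq_vecI, auto)
  finally show ?case using pCons.IH v by (simp add: poly_act_smult poly_act_pCons)
qed (use v in simp)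

lemma poly_act_zero_vec[simp]: "poly_act M p (0\<^sub>v d) = 0\<^sub>v d"
proof -
  have "mat_iter M l (0\<^sub>v d) = 0\<^sub>v d" for l by (induction l) (use M in auto)
  then show ?thesis unfolding poly_act_def by (auto intro!: eq_vecI)
qed

end

definition vec_min_poly :: "'a::field mat \<Rightarrow> 'a vec \<Rightarrow> 'a poly \<Rightarrow> bool" where
  "vec_min_poly M v g \<longleftrightarrow> lead_coeff g = 1 \<and> poly_act M g v = 0\<^sub>v (dim_vec v) \<and>
     (\<forall>p. poly_act M p v = 0\<^sub>v (dim_vec v) \<longrightarrow> g dvd p)"

lemma vec_min_poly_unique: "vec_min_poly M v g \<Longrightarrow> vec_min_poly M v g' \<Longrightarrow> g = g'"
  unfolding vec_min_poly_def by (intro monic_dvd_antisym) auto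

text \<open>Over a finite field two iterates of \<open>v\<close> coincide, which gives a nonzero
  annihilating polynomial.\<close>

lemma vec_min_poly_exists:
  fixes M :: "'a::{finite,field} mat"
  assumes M: "M \<in> carrier_mat d d" and v: "v \<in> carrier_vec d"
  shows "\<exists>g. vec_min_poly M v g"
proof -
  have "\<not> inj (\<lambda>k. mat_iter M k v)"
  proof
    assume "inj (\<lambda>k. mat_iter M k v)"
    moreover have "range (\<lambda>k. mat_iter M k v) \<subseteq> carrier_vec d" using mat_iter_carrier[OF M v] by auto
    ultimately have "finite (UNIV :: nat set)"
      using finite_carrier_vec[of d, where 'a='a] by (meson finite_imageD finite_subset)
    then show False by simp
  qed
  then obtain a b where ab: "a < b" "mat_iter M a v = mat_iter M b v"
    unfolding inj_def by (metis linorder_neqE_nat)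
  define p where "p = (monom 1 a + Polynomial.smult (-1) (monom 1 b) :: 'a poly)"
  have "coeff p a = 1" using ab by (simp add: p_def)
  then have pnz: "p \<noteq> 0" by auto
  have "poly_act M p v = mat_iter M b v + (-1) \<cdot>\<^sub>v mat_iter M b v"
    unfolding p_def poly_act_add[OF M v] poly_act_smult[OF M v] poly_act_monom[OF M v] ab(2) ..
  also have "\<dots> = 0\<^sub>v d" using mat_iter_carrier[OF M v, of b] by (intro eq_vecI) auto
  finally have p: "poly_act M p v = 0\<^sub>v d" .
  have "\<exists>s. s \<in> {p. poly_act M p v = 0\<^sub>v d} \<and> lead_coeff s = 1 \<and> (\<forall>p\<in>{p. poly_act M p v = 0\<^sub>v d}. s dvd p)"
    by (rule poly_ideal_generator[OF _ _ _ pnz])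
      (use p in \<open>auto simp: poly_act_add[OF M v] poly_act_mult[OF M v] poly_act_zero_vec[OF M]\<close>)
  then show ?thesis using v by (auto simp: vec_min_poly_def)
qed

text \<open>The form values of \<open>v\<close> and \<open>M^k v\<close>. At negative
  \<open>k\<close> the value is the one forced by invariance and antisymmetry, so that no inverse of
  \<open>M\<close> has to be written.\<close>

definition form_seq :: "'a::comm_ring_1 mat \<Rightarrow> 'a mat \<Rightarrow> 'a vec \<Rightarrow> int \<Rightarrow> 'a" where
  "form_seq J M v k = (if k \<ge> 0 then v \<bullet> (J *\<^sub>v mat_iter M (nat k) v) else - (v \<bullet> (J *\<^sub>v mat_iter M (nat (- k)) v)))"

context
  fixes J M :: "'a::field mat" and d :: nat
  assumes two: "(2::'a) \<noteq> 0" and J: "J \<in> carrier_mat d d" "J\<^sup>T = - J"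
    and M: "M \<in> carrier_mat d d" and iso: "M\<^sup>T * J * M = J"
begin

lemma isometry_form:
  assumes x: "x \<in> carrier_vec d" and y: "y \<in> carrier_vec d"
  shows "(M *\<^sub>v x) \<bullet> (J *\<^sub>v (M *\<^sub>v y)) = x \<bullet> (J *\<^sub>v y)"
proof -
  have "(M *\<^sub>v x) \<bullet> (J *\<^sub>v (M *\<^sub>v y)) = ((M\<^sup>T)\<^sup>T *\<^sub>v x) \<bullet> (J *\<^sub>v (M *\<^sub>v y))" by simp
  also have "\<dots> = x \<bullet> (M\<^sup>T *\<^sub>v (J *\<^sub>v (M *\<^sub>v y)))"
    by (rule transpose_vec_mult_scalar[of _ d d]) (use M J x y in auto)
  also have "M\<^sup>T *\<^sub>v (J *\<^sub>v (M *\<^sub>v y)) = (M\<^sup>T * J * M) *\<^sub>v y"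
  proof -
    have "(M\<^sup>T * J * M) *\<^sub>v y = (M\<^sup>T * J) *\<^sub>v (M *\<^sub>v y)"
      by (rule assoc_mult_mat_vec[of _ d d _ d]) (use M J y in auto)
    also have "\<dots> = M\<^sup>T *\<^sub>v (J *\<^sub>v (M *\<^sub>v y))"
      by (rule assoc_mult_mat_vec[of _ d d _ d]) (use M J y in auto)
    finally show ?thesis by simp
  qed
  finally show ?thesis unfolding iso .
qed

lemma isometry_form_iter:
  assumes x: "x \<in> carrier_vec d" and y: "y \<in> carrier_vec d"
  shows "mat_iter M a x \<bullet> (J *\<^sub>v mat_iter M a y) = x \<bullet> (J *\<^sub>v y)"
  by (induction a) (use isometry_form mat_iter_carrier[OF M] x y in auto)

context
  fixes v :: "'a vec"
  assumes v: "v \<in> carrier_vec d"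
begin

lemma form_seq_odd: "odd_seq (form_seq J M v)"
  using alternating_self[OF two J v] by (auto simp: odd_seq_def form_seq_def)

lemma form_iter_iter: "mat_iter M a v \<bullet> (J *\<^sub>v mat_iter M b v) = form_seq J M v (int b - int a)"
proof (cases "a \<le> b")
  case True
  then have "mat_iter M b v = mat_iter M a (mat_iter M (b - a) v)" using mat_iter_add[of M a "b - a" v] by simp
  then show ?thesis using isometry_form_iter[OF v, of "mat_iter M (b - a) v" a] True mat_iter_carrier[OF M v]
    by (simp add: form_seq_def of_nat_diff nat_diff_distrib')
next
  case False
  have "mat_iter M a v \<bullet> (J *\<^sub>v mat_iter M b v) = - (mat_iter M b v \<bullet> (J *\<^sub>v mat_iter M a v))"
    by (rule antisymmetric_swap[OF J]) (use mat_iter_carrier[OF M v] in auto)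
  also have "mat_iter M b v \<bullet> (J *\<^sub>v mat_iter M a v) = v \<bullet> (J *\<^sub>v mat_iter M (a - b) v)"
  proof -
    have "mat_iter M a v = mat_iter M b (mat_iter M (a - b) v)" using False mat_iter_add[of M b "a - b" v] by simp
    then show ?thesis using isometry_form_iter[OF v, of "mat_iter M (a - b) v" b] mat_iter_carrier[OF M v] by simp
  qed
  finally show ?thesis using False by (simp add: form_seq_def nat_diff_distrib')
qed

text \<open>This dictionary turns orthogonality inside the cyclic subspace into annihilation of the
  form sequence.\<close>

lemma form_iter_poly_act:
  "mat_iter M a v \<bullet> (J *\<^sub>v mat_iter M b (poly_act M p v)) = seq_act p (form_seq J M v) (int b - int a)"
proof (induction p arbitrary: b rule: pCons_induct)
  case 0
  have "mat_iter M b (0\<^sub>v d) = 0\<^sub>v d" by (induction b) (use M in auto)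
  moreover have "mat_iter M a v \<bullet> 0\<^sub>v d = 0" using mat_iter_carrier[OF M v, of a] by simp
  moreover have "J *\<^sub>v 0\<^sub>v d = 0\<^sub>v d" using J by auto
  ultimately show ?case using v by (simp add: poly_act_0[OF M])
next
  case (pCons c p)
  have lin: "mat_iter M b (c \<cdot>\<^sub>v v + w) = c \<cdot>\<^sub>v mat_iter M b v + mat_iter M b w" if w: "w \<in> carrier_vec d" for w
  proof (induction b)
    case (Suc b)
    then show ?case using M v w mat_iter_carrier[OF M v, of b] mat_iter_carrier[OF M w, of b]
      by (simp add: mult_add_distrib_mat_vec[OF M] mult_mat_vec[OF M])
  qed simp
  let ?w = "M *\<^sub>v poly_act M p v"
  have w: "?w \<in> carrier_vec d" using M poly_act_carrier[OF M v, of p] by auto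
  have "mat_iter M b ?w = mat_iter M (Suc b) (poly_act M p v)" using mat_iter_add[of M b 1 "poly_act M p v"] by simp
  then have "mat_iter M b (poly_act M (pCons c p) v) = c \<cdot>\<^sub>v mat_iter M b v + mat_iter M (Suc b) (poly_act M p v)"
    using lin[OF w] by (simp add: poly_act_pCons[OF M v])
  moreover have cs: "mat_iter M b v \<in> carrier_vec d" "mat_iter M (Suc b) (poly_act M p v) \<in> carrier_vec d" "mat_iter M a v \<in> carrier_vec d"
    using mat_iter_carrier[OF M v] mat_iter_carrier[OF M poly_act_carrier[OF M v]] by blast+
  ultimately have "mat_iter M a v \<bullet> (J *\<^sub>v mat_iter M b (poly_act M (pCons c p) v))
     = c * (mat_iter M a v \<bullet> (J *\<^sub>v mat_iter M b v)) + mat_iter M a v \<bullet> (J *\<^sub>v mat_iter M (Suc b) (poly_act M p v))"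
  proof -
    let ?x = "mat_iter M b v" and ?y = "mat_iter M (Suc b) (poly_act M p v)" and ?u = "mat_iter M a v"
    assume "mat_iter M b (poly_act M (pCons c p) v) = c \<cdot>\<^sub>v ?x + ?y"
      and cs: "?x \<in> carrier_vec d" "?y \<in> carrier_vec d" "?u \<in> carrier_vec d"
    then have "?u \<bullet> (J *\<^sub>v mat_iter M b (poly_act M (pCons c p) v)) = ?u \<bullet> (J *\<^sub>v (c \<cdot>\<^sub>v ?x + ?y))" by (simp only:)
    also have "J *\<^sub>v (c \<cdot>\<^sub>v ?x + ?y) = J *\<^sub>v (c \<cdot>\<^sub>v ?x) + J *\<^sub>v ?y"
      by (rule mult_add_distrib_mat_vec[OF J(1)]) (use cs in auto)
    also have "J *\<^sub>v (c \<cdot>\<^sub>v ?x) = c \<cdot>\<^sub>v (J *\<^sub>v ?x)" by (rule mult_mat_vec[OF J(1) cs(1)])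
    also have "?u \<bullet> (c \<cdot>\<^sub>v (J *\<^sub>v ?x) + J *\<^sub>v ?y) = ?u \<bullet> (c \<cdot>\<^sub>v (J *\<^sub>v ?x)) + ?u \<bullet> (J *\<^sub>v ?y)"
      by (rule scalar_prod_add_distrib[OF cs(3)]) (use cs J in \<open>auto intro!: mult_mat_vec_carrier[OF J(1)]\<close>)
    also have "?u \<bullet> (c \<cdot>\<^sub>v (J *\<^sub>v ?x)) = c * (?u \<bullet> (J *\<^sub>v ?x))"
      by (rule scalar_prod_smult_distrib[OF cs(3) mult_mat_vec_carrier[OF J(1) cs(1)]])
    finally show ?thesis .
  qed
  then show ?case unfolding pCons.IH form_iter_iter seq_act_pCons by (simp add: algebra_simps)
qed

lemma form_poly_act_zero:
  assumes x: "x \<in> carrier_vec d" and z: "\<And>a. mat_iter M a v \<bullet> (J *\<^sub>v x) = 0"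
  shows "poly_act M p v \<bullet> (J *\<^sub>v x) = 0"
proof -
  have "poly_act M p v \<bullet> (J *\<^sub>v x) = (\<Sum>i<d. (\<Sum>l\<le>degree p. coeff p l * (mat_iter M l v $ i)) * (J *\<^sub>v x) $ i)"
    using J v x by (auto simp: scalar_prod_def poly_act_def atLeast0LessThan intro!: sum.cong)
  also have "\<dots> = (\<Sum>l\<le>degree p. coeff p l * (\<Sum>i<d. mat_iter M l v $ i * (J *\<^sub>v x) $ i))"
    unfolding sum_distrib_left sum_distrib_right by (subst sum.swap) (simp add: mult_ac)
  also have "\<dots> = (\<Sum>l\<le>degree p. coeff p l * (mat_iter M l v \<bullet> (J *\<^sub>v x)))"
    using J by (auto simp: scalar_prod_def atLeast0LessThan intro!: sum.cong)
  finally show ?thesis using z by simp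
qed

lemma min_poly_kills_form_seq:
  assumes "poly_act M g v = 0\<^sub>v d"
  shows "kills g (form_seq J M v)"
proof
  fix i :: int
  have "mat_iter M b (0\<^sub>v d) = 0\<^sub>v d" for b by (induction b) (use M in auto)
  then have "mat_iter M (nat (- i)) v \<bullet> (J *\<^sub>v mat_iter M (nat i) (poly_act M g v)) = mat_iter M (nat (- i)) v \<bullet> (J *\<^sub>v 0\<^sub>v d)"
    using assms by simp
  also have "J *\<^sub>v 0\<^sub>v d = 0\<^sub>v d" using J by auto
  also have "mat_iter M (nat (- i)) v \<bullet> 0\<^sub>v d = 0" using mat_iter_carrier[OF M v] by simp
  finally show "seq_act g (form_seq J M v) i = 0"
    unfolding form_iter_poly_act by (cases "i \<ge> 0") simp_all
qed

end

end

section \<open>Toeplitz Gram matrices and the model of a cyclic subspace\<close>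

definition vpoly :: "nat \<Rightarrow> (nat \<Rightarrow> 'a::comm_ring_1) \<Rightarrow> 'a poly" where
  "vpoly n f = (\<Sum>i<n. monom (f i) i)"

lemma coeff_vpoly: "coeff (vpoly n f) i = (if i < n then f i else 0)"
proof -
  have "coeff (vpoly n f) i = (\<Sum>l<n. if l = i then f l else 0)"
    unfolding vpoly_def by (simp add: coeff_sum)
  then show ?thesis by simp
qed

lemma vpoly_degree: "vpoly n f = 0 \<or> degree (vpoly n f) < n"
proof (cases "n = 0")
  case False
  have "degree (vpoly n f) \<le> n - 1" by (rule degree_le) (use False in \<open>auto simp: coeff_vpoly\<close>)
  then have "degree (vpoly n f) < n" using False by linarith
  then show ?thesis ..
qed (simp add: vpoly_def)

lemma vpoly_dvd_zero:
  fixes s :: "'a::field poly"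
  assumes "s dvd vpoly (degree s) f"
  shows "vpoly (degree s) f = 0"
proof (rule ccontr)
  assume nz: "vpoly (degree s) f \<noteq> 0"
  with dvd_imp_degree_le[OF assms nz] vpoly_degree[of "degree s" f] show False by linarith
qed

lemma vpoly_monic: "lead_coeff t = 1 \<Longrightarrow> vpoly (degree t) (coeff t) = t - monom 1 (degree t)"
  by (rule poly_eqI) (auto simp: coeff_vpoly coeff_eq_0)

lemma sum_lessThan_split: "(\<Sum>i<a + (b::nat). f i) = (\<Sum>i<a. f i) + (\<Sum>i<b. f (a + i) :: 'b::comm_monoid_add)"
  by (induction b) (simp_all add: add.assoc)

text \<open>For a form sequence this is the Gram matrix of \<open>v, M v, ..., M^(e-1) v\<close>,
  which is Toeplitz because the form is invariant.\<close>

definition seq_gram :: "nat \<Rightarrow> (int \<Rightarrow> 'a::comm_ring_1) \<Rightarrow> 'a mat" where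
  "seq_gram e c = mat e e (\<lambda>(i,l). c (int l - int i))"

lemma seq_gram_carrier[simp]: "seq_gram e c \<in> carrier_mat e e"
  by (simp add: seq_gram_def)

lemma seq_gram_antisym: "odd_seq c \<Longrightarrow> (seq_gram e c)\<^sup>T = - seq_gram e c"
proof (rule eq_matI)
  fix i l assume "odd_seq c" "i < dim_row (- seq_gram e c)" "l < dim_col (- seq_gram e c)"
  moreover from \<open>odd_seq c\<close> have "c (int i - int l) = - c (int l - int i)"
    unfolding odd_seq_def by (drule_tac spec[of _ "int l - int i"]) simp
  ultimately show "(seq_gram e c)\<^sup>T $$ (i,l) = (- seq_gram e c) $$ (i,l)" by (simp add: seq_gram_def)
qed (simp_all add: seq_gram_def)

text \<open>A kernel vector is a polynomial \<open>p\<close> of degree below \<open>degree s\<close>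
  whose action on \<open>c\<close> vanishes on a window of \<open>degree s\<close> indices. As
  \<open>s\<close> also kills the sequence obtained from \<open>c\<close> by \<open>p\<close>, this
  sequence is zero, so \<open>s\<close> divides \<open>p\<close> and \<open>p = 0\<close>.\<close>

lemma seq_gram_det:
  fixes c :: "int \<Rightarrow> 'a::field"
  assumes s: "min_annihilator c s"
  shows "det (seq_gram (degree s) c) \<noteq> 0"
proof
  let ?e = "degree s"
  assume "det (seq_gram ?e c) = 0"
  then obtain x where x: "x \<in> carrier_vec ?e" "x \<noteq> 0\<^sub>v ?e" "seq_gram ?e c *\<^sub>v x = 0\<^sub>v ?e"
    using det_0_iff_vec_prod_zero_field[OF seq_gram_carrier] by blast
  let ?p = "vpoly ?e (\<lambda>i. x $ i)"
  have act: "seq_act ?p c k = (\<Sum>l<?e. x $ l * c (k + int l))" for k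
  proof -
    have "degree ?p \<le> ?e" using vpoly_degree[of ?e "\<lambda>i. x $ i"] by auto
    then have "seq_act ?p c k = (\<Sum>l\<le>?e. coeff ?p l * c (k + int l))" by (rule seq_act_ge)
    also have "\<dots> = (\<Sum>l<?e. x $ l * c (k + int l))"
      by (rule sum.mono_neutral_cong_right) (auto simp: coeff_vpoly)
    finally show ?thesis .
  qed
  have z: "seq_act ?p c (- int i) = 0" if "i < ?e" for i
  proof -
    have "(seq_gram ?e c *\<^sub>v x) $ i = 0" using x(3) that by simp
    moreover have "(seq_gram ?e c *\<^sub>v x) $ i = (\<Sum>l<?e. c (int l - int i) * x $ l)"
      using that x(1) by (auto simp: seq_gram_def scalar_prod_def atLeast0LessThan)
    ultimately show ?thesis unfolding act by (simp add: mult.commute)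
  qed
  have sk: "s \<noteq> 0" "coeff s 0 \<noteq> 0" "kills s c"
    using s min_annihilator_coeff_0[OF s] by (auto simp: min_annihilator_def)
  have "kills ?p c"
  proof
    fix i
    show "seq_act ?p c i = 0"
    proof (rule killed_zero_window[OF sk(1,2), of "seq_act ?p c" "1 - int ?e"])
      have "seq_act s c = (\<lambda>i. 0)" using sk(3) by auto
      then show "kills s (seq_act ?p c)"
        using seq_act_mult[of s ?p c] seq_act_mult[of ?p s c] by (simp add: mult.commute)
      show "seq_act ?p c (1 - int ?e + int l) = 0" if "l < ?e" for l
        using z[of "?e - 1 - l"] that by (simp add: of_nat_diff algebra_simps)
    qed
  qed
  then have "s dvd ?p" using s by (simp add: min_annihilator_def)
  then have "?p = 0" by (rule vpoly_dvd_zero)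
  then have "x $ i = 0" if "i < ?e" for i using coeff_vpoly[of ?e "\<lambda>i. x $ i" i] that by simp
  then show False using x(1,2) by (auto intro: eq_vecI)
qed

text \<open>On Toeplitz entries the companion matrix moves the column index by one and its transpose
  moves the row index by one, so differences of indices are restored; at the last index the
  recurrence of \<open>s\<close> supplies the missing value.\<close>

lemma companion_gram:
  fixes c :: "int \<Rightarrow> 'a::field"
  assumes odd: "odd_seq c" and ls: "lead_coeff s = 1" and ks: "kills s c"
  shows "(companion s)\<^sup>T * seq_gram (degree s) c * companion s = seq_gram (degree s) c"
proof -
  let ?e = "degree s" and ?S = "companion s" and ?A = "seq_gram (degree s) c"
  have S: "?S \<in> carrier_mat ?e ?e" by simp
  have rec: "(\<Sum>b<?e. coeff s b * c (k + int b)) = - c (k + int ?e)" for k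
  proof -
    have "(\<Sum>b\<le>?e. coeff s b * c (k + int b)) = 0" using ks by (simp add: seq_act_def)
    then show ?thesis using ls by (simp add: lessThan_Suc_atMost[symmetric] eq_neg_iff_add_eq_0)
  qed
  have Sent: "?S $$ (i,l) = (if Suc l < ?e then (if i = Suc l then 1 else 0) else - coeff s i)" if "i < ?e" "l < ?e" for i l
    using that by (simp add: companion_def)
  have AS: "(?A * ?S) $$ (i,l) = c (int l + 1 - int i)" if il: "i < ?e" "l < ?e" for i l
  proof -
    have "(?A * ?S) $$ (i,l) = (\<Sum>b<?e. c (int b - int i) * ?S $$ (b,l))"
      using il by (auto simp: seq_gram_def scalar_prod_def companion_def atLeast0LessThan intro!: sum.cong)
    also have "\<dots> = c (int l + 1 - int i)"
    proof (cases "Suc l < ?e")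
      case True
      have "(\<Sum>b<?e. c (int b - int i) * ?S $$ (b,l)) = (\<Sum>b<?e. if b = Suc l then c (int b - int i) else 0)"
        by (rule sum.cong) (use il True Sent in auto)
      then show ?thesis using True by (simp add: algebra_simps)
    next
      case False
      then have e: "int ?e = int l + 1" using il by linarith
      have "(\<Sum>b<?e. c (int b - int i) * ?S $$ (b,l)) = - (\<Sum>b<?e. coeff s b * c (- int i + int b))"
        unfolding sum_negf[symmetric] by (rule sum.cong) (use il False Sent in \<open>auto simp: algebra_simps\<close>)
      then show ?thesis unfolding rec using e by (simp add: algebra_simps)
    qed
    finally show ?thesis .
  qed
  have "?S\<^sup>T * (?A * ?S) = ?A"
  proof (rule eq_matI)
    fix i l assume "i < dim_row ?A" "l < dim_col ?A"
    then have il: "i < ?e" "l < ?e" by (auto simp: seq_gram_def)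
    have "(?S\<^sup>T * (?A * ?S)) $$ (i,l) = (\<Sum>b<?e. ?S $$ (b,i) * (?A * ?S) $$ (b,l))"
    proof -
      have AScar: "?A * ?S \<in> carrier_mat ?e ?e" by (rule mult_carrier_mat[of _ _ ?e]) auto
      have "(?S\<^sup>T * (?A * ?S)) $$ (i,l) = row (?S\<^sup>T) i \<bullet> col (?A * ?S) l"
        by (rule index_mult_mat(1)) (use il S AScar in auto)
      also have "row (?S\<^sup>T) i = col ?S i" by (rule row_transpose) (simp add: companion_def il)
      also have "col ?S i \<bullet> col (?A * ?S) l = (\<Sum>b<?e. col ?S i $ b * col (?A * ?S) l $ b)"
        unfolding scalar_prod_def by (simp add: atLeast0LessThan seq_gram_def)
      also have "\<dots> = (\<Sum>b<?e. ?S $$ (b,i) * (?A * ?S) $$ (b,l))"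
        unfolding col_def by (rule sum.cong[OF refl]) (use il carrier_matD[OF AScar] in \<open>simp add: companion_def\<close>)
      finally show ?thesis .
    qed
    also have "\<dots> = c (int l - int i)"
    proof (cases "Suc i < ?e")
      case True
      have "(\<Sum>b<?e. ?S $$ (b,i) * (?A * ?S) $$ (b,l)) = (\<Sum>b<?e. if b = Suc i then c (int l + 1 - int b) else 0)"
        by (rule sum.cong) (use il True Sent AS in auto)
      then show ?thesis using True by (simp add: algebra_simps)
    next
      case False
      then have e: "int ?e = int i + 1" using il by linarith
      have "(\<Sum>b<?e. ?S $$ (b,i) * (?A * ?S) $$ (b,l)) = (\<Sum>b<?e. coeff s b * c (- (int l + 1) + int b))"
      proof (rule sum.cong[OF refl])
        fix b assume "b \<in> {..<?e}"
        moreover have "c (int l + 1 - int b) = - c (- (int l + 1) + int b)"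
          using odd[unfolded odd_seq_def, rule_format, of "- (int l + 1) + int b"] by (simp add: algebra_simps)
        ultimately show "?S $$ (b,i) * (?A * ?S) $$ (b,l) = coeff s b * c (- (int l + 1) + int b)"
          using il False Sent AS by auto
      qed
      also have "\<dots> = - c (int i - int l)" unfolding rec using e by (simp add: algebra_simps)
      also have "\<dots> = c (int l - int i)" using odd[unfolded odd_seq_def, rule_format, of "int i - int l"] by simp
      finally show ?thesis .
    qed
    finally show "(?S\<^sup>T * (?A * ?S)) $$ (i,l) = ?A $$ (i,l)" using il by (simp add: seq_gram_def)
  qed (auto simp: seq_gram_def companion_def)
  moreover have "?S\<^sup>T * ?A * ?S = ?S\<^sup>T * (?A * ?S)"
    by (rule assoc_mult_mat[of _ ?e ?e _ ?e _ ?e]) auto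
  ultimately show ?thesis by simp
qed

text \<open>Representatives modulo \<open>s * t\<close>. The multiples
  \<open>s, z * s, ..., z^(j-1) * s\<close> come first because they will span the radical; the
  powers \<open>1, ..., z^(e-1)\<close> with \<open>e = degree s\<close> follow.\<close>

definition flag_poly :: "'a::field poly \<Rightarrow> nat \<Rightarrow> nat \<Rightarrow> 'a poly" where
  "flag_poly s j i = (if i < j then monom 1 i * s else monom 1 (i - j))"

text \<open>Multiplication by \<open>z\<close> modulo \<open>s * t\<close> in the basis
  \<open>flag_poly\<close>. The single 1 in the upper right block records that the reduction of
  \<open>z^e\<close> contains \<open>s\<close>, the first basis element.\<close>

definition flag_shift :: "'a::field poly \<Rightarrow> 'a poly \<Rightarrow> 'a mat" where
  "flag_shift s t = four_block_mat (companion t)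
     (mat (degree t) (degree s) (\<lambda>(i,l). if i = 0 \<and> Suc l = degree s then 1 else 0))
     (0\<^sub>m (degree s) (degree t)) (companion s)"

definition flag_gram :: "'a::field poly \<Rightarrow> 'a poly \<Rightarrow> (int \<Rightarrow> 'a) \<Rightarrow> 'a mat" where
  "flag_gram s t c = four_block_mat (0\<^sub>m (degree t) (degree t)) (0\<^sub>m (degree t) (degree s))
     (0\<^sub>m (degree s) (degree t)) (seq_gram (degree s) c)"

text \<open>Coordinates of the polynomial 1. For \<open>degree s = 0\<close> this is
  \<open>s\<close> itself, hence the first basis element.\<close>

definition flag_start :: "'a::field poly \<Rightarrow> 'a poly \<Rightarrow> 'a vec" where
  "flag_start s t = unit_vec (degree t + degree s) (if degree s = 0 then 0 else degree t)"

definition flag_basis :: "'a::field mat \<Rightarrow> 'a vec \<Rightarrow> 'a poly \<Rightarrow> 'a poly \<Rightarrow> 'a mat" where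
  "flag_basis M v s t = mat (dim_vec v) (degree t + degree s)
     (\<lambda>(a,i). poly_act M (flag_poly s (degree t) i) v $ a)"

context
  fixes s t :: "'a::field poly"
  assumes ls: "lead_coeff s = 1" and lt: "lead_coeff t = 1"
begin

private abbreviation (input) "j \<equiv> degree t"
private abbreviation (input) "e \<equiv> degree s"
private abbreviation (input) "w \<equiv> degree t + degree s"
private abbreviation (input) "B \<equiv> flag_shift s t"

lemma flag_shift_carrier: "B \<in> carrier_mat w w"
  unfolding flag_shift_def by (intro four_block_carrier_mat) auto

lemma flag_gram_carrier: "flag_gram s t c \<in> carrier_mat w w"
  unfolding flag_gram_def by (intro four_block_carrier_mat) auto

lemma flag_start_carrier: "flag_start s t \<in> carrier_vec w"
  by (simp add: flag_start_def)

lemma flag_shift_index: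
  assumes "l < w" "i < w"
  shows "B $$ (l,i) = (if i < j then (if l < j then (if Suc i < j then (if l = Suc i then 1 else 0) else - coeff t l) else 0)
    else (if l < j then (if l = 0 \<and> Suc (i - j) = e then 1 else 0)
      else (if Suc (i - j) < e then (if l - j = Suc (i - j) then 1 else 0) else - coeff s (l - j))))"
  using assms unfolding flag_shift_def companion_def by auto

lemma col_flag_shift:
  shows "Suc i < w \<Longrightarrow> Suc i \<noteq> j \<Longrightarrow> col B i = unit_vec w (Suc i)"
    and "Suc i = j \<Longrightarrow> col B i = vec w (\<lambda>l. if l < j then - coeff t l else 0)"
    and "Suc i = w \<Longrightarrow> j \<le> i \<Longrightarrow> col B i = vec w (\<lambda>l. if l < j then (if l = 0 then 1 else 0) else - coeff s (l - j))"
proof -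
  have c: "dim_row B = w" "dim_col B = w" using flag_shift_carrier by auto
  show "Suc i < w \<Longrightarrow> Suc i \<noteq> j \<Longrightarrow> col B i = unit_vec w (Suc i)"
    by (rule eq_vecI) (auto simp: c flag_shift_index unit_vec_def)
  show "Suc i = j \<Longrightarrow> col B i = vec w (\<lambda>l. if l < j then - coeff t l else 0)"
    by (rule eq_vecI) (auto simp: c flag_shift_index)
  show "Suc i = w \<Longrightarrow> j \<le> i \<Longrightarrow> col B i = vec w (\<lambda>l. if l < j then (if l = 0 then 1 else 0) else - coeff s (l - j))"
    by (rule eq_vecI) (auto simp: c flag_shift_index)
qed

lemma flag_shift_isometry:
  assumes "odd_seq c" "kills s c"
  shows "B\<^sup>T * flag_gram s t c * B = flag_gram s t c"
proof -
  let ?X = "mat j e (\<lambda>(i,l). if i = 0 \<and> Suc l = e then 1 else 0) :: 'a mat"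
  let ?C = "companion t" and ?S = "companion s" and ?A = "seq_gram e c"
  have BT: "B\<^sup>T = four_block_mat (?C\<^sup>T) (0\<^sub>m j e) (?X\<^sup>T) (?S\<^sup>T)"
    unfolding flag_shift_def by (subst transpose_four_block_mat[of _ j j _ e _ e]) auto
  have SA: "?S\<^sup>T * ?A \<in> carrier_mat e e" by (rule mult_carrier_mat[of _ _ e]) auto
  have zs: "?C\<^sup>T * 0\<^sub>m j j = 0\<^sub>m j j" "?C\<^sup>T * 0\<^sub>m j e = 0\<^sub>m j e" "?X\<^sup>T * 0\<^sub>m j j = 0\<^sub>m e j"
    "?X\<^sup>T * 0\<^sub>m j e = 0\<^sub>m e e" "?S\<^sup>T * 0\<^sub>m e j = 0\<^sub>m e j"
    by (rule right_mult_zero_mat, simp add: companion_def)+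
  have "B\<^sup>T * flag_gram s t c = four_block_mat (0\<^sub>m j j) (0\<^sub>m j e) (0\<^sub>m e j) (?S\<^sup>T * ?A)"
    unfolding BT flag_gram_def using SA
    by (subst mult_four_block_mat[of _ j j _ e _ e _ _ j _ e]) (auto simp: zs left_mult_zero_mat[of _ e j] left_mult_zero_mat[of _ e e])
  moreover have "four_block_mat (0\<^sub>m j j) (0\<^sub>m j e) (0\<^sub>m e j) (?S\<^sup>T * ?A) * B
     = four_block_mat (0\<^sub>m j j) (0\<^sub>m j e) (0\<^sub>m e j) (?S\<^sup>T * ?A * ?S)"
    unfolding flag_shift_def using SA mult_carrier_mat[OF SA companion_carrier]
    by (subst mult_four_block_mat[of _ j j _ e _ e _ _ j _ e])
      (auto simp: left_mult_zero_mat[OF companion_carrier] right_mult_zero_mat[OF SA])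
  ultimately show ?thesis using companion_gram[OF assms(1) ls assms(2)] by (simp add: flag_gram_def)
qed

lemma vec_as_poly:
  "(\<Sum>i<w. Polynomial.smult (x $ i) (flag_poly s j i)) = vpoly j (\<lambda>i. x $ i) * s + vpoly e (\<lambda>i. x $ (j + i))"
proof -
  have m: "Polynomial.smult a (monom 1 i * q) = monom a i * q" for a :: 'a and i q
    using mult_smult_left[of a "monom 1 i" q] by (simp add: smult_monom)
  have "(\<Sum>i<w. Polynomial.smult (x $ i) (flag_poly s j i))
     = (\<Sum>i<j. monom (x $ i) i * s) + (\<Sum>i<e. monom (x $ (j + i)) i)"
    unfolding sum_lessThan_split flag_poly_def by (simp add: smult_monom m)
  then show ?thesis by (simp add: vpoly_def sum_distrib_right)
qed

text \<open>The coordinates encode \<open>P1 * s + P0\<close> with \<open>P1\<close> shorter than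
  \<open>t\<close> and \<open>P0\<close> shorter than \<open>s\<close>. Divisibility by
  \<open>s\<close> kills \<open>P0\<close>, then divisibility by \<open>t\<close> kills
  \<open>P1\<close>; so the basis is independent modulo \<open>s * t\<close>.\<close>

lemma vec_as_poly_zero:
  assumes x: "x \<in> carrier_vec w" and dvd: "s * t dvd (\<Sum>i<w. Polynomial.smult (x $ i) (flag_poly s j i))"
  shows "x = 0\<^sub>v w"
proof -
  have s0: "s \<noteq> 0" using ls by auto
  let ?P1 = "vpoly j (\<lambda>i. x $ i)" and ?P0 = "vpoly e (\<lambda>i. x $ (j + i))"
  have st: "s * t dvd ?P1 * s + ?P0" using dvd unfolding vec_as_poly .
  then have "s dvd ?P1 * s + ?P0" by (rule dvd_mult_left)
  then have "s dvd ?P0" by (simp add: dvd_add_right_iff)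
  then have P0: "?P0 = 0" by (rule vpoly_dvd_zero)
  then have "s * t dvd s * ?P1" using st by (simp add: mult.commute)
  then have "t dvd ?P1" using s0 by (simp add: dvd_mult_cancel_left)
  then have P1: "?P1 = 0" by (rule vpoly_dvd_zero)
  have "x $ i = 0" if "i < w" for i
  proof (cases "i < j")
    case True
    then show ?thesis using P1 coeff_vpoly[of j "\<lambda>i. x $ i" i] by simp
  next
    case False
    then have "i - j < e" "j + (i - j) = i" using that by linarith+
    then show ?thesis using P0 coeff_vpoly[of e "\<lambda>i. x $ (j + i)" "i - j"] by simp
  qed
  then show ?thesis using x by (auto intro!: eq_vecI)
qed

text \<open>Multiplication by \<open>z\<close> leads to the next basis element except at the end of
  a chain, where \<open>z^j * s\<close> becomes \<open>(z^j - t) * s\<close> modulo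
  \<open>s * t\<close>, and \<open>z^e\<close> becomes \<open>s\<close> plus lower powers.\<close>

lemma flag_shift_step:
  assumes i: "i < w"
  shows "\<exists>r. (\<Sum>l<w. Polynomial.smult (col B i $ l) (flag_poly s j l)) = monom 1 1 * flag_poly s j i - r * (s * t)"
proof -
  have c: "dim_row B = w" using flag_shift_carrier by auto
  consider "Suc i < w" "Suc i \<noteq> j" | "Suc i = j" | "Suc i = w" "j \<le> i" using i by linarith
  then show ?thesis
  proof cases
    case 1
    have "(\<Sum>l<w. Polynomial.smult (col B i $ l) (flag_poly s j l)) = (\<Sum>l<w. if l = Suc i then flag_poly s j l else 0)"
      unfolding col_flag_shift(1)[OF 1] by (rule sum.cong) (use 1 in \<open>auto simp: unit_vec_def\<close>)
    also have "\<dots> = flag_poly s j (Suc i)" using 1 by simp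
    also have "\<dots> = monom 1 1 * flag_poly s j i"
      using 1 by (auto simp: flag_poly_def mult_monom Suc_diff_le simp flip: mult.assoc)
    finally show ?thesis by (intro exI[of _ 0]) simp
  next
    case 2
    have "vpoly j (\<lambda>l. col B i $ l) = - vpoly j (coeff t)"
      unfolding col_flag_shift(2)[OF 2] by (rule poly_eqI) (auto simp: coeff_vpoly)
    moreover have "vpoly e (\<lambda>l. col B i $ (j + l)) = 0"
      unfolding col_flag_shift(2)[OF 2] by (rule poly_eqI) (auto simp: coeff_vpoly)
    moreover have "flag_poly s j i = monom 1 i * s" using 2 by (simp add: flag_poly_def)
    moreover have "monom 1 1 * (monom 1 i * s) = monom 1 j * s" using 2 by (simp add: mult_monom flip: mult.assoc)
    ultimately have "(\<Sum>l<w. Polynomial.smult (col B i $ l) (flag_poly s j l)) = - (t - monom 1 j) * s"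
      and "monom 1 1 * flag_poly s j i = monom 1 j * s"
      unfolding vec_as_poly vpoly_monic[OF lt] by (simp_all only: add_0_right)
    then show ?thesis by (intro exI[of _ 1]) (simp add: algebra_simps)
  next
    \<comment> \<open>For \<open>j = 0\<close> there is no basis element to receive
      \<open>s\<close>; then \<open>t = 1\<close>, and \<open>s = s * t\<close> is itself reduced to
      0.\<close>
    case 3
    have "vpoly e (\<lambda>l. col B i $ (j + l)) = - vpoly e (coeff s)"
      unfolding col_flag_shift(3)[OF 3] by (rule poly_eqI) (auto simp: coeff_vpoly)
    moreover have "vpoly j (\<lambda>l. col B i $ l) = (if j = 0 then 0 else 1)"
      unfolding col_flag_shift(3)[OF 3] by (rule poly_eqI) (auto simp: coeff_vpoly)
    moreover have "flag_poly s j i = monom 1 (i - j)" using 3 by (simp add: flag_poly_def)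
    moreover have "monom 1 1 * monom 1 (i - j) = monom (1::'a) e"
    proof -
      have "Suc (i - j) = e" using 3 by linarith
      then show ?thesis by (simp add: mult_monom)
    qed
    moreover have "t = 1" if "j = 0" using that lt by (metis degree_eq_zeroE lead_coeff_pCons(2) one_pCons coeff_pCons_0)
    ultimately show ?thesis unfolding vec_as_poly vpoly_monic[OF ls]
      by (cases "j = 0") (auto intro!: exI[of _ 1] exI[of _ 0])
  qed
qed

lemma flag_shift_unit:
  assumes "i < w"
  shows "B *\<^sub>v unit_vec w i = col B i"
  using flag_shift_carrier assms by (auto intro!: eq_vecI)

text \<open>The iterates of the start vector run through unit vectors until the last column of the
  shift subtracts exactly the lower terms of \<open>s\<close>; what survives is the corner
  entry.\<close>

lemma flag_shift_poly_act_s: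
  "poly_act B s (flag_start s t) = (if j = 0 then 0\<^sub>v w else unit_vec w 0)"
proof (cases "e = 0")
  case True
  then have s1: "s = 1" using ls by (metis degree_eq_zeroE lead_coeff_pCons(2) one_pCons coeff_pCons_0)
  show ?thesis using poly_act_1[OF flag_shift_carrier flag_start_carrier] by (auto simp: s1 flag_start_def intro!: eq_vecI)
next
  case False
  let ?u = "flag_start s t"
  have it: "mat_iter B i ?u = unit_vec w (j + i)" if "i < e" for i
    using that by (induction i) (use False in \<open>auto simp: flag_start_def flag_shift_unit col_flag_shift(1)\<close>)
  obtain e' where e': "e = Suc e'" using False by (cases e) auto
  have top: "mat_iter B e ?u = col B (j + e')"
    using it[of e'] e' flag_shift_unit[of "j + e'"] by simp
  show ?thesis
  proof (rule eq_vecI)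
    fix a assume "a < dim_vec (if j = 0 then 0\<^sub>v w else unit_vec w 0 :: 'a vec)"
    then have a: "a < w" by (auto split: if_splits)
    have "poly_act B s ?u $ a = (\<Sum>l\<le>e. coeff s l * (mat_iter B l ?u $ a))"
      by (rule poly_act_index[OF flag_shift_carrier flag_start_carrier a order.refl])
    also have "\<dots> = (\<Sum>l<e. coeff s l * (unit_vec w (j + l) $ a)) + col B (j + e') $ a"
      using it top ls by (simp add: lessThan_Suc_atMost[symmetric])
    also have "(\<Sum>l<e. coeff s l * (unit_vec w (j + l) $ a)) = (if j \<le> a then coeff s (a - j) else 0)"
    proof -
      have "(\<Sum>l<e. coeff s l * (unit_vec w (j + l) $ a)) = (\<Sum>l<e. if l = a - j then (if j \<le> a then coeff s l else 0) else 0)"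
        by (rule sum.cong) (use a in \<open>auto simp: unit_vec_def\<close>)
      then show ?thesis using a by (simp add: less_diff_conv2)
    qed
    also have "col B (j + e') $ a = (if a < j then (if a = 0 then 1 else 0) else - coeff s (a - j))"
      using col_flag_shift(3)[of "j + e'"] e' a by simp
    finally show "poly_act B s ?u $ a = (if j = 0 then 0\<^sub>v w else unit_vec w 0) $ a" using a by auto
  qed (auto simp: poly_act_def flag_start_def)
qed

lemma flag_shift_flag_poly:
  assumes i: "i < w"
  shows "poly_act B (flag_poly s j i) (flag_start s t) = unit_vec w i"
proof (cases "i < j")
  case True
  have "poly_act B (flag_poly s j i) (flag_start s t) = mat_iter B i (poly_act B s (flag_start s t))"
    using True poly_act_monom[OF flag_shift_carrier poly_act_carrier[OF flag_shift_carrier flag_start_carrier]]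
    by (simp add: flag_poly_def poly_act_mult[OF flag_shift_carrier flag_start_carrier])
  also have "\<dots> = mat_iter B i (unit_vec w 0)" using True unfolding flag_shift_poly_act_s by simp
  also have "\<dots> = unit_vec w i" using True
    by (induction i) (auto simp: flag_shift_unit col_flag_shift(1))
  finally show ?thesis .
next
  case False
  have "mat_iter B k (flag_start s t) = unit_vec w (j + k)" if "k < e" for k
    using that by (induction k) (auto simp: flag_start_def flag_shift_unit col_flag_shift(1))
  from this[of "i - j"] show ?thesis using False i
    by (simp add: flag_poly_def poly_act_monom[OF flag_shift_carrier flag_start_carrier])
qed

text \<open>Since \<open>s\<close> carries the start vector to the first basis vector, it remains
  that \<open>t\<close> kills that one, by the last column of \<open>companion t\<close>.\<close>

lemma flag_shift_annihilated: "poly_act B (s * t) (flag_start s t) = 0\<^sub>v w"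
proof (cases "j = 0")
  case True
  then have "t = 1" using lt by (metis degree_eq_zeroE lead_coeff_pCons(2) one_pCons coeff_pCons_0)
  then show ?thesis using flag_shift_poly_act_s True by simp
next
  case False
  then obtain j' where j': "j = Suc j'" by (cases j) auto
  have "poly_act B (s * t) (flag_start s t) = poly_act B t (unit_vec w 0)"
    using poly_act_mult[OF flag_shift_carrier flag_start_carrier, of t s] flag_shift_poly_act_s False by (simp add: mult.commute)
  also have "\<dots> = 0\<^sub>v w"
  proof (rule eq_vecI)
    fix a assume "a < dim_vec (0\<^sub>v w :: 'a vec)"
    then have a: "a < w" by simp
    have it: "mat_iter B i (unit_vec w 0) = unit_vec w i" if "i < j" for i
      using that by (induction i) (auto simp: flag_shift_unit col_flag_shift(1))
    have top: "mat_iter B j (unit_vec w 0) = col B j'"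
      using it[of j'] j' flag_shift_unit[of j'] by simp
    have "poly_act B t (unit_vec w 0) $ a = (\<Sum>l\<le>j. coeff t l * (mat_iter B l (unit_vec w 0) $ a))"
      by (rule poly_act_index[OF flag_shift_carrier unit_vec_carrier a order.refl])
    also have "\<dots> = (\<Sum>l<j. coeff t l * (unit_vec w l $ a)) + col B j' $ a"
      using it top lt by (simp add: lessThan_Suc_atMost[symmetric])
    also have "(\<Sum>l<j. coeff t l * (unit_vec w l $ a)) = (\<Sum>l<j. if l = a then coeff t l else 0)"
      by (rule sum.cong) (use a in \<open>auto simp: unit_vec_def\<close>)
    also have "col B j' $ a = (if a < j then - coeff t a else 0)"
      using col_flag_shift(2)[of j'] j' a by simp
    finally show "poly_act B t (unit_vec w 0) $ a = 0\<^sub>v w $ a" using a by simp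
  qed (simp add: poly_act_def)
  finally show ?thesis .
qed

end

section \<open>Types of vectors and the bases adapted to them\<close>

lemma degree_0_monic: "degree p = 0 \<Longrightarrow> lead_coeff p = 1 \<Longrightarrow> p = (1::'a::comm_ring_1 poly)"
  by (metis degree_eq_zeroE lead_coeff_pCons(2) one_pCons coeff_pCons_0)

text \<open>\<open>s\<close> carries the non-degenerate quotient of the cyclic subspace, and
  \<open>t\<close> its radical, which consists of the images of the cyclic subspace under
  \<open>s(M)\<close> and has dimension \<open>degree t\<close>.\<close>

definition flag_type :: "'a::field mat \<Rightarrow> 'a mat \<Rightarrow> 'a vec \<Rightarrow> (int \<Rightarrow> 'a) \<Rightarrow> 'a poly \<Rightarrow> 'a poly \<Rightarrow> bool" where
  "flag_type J M v c s t \<longleftrightarrow> c = form_seq J M v \<and> min_annihilator c s \<and> vec_min_poly M v (s * t) \<and> lead_coeff t = 1"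

lemma flag_gram_index:
  assumes "a < degree t + degree s" "b < degree t + degree s"
  shows "flag_gram s t c $$ (a,b) = (if degree t \<le> a \<and> degree t \<le> b then c (int b - int a) else 0)"
  using assms unfolding flag_gram_def seq_gram_def by (auto simp: of_nat_diff)

lemma poly_act_sum_index:
  fixes M :: "'a::field mat"
  assumes M: "M \<in> carrier_mat d d" and v: "v \<in> carrier_vec d" and a: "a < d"
  shows "poly_act M (\<Sum>i<(n::nat). q i) v $ a = (\<Sum>i<n. poly_act M (q i) v $ a)"
proof (induction n)
  case (Suc n)
  have "dim_vec (poly_act M (q n) v) = d" using v by (simp add: poly_act_def)
  then show ?case using Suc a by (simp add: poly_act_add[OF M v])
qed (use M v a in simp)

lemma isometry_det:
  fixes J M :: "'a::field mat"
  assumes J: "J \<in> carrier_mat d d" "det J \<noteq> 0" and M: "M \<in> carrier_mat d d" and iso: "M\<^sup>T * J * M = J"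
  shows "det M \<noteq> 0"
proof
  assume "det M = 0"
  then have "det (M\<^sup>T * J * M) = 0"
    using det_mult[of "M\<^sup>T * J" d M] M J by simp
  then show False using iso J by simp
qed

context
  fixes J M :: "'a::{finite,field} mat" and d :: nat
  assumes two: "(2::'a) \<noteq> 0" and J: "J \<in> carrier_mat d d" "J\<^sup>T = - J" "det J \<noteq> 0"
    and M: "M \<in> carrier_mat d d" and iso: "M\<^sup>T * J * M = J"
begin

lemma flag_type_exists:
  assumes v: "v \<in> carrier_vec d"
  shows "\<exists>s t. flag_type J M v (form_seq J M v) s t"
proof -
  obtain g where g: "vec_min_poly M v g" using vec_min_poly_exists[OF M v] by blast
  then have gz: "g \<noteq> 0" "lead_coeff g = 1" and ga: "poly_act M g v = 0\<^sub>v d" using v by (auto simp: vec_min_poly_def)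
  have kg: "kills g (form_seq J M v)" by (rule min_poly_kills_form_seq[OF two J(1,2) M iso v ga])
  obtain s where s: "min_annihilator (form_seq J M v) s" using min_annihilator_exists[OF kg gz(1)] by blast
  then obtain t where t: "g = s * t" using kg unfolding min_annihilator_def by blast
  have "lead_coeff t = 1" using gz(2) s t by (simp add: lead_coeff_mult min_annihilator_def)
  then show ?thesis using g s t by (auto simp: flag_type_def)
qed

context
  fixes v :: "'a vec" and c :: "int \<Rightarrow> 'a" and s t :: "'a poly"
  assumes v: "v \<in> carrier_vec d" and type: "flag_type J M v c s t"
begin

private abbreviation (input) "jr \<equiv> degree t"
private abbreviation (input) "er \<equiv> degree s"
private abbreviation (input) "wr \<equiv> degree t + degree s"
private abbreviation (input) "Y \<equiv> flag_basis M v s t"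

private lemma facts: "lead_coeff s = 1" "lead_coeff t = 1" "c = form_seq J M v" "kills s c" "min_annihilator c s"
  "poly_act M (s * t) v = 0\<^sub>v d" "\<And>p. poly_act M p v = 0\<^sub>v d \<Longrightarrow> s * t dvd p"
  using type v by (auto simp: flag_type_def min_annihilator_def vec_min_poly_def)

lemma flag_basis_carrier: "Y \<in> carrier_mat d wr"
  using v by (simp add: flag_basis_def)

lemma col_flag_basis: "i < wr \<Longrightarrow> col Y i = poly_act M (flag_poly s jr i) v"
  using v by (auto intro!: eq_vecI simp: flag_basis_def poly_act_def)

lemma flag_basis_mult:
  assumes x: "x \<in> carrier_vec wr"
  shows "Y *\<^sub>v x = poly_act M (\<Sum>i<wr. Polynomial.smult (x $ i) (flag_poly s jr i)) v"
proof (rule eq_vecI)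
  fix a assume "a < dim_vec (poly_act M (\<Sum>i<wr. Polynomial.smult (x $ i) (flag_poly s jr i)) v)"
  then have a: "a < d" using v by (simp add: poly_act_def)
  have "(Y *\<^sub>v x) $ a = (\<Sum>i<wr. Y $$ (a,i) * x $ i)"
    using a x flag_basis_carrier by (auto simp: scalar_prod_def atLeast0LessThan intro!: sum.cong)
  also have "\<dots> = (\<Sum>i<wr. poly_act M (Polynomial.smult (x $ i) (flag_poly s jr i)) v $ a)"
  proof (rule sum.cong[OF refl])
    fix i assume "i \<in> {..<wr}"
    moreover have "dim_vec (poly_act M (flag_poly s jr i) v) = d" using v by (simp add: poly_act_def)
    ultimately show "Y $$ (a,i) * x $ i = poly_act M (Polynomial.smult (x $ i) (flag_poly s jr i)) v $ a"
      using a v by (simp add: flag_basis_def poly_act_smult[OF M v] mult.commute)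
  qed
  finally show "(Y *\<^sub>v x) $ a = poly_act M (\<Sum>i<wr. Polynomial.smult (x $ i) (flag_poly s jr i)) v $ a"
    by (simp add: poly_act_sum_index[OF M v a])
qed (use flag_basis_carrier v in \<open>simp add: poly_act_def\<close>)

lemma flag_basis_left_inverse: "\<exists>L \<in> carrier_mat wr d. L * Y = 1\<^sub>m wr"
proof (rule inj_imp_left_inverse[OF flag_basis_carrier])
  fix x assume x: "x \<in> carrier_vec wr" "Y *\<^sub>v x = 0\<^sub>v d"
  then show "x = 0\<^sub>v wr"
    unfolding flag_basis_mult[OF x(1)] by (intro vec_as_poly_zero facts(1,2) x(1) facts(7))
qed

lemma flag_basis_shift: "M * Y = Y * flag_shift s t"
proof (rule mat_col_eqI)
  have B: "flag_shift s t \<in> carrier_mat wr wr" by (rule flag_shift_carrier[OF facts(1,2)])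
  show "dim_row (M * Y) = dim_row (Y * flag_shift s t)" "dim_col (M * Y) = dim_col (Y * flag_shift s t)"
    using flag_basis_carrier M B by auto
  fix i assume "i < dim_col (Y * flag_shift s t)"
  then have i: "i < wr" using B by simp
  obtain r where r: "(\<Sum>l<wr. Polynomial.smult (col (flag_shift s t) i $ l) (flag_poly s jr l))
      = monom 1 1 * flag_poly s jr i - r * (s * t)"
    using flag_shift_step[OF facts(1,2) i] by blast
  have "col (Y * flag_shift s t) i = Y *\<^sub>v col (flag_shift s t) i"
    by (rule col_mult2[OF flag_basis_carrier B i])
  also have "\<dots> = poly_act M (monom 1 1 * flag_poly s jr i + (- r) * (s * t)) v"
    unfolding flag_basis_mult[OF col_carrier_vec[OF i B]] r by (simp only: mult_minus_left diff_conv_add_uminus)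
  also have "\<dots> = poly_act M (monom 1 1 * flag_poly s jr i) v"
    unfolding poly_act_add[OF M v] poly_act_mult[OF M v, of "- r"] facts(6) poly_act_zero_vec[OF M]
    using poly_act_carrier[OF M v] by simp
  also have "\<dots> = M *\<^sub>v poly_act M (flag_poly s jr i) v"
    unfolding poly_act_mult[OF M v] poly_act_monom[OF M poly_act_carrier[OF M v]] by simp
  also have "\<dots> = col (M * Y) i"
    using col_mult2[OF M flag_basis_carrier i] col_flag_basis[OF i] by simp
  finally show "col (M * Y) i = col (Y * flag_shift s t) i" by simp
qed

text \<open>As \<open>s\<close> kills the form sequence, all multiples of \<open>s(M) v\<close> are
  orthogonal to the cyclic subspace; the remaining entries are Toeplitz values.\<close>

lemma flag_basis_gram: "Y\<^sup>T * J * Y = flag_gram s t c"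
proof (rule eq_matI)
  fix i l assume "i < dim_row (flag_gram s t c)" "l < dim_col (flag_gram s t c)"
  then have il: "i < wr" "l < wr" using flag_gram_carrier[OF facts(1,2), of c] by auto
  have er: "(Y\<^sup>T * J * Y) $$ (i,l) = poly_act M (flag_poly s jr i) v \<bullet> (J *\<^sub>v poly_act M (flag_poly s jr l) v)"
    unfolding gram_index[OF flag_basis_carrier J(1) il] col_flag_basis[OF il(1)] col_flag_basis[OF il(2)] ..
  have z: "poly_act M p v \<bullet> (J *\<^sub>v poly_act M (flag_poly s jr l) v) = 0" if "l < jr" for l p
  proof (rule form_poly_act_zero[OF two J(1,2) M iso v poly_act_carrier[OF M v]])
    fix a
    have "kills (flag_poly s jr l) c"
      using that by (intro kills_dvd[OF _ facts(4)]) (simp add: flag_poly_def)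
    then show "mat_iter M a v \<bullet> (J *\<^sub>v poly_act M (flag_poly s jr l) v) = 0"
      using form_iter_poly_act[OF two J(1,2) M iso v, of a 0 "flag_poly s jr l"] by (simp add: facts(3))
  qed
  have c: "poly_act M p v \<in> carrier_vec d" for p by (rule poly_act_carrier[OF M v])
  show "(Y\<^sup>T * J * Y) $$ (i,l) = flag_gram s t c $$ (i,l)"
  proof (cases "l < jr")
    case True
    then show ?thesis unfolding er flag_gram_index[OF il] using z by simp
  next
    case l: False
    show ?thesis
    proof (cases "i < jr")
      case True
      then show ?thesis unfolding er flag_gram_index[OF il]
        using z[OF True, of "flag_poly s jr l"] antisymmetric_swap[OF J(1,2) c[of "flag_poly s jr i"] c[of "flag_poly s jr l"]] True by simp
    next
      case False
      then have fp: "flag_poly s jr i = monom 1 (i - jr)" "flag_poly s jr l = monom 1 (l - jr)"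
        using l by (auto simp: flag_poly_def)
      have "int (l - jr) - int (i - jr) = int l - int i" using l False by simp
      then show ?thesis unfolding er flag_gram_index[OF il] fp poly_act_monom[OF M v] form_iter_iter[OF two J(1,2) M iso v]
        using l False by (simp add: facts(3))
    qed
  qed
qed (use flag_basis_carrier flag_gram_carrier[OF facts(1,2), of c] in auto)

lemma flag_basis_start: "Y *\<^sub>v flag_start s t = v"
proof (cases "wr = 0")
  case True
  then have "s * t = 1" using degree_0_monic facts(1,2) by (metis add_is_0 mult_1)
  then have "v = 0\<^sub>v d" using facts(6) v M by simp
  then show ?thesis using True flag_basis_carrier by (auto intro!: eq_vecI simp: flag_start_def scalar_prod_def)
next
  case False
  define i where "i = (if er = 0 then 0 else jr)"
  have i: "i < wr" using False by (auto simp: i_def)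
  have "s = 1" if "er = 0" using degree_0_monic[OF that facts(1)] .
  then have "flag_poly s jr i = 1" using False by (auto simp: flag_poly_def i_def monom_0 one_pCons)
  moreover have "Y *\<^sub>v unit_vec wr i = col Y i" using flag_basis_carrier i by (auto intro!: eq_vecI)
  ultimately show ?thesis using col_flag_basis[OF i] v M by (simp add: flag_start_def i_def)
qed

text \<open>A factor \<open>z\<close> of \<open>t\<close> could be cancelled by inverting
  \<open>M\<close>, which would give an annihilator of \<open>v\<close> of smaller degree.\<close>

lemma flag_type_coeff_0: "coeff t 0 \<noteq> 0"
proof
  assume "coeff t 0 = 0"
  then obtain t' where t': "t = pCons 0 t'" by (metis coeff_pCons_0 pCons_cases)
  have nz: "t' \<noteq> 0" "s \<noteq> 0" using facts(1,2) t' by auto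
  have "s * t = monom 1 1 * (s * t')" by (simp add: t' monom_Suc monom_0)
  then have "M *\<^sub>v poly_act M (s * t') v = 0\<^sub>v d"
    using facts(6) unfolding \<open>s * t = monom 1 1 * (s * t')\<close> poly_act_mult[OF M v, of "monom 1 1" "s * t'"]
      poly_act_monom[OF M poly_act_carrier[OF M v], of 1 "s * t'"] by simp
  moreover obtain K where K: "K \<in> carrier_mat d d" "K * M = 1\<^sub>m d"
    using det_nonzero_inverse[OF M isometry_det[OF J(1,3) M iso]] by metis
  moreover have "K *\<^sub>v (M *\<^sub>v poly_act M (s * t') v) = poly_act M (s * t') v"
    using assoc_mult_mat_vec[OF K(1) M poly_act_carrier[OF M v], of "s * t'"] K(2) poly_act_carrier[OF M v, of "s * t'"] by simp
  moreover have "K *\<^sub>v 0\<^sub>v d = 0\<^sub>v d" using K(1) by auto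
  ultimately have "poly_act M (s * t') v = 0\<^sub>v d" by metis
  then have "s * t dvd s * t'" by (rule facts(7))
  then have "degree (s * t) \<le> degree (s * t')" using nz by (intro dvd_imp_degree_le) auto
  then show False using nz by (simp add: degree_mult_eq t')
qed

text \<open>The radical, with \<open>q^j\<close> elements, lies in the orthogonal space of the
  cyclic subspace, which has \<open>q^(d - w)\<close> elements for \<open>w = j + e\<close>.
  Comparing the two counts gives \<open>j + w <= d\<close>.\<close>

lemma flag_type_dim: "2 * jr + er \<le> d"
proof -
  obtain L where L: "L \<in> carrier_mat wr d" "L * Y = 1\<^sub>m wr" using flag_basis_left_inverse by blast
  let ?q = "card (UNIV :: 'a set)"
  have q: "?q > 1" using card_mono[of "UNIV :: 'a set" "{0,1}"] by simp
  let ?G = "flag_gram s t c"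
  have "inj_on (\<lambda>x. x @\<^sub>v 0\<^sub>v er) (carrier_vec jr :: 'a vec set)" by (rule inj_onI) auto
  moreover have "(\<lambda>x. x @\<^sub>v 0\<^sub>v er) ` carrier_vec jr \<subseteq> {a \<in> carrier_vec wr. ?G *\<^sub>v a = 0\<^sub>v wr}"
  proof (safe, goal_cases)
    case (2 _ x)
    have "?G *\<^sub>v (x @\<^sub>v 0\<^sub>v er) = (0\<^sub>m jr jr *\<^sub>v x + 0\<^sub>m jr er *\<^sub>v 0\<^sub>v er) @\<^sub>v (0\<^sub>m er jr *\<^sub>v x + seq_gram er c *\<^sub>v 0\<^sub>v er)"
      unfolding flag_gram_def by (rule four_block_mat_mult_vec[of _ jr jr _ er _ er]) (use 2 in auto)
    also have "seq_gram er c *\<^sub>v 0\<^sub>v er = 0\<^sub>v er" by (intro eq_vecI) (auto simp: seq_gram_def)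
    finally show ?case using 2 by (auto intro!: eq_vecI)
  qed auto
  ultimately have "card (carrier_vec jr :: 'a vec set) \<le> card {a \<in> carrier_vec wr. ?G *\<^sub>v a = 0\<^sub>v wr}"
    by (intro card_inj_on_le) (auto intro: finite_subset[OF _ finite_carrier_vec[of wr]])
  also have "\<dots> = card {x \<in> carrier_vec d. Y\<^sup>T *\<^sub>v (J *\<^sub>v x) = 0\<^sub>v wr \<and> x = Y *\<^sub>v (L *\<^sub>v x)}"
    using card_gram_fibre_span[OF J(1,3) flag_basis_carrier L, of "0\<^sub>v wr"] flag_basis_gram by simp
  also have "\<dots> \<le> card {x \<in> carrier_vec d. Y\<^sup>T *\<^sub>v (J *\<^sub>v x) = 0\<^sub>v wr}"
    by (rule card_mono) (auto intro: finite_subset[OF _ finite_carrier_vec[of d]])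
  finally have "?q ^ jr \<le> card {x \<in> carrier_vec d. Y\<^sup>T *\<^sub>v (J *\<^sub>v x) = 0\<^sub>v wr}" unfolding card_carrier_vec .
  then have "?q ^ jr * ?q ^ wr \<le> card {x \<in> carrier_vec d. Y\<^sup>T *\<^sub>v (J *\<^sub>v x) = 0\<^sub>v wr} * ?q ^ wr" by (rule mult_le_mono1)
  then have "?q ^ jr * ?q ^ wr \<le> ?q ^ d"
    unfolding card_gram_fibre[OF J(1,3) flag_basis_carrier L zero_carrier_vec] .
  then have "?q ^ (jr + wr) \<le> ?q ^ d" by (simp add: power_add)
  then have "jr + wr \<le> d" using q power_le_imp_le_exp by blast
  then show ?thesis by simp
qed

end

section \<open>Recovering a vector from an adapted frame\<close>

context
  fixes Y L :: "'a mat" and c :: "int \<Rightarrow> 'a" and s t :: "'a poly"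
  assumes odd: "odd_seq c" and ms: "min_annihilator c s" and lt: "lead_coeff t = 1" and t0: "coeff t 0 \<noteq> 0"
    and Y: "Y \<in> carrier_mat d (degree t + degree s)" and L: "L \<in> carrier_mat (degree t + degree s) d"
    and LY: "L * Y = 1\<^sub>m (degree t + degree s)"
    and gram: "Y\<^sup>T * J * Y = flag_gram s t c" and shift: "M * Y = Y * flag_shift s t"
begin

private abbreviation (input) "j' \<equiv> degree t"
private abbreviation (input) "e' \<equiv> degree s"
private abbreviation (input) "w' \<equiv> degree t + degree s"
private abbreviation (input) "B0 \<equiv> flag_shift s t"
private abbreviation (input) "u0 \<equiv> flag_start s t"

private lemma lst: "lead_coeff s = 1" using ms by (simp add: min_annihilator_def)
private lemma B0: "B0 \<in> carrier_mat w' w'" by (rule flag_shift_carrier[OF lst lt])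
private lemma u0: "u0 \<in> carrier_vec w'" by (rule flag_start_carrier[OF lst lt])
private lemma v0: "Y *\<^sub>v u0 \<in> carrier_vec d" using Y u0 by auto

private lemma iter_Y: "mat_iter M k (Y *\<^sub>v x) = Y *\<^sub>v mat_iter B0 k x" if x: "x \<in> carrier_vec w'" for x
proof (induction k)
  case (Suc k)
  let ?y = "mat_iter B0 k x"
  have y: "?y \<in> carrier_vec w'" by (rule mat_iter_carrier[OF B0 x])
  have "M *\<^sub>v (Y *\<^sub>v ?y) = (M * Y) *\<^sub>v ?y" by (rule assoc_mult_mat_vec[OF M Y y, symmetric])
  also have "\<dots> = Y *\<^sub>v (B0 *\<^sub>v ?y)" unfolding shift by (rule assoc_mult_mat_vec[OF Y B0 y])
  finally show ?case using Suc by simp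
qed simp

private lemma poly_act_Y: "poly_act M p (Y *\<^sub>v u0) = Y *\<^sub>v poly_act B0 p u0"
proof (induction p rule: pCons_induct)
  case 0
  then show ?case using Y u0 v0 poly_act_0[OF M v0] poly_act_0[OF B0 u0] by auto
next
  case (pCons a p)
  let ?y = "poly_act B0 p u0"
  have y: "?y \<in> carrier_vec w'" by (rule poly_act_carrier[OF B0 u0])
  have "M *\<^sub>v (Y *\<^sub>v ?y) = Y *\<^sub>v (B0 *\<^sub>v ?y)" using iter_Y[OF y, of 1] by simp
  moreover have "Y *\<^sub>v (a \<cdot>\<^sub>v u0 + B0 *\<^sub>v ?y) = Y *\<^sub>v (a \<cdot>\<^sub>v u0) + Y *\<^sub>v (B0 *\<^sub>v ?y)"
    by (rule mult_add_distrib_mat_vec[OF Y]) (use u0 B0 y in auto)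
  ultimately show ?case unfolding poly_act_pCons[OF M v0] poly_act_pCons[OF B0 u0] pCons.IH
    by (simp add: mult_mat_vec[OF Y u0])
qed

private lemma Y_inj: "Y *\<^sub>v x = 0\<^sub>v d \<Longrightarrow> x \<in> carrier_vec w' \<Longrightarrow> x = 0\<^sub>v w'"
  using assoc_mult_mat_vec[OF L Y, of x] LY L by auto

private lemma form_Y: "(Y *\<^sub>v x) \<bullet> (J *\<^sub>v (Y *\<^sub>v y)) = x \<bullet> (flag_gram s t c *\<^sub>v y)"
  if x: "x \<in> carrier_vec w'" and y: "y \<in> carrier_vec w'" for x y
proof -
  have "(Y *\<^sub>v x) \<bullet> (J *\<^sub>v (Y *\<^sub>v y)) = ((Y\<^sup>T)\<^sup>T *\<^sub>v x) \<bullet> (J *\<^sub>v (Y *\<^sub>v y))" by simp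
  also have "\<dots> = x \<bullet> (Y\<^sup>T *\<^sub>v (J *\<^sub>v (Y *\<^sub>v y)))"
    by (rule transpose_vec_mult_scalar[of _ w' d]) (use Y J x y in auto)
  also have "Y\<^sup>T *\<^sub>v (J *\<^sub>v (Y *\<^sub>v y)) = (Y\<^sup>T * J * Y) *\<^sub>v y"
  proof -
    have "(Y\<^sup>T * J * Y) *\<^sub>v y = (Y\<^sup>T * J) *\<^sub>v (Y *\<^sub>v y)"
      by (rule assoc_mult_mat_vec[of _ w' d _ w']) (use Y J y in auto)
    also have "\<dots> = Y\<^sup>T *\<^sub>v (J *\<^sub>v (Y *\<^sub>v y))"
      by (rule assoc_mult_mat_vec[of _ w' d _ d]) (use Y J y in auto)
    finally show ?thesis by simp
  qed
  finally show ?thesis unfolding gram .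
qed

private lemma flag_poly_Y: "i < w' \<Longrightarrow> poly_act M (flag_poly s j' i) (Y *\<^sub>v u0) = col Y i"
  unfolding poly_act_Y using flag_shift_flag_poly[OF lst lt] Y by (auto intro!: eq_vecI)

lemma flag_basis_of_gram: "flag_basis M (Y *\<^sub>v u0) s t = Y"
proof (rule eq_matI)
  fix a i assume "a < dim_row Y" "i < dim_col Y"
  then have "a < d" "i < w'" using Y by auto
  then show "flag_basis M (Y *\<^sub>v u0) s t $$ (a,i) = Y $$ (a,i)"
    using flag_poly_Y[of i] Y by (simp add: flag_basis_def)
qed (use Y in \<open>auto simp: flag_basis_def\<close>)

text \<open>\<open>Y\<close> intertwines the model with \<open>M\<close>, so the minimal polynomial
  can be computed in the model. The form sequence needs a detour through \<open>t\<close>, since the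
  Gram matrix controls only finitely many of its values directly.\<close>

lemma flag_type_of_gram: "flag_type J M (Y *\<^sub>v u0) c s t"
proof -
  let ?v0 = "Y *\<^sub>v u0" and ?c = "form_seq J M (Y *\<^sub>v u0)"
  have st: "poly_act M (s * t) ?v0 = 0\<^sub>v d"
    unfolding poly_act_Y flag_shift_annihilated[OF lst lt] using Y by auto
  have mp: "vec_min_poly M ?v0 (s * t)"
    unfolding vec_min_poly_def
  proof (intro conjI allI impI)
    show "lead_coeff (s * t) = 1" using lst lt by (simp add: lead_coeff_mult)
    show "poly_act M (s * t) ?v0 = 0\<^sub>v (dim_vec ?v0)" using st Y by simp
    fix p assume "poly_act M p ?v0 = 0\<^sub>v (dim_vec ?v0)"
    then have "Y *\<^sub>v poly_act B0 p u0 = 0\<^sub>v d" using Y by (simp add: poly_act_Y)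
    then have "poly_act B0 p u0 = 0\<^sub>v w'" by (rule Y_inj[OF _ poly_act_carrier[OF B0 u0]])
    show "s * t dvd p"
    proof -
      have snz: "s \<noteq> 0" "t \<noteq> 0" using lst lt by auto
      \<comment> \<open>Every remainder modulo \<open>s * t\<close> is a combination of the basis
        \<open>flag_poly\<close> with some coordinates \<open>x\<close>, and it sends the start
        vector to exactly that coordinate vector.\<close>
      define r where "r = p mod (s * t)"
      have "poly_act B0 p u0 = poly_act B0 ((p div (s * t)) * (s * t) + r) u0" unfolding r_def by (simp only: div_mult_mod_eq)
      also have "\<dots> = poly_act B0 r u0"
        unfolding poly_act_add[OF B0 u0] poly_act_mult[OF B0 u0, of _ "s * t"] flag_shift_annihilated[OF lst lt] poly_act_zero_vec[OF B0]
        using poly_act_carrier[OF B0 u0] by simp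
      finally have r0: "poly_act B0 r u0 = 0\<^sub>v w'" using \<open>poly_act B0 p u0 = 0\<^sub>v w'\<close> by simp
      have dr: "r = 0 \<or> degree r < w'"
        using degree_mod_less[of "s * t" p] snz by (auto simp: r_def degree_mult_eq add.commute)
      have r2: "degree (r mod s) < e' \<or> r mod s = 0" using degree_mod_less[of s r] snz by auto
      have r1: "degree (r div s) < j' \<or> r div s = 0"
      proof (cases "r div s = 0")
        case False
        have small: "r mod s = 0 \<or> degree (r mod s) < degree (r div s * s)"
          using r2 False snz by (auto simp: degree_mult_eq)
        have dadd: "degree (P + Q) = degree P" if "Q = 0 \<or> degree Q < degree P" for P Q :: "'a poly"
          using that by (auto simp: degree_add_eq_left)
        have "degree (r div s * s + r mod s) = degree (r div s * s)" by (rule dadd[OF small])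
        then have "degree r = degree (r div s) + e'"
          unfolding div_mult_mod_eq degree_mult_eq[OF False snz(1)] .
        moreover have "r \<noteq> 0" using False by auto
        ultimately show ?thesis using dr by simp
      qed simp
      define x where "x = vec w' (\<lambda>i. if i < j' then coeff (r div s) i else coeff (r mod s) (i - j'))"
      have x: "x \<in> carrier_vec w'" by (simp add: x_def)
      have P1: "vpoly j' (\<lambda>i. x $ i) = r div s"
        using r1 by (intro poly_eqI) (auto simp: coeff_vpoly x_def coeff_eq_0)
      have P0: "vpoly e' (\<lambda>i. x $ (j' + i)) = r mod s"
        using r2 by (intro poly_eqI) (auto simp: coeff_vpoly x_def coeff_eq_0)
      have "(\<Sum>i<w'. Polynomial.smult (x $ i) (flag_poly s j' i)) = r"
        unfolding vec_as_poly[OF lst lt] P1 P0 by simp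
      then have "poly_act B0 r u0 $ a = x $ a" if "a < w'" for a
      proof -
        have "poly_act B0 r u0 $ a = (\<Sum>i<w'. poly_act B0 (Polynomial.smult (x $ i) (flag_poly s j' i)) u0 $ a)"
          using poly_act_sum_index[OF B0 u0 that] \<open>_ = r\<close> by metis
        also have "\<dots> = (\<Sum>i<w'. if i = a then x $ i else 0)"
          by (rule sum.cong) (use that in \<open>auto simp: poly_act_smult[OF B0 u0] flag_shift_flag_poly[OF lst lt] unit_vec_def\<close>)
        finally show ?thesis using that by simp
      qed
      then have "x = 0\<^sub>v w'" using r0 x by (auto intro!: eq_vecI)
      then have "r = 0" using vec_as_poly[OF lst lt, of x] P1 P0 \<open>_ = r\<close> by simp
      then show ?thesis by (simp add: r_def dvd_eq_mod_eq_0)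
    qed
  qed
  have su: "flag_gram s t c *\<^sub>v poly_act B0 s u0 = 0\<^sub>v w'"
  proof (cases "j' = 0")
    case False
    have "col (flag_gram s t c) 0 = 0\<^sub>v w'"
      using flag_gram_carrier[OF lst lt, of c] False by (auto intro!: eq_vecI simp: flag_gram_index)
    moreover have "flag_gram s t c *\<^sub>v unit_vec w' 0 = col (flag_gram s t c) 0"
      using flag_gram_carrier[OF lst lt, of c] False by (auto intro!: eq_vecI)
    ultimately show ?thesis unfolding flag_shift_poly_act_s[OF lst lt] using False by simp
  qed (use flag_shift_poly_act_s[OF lst lt] flag_gram_carrier[OF lst lt, of c] in auto)
  \<comment> \<open>\<open>s\<close> sends the start vector into the kernel of the Gram matrix.
    Pairing the result with the iterates of the start vector covers the indices
    \<open>k <= 0\<close>; the recurrence given by \<open>t\<close> then extends the vanishing to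
    all indices.\<close>
  have neg: "seq_act s ?c k = 0" if "k \<le> 0" for k
  proof -
    have "seq_act s ?c (int 0 - int (nat (- k))) = mat_iter M (nat (- k)) ?v0 \<bullet> (J *\<^sub>v mat_iter M 0 (poly_act M s ?v0))"
      by (rule form_iter_poly_act[OF two J(1,2) M iso v0, symmetric])
    also have "\<dots> = mat_iter B0 (nat (- k)) u0 \<bullet> (flag_gram s t c *\<^sub>v poly_act B0 s u0)"
      unfolding iter_Y[OF u0] poly_act_Y mat_iter_simps
      by (rule form_Y) (use mat_iter_carrier[OF B0 u0] poly_act_carrier[OF B0 u0] in auto)
    also have "\<dots> = 0" unfolding su using mat_iter_carrier[OF B0 u0] by simp
    finally show ?thesis using that by simp
  qed
  have ks: "kills s ?c"
  proof
    fix i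
    show "seq_act s ?c i = 0"
    proof (rule killed_zero_window[of t "seq_act s ?c" "- int j'"])
      show "t \<noteq> 0" using lt by auto
      show "coeff t 0 \<noteq> 0" by (rule t0)
      show "kills t (seq_act s ?c)"
        using min_poly_kills_form_seq[OF two J(1,2) M iso v0 st] seq_act_mult[of t s ?c] by (simp add: mult.commute)
      show "seq_act s ?c (- int j' + int l) = 0" if "l < j'" for l
        using that by (intro neg) simp
    qed
  qed
  have "?c = c"
  proof (rule killed_eq_window[of s _ _ 0])
    show "s \<noteq> 0" using lst by auto
    show "coeff s 0 \<noteq> 0" by (rule min_annihilator_coeff_0[OF ms])
    show "kills s ?c" by (rule ks)
    show "kills s c" using ms by (simp add: min_annihilator_def)
    fix l assume l: "l < e'"
    have ut: "poly_act B0 (flag_poly s j' (j' + l)) u0 = unit_vec w' (j' + l)"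
      using l by (intro flag_shift_flag_poly[OF lst lt]) simp
    then have it: "mat_iter B0 l u0 = unit_vec w' (j' + l)" using poly_act_monom[OF B0 u0, of l] by (simp add: flag_poly_def)
    have uj: "u0 = unit_vec w' j'" using l by (simp add: flag_start_def)
    have "?c (int l) = ?v0 \<bullet> (J *\<^sub>v mat_iter M l ?v0)" by (simp add: form_seq_def)
    also have "\<dots> = u0 \<bullet> (flag_gram s t c *\<^sub>v unit_vec w' (j' + l))"
      unfolding iter_Y[OF u0] it by (rule form_Y[OF u0]) simp
    also have "u0 \<bullet> (flag_gram s t c *\<^sub>v unit_vec w' (j' + l)) = flag_gram s t c $$ (j', j' + l)"
      unfolding uj using l flag_gram_carrier[OF lst lt, of c] by simp
    also have "\<dots> = c (int l)" using l by (simp add: flag_gram_index)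
    finally show "?c (0 + int l) = c (0 + int l)" by simp
  qed
  then show ?thesis using ms mp lt by (simp add: flag_type_def)
qed

end

end

section \<open>Equidistribution of isometries with a given cyclic flag\<close>

definition isometries :: "nat \<Rightarrow> 'a::field mat \<Rightarrow> 'a mat set" where
  "isometries d J = {M \<in> carrier_mat d d. M\<^sup>T * J * M = J}"

text \<open>For a nonzero constant coefficient, the monic polynomial whose roots are the inverses of
  the roots of \<open>t\<close>.\<close>

definition dual_poly :: "'a::field poly \<Rightarrow> 'a poly" where
  "dual_poly t = Polynomial.smult (inverse (coeff t 0)) (reflect_poly t)"

lemma gram_mult:
  fixes J :: "'a::comm_ring_1 mat"
  assumes M: "M \<in> carrier_mat d n" and P: "P \<in> carrier_mat n w" and J: "J \<in> carrier_mat d d"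
  shows "(M * P)\<^sup>T * J * (M * P) = P\<^sup>T * (M\<^sup>T * J * M) * P"
proof -
  have "(M * P)\<^sup>T * J * (M * P) = P\<^sup>T * M\<^sup>T * J * (M * P)" by (simp only: transpose_mult[OF M P])
  also have "\<dots> = P\<^sup>T * (M\<^sup>T * (J * (M * P)))"
    using assms by (simp add: assoc_mult_mat[of _ w n _ d _ d] assoc_mult_mat[of _ w d _ d _ w] assoc_mult_mat[of _ w n _ d _ w] assoc_mult_mat[of _ n d _ d _ w])
  also have "\<dots> = P\<^sup>T * (M\<^sup>T * J * M) * P"
    using assms by (simp add: assoc_mult_mat[of _ w n _ n _ w] assoc_mult_mat[of _ n d _ d _ n] assoc_mult_mat[of _ n d _ n _ w] assoc_mult_mat[of _ d d _ n _ w])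
  finally show ?thesis .
qed

lemma isometries_mult:
  assumes "M \<in> isometries d J" "N \<in> isometries d J" "J \<in> carrier_mat d d"
  shows "M * N \<in> isometries d J"
  using assms gram_mult[of M d d N d J] by (auto simp: isometries_def)

lemma finite_isometries: "finite (isometries d (J :: 'a::{finite,field} mat))"
  unfolding isometries_def using finite_carrier_mat by (rule finite_subset[rotated]) auto

lemma congruence_inverse:
  fixes J :: "'a::field mat"
  assumes P: "P \<in> carrier_mat d d" and K: "K \<in> carrier_mat d d" "P * K = 1\<^sub>m d" and J: "J \<in> carrier_mat d d"
    and G: "P\<^sup>T * J * P = G"
  shows "K\<^sup>T * G * K = J"
  using gram_mult[OF P K(1) J] K(2) J unfolding G by simp

lemma isometries_inverse:
  fixes J :: "'a::field mat"
  assumes J: "J \<in> carrier_mat d d" "det J \<noteq> 0" and M: "M \<in> isometries d J"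
  obtains K where "K \<in> isometries d J" "K * M = 1\<^sub>m d" "M * K = 1\<^sub>m d"
proof -
  have M': "M \<in> carrier_mat d d" "M\<^sup>T * J * M = J" using M by (auto simp: isometries_def)
  obtain K where K: "K \<in> carrier_mat d d" "M * K = 1\<^sub>m d" "K * M = 1\<^sub>m d"
    using det_nonzero_inverse[OF M'(1) isometry_det[OF J M']] .
  then have "K \<in> isometries d J" using congruence_inverse[OF M'(1) K(1,2) J(1) M'(2)] by (simp add: isometries_def)
  then show ?thesis using K that by blast
qed

lemma mat_cancel_left:
  fixes K :: "'a::semiring_1 mat"
  assumes "K \<in> carrier_mat d d" "P \<in> carrier_mat d d" "K * P = 1\<^sub>m d" "X \<in> carrier_mat d w"
  shows "K * (P * X) = X"
  using assoc_mult_mat[OF assms(1,2,4)] assms(3,4) by simp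

lemma mat_cancel_right:
  fixes K :: "'a::semiring_1 mat"
  assumes "K \<in> carrier_mat d d" "P \<in> carrier_mat d d" "K * P = 1\<^sub>m d" "X \<in> carrier_mat w d"
  shows "X * K * P = X"
  using assoc_mult_mat[OF assms(4,1,2)] assms(3,4) by simp

lemma isometries_conj:
  fixes J :: "'a::field mat"
  assumes J: "J \<in> carrier_mat d d" and P: "P \<in> carrier_mat d d" and K: "K \<in> carrier_mat d d" "P * K = 1\<^sub>m d"
    and G: "P\<^sup>T * J * P = G" and M: "M \<in> isometries d J"
  shows "K * M * P \<in> isometries d G" "char_poly (K * M * P) = char_poly M"
proof -
  have M': "M \<in> carrier_mat d d" "M\<^sup>T * J * M = J" using M by (auto simp: isometries_def)
  have Gc: "G \<in> carrier_mat d d" using G P J by auto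
  have KP: "K * P = 1\<^sub>m d" by (rule mat_mult_left_right_inverse[OF P K])
  have KJ: "K\<^sup>T * G * K = J" by (rule congruence_inverse[OF P K J G])
  have "(K * M)\<^sup>T * G * (K * M) = J" using gram_mult[OF K(1) M'(1) Gc] KJ M'(2) by simp
  then have "(K * M * P)\<^sup>T * G * (K * M * P) = G"
    using gram_mult[OF mult_carrier_mat[OF K(1) M'(1)] P Gc] G by simp
  then show "K * M * P \<in> isometries d G" using K M' P by (simp add: isometries_def)
  have "similar_mat (K * M * P) M"
    unfolding similar_mat_def similar_mat_wit_def using K M' P KP
    by (intro exI[of _ K] exI[of _ P]) (auto simp: Let_def)
  then show "char_poly (K * M * P) = char_poly M" by (rule char_poly_similar)
qed

section \<open>Isometries with prescribed action on the model flag\<close>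

definition mid_block :: "nat \<Rightarrow> nat \<Rightarrow> 'a mat \<Rightarrow> 'a mat" where
  "mid_block w p M = mat p p (\<lambda>(a,b). M $$ (w + a, w + b))"

definition mid_embed :: "nat \<Rightarrow> nat \<Rightarrow> nat \<Rightarrow> 'a::{zero,one} mat \<Rightarrow> 'a mat" where
  "mid_embed w p j h = four_block_mat (1\<^sub>m w) (0\<^sub>m w (p + j)) (0\<^sub>m (p + j) w)
     (four_block_mat h (0\<^sub>m p j) (0\<^sub>m j p) (1\<^sub>m j))"

lemma first_cols_block: "first_cols (w + r) w = four_block_mat (1\<^sub>m w) (0\<^sub>m w 0) (0\<^sub>m r w) (0\<^sub>m r 0 :: 'a::{zero,one} mat)"
  unfolding first_cols_def by (intro eq_matI) auto

lemma block_first_cols: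
  fixes X :: "'a::field mat"
  assumes "X \<in> carrier_mat w w" "Q \<in> carrier_mat w r" "Z \<in> carrier_mat r w" "T \<in> carrier_mat r r"
  shows "four_block_mat X Q Z T * first_cols (w + r) w = four_block_mat X (0\<^sub>m w 0) Z (0\<^sub>m r 0)"
  unfolding first_cols_block using assms
  by (subst mult_four_block_mat[of _ w w _ r _ r _ _ w _ 0]) (auto intro!: cong_four_block_mat eq_matI)

lemma first_cols_mult_block:
  fixes X :: "'a::field mat"
  assumes "X \<in> carrier_mat w w"
  shows "first_cols (w + r) w * X = four_block_mat X (0\<^sub>m w 0) (0\<^sub>m r w) (0\<^sub>m r 0)"
proof (rule eq_matI)
  fix a b assume "a < dim_row (four_block_mat X (0\<^sub>m w 0) (0\<^sub>m r w) (0\<^sub>m r 0))" "b < dim_col (four_block_mat X (0\<^sub>m w 0) (0\<^sub>m r w) (0\<^sub>m r 0))"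
  then have ab: "a < w + r" "b < w" using assms by auto
  have "(first_cols (w + r) w * X) $$ (a,b) = (\<Sum>i<w. (if a = i then 1 else 0) * X $$ (i,b))"
    using ab assms by (auto simp: first_cols_def scalar_prod_def atLeast0LessThan intro!: sum.cong)
  also have "\<dots> = (\<Sum>i<w. if i = a then X $$ (i,b) else 0)" by (rule sum.cong) auto
  also have "\<dots> = four_block_mat X (0\<^sub>m w 0) (0\<^sub>m r w) (0\<^sub>m r 0) $$ (a,b)" using ab assms by auto
  finally show "(first_cols (w + r) w * X) $$ (a,b) = four_block_mat X (0\<^sub>m w 0) (0\<^sub>m r w) (0\<^sub>m r 0) $$ (a,b)" .
qed (use assms in \<open>auto simp: first_cols_def\<close>)

context
  fixes c :: "int \<Rightarrow> 'a::{finite,field}" and s t :: "'a poly" and p :: nat and H :: "'a mat"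
  assumes two: "(2::'a) \<noteq> 0" and odd: "odd_seq c" and ms: "min_annihilator c s"
    and lt: "lead_coeff t = 1" and t0: "coeff t 0 \<noteq> 0"
    and H: "H \<in> carrier_mat p p" "H\<^sup>T = - H" "det H \<noteq> 0"
begin

private abbreviation (input) "jn \<equiv> degree t"
private abbreviation (input) "en \<equiv> degree s"
private abbreviation (input) "wn \<equiv> degree t + degree s"
private abbreviation (input) "d \<equiv> (degree t + degree s) + (p + degree t)"
private abbreviation (input) "A \<equiv> seq_gram (degree s) c"
private abbreviation (input) "G \<equiv> flag_form (degree t) (degree s) p (seq_gram (degree s) c) H"
private abbreviation (input) "E \<equiv> first_cols ((degree t + degree s) + (p + degree t)) (degree t + degree s)"
private abbreviation (input) "Bn \<equiv> flag_shift s t"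
private abbreviation (input) "stab \<equiv> {M \<in> isometries d G. M * E = E * Bn}"

private lemma ls: "lead_coeff s = 1" and ks: "kills s c" using ms by (simp_all add: min_annihilator_def)

lemma flag_form_facts: "G \<in> carrier_mat d d" "G\<^sup>T = - G" "det G \<noteq> 0"
proof -
  show "G \<in> carrier_mat d d" by (rule flag_form_carrier[OF seq_gram_carrier H(1)])
  show "G\<^sup>T = - G" by (rule flag_form_antisym[OF seq_gram_carrier H(1) seq_gram_antisym[OF odd] H(2)])
  obtain A' where A': "A' \<in> carrier_mat en en" "A * A' = 1\<^sub>m en" using det_nonzero_inverse[OF seq_gram_carrier seq_gram_det[OF ms]] by metis
  obtain H' where H': "H' \<in> carrier_mat p p" "H * H' = 1\<^sub>m p" using det_nonzero_inverse[OF H(1,3)] by metis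
  show "det G \<noteq> 0" by (rule flag_form_inverse[OF seq_gram_carrier H(1) A' H'])
qed

lemma flag_form_top: "E\<^sup>T * G * E = flag_gram s t c"
proof (rule eq_matI)
  fix a b assume "a < dim_row (flag_gram s t c)" "b < dim_col (flag_gram s t c)"
  then have ab: "a < wn" "b < wn" using flag_gram_carrier[OF ls lt, of c] by auto
  have "(E\<^sup>T * G * E) $$ (a,b) = unit_vec d a \<bullet> (G *\<^sub>v unit_vec d b)"
    unfolding gram_index[OF first_cols_carrier flag_form_facts(1) ab] col_first_cols[OF ab(1)] col_first_cols[OF ab(2)] ..
  also have "\<dots> = G $$ (a,b)" using ab flag_form_facts(1) by simp
  also have "\<dots> = flag_gram s t c $$ (a,b)"
    using ab unfolding flag_form_def flag_gram_def by (simp add: seq_gram_def)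
  finally show "(E\<^sup>T * G * E) $$ (a,b) = flag_gram s t c $$ (a,b)" .
qed (use flag_gram_carrier[OF ls lt, of c] in \<open>auto simp: first_cols_def\<close>)

lemma flag_shift_det: "det (companion t) \<noteq> 0" "det (companion s) \<noteq> 0" "det Bn \<noteq> 0"
proof -
  show C: "det (companion t) \<noteq> 0"
    using coeff_0_char_poly[OF companion_carrier[of t]] t0 unfolding char_poly_companion[OF lt] by auto
  show S: "det (companion s) \<noteq> 0"
    using coeff_0_char_poly[OF companion_carrier[of s]] min_annihilator_coeff_0[OF ms] unfolding char_poly_companion[OF ls] by auto
  have "det Bn = det (companion t) * det (companion s)"
    unfolding flag_shift_def by (rule det_four_block_mat_lower_left_zero) auto
  then show "det Bn \<noteq> 0" using C S by simp
qed

text \<open>The condition on \<open>M\<close> fixes its first block column, so \<open>M\<close> is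
  block triangular with diagonal blocks \<open>companion t\<close>, \<open>companion s\<close>,
  \<open>N\<close> and the inverse transpose of \<open>companion t\<close>. The last of them
  contributes \<open>dual_poly t\<close>.\<close>

lemma stab_blocks:
  assumes M: "M \<in> stab"
  shows "mid_block wn p M \<in> isometries p H" "char_poly M = s * t * dual_poly t * char_poly (mid_block wn p M)"
    and "h \<in> carrier_mat p p \<Longrightarrow> mid_block wn p (M * mid_embed wn p jn h) = mid_block wn p M * h"
proof -
  have Mc: "M \<in> carrier_mat (wn + (p + jn)) (wn + (p + jn))" and iso: "M\<^sup>T * G * M = G" and ME: "M * E = E * Bn"
    using M by (auto simp: isometries_def)
  obtain B' Q Z0 T where M1: "M = four_block_mat B' Q Z0 T" "B' \<in> carrier_mat wn wn" "Q \<in> carrier_mat wn (p + jn)"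
    "Z0 \<in> carrier_mat (p + jn) wn" "T \<in> carrier_mat (p + jn) (p + jn)"
    using four_block_mat_decompose[OF Mc] by metis
  have Bc: "Bn \<in> carrier_mat wn wn" by (rule flag_shift_carrier[OF ls lt])
  have "four_block_mat B' (0\<^sub>m wn 0) Z0 (0\<^sub>m (p + jn) 0) = four_block_mat Bn (0\<^sub>m wn 0) (0\<^sub>m (p + jn) wn) (0\<^sub>m (p + jn) 0)"
    using ME unfolding M1(1) block_first_cols[OF M1(2-5)] first_cols_mult_block[OF Bc] .
  then have B': "B' = Bn" and Z0: "Z0 = 0\<^sub>m (p + jn) wn"
    using four_block_mat_eqD(1,3)[OF M1(2) zero_carrier_mat M1(4) zero_carrier_mat Bc zero_carrier_mat zero_carrier_mat zero_carrier_mat] by auto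
  obtain K L K' L' where Q: "Q = four_block_mat K L K' L'" "K \<in> carrier_mat jn p" "L \<in> carrier_mat jn jn" "K' \<in> carrier_mat en p" "L' \<in> carrier_mat en jn"
    using four_block_mat_decompose[OF M1(3)] by metis
  obtain N N' Z D where T: "T = four_block_mat N N' Z D" "N \<in> carrier_mat p p" "N' \<in> carrier_mat p jn" "Z \<in> carrier_mat jn p" "D \<in> carrier_mat jn jn"
    using four_block_mat_decompose[OF M1(5)] by metis
  let ?X = "mat jn en (\<lambda>(i,l). if i = 0 \<and> Suc l = en then 1 else 0) :: 'a mat"
  have Mf: "M = four_block_mat (four_block_mat (companion t) ?X (0\<^sub>m en jn) (companion s)) (four_block_mat K L K' L')
       (0\<^sub>m (p + jn) (jn + en)) (four_block_mat N N' Z D)"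
    unfolding M1(1) B' Z0 Q(1) T(1) flag_shift_def ..
  note blocks = flag_isometry_blocks[OF seq_gram_carrier H(1) companion_carrier mat_carrier companion_carrier Q(2-5) T(2-5)
      flag_shift_det(1,2) seq_gram_det[OF ms] Mf iso]
  have mb: "mid_block wn p M = N"
    unfolding mid_block_def M1(1) T(1) using M1 T by (intro eq_matI) auto
  show "mid_block wn p M \<in> isometries p H" using blocks(3) T by (simp add: mb isometries_def)
  have "char_poly M = char_poly Bn * char_poly T"
    unfolding M1(1) B' Z0 by (rule char_poly_four_block_upper[OF Bc M1(3,5)])
  moreover have "char_poly Bn = char_poly (companion t) * char_poly (companion s)"
    unfolding flag_shift_def by (rule char_poly_four_block_upper) auto
  moreover have "char_poly T = char_poly N * char_poly D"
    unfolding T(1) blocks(1) by (rule char_poly_four_block_upper[OF T(2,3,5)])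
  moreover have "char_poly D = dual_poly t"
    using char_poly_inverse[of "(companion t)\<^sup>T" jn D] blocks(2) T(5) char_poly_companion[OF lt]
    by (simp add: dual_poly_def char_poly_transpose_mat[OF companion_carrier])
  ultimately show "char_poly M = s * t * dual_poly t * char_poly (mid_block wn p M)"
    unfolding mb char_poly_companion[OF ls] char_poly_companion[OF lt] by (simp only: mult_ac)
  show "mid_block wn p (M * mid_embed wn p jn h) = mid_block wn p M * h" if h: "h \<in> carrier_mat p p"
  proof -
    let ?h = "four_block_mat h (0\<^sub>m p jn) (0\<^sub>m jn p) (1\<^sub>m jn)"
    have hc: "?h \<in> carrier_mat (p + jn) (p + jn)" using h by (intro four_block_carrier_mat) auto
    have Th: "T * ?h = four_block_mat (N * h) N' (Z * h) D"
      unfolding T(1) using h T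
      by (subst mult_four_block_mat[of _ p p _ jn _ jn _ _ p _ jn]) auto
    have "M * mid_embed wn p jn h = four_block_mat (B' * 1\<^sub>m wn + Q * 0\<^sub>m (p + jn) wn) (B' * 0\<^sub>m wn (p + jn) + Q * ?h)
        (Z0 * 1\<^sub>m wn + T * 0\<^sub>m (p + jn) wn) (Z0 * 0\<^sub>m wn (p + jn) + T * ?h)"
      unfolding M1(1) mid_embed_def
      by (rule mult_four_block_mat[OF M1(2-5) one_carrier_mat zero_carrier_mat zero_carrier_mat hc])
    moreover have "Z0 * 0\<^sub>m wn (p + jn) + T * ?h = T * ?h" using M1(4,5) hc by (simp add: right_mult_zero_mat[OF M1(4)] left_add_zero_mat[OF mult_carrier_mat[OF M1(5) hc]])
    ultimately have "M * mid_embed wn p jn h = four_block_mat (B' * 1\<^sub>m wn + Q * 0\<^sub>m (p + jn) wn) (B' * 0\<^sub>m wn (p + jn) + Q * ?h)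
        (Z0 * 1\<^sub>m wn + T * 0\<^sub>m (p + jn) wn) (four_block_mat (N * h) N' (Z * h) D)" by (simp only: Th)
    then show ?thesis unfolding mb unfolding mid_block_def using h M1 T by (intro eq_matI) auto
  qed
qed

lemma mid_embed_isometry:
  assumes h: "h \<in> isometries p H"
  shows "mid_embed wn p jn h \<in> isometries d G" "mid_embed wn p jn h * E = E"
proof -
  have hc: "h \<in> carrier_mat p p" and hh: "h\<^sup>T * H * h = H" using h by (auto simp: isometries_def)
  let ?h = "four_block_mat h (0\<^sub>m p jn) (0\<^sub>m jn p) (1\<^sub>m jn)"
  have hc': "?h \<in> carrier_mat (p + jn) (p + jn)" using hc by (intro four_block_carrier_mat) auto
  have ht: "?h\<^sup>T = four_block_mat (h\<^sup>T) (0\<^sub>m p jn) (0\<^sub>m jn p) (1\<^sub>m jn)"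
    using hc by (subst transpose_four_block_mat[of _ p p _ jn _ jn]) auto
  have Fc: "mid_embed wn p jn h \<in> carrier_mat d d" unfolding mid_embed_def by (rule four_block_carrier_mat[OF one_carrier_mat hc'])
  let ?G11 = "four_block_mat (0\<^sub>m jn jn) (0\<^sub>m jn en) (0\<^sub>m en jn) A"
  let ?G12 = "four_block_mat (0\<^sub>m jn p) (1\<^sub>m jn) (0\<^sub>m en p) (0\<^sub>m en jn) :: 'a mat"
  let ?G21 = "four_block_mat (0\<^sub>m p jn) (0\<^sub>m p en) (- 1\<^sub>m jn) (0\<^sub>m jn en) :: 'a mat"
  let ?G22 = "four_block_mat H (0\<^sub>m p jn) (0\<^sub>m jn p) (0\<^sub>m jn jn)"
  have c11: "?G11 \<in> carrier_mat wn wn" and c12: "?G12 \<in> carrier_mat wn (p + jn)"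
    and c21: "?G21 \<in> carrier_mat (p + jn) wn" and c22: "?G22 \<in> carrier_mat (p + jn) (p + jn)"
    using H by (auto intro!: four_block_carrier_mat)
  have G12h: "?G12 * ?h = ?G12"
    using hc by (subst mult_four_block_mat[of _ jn p _ jn _ en _ _ p _ jn]) auto
  have hG21: "?h\<^sup>T * ?G21 = ?G21"
    unfolding ht using hc by (subst mult_four_block_mat[of _ p p _ jn _ jn _ _ jn _ en]) auto
  have G22h: "?G22 * ?h = four_block_mat (H * h) (0\<^sub>m p jn) (0\<^sub>m jn p) (0\<^sub>m jn jn)"
    using hc H by (subst mult_four_block_mat[of _ p p _ jn _ jn _ _ p _ jn]) auto
  have "?h\<^sup>T * (?G22 * ?h) = four_block_mat (h\<^sup>T * (H * h)) (0\<^sub>m p jn) (0\<^sub>m jn p) (0\<^sub>m jn jn)"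
    unfolding G22h ht using hc H by (subst mult_four_block_mat[of _ p p _ jn _ jn _ _ p _ jn]) auto
  moreover have "h\<^sup>T * (H * h) = H" using hh assoc_mult_mat[of "h\<^sup>T" p p H p h p] hc H by simp
  ultimately have hG22h: "?h\<^sup>T * (?G22 * ?h) = ?G22" by simp
  have GF: "G * mid_embed wn p jn h = four_block_mat ?G11 ?G12 ?G21 (?G22 * ?h)"
  proof -
    have "G * mid_embed wn p jn h = four_block_mat (?G11 * 1\<^sub>m wn + ?G12 * 0\<^sub>m (p + jn) wn) (?G11 * 0\<^sub>m wn (p + jn) + ?G12 * ?h)
       (?G21 * 1\<^sub>m wn + ?G22 * 0\<^sub>m (p + jn) wn) (?G21 * 0\<^sub>m wn (p + jn) + ?G22 * ?h)"
      unfolding flag_form_def mid_embed_def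
      by (rule mult_four_block_mat[OF c11 c12 c21 c22 one_carrier_mat zero_carrier_mat zero_carrier_mat hc'])
    then show ?thesis
      unfolding G12h right_mult_one_mat[OF c11] right_mult_one_mat[OF c21] right_mult_zero_mat[OF c12] right_mult_zero_mat[OF c22]
        right_mult_zero_mat[OF c11] right_mult_zero_mat[OF c21] right_add_zero_mat[OF c11] right_add_zero_mat[OF c21]
        left_add_zero_mat[OF c12] left_add_zero_mat[OF mult_carrier_mat[OF c22 hc']] .
  qed
  have FT: "(mid_embed wn p jn h)\<^sup>T = four_block_mat (1\<^sub>m wn) (0\<^sub>m wn (p + jn)) (0\<^sub>m (p + jn) wn) (?h\<^sup>T)"
    unfolding mid_embed_def by (subst transpose_four_block_mat[OF one_carrier_mat zero_carrier_mat zero_carrier_mat hc']) simp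
  have hct: "?h\<^sup>T \<in> carrier_mat (p + jn) (p + jn)" using hc' by (simp only: transpose_carrier_mat)
  have c22h: "?G22 * ?h \<in> carrier_mat (p + jn) (p + jn)" by (rule mult_carrier_mat[OF c22 hc'])
  have "(mid_embed wn p jn h)\<^sup>T * (G * mid_embed wn p jn h) = four_block_mat
      (1\<^sub>m wn * ?G11 + 0\<^sub>m wn (p + jn) * ?G21) (1\<^sub>m wn * ?G12 + 0\<^sub>m wn (p + jn) * (?G22 * ?h))
      (0\<^sub>m (p + jn) wn * ?G11 + ?h\<^sup>T * ?G21) (0\<^sub>m (p + jn) wn * ?G12 + ?h\<^sup>T * (?G22 * ?h))"
    unfolding FT GF by (rule mult_four_block_mat[OF one_carrier_mat zero_carrier_mat zero_carrier_mat hct c11 c12 c21 c22h])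
  also have "\<dots> = G"
    unfolding hG21 hG22h left_mult_one_mat[OF c11] left_mult_one_mat[OF c12] left_mult_zero_mat[OF c21] left_mult_zero_mat[OF c22h]
      left_mult_zero_mat[OF c11] left_mult_zero_mat[OF c12] right_add_zero_mat[OF c11] right_add_zero_mat[OF c12]
      left_add_zero_mat[OF c21] left_add_zero_mat[OF c22] flag_form_def ..
  finally have "(mid_embed wn p jn h)\<^sup>T * G * mid_embed wn p jn h = G"
    using assoc_mult_mat[of "(mid_embed wn p jn h)\<^sup>T" d d G d "mid_embed wn p jn h" d] Fc flag_form_facts(1) by simp
  then show "mid_embed wn p jn h \<in> isometries d G" using Fc by (simp add: isometries_def)
  show "mid_embed wn p jn h * E = E"
    unfolding mid_embed_def block_first_cols[OF one_carrier_mat zero_carrier_mat zero_carrier_mat hc']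
    by (rule first_cols_block[symmetric])
qed

lemma mid_embed_mult:
  fixes h h' :: "'a mat"
  assumes "h \<in> carrier_mat p p" "h' \<in> carrier_mat p p"
  shows "mid_embed wn p jn h * mid_embed wn p jn h' = mid_embed wn p jn (h * h')"
proof -
  have c: "four_block_mat h (0\<^sub>m p jn) (0\<^sub>m jn p) (1\<^sub>m jn) \<in> carrier_mat (p + jn) (p + jn)" if "h \<in> carrier_mat p p" for h :: "'a mat"
    using that by (intro four_block_carrier_mat) auto
  have "four_block_mat h (0\<^sub>m p jn) (0\<^sub>m jn p) (1\<^sub>m jn) * four_block_mat h' (0\<^sub>m p jn) (0\<^sub>m jn p) (1\<^sub>m jn)
     = four_block_mat (h * h') (0\<^sub>m p jn) (0\<^sub>m jn p) (1\<^sub>m jn)"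
    using assms by (subst mult_four_block_mat[of _ p p _ jn _ jn _ _ p _ jn]) auto
  then show ?thesis unfolding mid_embed_def using assms c[OF assms(1)] c[OF assms(2)] mult_carrier_mat[OF c[OF assms(1)] c[OF assms(2)]]
    by (subst mult_four_block_mat[of _ wn wn _ "p + jn" _ "p + jn" _ _ wn _ "p + jn"]) auto
qed

lemma mid_embed_one: "mid_embed wn p jn (1\<^sub>m p) = 1\<^sub>m d"
  unfolding mid_embed_def by simp

text \<open>Averaging over right translations by \<open>mid_embed\<close> shows that the block \<open>N\<close> is equidistributed
  on the smaller isometry group.\<close>
lemma sum_stab:
  fixes \<Psi> :: "'a poly \<Rightarrow> real"
  shows "(\<Sum>M\<in>stab. \<Psi> (char_poly M)) * real (card (isometries p H))
    = real (card stab) * (\<Sum>N\<in>isometries p H. \<Psi> (s * t * dual_poly t * char_poly N))"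
proof -
  define g where "g N = \<Psi> (s * t * dual_poly t * char_poly N)" for N
  define b :: "'a mat \<Rightarrow> 'a mat" where "b = mid_block wn p"
  define m :: "'a mat \<Rightarrow> 'a mat" where "m = mid_embed wn p jn"
  have carr: "h \<in> carrier_mat p p" if "h \<in> isometries p H" for h using that by (simp add: isometries_def)
  have move: "M * m h \<in> stab" if "M \<in> stab" "h \<in> isometries p H" for M h
  proof -
    have Mc: "M \<in> carrier_mat d d" using that(1) by (simp add: isometries_def)
    have mc: "m h \<in> isometries d G" "m h * E = E" using mid_embed_isometry[OF that(2)] by (auto simp: m_def)
    have "M * m h * E = M * (m h * E)"
      by (rule assoc_mult_mat[OF Mc _ first_cols_carrier]) (use mc in \<open>simp add: isometries_def\<close>)
    then show ?thesis using that(1) mc isometries_mult[OF _ mc(1) flag_form_facts(1)] by simp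
  qed
  have mcancel: "M * m h * m h' = M" if M: "M \<in> stab" and h: "h \<in> isometries p H" "h' \<in> isometries p H" "h * h' = 1\<^sub>m p" for M h h'
  proof -
    have Mc: "M \<in> carrier_mat d d" using M by (simp add: isometries_def)
    have mc: "m h \<in> carrier_mat d d" "m h' \<in> carrier_mat d d"
      using mid_embed_isometry(1)[OF h(1)] mid_embed_isometry(1)[OF h(2)] by (auto simp: m_def isometries_def)
    have "M * m h * m h' = M * (m h * m h')" by (rule assoc_mult_mat[OF Mc mc])
    also have "m h * m h' = 1\<^sub>m d" unfolding m_def mid_embed_mult[OF carr[OF h(1)] carr[OF h(2)]] h(3) mid_embed_one ..
    finally show ?thesis using Mc by simp
  qed
  have right: "(\<Sum>M\<in>stab. g (b (M * m h))) = (\<Sum>M\<in>stab. g (b M))" if h: "h \<in> isometries p H" for h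
  proof -
    obtain h' where h': "h' \<in> isometries p H" "h' * h = 1\<^sub>m p" "h * h' = 1\<^sub>m p"
      using isometries_inverse[OF H(1,3) h] by metis
    show ?thesis
      by (rule sum.reindex_bij_witness[where i = "\<lambda>M. M * m h'" and j = "\<lambda>M. M * m h"])
        (use move mcancel h h' in auto)
  qed
  have left: "(\<Sum>h\<in>isometries p H. g (N * h)) = (\<Sum>h\<in>isometries p H. g h)" if N: "N \<in> isometries p H" for N
  proof -
    obtain K where K: "K \<in> isometries p H" "K * N = 1\<^sub>m p" "N * K = 1\<^sub>m p"
      using isometries_inverse[OF H(1,3) N] by metis
    show ?thesis
      by (rule sum.reindex_bij_witness[where i = "\<lambda>h. K * h" and j = "\<lambda>h. N * h"])
        (use isometries_mult[OF N _ H(1)] isometries_mult[OF K(1) _ H(1)] mat_cancel_left[where w = p, OF carr[OF K(1)] carr[OF N] K(2)]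
          mat_cancel_left[where w = p, OF carr[OF N] carr[OF K(1)] K(3)] carr in auto)
  qed
  \<comment> \<open>The sum of \<open>g (b (M * m h))\<close> over \<open>M\<close> and
    \<open>h\<close> is evaluated in both orders: right multiplication by \<open>m h\<close>
    permutes \<open>stab\<close>, and \<open>b\<close> sends \<open>M * m h\<close> to
    \<open>b M * h\<close>, which runs over the smaller group together with
    \<open>h\<close>.\<close>
  have "(\<Sum>M\<in>stab. \<Psi> (char_poly M)) = (\<Sum>M\<in>stab. g (b M))"
    by (rule sum.cong[OF refl]) (simp add: g_def b_def stab_blocks(2))
  moreover have "(\<Sum>h\<in>isometries p H. \<Sum>M\<in>stab. g (b (M * m h))) = real (card (isometries p H)) * (\<Sum>M\<in>stab. g (b M))"
    using right by simp
  moreover have "(\<Sum>h\<in>isometries p H. \<Sum>M\<in>stab. g (b (M * m h))) = (\<Sum>M\<in>stab. \<Sum>h\<in>isometries p H. g (b M * h))"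
    by (subst sum.swap) (intro sum.cong refl, simp add: b_def m_def stab_blocks(3) carr)
  moreover have "(\<Sum>M\<in>stab. \<Sum>h\<in>isometries p H. g (b M * h)) = real (card stab) * (\<Sum>h\<in>isometries p H. g h)"
    using left stab_blocks(1) by (simp add: b_def)
  ultimately show ?thesis by (simp add: g_def mult.commute)
qed

end

section \<open>From the adapted form to an arbitrary form\<close>

context
  fixes c :: "int \<Rightarrow> 'a::{finite,field}" and s t :: "'a poly" and p :: nat and H J :: "'a mat"
  assumes two: "(2::'a) \<noteq> 0" and odd: "odd_seq c" and ms: "min_annihilator c s"
    and lt: "lead_coeff t = 1" and t0: "coeff t 0 \<noteq> 0"
    and H: "H \<in> carrier_mat p p" "H\<^sup>T = - H" "det H \<noteq> 0"
    and J: "J \<in> carrier_mat ((degree t + degree s) + (p + degree t)) ((degree t + degree s) + (p + degree t))"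
      "J\<^sup>T = - J" "det J \<noteq> 0"
begin

private abbreviation (input) "wm \<equiv> degree t + degree s"
private abbreviation (input) "dm \<equiv> (degree t + degree s) + (p + degree t)"
private abbreviation (input) "Gm \<equiv> flag_form (degree t) (degree s) p (seq_gram (degree s) c) H"
private abbreviation (input) "Em \<equiv> first_cols ((degree t + degree s) + (p + degree t)) (degree t + degree s)"
private abbreviation (input) "Bm \<equiv> flag_shift s t"
private abbreviation (input) "stabm \<equiv> {M \<in> isometries dm Gm. M * Em = Em * Bm}"
private abbreviation (input) "frames \<equiv> {Y \<in> carrier_mat dm wm. (\<exists>L \<in> carrier_mat wm dm. L * Y = 1\<^sub>m wm) \<and> Y\<^sup>T * J * Y = flag_gram s t c}"

private lemma lsm: "lead_coeff s = 1" and ksm: "kills s c" using ms by (simp_all add: min_annihilator_def)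
private lemma Gm: "Gm \<in> carrier_mat dm dm" "Gm\<^sup>T = - Gm" "det Gm \<noteq> 0" by (rule flag_form_facts[OF two odd ms lt t0 H])+
private lemma top: "Em\<^sup>T * Gm * Em = flag_gram s t c" by (rule flag_form_top[OF two odd ms lt t0 H])
private lemma Bc: "Bm \<in> carrier_mat wm wm" by (rule flag_shift_carrier[OF lsm lt])
private lemma Ec: "Em \<in> carrier_mat dm wm" by simp

private lemma assoc_w: "X \<in> carrier_mat dm dm \<Longrightarrow> Y \<in> carrier_mat dm dm \<Longrightarrow> Z \<in> carrier_mat dm wm \<Longrightarrow> X * Y * Z = X * (Y * Z)"
  for X Y Z :: "'a mat"
  by (rule assoc_mult_mat)
private lemma assoc_B: "X \<in> carrier_mat dm dm \<Longrightarrow> Y \<in> carrier_mat dm wm \<Longrightarrow> X * Y * Bm = X * (Y * Bm)"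
  for X Y :: "'a mat"
  by (rule assoc_mult_mat[OF _ _ Bc])
private lemma mult_d: "X \<in> carrier_mat dm dm \<Longrightarrow> Y \<in> carrier_mat dm dm \<Longrightarrow> X * Y \<in> carrier_mat dm dm"
  and mult_w: "X \<in> carrier_mat dm dm \<Longrightarrow> Z \<in> carrier_mat dm wm \<Longrightarrow> X * Z \<in> carrier_mat dm wm"
  for X Y Z :: "'a mat"
  by (rule mult_carrier_mat; assumption)+

private lemma frame_extend:
  assumes Y: "Y \<in> frames"
  obtains P K where "P \<in> carrier_mat dm dm" "K \<in> carrier_mat dm dm" "P * K = 1\<^sub>m dm" "K * P = 1\<^sub>m dm" "P\<^sup>T * J * P = Gm" "P * Em = Y"
proof -
  obtain L where L: "L \<in> carrier_mat wm dm" "L * Y = 1\<^sub>m wm" and Y': "Y \<in> carrier_mat dm wm" "Y\<^sup>T * J * Y = Em\<^sup>T * Gm * Em"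
    using Y by (auto simp: top)
  obtain P where P: "P \<in> carrier_mat dm dm" "P\<^sup>T * J * P = Gm" "P * Em = Y"
    using witt_extension[OF two J Gm _ Y'(1) L Y'(2)] by auto
  have "det P \<noteq> 0"
  proof
    assume "det P = 0"
    then have "det (P\<^sup>T * J * P) = 0" using det_mult[of "P\<^sup>T * J" dm P] P J(1) by simp
    then show False using P(2) Gm(3) by simp
  qed
  then obtain K where "K \<in> carrier_mat dm dm" "P * K = 1\<^sub>m dm" "K * P = 1\<^sub>m dm" using det_nonzero_inverse[OF P(1)] by metis
  then show ?thesis using that P by blast
qed

text \<open>Conjugation by a Witt extension \<open>P\<close> of the frame \<open>Y\<close> carries
  the isometries of \<open>J\<close> that act on \<open>Y\<close> through \<open>Bm\<close> to
  \<open>stabm\<close> and preserves characteristic polynomials.\<close>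

private lemma sum_frame:
  fixes \<Psi> :: "'a poly \<Rightarrow> real"
  assumes Y: "Y \<in> frames"
  shows "(\<Sum>M | M \<in> isometries dm J \<and> M * Y = Y * Bm. \<Psi> (char_poly M)) = (\<Sum>M\<in>stabm. \<Psi> (char_poly M))"
proof -
  obtain P K where P: "P \<in> carrier_mat dm dm" and K: "K \<in> carrier_mat dm dm" "P * K = 1\<^sub>m dm" "K * P = 1\<^sub>m dm"
    and PG: "P\<^sup>T * J * P = Gm" and PE: "P * Em = Y"
    using frame_extend[OF Y] .
  have Yc: "Y \<in> carrier_mat dm wm" using Y by simp
  have KY: "K * Y = Em" using mat_cancel_left[OF K(1) P K(3) Ec] PE by simp
  have KJ: "K\<^sup>T * Gm * K = J" by (rule congruence_inverse[OF P K(1,2) J(1) PG])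
  note cP = mat_cancel_left[where w = dm, OF P K(1,2)] and cK = mat_cancel_left[where w = dm, OF K(1) P K(3)]
  have carr: "M \<in> carrier_mat dm dm" if "M \<in> isometries dm F" for M and F :: "'a mat" using that by (simp add: isometries_def)
  show ?thesis
  proof (rule sum.reindex_bij_witness[where i = "\<lambda>M. P * M * K" and j = "\<lambda>M. K * M * P"])
    fix M assume "M \<in> {M. M \<in> isometries dm J \<and> M * Y = Y * Bm}"
    then have M: "M \<in> isometries dm J" "M * Y = Y * Bm" and Mc: "M \<in> carrier_mat dm dm" using carr by auto
    show "P * (K * M * P) * K = M"
      using P K(1) Mc by (simp add: mult_d cP K(2))
    have "K * M * P * Em = K * (M * Y)" using P K(1) Mc PE by (simp add: assoc_w mult_d mult_w)
    also have "\<dots> = Em * Bm" using K(1) Yc KY assoc_B[of K Y] M(2) by simp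
    finally show "K * M * P \<in> stabm" using isometries_conj(1)[OF J(1) P K(1,2) PG M(1)] by simp
    show "\<Psi> (char_poly (K * M * P)) = \<Psi> (char_poly M)"
      using isometries_conj(2)[OF J(1) P K(1,2) PG M(1)] by simp
  next
    fix M assume "M \<in> stabm"
    then have M: "M \<in> isometries dm Gm" "M * Em = Em * Bm" and Mc: "M \<in> carrier_mat dm dm" using carr by auto
    show "K * (P * M * K) * P = M"
      using P K(1) Mc by (simp add: mult_d cK K(3))
    have "P * M * K * Y = P * (M * Em)" using P K(1) Mc KY Yc by (simp add: assoc_w mult_d mult_w)
    also have "\<dots> = Y * Bm" using P Ec PE assoc_B[of P Em] M(2) by simp
    finally show "P * M * K \<in> {M. M \<in> isometries dm J \<and> M * Y = Y * Bm}"
      using isometries_conj(1)[OF Gm(1) K(1) P K(3) KJ M(1)] by simp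
  qed
qed

text \<open>The matrices \<open>P\<close> that carry \<open>J\<close> to \<open>Gm\<close> form a
  torsor under the isometries of \<open>J\<close>. They are sorted by the frame
  \<open>P * Em\<close>; each fibre is a coset of the isometries of \<open>Gm\<close> that fix
  \<open>Em\<close>, and so is \<open>stabm\<close>.\<close>

private lemma card_frames: "card frames * card stabm = card (isometries dm J)"
proof -
  define F where "F = {P \<in> carrier_mat dm dm. P\<^sup>T * J * P = Gm}"
  have finF: "finite F" unfolding F_def using finite_carrier_mat by (rule finite_subset[rotated]) auto
  have finY: "finite frames" using finite_carrier_mat by (rule finite_subset[rotated]) auto
  have inv: "\<exists>K. K \<in> carrier_mat dm dm \<and> P * K = 1\<^sub>m dm \<and> K * P = 1\<^sub>m dm" if "P \<in> F" for P
  proof -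
    have Pc: "P \<in> carrier_mat dm dm" and PG: "P\<^sup>T * J * P = Gm" using that by (auto simp: F_def)
    have "det P \<noteq> 0"
    proof
      assume "det P = 0"
      then have "det (P\<^sup>T * J * P) = 0" using det_mult[of "P\<^sup>T * J" dm P] Pc J(1) by simp
      then show False using PG Gm(3) by simp
    qed
    then show ?thesis using det_nonzero_inverse[of P dm] that by (auto simp: F_def)
  qed
  have "card (isometries dm J) = card F"
  proof -
    have "\<exists>P \<in> carrier_mat dm dm. P\<^sup>T * J * P = Gm \<and> P * first_cols dm 0 = 0\<^sub>m dm 0"
      by (rule witt_extension[OF two J Gm _ _ zero_carrier_mat[of 0 dm]])
        (use J(1) Gm(1) in \<open>auto intro!: eq_matI simp: first_cols_def\<close>)
    then obtain P where P: "P \<in> carrier_mat dm dm" "P\<^sup>T * J * P = Gm" by blast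
    then obtain K where K: "K \<in> carrier_mat dm dm" "P * K = 1\<^sub>m dm" "K * P = 1\<^sub>m dm" using inv[of P] by (auto simp: F_def)
    have KJ: "K\<^sup>T * Gm * K = J" by (rule congruence_inverse[OF P(1) K(1,2) J(1) P(2)])
    have "bij_betw (\<lambda>M. M * P) (isometries dm J) F"
    proof (rule bij_betwI[where g = "\<lambda>Q. Q * K"])
      show "(\<lambda>M. M * P) \<in> isometries dm J \<rightarrow> F"
        using P gram_mult[OF _ P(1) J(1)] by (auto simp: isometries_def F_def)
      show "(\<lambda>Q. Q * K) \<in> F \<rightarrow> isometries dm J"
        using K(1) KJ gram_mult[OF _ K(1) J(1)] by (auto simp: isometries_def F_def)
    qed (use mat_cancel_right[where w = dm, OF P(1) K(1,2)] mat_cancel_right[where w = dm, OF K(1) P(1) K(3)] in \<open>auto simp: isometries_def F_def\<close>)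
    then show ?thesis by (rule bij_betw_same_card)
  qed
  also have "card F = (\<Sum>Y\<in>frames. card {P \<in> F. P * Em = Y})"
  proof -
    have "P * Em \<in> frames" if P: "P \<in> F" for P
    proof -
      obtain K where K: "K \<in> carrier_mat dm dm" "K * P = 1\<^sub>m dm" using inv[OF P] by blast
      have Pc: "P \<in> carrier_mat dm dm" using P by (simp add: F_def)
      have "Em\<^sup>T * K * (P * Em) = Em\<^sup>T * (K * (P * Em))"
        by (rule assoc_mult_mat[of _ wm dm _ dm _ wm]) (use K Pc mult_w[OF Pc Ec] Ec in auto)
      also have "\<dots> = 1\<^sub>m wm"
        unfolding mat_cancel_left[OF K(1) Pc K(2) Ec] by (rule first_cols_left_inverse) simp
      finally have "\<exists>L \<in> carrier_mat wm dm. L * (P * Em) = 1\<^sub>m wm"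
        using K(1) Ec by (intro bexI[of _ "Em\<^sup>T * K"]) (auto intro!: mult_carrier_mat[of _ wm dm])
      moreover have "(P * Em)\<^sup>T * J * (P * Em) = flag_gram s t c"
        using gram_mult[OF Pc Ec J(1)] P top by (simp add: F_def)
      ultimately show ?thesis using mult_w[OF Pc Ec] by simp
    qed
    then have "F = (\<Union>Y\<in>frames. {P \<in> F. P * Em = Y})" by blast
    then have "card F = card (\<Union>Y\<in>frames. {P \<in> F. P * Em = Y})" by simp
    also have "\<dots> = (\<Sum>Y\<in>frames. card {P \<in> F. P * Em = Y})"
      by (rule card_UN_disjoint) (use finY finF in auto)
    finally show ?thesis .
  qed
  also have "\<dots> = (\<Sum>Y\<in>frames. card stabm)"
  proof (rule sum.cong[OF refl])
    fix Y assume Y: "Y \<in> frames"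
    obtain P K where P: "P \<in> carrier_mat dm dm" and K: "K \<in> carrier_mat dm dm" "P * K = 1\<^sub>m dm" "K * P = 1\<^sub>m dm"
      and PG: "P\<^sup>T * J * P = Gm" and PE: "P * Em = Y"
      using frame_extend[OF Y] .
    have Yc: "Y \<in> carrier_mat dm wm" using Y by simp
    have KJ: "K\<^sup>T * Gm * K = J" by (rule congruence_inverse[OF P K(1,2) J(1) PG])
    have KY: "K * Y = Em" using mat_cancel_left[OF K(1) P K(3) Ec] PE by simp
    have EB: "Em * Bm \<in> carrier_mat dm wm" by (rule mult_carrier_mat[OF Ec Bc])
    \<comment> \<open>\<open>stabm\<close> is a coset, so a base point is needed: \<open>Bm\<close>
      preserves the Gram matrix of the frame, and Witt extension realises it by an isometry.\<close>
    obtain M0 where M0: "M0 \<in> stabm"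
    proof -
      obtain B' where B': "B' \<in> carrier_mat wm wm" "B' * Bm = 1\<^sub>m wm"
        using det_nonzero_inverse[OF Bc flag_shift_det(3)[OF two odd ms lt t0 H]] by metis
      have "B' * Em\<^sup>T * (Em * Bm) = B' * (Em\<^sup>T * (Em * Bm))"
        by (rule assoc_mult_mat[of _ wm wm _ dm _ wm]) (use B' EB Ec in auto)
      also have "Em\<^sup>T * (Em * Bm) = Em\<^sup>T * Em * Bm"
        by (rule assoc_mult_mat[symmetric, of _ wm dm _ wm _ wm]) (use Bc Ec in auto)
      also have "Em\<^sup>T * Em = (1\<^sub>m wm :: 'a mat)" by (rule first_cols_left_inverse) simp
      finally have L: "B' * Em\<^sup>T * (Em * Bm) = 1\<^sub>m wm" using B' Bc by simp
      have Lc: "B' * Em\<^sup>T \<in> carrier_mat wm dm" by (rule mult_carrier_mat[OF B'(1)]) (use Ec in auto)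
      have "(Em * Bm)\<^sup>T * Gm * (Em * Bm) = Em\<^sup>T * Gm * Em"
        unfolding gram_mult[OF Ec Bc Gm(1)] top by (rule flag_shift_isometry[OF lsm lt odd ksm])
      then obtain M where "M \<in> carrier_mat dm dm" "M\<^sup>T * Gm * M = Gm" "M * Em = Em * Bm"
        using witt_extension[OF two Gm Gm _ EB Lc L] by auto
      then show ?thesis using that by (auto simp: isometries_def)
    qed
    obtain M1 where M1: "M1 \<in> isometries dm Gm" "M1 * M0 = 1\<^sub>m dm" "M0 * M1 = 1\<^sub>m dm"
      using isometries_inverse[OF Gm(1,3)] M0 by blast
    have Mc: "M0 \<in> carrier_mat dm dm" "M1 \<in> carrier_mat dm dm" using M0 M1 by (auto simp: isometries_def)
    have M0i: "M0 \<in> isometries dm Gm" "M0 * Em = Em * Bm" using M0 by auto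
    have M1E: "M1 * (Em * Bm) = Em" using mat_cancel_left[OF Mc(2,1) M1(2) Ec] M0i(2) by simp
    have "bij_betw (\<lambda>P'. M0 * (K * P')) {P \<in> F. P * Em = Y} stabm"
    proof (rule bij_betwI[where g = "\<lambda>M. P * (M1 * M)"])
      show "(\<lambda>P'. M0 * (K * P')) \<in> {P \<in> F. P * Em = Y} \<rightarrow> stabm"
      proof
        fix P' assume "P' \<in> {P \<in> F. P * Em = Y}"
        then have P': "P' \<in> carrier_mat dm dm" "P'\<^sup>T * J * P' = Gm" "P' * Em = Y" by (auto simp: F_def)
        have KP': "K * P' \<in> carrier_mat dm dm" by (rule mult_d[OF K(1) P'(1)])
        have "K * P' \<in> isometries dm Gm"
          using gram_mult[OF K(1) P'(1) Gm(1)] KJ P'(2) KP' by (simp add: isometries_def)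
        then have "M0 * (K * P') \<in> isometries dm Gm" by (rule isometries_mult[OF M0i(1) _ Gm(1)])
        moreover have "M0 * (K * P') * Em = M0 * (K * (P' * Em))"
          using Mc K(1) P'(1) Ec by (simp add: assoc_w mult_d mult_w)
        ultimately show "M0 * (K * P') \<in> stabm" using P'(3) KY M0i(2) by simp
      qed
      show "(\<lambda>M. P * (M1 * M)) \<in> stabm \<rightarrow> {P \<in> F. P * Em = Y}"
      proof
        fix M assume M: "M \<in> stabm"
        then have Mi: "M \<in> isometries dm Gm" "M * Em = Em * Bm" "M \<in> carrier_mat dm dm" by (auto simp: isometries_def)
        have "M1 * M \<in> isometries dm Gm" by (rule isometries_mult[OF M1(1) Mi(1) Gm(1)])
        then have MM: "M1 * M \<in> carrier_mat dm dm" "(M1 * M)\<^sup>T * Gm * (M1 * M) = Gm" by (auto simp: isometries_def)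
        have "(P * (M1 * M))\<^sup>T * J * (P * (M1 * M)) = Gm" using gram_mult[OF P MM(1) J(1)] PG MM(2) by simp
        moreover have "P * (M1 * M) * Em = P * (M1 * (M * Em))"
          using P Mc Mi(3) Ec by (simp add: assoc_w mult_d mult_w)
        ultimately show "P * (M1 * M) \<in> {P \<in> F. P * Em = Y}"
          using Mi(2) M1E PE mult_d[OF P MM(1)] by (simp add: F_def)
      qed
      show "P * (M1 * (M0 * (K * P'))) = P'" if "P' \<in> {P \<in> F. P * Em = Y}" for P'
      proof -
        have P': "P' \<in> carrier_mat dm dm" using that by (simp add: F_def)
        show ?thesis unfolding mat_cancel_left[OF Mc(2,1) M1(2) mult_d[OF K(1) P']] by (rule mat_cancel_left[OF P K(1,2) P'])
      qed
      show "M0 * (K * (P * (M1 * M))) = M" if "M \<in> stabm" for M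
      proof -
        have Mc': "M \<in> carrier_mat dm dm" using that by (simp add: isometries_def)
        show ?thesis unfolding mat_cancel_left[OF K(1) P K(3) mult_d[OF Mc(2) Mc']] by (rule mat_cancel_left[OF Mc M1(3) Mc'])
      qed
    qed
    then show "card {P \<in> F. P * Em = Y} = card stabm" by (rule bij_betw_same_card)
  qed
  finally show ?thesis by simp
qed

text \<open>\<open>flag_basis\<close> turns the vectors of the given type into the frames on which
  \<open>M\<close> acts through \<open>Bm\<close>, after which the order of summation is exchanged.
  The factor on the right shows that the type is met, on average over the isometries, by exactly one
  vector.\<close>

theorem sum_flag_type:
  fixes \<Psi> :: "'a poly \<Rightarrow> real"
  shows "(\<Sum>M\<in>isometries dm J. \<Sum>v | v \<in> carrier_vec dm \<and> flag_type J M v c s t. \<Psi> (char_poly M)) * real (card (isometries p H))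
    = real (card (isometries dm J)) * (\<Sum>N\<in>isometries p H. \<Psi> (s * t * dual_poly t * char_poly N))"
proof -
  have finY: "finite frames" using finite_carrier_mat by (rule finite_subset[rotated]) auto
  have card_v: "card {v. v \<in> carrier_vec dm \<and> flag_type J M v c s t} = card {Y. Y \<in> frames \<and> M * Y = Y * Bm}"
    if M: "M \<in> isometries dm J" for M
  proof -
    have Mc: "M \<in> carrier_mat dm dm" "M\<^sup>T * J * M = J" using M by (auto simp: isometries_def)
    have "bij_betw (\<lambda>v. flag_basis M v s t) {v. v \<in> carrier_vec dm \<and> flag_type J M v c s t} {Y. Y \<in> frames \<and> M * Y = Y * Bm}"
    proof (rule bij_betwI[where g = "\<lambda>Y. Y *\<^sub>v flag_start s t"])
      show "(\<lambda>v. flag_basis M v s t) \<in> {v. v \<in> carrier_vec dm \<and> flag_type J M v c s t} \<rightarrow> {Y. Y \<in> frames \<and> M * Y = Y * Bm}"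
      proof
        fix v assume "v \<in> {v. v \<in> carrier_vec dm \<and> flag_type J M v c s t}"
        then have v: "v \<in> carrier_vec dm" "flag_type J M v c s t" by auto
        show "flag_basis M v s t \<in> {Y. Y \<in> frames \<and> M * Y = Y * Bm}"
          using flag_basis_carrier[OF two J Mc v] flag_basis_left_inverse[OF two J Mc v] flag_basis_gram[OF two J Mc v]
            flag_basis_shift[OF two J Mc v] by simp
      qed
      show "(\<lambda>Y. Y *\<^sub>v flag_start s t) \<in> {Y. Y \<in> frames \<and> M * Y = Y * Bm} \<rightarrow> {v. v \<in> carrier_vec dm \<and> flag_type J M v c s t}"
      proof
        fix Y assume "Y \<in> {Y. Y \<in> frames \<and> M * Y = Y * Bm}"
        then obtain L where Y: "Y \<in> carrier_mat dm wm" "L \<in> carrier_mat wm dm" "L * Y = 1\<^sub>m wm" "Y\<^sup>T * J * Y = flag_gram s t c" "M * Y = Y * Bm"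
          by auto
        show "Y *\<^sub>v flag_start s t \<in> {v. v \<in> carrier_vec dm \<and> flag_type J M v c s t}"
          using flag_type_of_gram[OF two J Mc odd ms lt t0 Y] mult_mat_vec_carrier[OF Y(1) flag_start_carrier[OF lsm lt]] by simp
      qed
      show "flag_basis M v s t *\<^sub>v flag_start s t = v" if "v \<in> {v. v \<in> carrier_vec dm \<and> flag_type J M v c s t}" for v
        using that flag_basis_start[OF two J Mc, of v c s t] by blast
      show "flag_basis M (Y *\<^sub>v flag_start s t) s t = Y" if Ym: "Y \<in> {Y. Y \<in> frames \<and> M * Y = Y * Bm}" for Y
      proof -
        obtain L where Y: "Y \<in> carrier_mat dm wm" "L \<in> carrier_mat wm dm" "L * Y = 1\<^sub>m wm" "Y\<^sup>T * J * Y = flag_gram s t c" "M * Y = Y * Bm"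
          using Ym by auto
        show ?thesis by (rule flag_basis_of_gram[OF two J Mc odd ms lt t0 Y])
      qed
    qed
    then show ?thesis by (rule bij_betw_same_card)
  qed
  have "(\<Sum>M\<in>isometries dm J. \<Sum>v | v \<in> carrier_vec dm \<and> flag_type J M v c s t. \<Psi> (char_poly M))
    = (\<Sum>M\<in>isometries dm J. \<Sum>Y | Y \<in> frames \<and> M * Y = Y * Bm. \<Psi> (char_poly M))"
    using card_v by (intro sum.cong refl) (simp only: sum_constant)
  also have "\<dots> = (\<Sum>Y\<in>frames. \<Sum>M | M \<in> isometries dm J \<and> M * Y = Y * Bm. \<Psi> (char_poly M))"
    by (rule sum.swap_restrict[OF finite_isometries finY])
  also have "\<dots> = (\<Sum>Y\<in>frames. \<Sum>M\<in>stabm. \<Psi> (char_poly M))"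
    by (rule sum.cong[OF refl]) (rule sum_frame)
  also have "\<dots> = real (card frames) * (\<Sum>M\<in>stabm. \<Psi> (char_poly M))"
    by (simp only: sum_constant)
  finally have "(\<Sum>M\<in>isometries dm J. \<Sum>v | v \<in> carrier_vec dm \<and> flag_type J M v c s t. \<Psi> (char_poly M)) * real (card (isometries p H))
    = real (card frames) * (real (card stabm) * (\<Sum>N\<in>isometries p H. \<Psi> (s * t * dual_poly t * char_poly N)))"
    using sum_stab[OF two odd ms lt t0 H, of \<Psi>] by (simp only: mult.assoc)
  then show ?thesis using card_frames by (simp only: mult.assoc[symmetric] of_nat_mult[symmetric])
qed

end

section \<open>Palindromic polynomials\<close>

abbreviation "quad_poly \<equiv> [:1, 0, 1::'a::field:]"

text \<open>\<open>z^n * Q (z + 1/z)\<close> without denominators. The exponent \<open>n\<close> is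
  kept separate from \<open>degree Q\<close>, which makes the map linear in
  \<open>Q\<close>.\<close>

definition recip_hom :: "nat \<Rightarrow> 'a::field poly \<Rightarrow> 'a poly" where
  "recip_hom n Q = (\<Sum>b\<le>n. Polynomial.smult (coeff Q b) (monom 1 (n - b) * quad_poly ^ b))"

definition recip_poly :: "'a::field poly \<Rightarrow> 'a poly" where
  "recip_poly Q = recip_hom (degree Q) Q"

lemma recip_hom_add: "recip_hom n (P + Q) = recip_hom n P + recip_hom n Q"
  by (simp add: recip_hom_def sum.distrib smult_add_left)

lemma recip_hom_diff: "recip_hom n (P - Q) = recip_hom n P - recip_hom n Q"
  by (simp add: recip_hom_def sum_subtractf smult_diff_left)

lemma recip_hom_smult: "recip_hom n (Polynomial.smult a Q) = Polynomial.smult a (recip_hom n Q)"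
  by (rule poly_eqI) (simp add: recip_hom_def coeff_sum sum_distrib_left mult.assoc)

lemma recip_hom_0[simp]: "recip_hom n 0 = 0"
  by (simp add: recip_hom_def)

lemma recip_hom_pCons: "recip_hom (Suc n) (pCons a Q) = monom a (Suc n) + quad_poly * recip_hom n Q"
proof -
  have "recip_hom (Suc n) (pCons a Q) = monom a (Suc n)
    + (\<Sum>b\<le>n. Polynomial.smult (coeff Q b) (monom 1 (n - b) * quad_poly ^ Suc b))"
    unfolding recip_hom_def by (subst sum.atMost_Suc_shift) (simp add: smult_monom)
  then show ?thesis
    by (simp only: recip_hom_def sum_distrib_left mult_smult_right power_Suc mult.left_commute)
qed

lemma recip_hom_Suc:
  assumes "degree Q \<le> n"
  shows "recip_hom (Suc n) Q = monom 1 1 * recip_hom n Q"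
proof -
  have z: "coeff Q (Suc n) = 0" using assms by (intro coeff_eq_0) simp
  have "recip_hom (Suc n) Q = (\<Sum>b\<le>n. Polynomial.smult (coeff Q b) (monom 1 (Suc n - b) * quad_poly ^ b))"
    by (simp add: recip_hom_def z)
  also have "\<dots> = (\<Sum>b\<le>n. Polynomial.smult (coeff Q b) (monom 1 1 * (monom 1 (n - b) * quad_poly ^ b)))"
    by (rule sum.cong[OF refl]) (simp add: mult_monom Suc_diff_le flip: mult.assoc)
  finally show ?thesis by (simp only: recip_hom_def sum_distrib_left mult_smult_right)
qed

lemma recip_hom_raise: "degree Q \<le> n \<Longrightarrow> recip_hom (k + n) Q = monom 1 k * recip_hom n Q"
proof (induction k)
  case (Suc k)
  have "recip_hom (Suc (k + n)) Q = monom 1 1 * recip_hom (k + n) Q" using Suc.prems by (intro recip_hom_Suc) simp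
  then show ?case using Suc by (simp add: mult_monom flip: mult.assoc)
qed (simp add: monom_0 flip: one_pCons)

lemma recip_hom_mult:
  assumes "degree P \<le> n" "degree Q \<le> m"
  shows "recip_hom (n + m) (P * Q) = recip_hom n P * recip_hom m Q"
  using assms(1)
proof (induction P arbitrary: n rule: pCons_induct)
  case (pCons a P)
  show ?case
  proof (cases n)
    case 0
    then have "P = 0" using pCons by (auto split: if_splits)
    then show ?thesis using 0 by (simp add: recip_hom_smult recip_hom_def[of 0])
  next
    case (Suc k)
    have dP: "degree P \<le> k" using pCons.prems Suc by (cases "P = 0") auto
    have "recip_hom (n + m) (pCons a P * Q) = recip_hom (Suc k + m) (Polynomial.smult a Q) + recip_hom (Suc (k + m)) (pCons 0 (P * Q))"
      by (simp add: Suc mult_pCons_left recip_hom_add)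
    also have "\<dots> = Polynomial.smult a (monom 1 (Suc k)) * recip_hom m Q + quad_poly * recip_hom (k + m) (P * Q)"
      unfolding recip_hom_smult recip_hom_raise[OF assms(2)] recip_hom_pCons by simp
    also have "\<dots> = (monom a (Suc k) + quad_poly * recip_hom k P) * recip_hom m Q"
      unfolding pCons.IH[OF dP] by (simp add: smult_monom distrib_right mult.assoc)
    finally show ?thesis by (simp only: Suc recip_hom_pCons)
  qed
qed simp

lemma recip_poly_mult:
  assumes "P \<noteq> 0" "Q \<noteq> 0"
  shows "recip_poly (P * Q) = recip_poly P * recip_poly Q"
  using recip_hom_mult[of P "degree P" Q "degree Q"] assms by (simp add: recip_poly_def degree_mult_eq)

lemma recip_poly_degree_lead:
  "degree (recip_poly Q) = 2 * degree Q \<and> coeff (recip_poly Q) (2 * degree Q) = lead_coeff Q"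
proof (induction Q rule: pCons_induct)
  case 0
  then show ?case by (simp add: recip_poly_def)
next
  case (pCons a Q)
  show ?case
  proof (cases "Q = 0")
    case True
    then show ?thesis by (simp add: recip_poly_def recip_hom_def)
  next
    case False
    have eq: "recip_poly (pCons a Q) = monom a (Suc (degree Q)) + quad_poly * recip_poly Q"
      using False by (simp add: recip_poly_def recip_hom_pCons)
    have nz: "recip_poly Q \<noteq> 0" using pCons.IH False by (metis coeff_0 leading_coeff_0_iff)
    have d2: "degree (quad_poly * recip_poly Q) = 2 * degree Q + 2"
      using nz pCons.IH by (subst degree_mult_eq) auto
    have l2: "coeff (quad_poly * recip_poly Q) (2 * degree Q + 2) = lead_coeff Q"
    proof -
      have "coeff (quad_poly * recip_poly Q) (2 * degree Q + 2) = lead_coeff (quad_poly * recip_poly Q)" by (simp only: d2)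
      also have "\<dots> = lead_coeff (quad_poly :: 'a poly) * lead_coeff (recip_poly Q)" by (rule lead_coeff_mult)
      also have "\<dots> = lead_coeff Q" using pCons.IH by simp
      finally show ?thesis .
    qed
    have "degree (monom a (Suc (degree Q))) < degree (quad_poly * recip_poly Q)"
      unfolding d2 by (rule le_less_trans[OF degree_monom_le]) simp
    then have "degree (recip_poly (pCons a Q)) = 2 * degree Q + 2" unfolding eq by (simp only: degree_add_eq_right d2)
    moreover have "coeff (recip_poly (pCons a Q)) (2 * degree Q + 2) = lead_coeff Q"
      unfolding eq coeff_add l2 by simp
    ultimately show ?thesis using False by simp
  qed
qed

lemma degree_recip_poly[simp]: "degree (recip_poly Q) = 2 * degree Q"
  using recip_poly_degree_lead by blast

lemma lead_coeff_recip_poly: "lead_coeff (recip_poly Q) = lead_coeff Q"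
  using recip_poly_degree_lead by simp

lemma recip_hom_nonzero: "Q \<noteq> 0 \<Longrightarrow> degree Q \<le> n \<Longrightarrow> degree (recip_hom n Q) = n + degree Q"
proof -
  assume Q: "Q \<noteq> 0" "degree Q \<le> n"
  have "recip_hom n Q = monom 1 (n - degree Q) * recip_poly Q"
    using recip_hom_raise[OF order.refl, of "n - degree Q" Q] Q by (simp add: recip_poly_def)
  moreover have "recip_poly Q \<noteq> 0" using lead_coeff_recip_poly[of Q] Q by (metis leading_coeff_0_iff)
  moreover have "monom 1 (n - degree Q) \<noteq> (0::'a poly)" by simp
  ultimately show ?thesis using Q by (simp add: degree_mult_eq degree_monom_eq)
qed

lemma recip_hom_eq_0: "degree Q \<le> n \<Longrightarrow> recip_hom n Q = 0 \<Longrightarrow> Q = 0"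
proof (rule ccontr)
  assume h: "degree Q \<le> n" "recip_hom n Q = 0" "Q \<noteq> 0"
  have d: "n + degree Q = 0" using recip_hom_nonzero[OF h(3,1)] h(2) by simp
  then have "recip_hom n Q = recip_poly Q" by (simp add: recip_poly_def)
  then show False using lead_coeff_recip_poly[of Q] h by auto
qed

lemma recip_poly_inj:
  assumes "recip_poly P = recip_poly Q"
  shows "P = Q"
proof -
  have d: "degree P = degree Q" using assms degree_recip_poly by (metis mult_left_cancel zero_neq_numeral)
  have "recip_hom (degree P) (P - Q) = 0" unfolding recip_hom_diff using assms d by (simp add: recip_poly_def)
  moreover have "degree (P - Q) \<le> degree P" using d by (intro degree_diff_le) auto
  ultimately have "P - Q = 0" by (rule recip_hom_eq_0[of _ "degree P", rotated])
  then show ?thesis by simp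
qed

lemma recip_poly_1[simp]: "recip_poly 1 = 1"
  by (simp add: recip_poly_def recip_hom_def)

lemma rev_poly_add: "rev_poly n (f + g) = rev_poly n f + rev_poly n g"
  by (rule poly_eqI) (simp add: coeff_rev_poly)

lemma rev_poly_quad:
  fixes f :: "'a::field poly"
  assumes "degree f \<le> m"
  shows "rev_poly (Suc (Suc m)) (quad_poly * f) = quad_poly * rev_poly m f"
proof (rule poly_eqI)
  fix i
  have q: "quad_poly * g = g + pCons 0 (pCons 0 g)" for g :: "'a poly" by (simp add: mult_pCons_left)
  have z: "coeff f l = 0" if "l > m" for l using assms that by (intro coeff_eq_0) simp
  consider "i = 0" | "i = 1" | k where "i = Suc (Suc k)"
    by (metis One_nat_def not0_implies_Suc)
  then show "coeff (rev_poly (Suc (Suc m)) (quad_poly * f)) i = coeff (quad_poly * rev_poly m f) i"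
  proof cases
    case 1
    then show ?thesis by (simp add: q coeff_rev_poly z)
  next
    case 2
    then show ?thesis by (cases m) (simp_all add: q coeff_rev_poly z)
  next
    case 3
    show ?thesis
    proof (cases "i \<le> m")
      case True
      then have "Suc (Suc m) - i = Suc (Suc (m - i))" by simp
      then show ?thesis using True 3 by (simp add: q coeff_rev_poly)
    next
      case False
      then consider "i = Suc m" | "i = Suc (Suc m)" | "i > Suc (Suc m)" by linarith
      then show ?thesis using 3 by cases (simp_all add: q coeff_rev_poly)
    qed
  qed
qed

lemma recip_hom_degree_le: "degree (recip_hom n Q) \<le> 2 * n"
  unfolding recip_hom_def
proof (rule degree_sum_le)
  fix b assume "b \<in> {..n}"
  have "degree (monom (1::'a) (n - b) * quad_poly ^ b) \<le> (n - b) + 2 * b"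
    by (rule order.trans[OF degree_mult_le add_mono[OF degree_monom_le]])
      (rule order.trans[OF degree_power_le], simp)
  then show "degree (Polynomial.smult (coeff Q b) (monom 1 (n - b) * quad_poly ^ b)) \<le> 2 * n"
    using \<open>b \<in> {..n}\<close> by (intro order.trans[OF degree_smult_le]) simp
qed simp

lemma rev_poly_recip_hom: "rev_poly (2 * n) (recip_hom n Q) = recip_hom n Q"
proof (induction n arbitrary: Q)
  case 0
  show ?case by (rule poly_eqI) (auto simp: coeff_rev_poly recip_hom_def coeff_pCons split: nat.splits)
next
  case (Suc n)
  obtain a R where Q: "Q = pCons a R" by (cases Q)
  have m: "rev_poly (Suc (Suc (2 * n))) (monom a (Suc n)) = monom a (Suc n)"
    by (rule poly_eqI) (auto simp: coeff_rev_poly)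
  have "rev_poly (Suc (Suc (2 * n))) (recip_hom (Suc n) Q) = recip_hom (Suc n) Q"
    unfolding Q recip_hom_pCons rev_poly_add m rev_poly_quad[OF recip_hom_degree_le] Suc.IH ..
  then show ?case by simp
qed

text \<open>Subtracting \<open>a * (1 + z^2)^n\<close>, with \<open>a\<close> the constant
  coefficient, removes the constant term and by symmetry the top one; what is left is
  \<open>z\<close> times a symmetric polynomial for \<open>n - 1\<close>.\<close>

lemma rev_poly_fixed_is_recip_hom:
  fixes p :: "'a::field poly"
  assumes "degree p \<le> 2 * n" "rev_poly (2 * n) p = p"
  shows "\<exists>Q. degree Q \<le> n \<and> p = recip_hom n Q"
  using assms
proof (induction n arbitrary: p)
  case 0
  then obtain a where "p = [:a:]" by (metis degree_eq_zeroE le_zero_eq mult_zero_right)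
  then show ?case by (intro exI[of _ "[:a:]"]) (simp add: recip_hom_def)
next
  case (Suc n)
  define a where "a = coeff p 0"
  have sym: "coeff p i = coeff p (2 * Suc n - i)" if "i \<le> 2 * Suc n" for i
    using arg_cong[OF Suc.prems(2), of "\<lambda>p. coeff p i"] that by (simp add: coeff_rev_poly)
  define r where "r = p - Polynomial.smult a (quad_poly ^ Suc n)"
  have e: "Polynomial.smult a (quad_poly ^ Suc n) = recip_hom (Suc n) (monom a (Suc n))"
  proof -
    have "recip_hom (Suc n) (monom a (Suc n)) = (\<Sum>b\<le>Suc n. if b = Suc n then Polynomial.smult a (quad_poly ^ b) else 0)"
      unfolding recip_hom_def by (rule sum.cong) (auto simp: monom_0 one_pCons)
    then show ?thesis by simp
  qed
  have r_rev: "rev_poly (2 * Suc n) r = r"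
  proof (rule poly_eqI)
    fix i
    have "coeff (recip_hom (Suc n) (monom a (Suc n))) i = coeff (rev_poly (2 * Suc n) (recip_hom (Suc n) (monom a (Suc n)))) i"
      by (simp only: rev_poly_recip_hom)
    moreover have "coeff p i = coeff (rev_poly (2 * Suc n) p) i" using Suc.prems(2) by simp
    ultimately show "coeff (rev_poly (2 * Suc n) r) i = coeff r i"
      unfolding r_def e by (simp add: coeff_rev_poly)
  qed
  have r0: "coeff r 0 = 0"
    by (simp add: r_def a_def coeff_0_power)
  then obtain r' where r': "r = pCons 0 r'" by (metis coeff_pCons_0 pCons_cases)
  have rtop: "coeff r i = 0" if "i \<ge> 2 * Suc n" for i
  proof (cases "i = 2 * Suc n")
    case True
    then show ?thesis using arg_cong[OF r_rev, of "\<lambda>p. coeff p i"] r0 by (simp add: coeff_rev_poly)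
  next
    case False
    then have "i > 2 * Suc n" using that by simp
    then show ?thesis using arg_cong[OF r_rev, of "\<lambda>p. coeff p i"] by (simp add: coeff_rev_poly)
  qed
  have "degree r' \<le> 2 * n"
  proof (rule degree_le, intro allI impI)
    fix i assume "i > 2 * n"
    then have "coeff r (Suc i) = 0" by (intro rtop) simp
    then show "coeff r' i = 0" by (simp add: r')
  qed
  moreover have "rev_poly (2 * n) r' = r'"
  proof (rule poly_eqI)
    fix i
    show "coeff (rev_poly (2 * n) r') i = coeff r' i"
    proof (cases "i \<le> 2 * n")
      case True
      have "coeff r (Suc i) = coeff r (2 * Suc n - Suc i)"
        using arg_cong[OF r_rev, of "\<lambda>p. coeff p (Suc i)"] True by (simp add: coeff_rev_poly)
      moreover have "2 * Suc n - Suc i = Suc (2 * n - i)" using True by simp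
      ultimately show ?thesis using True by (simp add: coeff_rev_poly r')
    next
      case False
      then show ?thesis using \<open>degree r' \<le> 2 * n\<close> by (simp add: coeff_rev_poly coeff_eq_0)
    qed
  qed
  ultimately obtain Q where Q: "degree Q \<le> n" "r' = recip_hom n Q" using Suc.IH by blast
  have "p = r + Polynomial.smult a (quad_poly ^ Suc n)" by (simp add: r_def)
  also have "r = monom 1 1 * recip_hom n Q" using r' Q by (simp add: monom_Suc monom_0)
  also have "\<dots> = recip_hom (Suc n) Q" using recip_hom_Suc[OF Q(1)] by simp
  finally have "p = recip_hom (Suc n) (Q + monom a (Suc n))" by (simp only: e recip_hom_add)
  moreover have "degree (Q + monom a (Suc n)) \<le> Suc n"
    using Q(1) by (intro degree_add_le) (auto simp: degree_monom_le)
  ultimately show ?case by blast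
qed

lemma reflect_eq_rev: "reflect_poly p = rev_poly (degree p) p"
  by (rule poly_eqI) (simp add: coeff_reflect_poly coeff_rev_poly)

lemma reflect_recip_poly: "reflect_poly (recip_poly Q) = recip_poly Q"
  using rev_poly_recip_hom[of "degree Q" Q] by (simp add: reflect_eq_rev recip_poly_def[symmetric])

lemma palindromic_is_recip_poly:
  fixes p :: "'a::field poly"
  assumes "lead_coeff p = 1" "reflect_poly p = p" "even (degree p)"
  obtains Q where "lead_coeff Q = 1" "p = recip_poly Q" "degree p = 2 * degree Q"
proof -
  obtain n where n: "degree p = 2 * n" using assms(3) by blast
  then have "rev_poly (2 * n) p = p" using assms(2) by (simp add: reflect_eq_rev)
  then obtain Q where Q: "degree Q \<le> n" "p = recip_hom n Q" using rev_poly_fixed_is_recip_hom[of p n] n by auto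
  have "Q \<noteq> 0" using Q assms(1) by auto
  then have "degree Q = n" using recip_hom_nonzero[OF _ Q(1)] Q(2) n by simp
  then have "p = recip_poly Q" using Q by (simp add: recip_poly_def)
  moreover have "lead_coeff Q = 1" using lead_coeff_recip_poly[of Q] calculation assms(1) by simp
  ultimately show ?thesis using that \<open>degree Q = n\<close> n by blast
qed

lemma dual_poly_facts:
  fixes t :: "'a::field poly"
  assumes lt: "lead_coeff t = 1" and t0: "coeff t 0 \<noteq> 0"
  shows "lead_coeff (dual_poly t) = 1" "degree (dual_poly t) = degree t" "coeff (dual_poly t) 0 \<noteq> 0"
    "reflect_poly (t * dual_poly t) = t * dual_poly t" "dual_poly (dual_poly t) = t"
proof -
  show d: "degree (dual_poly t) = degree t" using t0 by (simp add: dual_poly_def degree_reflect_poly_eq)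
  show "lead_coeff (dual_poly t) = 1" unfolding d using t0 by (simp add: dual_poly_def coeff_reflect_poly)
  show c0: "coeff (dual_poly t) 0 \<noteq> 0" using lt t0 by (simp add: dual_poly_def coeff_reflect_poly)
  have r: "reflect_poly (dual_poly t) = Polynomial.smult (inverse (coeff t 0)) t"
    using t0 by (simp add: dual_poly_def reflect_poly_smult reflect_poly_reflect_poly)
  show "reflect_poly (t * dual_poly t) = t * dual_poly t"
    unfolding reflect_poly_mult r by (simp add: dual_poly_def mult.commute)
  show "dual_poly (dual_poly t) = t"
    unfolding dual_poly_def[of "dual_poly t"] r using lt t0 by (simp add: dual_poly_def coeff_reflect_poly)
qed

text \<open>The product of \<open>t\<close> with its dual plays the part of the norm from
  polynomials in \<open>z\<close> and \<open>1/z\<close> down to polynomials in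
  \<open>z + 1/z\<close>.\<close>

lemma mult_dual_is_recip:
  fixes t :: "'a::field poly"
  assumes "lead_coeff t = 1" "coeff t 0 \<noteq> 0"
  obtains T where "lead_coeff T = 1" "t * dual_poly t = recip_poly T" "degree T = degree t"
proof -
  have nz: "t \<noteq> 0" "dual_poly t \<noteq> 0" using assms dual_poly_facts(1)[OF assms] by auto
  have d: "degree (t * dual_poly t) = 2 * degree t" using nz dual_poly_facts(2)[OF assms] by (simp add: degree_mult_eq)
  have "lead_coeff (t * dual_poly t) = 1" unfolding lead_coeff_mult using dual_poly_facts(1)[OF assms] assms(1) by simp
  moreover have "even (degree (t * dual_poly t))" unfolding d by simp
  ultimately obtain T where "lead_coeff T = 1" "t * dual_poly t = recip_poly T" "degree (t * dual_poly t) = 2 * degree T"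
    using palindromic_is_recip_poly[OF _ dual_poly_facts(4)[OF assms]] by metis
  then show ?thesis using that d by simp
qed

section \<open>Recursion over cyclic flags\<close>

lemma finite_degree_le: "finite {p :: 'a::{finite,comm_ring_1} poly. degree p \<le> n}"
proof -
  have "inj_on (\<lambda>p. vec (Suc n) (coeff p)) {p :: 'a poly. degree p \<le> n}"
  proof (rule inj_onI)
    fix p q :: "'a poly" assume pq: "p \<in> {p. degree p \<le> n}" "q \<in> {p. degree p \<le> n}" and eq: "vec (Suc n) (coeff p) = vec (Suc n) (coeff q)"
    show "p = q"
    proof (rule poly_eqI)
      fix i
      show "coeff p i = coeff q i"
        using arg_cong[OF eq, of "\<lambda>v. v $ i"] pq by (cases "i < Suc n") (auto simp: coeff_eq_0)
    qed
  qed
  moreover have "(\<lambda>p. vec (Suc n) (coeff p)) ` {p :: 'a poly. degree p \<le> n} \<subseteq> carrier_vec (Suc n)" by auto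
  ultimately show ?thesis using finite_carrier_vec[of "Suc n", where 'a='a] by (rule inj_on_finite)
qed

lemma finite_killed:
  fixes s :: "'a::{finite,field} poly"
  assumes "s \<noteq> 0" "coeff s 0 \<noteq> 0"
  shows "finite {c. kills s c}"
proof -
  have "inj_on (\<lambda>c. vec (degree s) (\<lambda>l. c (int l))) {c. kills s c}"
  proof (rule inj_onI)
    fix c c' assume c: "c \<in> {c. kills s c}" "c' \<in> {c. kills s c}"
      and eq: "vec (degree s) (\<lambda>l. c (int l)) = vec (degree s) (\<lambda>l. c' (int l))"
    show "c = c'"
    proof (rule killed_eq_window[OF assms, of _ _ 0])
      show "c (0 + int l) = c' (0 + int l)" if "l < degree s" for l
        using arg_cong[OF eq, of "\<lambda>v. v $ l"] that by simp
    qed (use c in auto)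
  qed
  moreover have "(\<lambda>c. vec (degree s) (\<lambda>l. c (int l))) ` {c. kills s c} \<subseteq> carrier_vec (degree s)" by auto
  ultimately show ?thesis using finite_carrier_vec[of "degree s", where 'a='a] by (rule inj_on_finite)
qed

text \<open>The hyperbolic form. All smaller blocks are measured with it, so the recursion expresses
  the mean for any form through one form per size.\<close>

definition std_form :: "nat \<Rightarrow> 'a::field mat" where
  "std_form m = flag_form m 0 0 (0\<^sub>m 0 0) (0\<^sub>m 0 0)"

lemma std_form_facts:
  "std_form m \<in> (carrier_mat (2 * m) (2 * m) :: 'a::field mat set)"
  "(std_form m)\<^sup>T = - (std_form m :: 'a mat)" "det (std_form m :: 'a mat) \<noteq> 0"
proof -
  have "flag_form m 0 0 (0\<^sub>m 0 0) (0\<^sub>m 0 0 :: 'a mat) \<in> carrier_mat ((m + 0) + (0 + m)) ((m + 0) + (0 + m))"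
    by (rule flag_form_carrier) auto
 then show "std_form m \<in> (carrier_mat (2 * m) (2 * m) :: 'a mat set)" by (simp add: std_form_def mult_2)
  show "(std_form m)\<^sup>T = - (std_form m :: 'a mat)" unfolding std_form_def by (rule flag_form_antisym) auto
  show "det (std_form m :: 'a mat) \<noteq> 0" unfolding std_form_def
    by (rule flag_form_inverse[of _ _ _ _ "0\<^sub>m 0 0" "0\<^sub>m 0 0"]) (auto intro!: eq_matI)
qed

text \<open>The conditions characterise the types that occur in dimension \<open>2 * n\<close>:
  sufficiency follows from \<open>sum_flag_type_std\<close> with a constant test function.\<close>

definition flag_types :: "nat \<Rightarrow> ((int \<Rightarrow> 'a::field) \<times> 'a poly \<times> 'a poly) set" where
  "flag_types n = {(c, s, t). odd_seq c \<and> min_annihilator c s \<and> lead_coeff t = 1 \<and> coeff t 0 \<noteq> 0 \<and> degree s + 2 * degree t \<le> 2 * n}"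

lemma finite_flag_types: "finite (flag_types n :: ((int \<Rightarrow> 'a::{finite,field}) \<times> 'a poly \<times> 'a poly) set)"
proof -
  let ?S = "{s :: 'a poly. s \<noteq> 0 \<and> degree s \<le> 2 * n \<and> lead_coeff s = 1 \<and> coeff s 0 \<noteq> 0}"
  have S: "finite ?S" by (rule finite_subset[OF _ finite_degree_le[of "2 * n"]]) auto
  have "finite (\<Union>s\<in>?S. {c. kills s c} \<times> {s} \<times> {t :: 'a poly. degree t \<le> n})"
    using S finite_killed finite_degree_le by (intro finite_UN_I finite_cartesian_product) auto
  moreover have "flag_types n \<subseteq> (\<Union>s\<in>?S. {c. kills s c} \<times> {s} \<times> {t :: 'a poly. degree t \<le> n})"
  proof
    fix \<tau> :: "(int \<Rightarrow> 'a) \<times> 'a poly \<times> 'a poly" assume \<tau>: "\<tau> \<in> flag_types n"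
    obtain c s t where [simp]: "\<tau> = (c, s, t)" by (cases \<tau>)
    have m: "min_annihilator c s" using \<tau> by (simp add: flag_types_def)
    show "\<tau> \<in> (\<Union>s\<in>?S. {c. kills s c} \<times> {s} \<times> {t :: 'a poly. degree t \<le> n})"
      using \<tau> min_annihilator_coeff_0[OF m] m by (auto simp: flag_types_def min_annihilator_def)
  qed
  ultimately show ?thesis by (rule finite_subset[rotated])
qed

definition isometry_mean :: "nat \<Rightarrow> 'a::{finite,field} mat \<Rightarrow> ('a poly \<Rightarrow> real) \<Rightarrow> real" where
  "isometry_mean d J \<Psi> = (\<Sum>M\<in>isometries d J. \<Psi> (char_poly M)) / real (card (isometries d J))"

lemma card_isometries_pos:
  assumes "J \<in> carrier_mat d d"
  shows "card (isometries d (J :: 'a::{finite,field} mat)) > 0"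
proof -
  have "1\<^sub>m d \<in> isometries d J" using assms by (simp add: isometries_def)
  then show ?thesis using finite_isometries[of d J] card_gt_0_iff by blast
qed

context
  assumes two: "(2::'a::{finite,field}) \<noteq> 0"
begin

lemma sum_flag_type_std:
  fixes J :: "'a mat" and \<Psi> :: "'a poly \<Rightarrow> real"
  assumes J: "J \<in> carrier_mat (2 * n) (2 * n)" "J\<^sup>T = - J" "det J \<noteq> 0"
    and \<tau>: "(c, s, t) \<in> flag_types n"
  shows "(\<Sum>M\<in>isometries (2 * n) J. \<Sum>v | v \<in> carrier_vec (2 * n) \<and> flag_type J M v c s t. \<Psi> (char_poly M)) / real (card (isometries (2 * n) J))
    = isometry_mean (2 * (n - degree s div 2 - degree t)) (std_form (n - degree s div 2 - degree t)) (\<lambda>x. \<Psi> (s * t * dual_poly t * x))"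
proof -
  define m where "m = n - degree s div 2 - degree t"
  have \<tau>': "odd_seq c" "min_annihilator c s" "lead_coeff t = 1" "coeff t 0 \<noteq> 0" "degree s + 2 * degree t \<le> 2 * n"
    using \<tau> by (auto simp: flag_types_def)
  \<comment> \<open>Palindromicity enters here: an even \<open>degree s\<close> leaves a middle
    block of even size \<open>2 * m\<close>.\<close>
  have "even (degree s)" by (rule odd_min_annihilator_palindromic(2)[OF two \<tau>'(1,2)])
  then have d: "(degree t + degree s) + (2 * m + degree t) = 2 * n"
    using \<tau>'(5) unfolding m_def by (elim evenE) simp
  note J' = J[folded d]
  note main = sum_flag_type[OF two \<tau>'(1-4) std_form_facts[of m] J', of \<Psi>, unfolded d]
  have p: "real (card (isometries (2 * m) (std_form m :: 'a mat))) > 0" "real (card (isometries (2 * n) J)) > 0"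
    using card_isometries_pos[OF std_form_facts(1)[of m, where 'a='a]] card_isometries_pos[OF J(1)] by simp_all
  show ?thesis
    unfolding isometry_mean_def m_def[symmetric] using main p by (simp add: field_simps)
qed

text \<open>For each \<open>M\<close> the \<open>q^(2 * n)\<close> vectors are distributed over the
  types, and the contribution of every type is known.\<close>

lemma isometry_mean_recursion:
  fixes J :: "'a mat" and \<Psi> :: "'a poly \<Rightarrow> real"
  assumes J: "J \<in> carrier_mat (2 * n) (2 * n)" "J\<^sup>T = - J" "det J \<noteq> 0"
  shows "real (card (UNIV :: 'a set)) ^ (2 * n) * isometry_mean (2 * n) J \<Psi>
    = (\<Sum>(c, s, t)\<in>flag_types n. isometry_mean (2 * (n - degree s div 2 - degree t)) (std_form (n - degree s div 2 - degree t))
        (\<lambda>x. \<Psi> (s * t * dual_poly t * x)))"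
proof -
  have part: "(\<Sum>v\<in>(carrier_vec (2 * n) :: 'a vec set). \<Psi> (char_poly M))
      = (\<Sum>(c, s, t)\<in>flag_types n. \<Sum>v | v \<in> carrier_vec (2 * n) \<and> flag_type J M v c s t. \<Psi> (char_poly M))"
    if M: "M \<in> isometries (2 * n) J" for M
  proof -
    have Mc: "M \<in> carrier_mat (2 * n) (2 * n)" "M\<^sup>T * J * M = J" using M by (auto simp: isometries_def)
    define R where "R v \<tau> = (case \<tau> of (c, s, t) \<Rightarrow> flag_type J M v c s t)" for v \<tau>
    \<comment> \<open>Uniqueness holds because \<open>v\<close> determines \<open>c\<close>,
      \<open>c\<close> determines \<open>s\<close>, and the minimal polynomial \<open>s * t\<close>
      then determines \<open>t\<close>.\<close>
    have one: "card {\<tau> \<in> flag_types n. R v \<tau>} = 1" if v: "v \<in> carrier_vec (2 * n)" for v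
    proof -
      obtain s t where st: "flag_type J M v (form_seq J M v) s t" using flag_type_exists[OF two J Mc v] by blast
      have "(form_seq J M v, s, t) \<in> flag_types n"
        using form_seq_odd[OF two J(1,2) Mc v] flag_type_coeff_0[OF two J Mc v st] flag_type_dim[OF two J Mc v st] st
        by (simp add: flag_types_def flag_type_def add.commute)
      moreover have "\<tau> = (form_seq J M v, s, t)" if "R v \<tau>" for \<tau>
      proof -
        obtain c' s' t' where \<tau>: "\<tau> = (c', s', t')" by (cases \<tau>)
        have ft: "flag_type J M v c' s' t'" using that \<tau> by (simp add: R_def)
        have c: "c' = form_seq J M v" using ft by (simp add: flag_type_def)
        have s: "s' = s" using ft st unfolding flag_type_def by (metis min_annihilator_unique)
        have "s * t' = s * t" using ft st unfolding flag_type_def s by (metis vec_min_poly_unique)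
        moreover have "s \<noteq> 0" using st by (auto simp: flag_type_def min_annihilator_def)
        ultimately show ?thesis using c s \<tau> by simp
      qed
      ultimately have "{\<tau> \<in> flag_types n. R v \<tau>} = {(form_seq J M v, s, t)}" using st by (auto simp: R_def)
      then show ?thesis by simp
    qed
    have "(\<Sum>v\<in>(carrier_vec (2 * n) :: 'a vec set). \<Psi> (char_poly M)) = (\<Sum>v\<in>carrier_vec (2 * n). \<Sum>\<tau> | \<tau> \<in> flag_types n \<and> R v \<tau>. \<Psi> (char_poly M))"
      by (rule sum.cong[OF refl]) (simp add: one)
    also have "\<dots> = (\<Sum>\<tau>\<in>flag_types n. \<Sum>v | v \<in> carrier_vec (2 * n) \<and> R v \<tau>. \<Psi> (char_poly M))"
      by (rule sum.swap_restrict[OF finite_carrier_vec finite_flag_types])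
    finally show ?thesis by (simp add: R_def case_prod_beta')
  qed
  have "real (card (UNIV :: 'a set)) ^ (2 * n) * isometry_mean (2 * n) J \<Psi>
    = (\<Sum>M\<in>isometries (2 * n) J. \<Sum>v\<in>(carrier_vec (2 * n) :: 'a vec set). \<Psi> (char_poly M)) / real (card (isometries (2 * n) J))"
    by (simp add: isometry_mean_def card_carrier_vec sum_distrib_left)
  also have "\<dots> = (\<Sum>(c, s, t)\<in>flag_types n. (\<Sum>M\<in>isometries (2 * n) J. \<Sum>v | v \<in> carrier_vec (2 * n) \<and> flag_type J M v c s t. \<Psi> (char_poly M))
      / real (card (isometries (2 * n) J)))"
    using part by (simp add: case_prod_beta' sum_divide_distrib) (subst sum.swap, simp)
  also have "\<dots> = (\<Sum>(c, s, t)\<in>flag_types n. isometry_mean (2 * (n - degree s div 2 - degree t)) (std_form (n - degree s div 2 - degree t))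
        (\<lambda>x. \<Psi> (s * t * dual_poly t * x)))"
    by (rule sum.cong[OF refl]) (use sum_flag_type_std[OF J] in auto)
  finally show ?thesis .
qed

lemma flag_type_recip:
  assumes "(c, s, t) \<in> flag_types n"
  obtains S T :: "'a poly" where "lead_coeff S = 1" "s = recip_poly S" "degree s = 2 * degree S"
    "lead_coeff T = 1" "t * dual_poly t = recip_poly T" "degree T = degree t"
proof -
  have \<tau>: "odd_seq c" "min_annihilator c s" "lead_coeff t = 1" "coeff t 0 \<noteq> 0"
    using assms by (auto simp: flag_types_def)
  have ls: "lead_coeff s = 1" using \<tau>(2) by (simp add: min_annihilator_def)
  obtain S where "lead_coeff S = 1" "s = recip_poly S" "degree s = 2 * degree S"
    using palindromic_is_recip_poly[OF ls odd_min_annihilator_palindromic[OF two \<tau>(1,2)]] .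
  moreover obtain T where "lead_coeff T = 1" "t * dual_poly t = recip_poly T" "degree T = degree t"
    using mult_dual_is_recip[OF \<tau>(3,4)] .
  ultimately show ?thesis using that by blast
qed

text \<open>Induction through one nonzero vector. The mean formula for its type, applied to the
  indicator of \<open>char_poly M\<close>, is positive, so some smaller isometry \<open>N\<close>
  satisfies \<open>char_poly M = s * t * dual_poly t * char_poly N\<close>.\<close>

lemma char_poly_isometry_recip:
  fixes J :: "'a mat"
  assumes "J \<in> carrier_mat (2 * n) (2 * n)" "J\<^sup>T = - J" "det J \<noteq> 0" "M \<in> isometries (2 * n) J"
  shows "\<exists>Q. lead_coeff Q = 1 \<and> degree Q = n \<and> char_poly M = recip_poly Q"
  using assms
proof (induction n arbitrary: J M rule: less_induct)
  case (less n)
  have Mc: "M \<in> carrier_mat (2 * n) (2 * n)" "M\<^sup>T * J * M = J" using less.prems(4) by (auto simp: isometries_def)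
  have dm: "degree (char_poly M) = 2 * n" "lead_coeff (char_poly M) = 1"
    using degree_monic_char_poly[OF Mc(1)] by auto
  show ?case
  proof (cases "n = 0")
    case True
    then have "char_poly M = recip_poly 1" using dm degree_0_monic by (metis mult_0_right recip_poly_1)
    then show ?thesis using True by (intro exI[of _ 1]) simp
  next
    case False
    define v :: "'a vec" where "v = unit_vec (2 * n) 0"
    have v: "v \<in> carrier_vec (2 * n)" by (simp add: v_def)
    obtain s t where st: "flag_type J M v (form_seq J M v) s t" using flag_type_exists[OF two less.prems(1-3) Mc v] by blast
    define c where "c = form_seq J M v"
    have st': "flag_type J M v c s t" using st by (simp add: c_def)
    have \<tau>: "(c, s, t) \<in> flag_types n"
      using form_seq_odd[OF two less.prems(1,2) Mc v] flag_type_coeff_0[OF two less.prems(1-3) Mc v st]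
        flag_type_dim[OF two less.prems(1-3) Mc v st] st
      by (simp add: flag_types_def flag_type_def add.commute c_def)
    obtain S T where ST: "lead_coeff S = 1" "s = recip_poly S" "degree s = 2 * degree S"
      "lead_coeff T = 1" "t * dual_poly t = recip_poly T" "degree T = degree t" using flag_type_recip[OF \<tau>] .
    define m where "m = n - degree s div 2 - degree t"
    have "degree s + degree t \<noteq> 0"
    proof
      assume "degree s + degree t = 0"
      then have "s = 1" "t = 1" using st degree_0_monic[of s] degree_0_monic[of t] by (auto simp: flag_type_def min_annihilator_def)
      then have "v = 0\<^sub>v (2 * n)" using st v Mc(1) by (simp add: flag_type_def vec_min_poly_def)
      then have "v $ 0 = 0" using False by simp
      then show False using False by (simp add: v_def)
    qed
    then have mn: "m < n" using False ST(3) by (auto simp: m_def)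
    let ?\<Psi> = "\<lambda>x. if x = char_poly M then 1 else 0 :: real"
    have "(\<Sum>M'\<in>isometries (2 * n) J. \<Sum>v | v \<in> carrier_vec (2 * n) \<and> flag_type J M' v c s t. ?\<Psi> (char_poly M'))
        \<ge> (\<Sum>v | v \<in> carrier_vec (2 * n) \<and> flag_type J M v c s t. ?\<Psi> (char_poly M))"
      by (rule member_le_sum[OF less.prems(4)]) (auto simp: finite_isometries intro: sum_nonneg)
    moreover have "(\<Sum>v | v \<in> carrier_vec (2 * n) \<and> flag_type J M v c s t. ?\<Psi> (char_poly M)) > 0"
    proof -
      have "finite {v. v \<in> carrier_vec (2 * n) \<and> flag_type J M v c s t}"
        by (rule finite_subset[OF _ finite_carrier_vec[of "2 * n"]]) auto
      then have "card {v. v \<in> carrier_vec (2 * n) \<and> flag_type J M v c s t} > 0"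
        using v st' card_gt_0_iff by blast
      then show ?thesis by simp
    qed
    ultimately have "isometry_mean (2 * m) (std_form m) (\<lambda>x. ?\<Psi> (s * t * dual_poly t * x)) > 0"
      unfolding sum_flag_type_std[OF less.prems(1-3) \<tau>, of ?\<Psi>, folded m_def, symmetric]
      using card_isometries_pos[OF less.prems(1)] by (intro divide_pos_pos) auto
    then have "\<exists>N\<in>isometries (2 * m) (std_form m :: 'a mat). s * t * dual_poly t * char_poly N = char_poly M"
    proof (rule contrapos_pp)
      assume "\<not> (\<exists>N\<in>isometries (2 * m) (std_form m :: 'a mat). s * t * dual_poly t * char_poly N = char_poly M)"
      then have "(\<Sum>N\<in>isometries (2 * m) (std_form m :: 'a mat). ?\<Psi> (s * t * dual_poly t * char_poly N)) = 0"
        by (intro sum.neutral) auto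
      then show "\<not> isometry_mean (2 * m) (std_form m) (\<lambda>x. ?\<Psi> (s * t * dual_poly t * x)) > 0"
        by (simp add: isometry_mean_def)
    qed
    then obtain N where N: "N \<in> isometries (2 * m) (std_form m)" "s * t * dual_poly t * char_poly N = char_poly M" by blast
    obtain R where R: "lead_coeff R = 1" "degree R = m" "char_poly N = recip_poly R"
      using less.IH[OF mn std_form_facts N(1)] by blast
    have nz: "S \<noteq> 0" "T \<noteq> 0" "R \<noteq> 0" using ST(1,4) R(1) by auto
    have "char_poly M = recip_poly S * recip_poly T * recip_poly R"
      using N(2) ST(2,5) R(3) by (simp add: mult.assoc)
    also have "\<dots> = recip_poly (S * T * R)" using nz by (simp add: recip_poly_mult)
    finally have e: "char_poly M = recip_poly (S * T * R)" .
    moreover have "lead_coeff (S * T * R) = 1" using ST(1,4) R(1) by (simp add: lead_coeff_mult)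
    moreover have "degree (S * T * R) = n" using dm(1) unfolding e by simp
    ultimately show ?thesis by blast
  qed
qed

end

section \<open>Odd sequences with a prescribed annihilator\<close>

lemma dvd_monom_mult_cancel:
  fixes g h :: "'a::field poly"
  assumes g: "coeff g 0 \<noteq> 0" and "g dvd monom 1 a * h"
  shows "g dvd h"
  using assms(2)
proof (induction a)
  case (Suc a)
  then have "g dvd pCons 0 (monom 1 a * h)" by (simp add: monom_Suc)
  then obtain r where r: "pCons 0 (monom 1 a * h) = g * r" by (elim dvdE)
  have "coeff g 0 * coeff r 0 = 0" using arg_cong[OF r, of "\<lambda>p. coeff p 0"] by (simp add: coeff_mult)
  then have "coeff r 0 = 0" using g by simp
  then obtain r' where "r = pCons 0 r'" by (metis coeff_pCons_0 pCons_cases)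
  then have "monom 1 a * h = g * r'" using r by simp
  then show ?case using Suc.IH by simp
qed (simp add: monom_0 flip: one_pCons)

text \<open>\<open>z\<close> is a unit modulo \<open>g\<close>, and the residue ring is finite, so
  \<open>z\<close> has finite order.\<close>

lemma monom_periodic_mod:
  fixes g :: "'a::{finite,field} poly"
  assumes g: "g \<noteq> 0" "coeff g 0 \<noteq> 0"
  obtains N where "N > 0" "\<And>x y. x mod N = y mod N \<Longrightarrow> monom 1 x mod g = monom 1 y mod g"
proof -
  have "\<not> inj (\<lambda>k. monom (1::'a) k mod g)"
  proof
    assume "inj (\<lambda>k. monom (1::'a) k mod g)"
    moreover have "range (\<lambda>k. monom (1::'a) k mod g) \<subseteq> {p. degree p \<le> degree g}"
      using degree_mod_less[OF g(1)] by (auto simp: less_imp_le) (metis degree_0 le0 less_imp_le)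
    ultimately have "finite (UNIV :: nat set)"
      using finite_degree_le[of "degree g", where 'a='a] by (meson finite_imageD finite_subset)
    then show False by simp
  qed
  then obtain a b where ab: "a < b" "monom (1::'a) a mod g = monom 1 b mod g"
    unfolding inj_def by (metis linorder_neqE_nat)
  define N where "N = b - a"
  have "monom (1::'a) b = monom 1 a * monom 1 N" using ab by (simp add: mult_monom N_def)
  then have "g dvd monom 1 a * (monom 1 N - 1)"
    using ab(2) by (simp add: mod_eq_dvd_iff right_diff_distrib dvd_diff_commute)
  then have gN: "g dvd monom 1 N - 1" by (rule dvd_monom_mult_cancel[OF g(2)])
  have step: "monom 1 (x + N * r) mod g = monom 1 x mod g" for x r
  proof (induction r)
    case (Suc r)
    have "monom (1::'a) (x + N * Suc r) - monom 1 (x + N * r) = monom 1 (x + N * r) * (monom 1 N - 1)"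
      by (simp add: mult_monom right_diff_distrib algebra_simps)
    then have "g dvd monom 1 (x + N * Suc r) - monom 1 (x + N * r)" using gN by (simp only: dvd_mult)
    then have "monom 1 (x + N * Suc r) mod g = monom 1 (x + N * r) mod g" by (simp only: mod_eq_dvd_iff)
    then show ?case using Suc by (rule trans)
  qed simp
  show ?thesis
  proof (rule that)
    show "N > 0" using ab by (simp add: N_def)
    fix x y assume "x mod N = y mod N"
    have "monom (1::'a) z mod g = monom 1 (z mod N) mod g" for z
      using step[of "z mod N" "z div N"] by (simp add: add.commute)
    then show "monom 1 x mod g = monom (1::'a) y mod g" using \<open>x mod N = y mod N\<close> by metis
  qed
qed

text \<open>The sequence is \<open>c i = lf (z^(i - i0))\<close>, where \<open>lf\<close> is the
  linear functional modulo \<open>g\<close> with values \<open>\<alpha>\<close> on the basis of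
  powers. Reducing exponents modulo a period of \<open>z\<close> gives a meaning to negative
  ones.\<close>

lemma killed_extension:
  fixes g :: "'a::{finite,field} poly" and \<alpha> :: "nat \<Rightarrow> 'a"
  assumes g: "g \<noteq> 0" "coeff g 0 \<noteq> 0"
  shows "\<exists>c. kills g c \<and> (\<forall>l<degree g. c (i0 + int l) = \<alpha> l)"
proof -
  obtain N where N: "N > 0" and per: "\<And>x y. x mod N = y mod N \<Longrightarrow> monom (1::'a) x mod g = monom 1 y mod g"
    by (rule monom_periodic_mod[OF g]) blast
  define lf where "lf p = (\<Sum>l<degree g. \<alpha> l * coeff (p mod g) l)" for p
  have lf_add: "lf (p + r) = lf p + lf r" for p r
    by (simp add: lf_def poly_mod_add_left sum.distrib distrib_left)
  have lf_smult: "lf (Polynomial.smult a p) = a * lf p" for a p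
    by (simp add: lf_def mod_smult_left sum_distrib_left mult_ac)
  have lf_sum: "lf (\<Sum>l\<le>(n::nat). h l) = (\<Sum>l\<le>n. lf (h l))" for h n
    by (induction n) (simp_all add: lf_add)
  define c where "c i = lf (monom 1 (nat ((i - i0) mod int N)))" for i
  have lf_per: "lf (monom 1 x) = lf (monom 1 y)" if "x mod N = y mod N" for x y
    using per[OF that] by (simp add: lf_def)
  have "kills g c"
  proof
    fix i
    let ?k = "nat ((i - i0) mod int N)"
    have "c (i + int l) = lf (monom 1 (?k + l))" for l
      unfolding c_def
    proof (rule lf_per)
      have "int (nat ((i + int l - i0) mod int N)) = (i - i0 + int l) mod int N" using N by (simp add: algebra_simps)
      moreover have "int (?k + l) mod int N = (i - i0 + int l) mod int N" using N by (simp add: mod_add_left_eq)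
      ultimately show "nat ((i + int l - i0) mod int N) mod N = (?k + l) mod N"
        by (metis (no_types, lifting) mod_mod_trivial of_nat_eq_iff of_nat_mod)
    qed
    then have "seq_act g c i = lf (\<Sum>l\<le>degree g. Polynomial.smult (coeff g l) (monom 1 (?k + l)))"
      unfolding seq_act_def lf_sum lf_smult by simp
    also have "(\<Sum>l\<le>degree g. Polynomial.smult (coeff g l) (monom 1 (?k + l))) = monom 1 ?k * (\<Sum>l\<le>degree g. monom (coeff g l) l)"
      by (simp add: sum_distrib_left mult_monom smult_monom)
    also have "(\<Sum>l\<le>degree g. monom (coeff g l) l) = g" by (rule poly_as_sum_of_monoms)
    also have "lf (monom 1 ?k * g) = 0" by (simp add: lf_def)
    finally show "seq_act g c i = 0" .
  qed
  moreover have "c (i0 + int l) = \<alpha> l" if l: "l < degree g" for l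
  proof -
    have "c (i0 + int l) = lf (monom 1 l)"
      unfolding c_def by (rule lf_per) (simp add: nat_mod_distrib flip: of_nat_mod)
    also have "monom 1 l mod g = monom (1::'a) l" using l by (intro mod_poly_less) (simp add: degree_monom_eq)
    then have "lf (monom 1 l) = (\<Sum>i<degree g. if i = l then \<alpha> i else 0)"
      unfolding lf_def by (intro sum.cong) auto
    also have "\<dots> = \<alpha> l" using l by simp
    finally show ?thesis .
  qed
  ultimately show ?thesis by blast
qed

lemma coeff_0_recip_poly:
  assumes "lead_coeff S = 1"
  shows "coeff (recip_poly S) 0 = 1"
  using arg_cong[OF reflect_recip_poly[of S], of "\<lambda>p. coeff p 0"] lead_coeff_recip_poly[of S] assms
  by (simp add: coeff_reflect_poly)

text \<open>With \<open>m = degree S\<close>, such a sequence is determined by its values at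
  \<open>1, ..., m\<close>, and these can be chosen freely.\<close>

lemma card_odd_killed:
  fixes S :: "'a::{finite,field} poly"
  assumes two: "(2::'a) \<noteq> 0" and S: "lead_coeff S = 1"
  shows "finite {c. odd_seq c \<and> kills (recip_poly S) c}"
    and "card {c. odd_seq c \<and> kills (recip_poly S) c} = card (UNIV :: 'a set) ^ degree S"
proof -
  let ?s = "recip_poly S" and ?m = "degree S"
  have s: "?s \<noteq> 0" "coeff ?s 0 \<noteq> 0" "lead_coeff ?s = 1" "degree ?s = 2 * ?m"
    using coeff_0_recip_poly[OF S] lead_coeff_recip_poly[of S] S by auto
  show fin: "finite {c. odd_seq c \<and> kills ?s c}"
    by (rule finite_subset[OF _ finite_killed[OF s(1,2)]]) auto
  have "bij_betw (\<lambda>c. vec ?m (\<lambda>l. c (int l + 1))) {c. odd_seq c \<and> kills ?s c} (carrier_vec ?m)"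
    unfolding bij_betw_def
  proof (intro conjI equalityI subsetI)
    show "inj_on (\<lambda>c. vec ?m (\<lambda>l. c (int l + 1))) {c. odd_seq c \<and> kills ?s c}"
    proof (rule inj_onI)
      fix c c' assume c: "c \<in> {c. odd_seq c \<and> kills ?s c}" "c' \<in> {c. odd_seq c \<and> kills ?s c}"
        and eq: "vec ?m (\<lambda>l. c (int l + 1)) = vec ?m (\<lambda>l. c' (int l + 1))"
      have pos: "c (int l + 1) = c' (int l + 1)" if "l < ?m" for l
        using arg_cong[OF eq, of "\<lambda>v. v $ l"] that by simp
      have zero: "c 0 = 0" if "odd_seq c" for c :: "int \<Rightarrow> 'a"
      proof -
        have "c 0 = - c 0" using that[unfolded odd_seq_def, rule_format, of 0] by simp
        then have "2 * c 0 = 0" by (simp only: mult_2 add_eq_0_iff2)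
        then show ?thesis using two by simp
      qed
      have win: "c i = c' i" if "\<bar>i\<bar> \<le> int ?m" for i
      proof -
        have p: "c i = c' i" if "i > 0" "i \<le> int ?m" for i
          using pos[of "nat (i - 1)"] that by simp
        consider "i > 0" | "i = 0" | "i < 0" by linarith
        then show ?thesis
        proof cases
          case 3
          have "c (- i) = c' (- i)" using 3 that by (intro p) auto
          then show ?thesis using c unfolding odd_seq_def by (metis (mono_tags, lifting) mem_Collect_eq minus_minus)
        next
          case 2
          then show ?thesis using zero[of c] zero[of c'] c by simp
        qed (use p that in auto)
      qed
      show "c = c'"
        by (rule killed_eq_window[OF s(1,2), of _ _ "1 - int ?m"]) (use c win s(4) in auto)
    qed
  next
    fix \<beta> :: "'a vec" assume \<beta>: "\<beta> \<in> carrier_vec ?m"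
    \<comment> \<open>Odd extension of the chosen values. With \<open>m = degree S\<close>, the
      recurrence is fed the window from \<open>1 - m\<close> to \<open>m\<close>, of length
      \<open>2 * m\<close>; that the resulting \<open>c\<close> is odd everywhere has to be
      proved.\<close>
    define b where "b i = (if i > 0 then \<beta> $ nat (i - 1) else if i = 0 then 0 else - (\<beta> $ nat (- i - 1)))" for i :: int
    have bodd: "b (- i) = - b i" for i by (auto simp: b_def)
    obtain c where c: "kills ?s c" "\<And>l. l < 2 * ?m \<Longrightarrow> c (1 - int ?m + int l) = b (1 - int ?m + int l)"
      using killed_extension[OF s(1,2), of "1 - int ?m" "\<lambda>l. b (1 - int ?m + int l)"] s(4) by auto
    have cb: "c i = b i" if "1 - int ?m \<le> i" "i \<le> int ?m" for i
      using c(2)[of "nat (i - 1 + int ?m)"] that by simp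
    \<comment> \<open>The failure of oddness; it is an even sequence and, by palindromicity, killed
      by the same polynomial.\<close>
    define d where "d i = c i + c (- i)" for i
    have kd: "seq_act ?s d i = 0" for i
    proof -
      have "seq_act ?s d i = seq_act ?s c i + (\<Sum>l\<le>2 * ?m. coeff ?s l * c (- i - int l))"
        unfolding seq_act_def d_def s(4) by (simp add: sum.distrib distrib_left)
      also have "(\<Sum>l\<le>2 * ?m. coeff ?s l * c (- i - int l)) = (\<Sum>l\<le>2 * ?m. coeff ?s (2 * ?m - l) * c (- i - int (2 * ?m) + int l))"
        by (rule sum.reindex_bij_witness[of _ "\<lambda>l. 2 * ?m - l" "\<lambda>l. 2 * ?m - l"]) (auto simp: of_nat_diff algebra_simps)
      also have "\<dots> = (\<Sum>l\<le>2 * ?m. coeff ?s l * c (- i - int (2 * ?m) + int l))"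
      proof (rule sum.cong[OF refl])
        fix l assume "l \<in> {..2 * ?m}"
        then have "coeff ?s (2 * ?m - l) = coeff ?s l"
          using arg_cong[OF reflect_recip_poly[of S], of "\<lambda>p. coeff p l"] by (simp add: coeff_reflect_poly)
        then show "coeff ?s (2 * ?m - l) * c (- i - int (2 * ?m) + int l) = coeff ?s l * c (- i - int (2 * ?m) + int l)" by simp
      qed
      also have "\<dots> = seq_act ?s c (- i - int (2 * ?m))" by (simp add: seq_act_def)
      finally show ?thesis using c(1) by simp
    qed
    have dz: "d i = 0" if "\<bar>i\<bar> < int ?m" for i
      using cb[of i] cb[of "- i"] bodd[of i] that by (simp add: d_def)
    \<comment> \<open>The end \<open>m = degree S\<close> of the window has no mirror image in it.
      The recurrence at \<open>- m\<close> leaves only its two extreme terms,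
      \<open>d (- m) + d m = 0\<close>, and \<open>d\<close> is even.\<close>
    have dm: "d (int ?m) = 0"
    proof (cases "?m = 0")
      case True
      then show ?thesis using kd[of 0] s(3) by (simp add: seq_act_def)
    next
      case False
      have "seq_act ?s d (- int ?m) = (\<Sum>l\<in>{0, 2 * ?m}. coeff ?s l * d (- int ?m + int l))"
        unfolding seq_act_def s(4)
      proof (rule sum.mono_neutral_right)
        show "\<forall>l\<in>{..2 * ?m} - {0, 2 * ?m}. coeff ?s l * d (- int ?m + int l) = 0"
          by (intro ballI) (subst dz, auto)
      qed auto
      also have "\<dots> = d (- int ?m) + d (int ?m)" using False s(3,4) coeff_0_recip_poly[OF S] by simp
      also have "d (- int ?m) = d (int ?m)" by (simp add: d_def)
      finally have "2 * d (int ?m) = 0" using kd[of "- int ?m"] by simp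
      then show ?thesis using two by simp
    qed
    have "d i = 0" for i
    proof (rule killed_zero_window[OF s(1,2), of d "1 - int ?m"])
      show "kills ?s d" using kd by simp
      fix l assume "l < degree ?s"
      then have l: "l < 2 * ?m" using s(4) by simp
      show "d (1 - int ?m + int l) = 0"
      proof (cases "l = 2 * ?m - 1")
        case True
        then have "1 - int ?m + int l = int ?m" using l by (simp add: of_nat_diff)
        then show ?thesis using dm by (simp only:)
      qed (use l in \<open>intro dz, auto\<close>)
    qed
    then have "odd_seq c" unfolding odd_seq_def d_def by (metis add_eq_0_iff)
    moreover have "\<beta> = vec ?m (\<lambda>l. c (int l + 1))"
      using \<beta> by (intro eq_vecI) (auto simp: cb b_def)
    ultimately show "\<beta> \<in> (\<lambda>c. vec ?m (\<lambda>l. c (int l + 1))) ` {c. odd_seq c \<and> kills ?s c}" using c(1) by blast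
  qed auto
  then show "card {c. odd_seq c \<and> kills ?s c} = card (UNIV :: 'a set) ^ ?m"
    unfolding card_carrier_vec[symmetric] by (rule bij_betw_same_card)
qed

lemma recip_poly_nonzero: "S \<noteq> 0 \<Longrightarrow> recip_poly S \<noteq> 0"
  using lead_coeff_recip_poly[of S] by (metis leading_coeff_0_iff)

text \<open>Reflection is multiplicative, so a quotient of palindromic polynomials is palindromic,
  and its degree is a difference of even numbers.\<close>

lemma recip_poly_quotient:
  assumes "lead_coeff P = 1" "lead_coeff Q = 1" "recip_poly Q = recip_poly P * r"
  obtains R where "lead_coeff R = 1" "r = recip_poly R" "Q = P * R"
proof -
  have nz: "P \<noteq> 0" "Q \<noteq> 0" using assms(1,2) by auto
  have rnz: "r \<noteq> 0" "recip_poly P \<noteq> 0" using assms(3) recip_poly_nonzero[OF nz(2)] by auto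
  have lr: "lead_coeff r = 1"
    using arg_cong[OF assms(3), of lead_coeff] assms(1,2) unfolding lead_coeff_mult lead_coeff_recip_poly by simp
  have "recip_poly Q = recip_poly P * reflect_poly r"
    using arg_cong[OF assms(3), of reflect_poly] by (simp only: reflect_poly_mult reflect_recip_poly)
  then have "recip_poly P * reflect_poly r = recip_poly P * r" using assms(3) by (rule trans[OF sym])
  then have rr: "reflect_poly r = r" using rnz by simp
  have "2 * degree Q = 2 * degree P + degree r"
    using arg_cong[OF assms(3), of degree] rnz by (simp add: degree_mult_eq)
  then have "even (degree r)" by presburger
  then obtain R where R: "lead_coeff R = 1" "r = recip_poly R"
    using palindromic_is_recip_poly[OF lr rr] by metis
  have "R \<noteq> 0" using R(1) by auto
  then have "recip_poly Q = recip_poly (P * R)" using assms(3) R nz by (simp add: recip_poly_mult)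
  then have "Q = P * R" by (rule recip_poly_inj)
  then show ?thesis using that R by blast
qed

lemma recip_poly_dvd_iff:
  assumes "lead_coeff P = 1" "lead_coeff Q = 1"
  shows "recip_poly P dvd recip_poly Q \<longleftrightarrow> P dvd Q"
proof
  assume "recip_poly P dvd recip_poly Q"
  then obtain r where r: "recip_poly Q = recip_poly P * r" by (elim dvdE)
  obtain R where "Q = P * R" by (rule recip_poly_quotient[OF assms r])
  then show "P dvd Q" by simp
next
  assume "P dvd Q"
  then obtain R where R: "Q = P * R" by (elim dvdE)
  have "Q \<noteq> 0" using assms(2) by auto
  then have nz: "P \<noteq> 0" "R \<noteq> 0" unfolding R by auto
  show "recip_poly P dvd recip_poly Q" unfolding R recip_poly_mult[OF nz] by (rule dvd_triv_left)
qed

definition exact_count :: "'a::field poly \<Rightarrow> nat" where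
  "exact_count S = card {c. odd_seq c \<and> min_annihilator c (recip_poly S)}"

text \<open>The minimal annihilator of an odd sequence is palindromic and so of the form
  \<open>recip_poly D\<close>; the sequences killed by \<open>recip_poly S\<close> are sorted by
  \<open>D\<close>.\<close>

lemma sum_exact_count:
  fixes S :: "'a::{finite,field} poly"
  assumes two: "(2::'a) \<noteq> 0" and S: "lead_coeff S = 1"
  shows "(\<Sum>D | lead_coeff D = 1 \<and> D dvd S. exact_count D) = card (UNIV :: 'a set) ^ degree S"
proof -
  have "S \<noteq> 0" using S by auto
  then have snz: "S \<noteq> 0" "recip_poly S \<noteq> 0" using recip_poly_nonzero[of S] by auto
  let ?D = "{D. lead_coeff D = 1 \<and> D dvd S}"
  have fin: "finite ?D"
    by (rule finite_subset[OF _ finite_degree_le[of "degree S"]]) (use snz dvd_imp_degree_le in auto)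
  have "{c. odd_seq c \<and> kills (recip_poly S) c} = (\<Union>D\<in>?D. {c. odd_seq c \<and> min_annihilator c (recip_poly D)})"
  proof (intro equalityI subsetI)
    fix c assume "c \<in> {c. odd_seq c \<and> kills (recip_poly S) c}"
    then have c: "odd_seq c" "kills (recip_poly S) c" by auto
    obtain s where s: "min_annihilator c s" using min_annihilator_exists[OF c(2) snz(2)] by blast
    then have ls: "lead_coeff s = 1" and dvd: "s dvd recip_poly S" using c(2) by (auto simp: min_annihilator_def)
    obtain D where D: "lead_coeff D = 1" "s = recip_poly D"
      using palindromic_is_recip_poly[OF ls odd_min_annihilator_palindromic[OF two c(1) s]] by metis
    then have "D dvd S" using dvd recip_poly_dvd_iff[OF D(1) S] by simp
    then show "c \<in> (\<Union>D\<in>?D. {c. odd_seq c \<and> min_annihilator c (recip_poly D)})" using c s D by auto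
  next
    fix c assume "c \<in> (\<Union>D\<in>?D. {c. odd_seq c \<and> min_annihilator c (recip_poly D)})"
    then obtain D where D: "lead_coeff D = 1" "D dvd S" "odd_seq c" "min_annihilator c (recip_poly D)" by auto
    have "recip_poly D dvd recip_poly S" using recip_poly_dvd_iff[OF D(1) S] D(2) by simp
    moreover have "kills (recip_poly D) c" using D(4) by (simp add: min_annihilator_def)
    ultimately show "c \<in> {c. odd_seq c \<and> kills (recip_poly S) c}" using D(3) kills_dvd by blast
  qed
  then have "card (UNIV :: 'a set) ^ degree S = card (\<Union>D\<in>?D. {c. odd_seq c \<and> min_annihilator c (recip_poly D)})"
    using card_odd_killed(2)[OF two S] by simp
  also have "\<dots> = (\<Sum>D\<in>?D. card {c. odd_seq c \<and> min_annihilator c (recip_poly D)})"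
  proof (rule card_UN_disjoint[OF fin])
    show "\<forall>D\<in>?D. finite {c. odd_seq c \<and> min_annihilator c (recip_poly D)}"
    proof
      fix D assume "D \<in> ?D"
      then have "lead_coeff D = 1" by simp
      from card_odd_killed(1)[OF two this] show "finite {c. odd_seq c \<and> min_annihilator c (recip_poly D)}"
        by (rule finite_subset[rotated]) (auto simp: min_annihilator_def)
    qed
    show "\<forall>D\<in>?D. \<forall>D'\<in>?D. D \<noteq> D' \<longrightarrow> {c. odd_seq c \<and> min_annihilator c (recip_poly D)} \<inter> {c. odd_seq c \<and> min_annihilator c (recip_poly D')} = {}"
      using min_annihilator_unique recip_poly_inj by blast
  qed
  finally show ?thesis by (simp add: exact_count_def)
qed

section \<open>Quadratic characters and norms\<close>

definition quad_char :: "'a::field \<Rightarrow> int" where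
  "quad_char a = (if a = 0 then 0 else if \<exists>b. a = b * b then 1 else - 1)"

lemma quad_char_0[simp]: "quad_char 0 = 0"
  by (simp add: quad_char_def)

lemma quad_char_square: "b \<noteq> 0 \<Longrightarrow> quad_char (b * b) = 1"
  by (auto simp: quad_char_def)

lemma quad_char_cases: "quad_char a = 0 \<or> quad_char a = 1 \<or> quad_char a = - 1"
  by (simp add: quad_char_def)

lemma quad_char_eq_0[simp]: "quad_char a = 0 \<longleftrightarrow> a = 0"
  by (simp add: quad_char_def)

text \<open>Comparing the sums of \<open>x + 1\<close> and of \<open>x\<close> over the field shows
  that its cardinality is zero in it.\<close>

lemma two_nonzero_of_odd_card:
  assumes "odd (card (UNIV :: 'a::{finite,field} set))"
  shows "(2::'a) \<noteq> 0"
proof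
  assume two: "(2::'a) = 0"
  have "(\<Sum>x\<in>(UNIV :: 'a set). x + 1) = (\<Sum>x\<in>(UNIV :: 'a set). x)"
    by (rule sum.reindex_bij_witness[of _ "\<lambda>x. x - 1" "\<lambda>x. x + 1"]) auto
  then have "of_nat (card (UNIV :: 'a set)) = (0::'a)" by (simp add: sum.distrib)
  moreover obtain k where "card (UNIV :: 'a set) = 2 * k + 1" using assms by (elim oddE)
  ultimately show False using two by simp
qed

context
  assumes two: "(2::'a::{finite,field}) \<noteq> 0"
begin

private lemma neg_ne: "b \<noteq> - b" if "b \<noteq> 0" for b :: 'a
proof
  assume "b = - b"
  then have "2 * b = 0" by (simp only: mult_2 add_eq_0_iff2)
  then show False using two that by simp
qed

lemma card_square_roots: "int (card {u. u * u = a}) = 1 + quad_char (a :: 'a)"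
proof -
  consider "a = 0" | b where "a = b * b" "b \<noteq> 0" | "a \<noteq> 0" "\<nexists>b. a = b * b" by (metis mult_zero_left)
  then show ?thesis
  proof cases
    case 1
    then have "{u. u * u = a} = {0}" by auto
    then show ?thesis using 1 by simp
  next
    case 2
    have "{u. u * u = a} = {b, - b}" using 2 by (auto simp: square_eq_iff)
    then show ?thesis using 2 neg_ne[of b] quad_char_square[of b] by simp
  next
    case 3
    then have "{u. u * u = a} = {}" by auto
    then show ?thesis using 3 by (simp add: quad_char_def)
  qed
qed

lemma sum_quad_char: "(\<Sum>a\<in>UNIV. quad_char (a :: 'a)) = 0"
proof -
  have "(\<Sum>a\<in>(UNIV :: 'a set). int (card {u. u * u = a})) = int (card (\<Union>a\<in>(UNIV :: 'a set). {u. u * u = a}))"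
    by (subst card_UN_disjoint) auto
  also have "(\<Union>a\<in>(UNIV :: 'a set). {u. u * u = a}) = UNIV" by auto
  finally show ?thesis by (simp add: card_square_roots sum.distrib)
qed

text \<open>Only a product of two non-squares needs work: multiplication by \<open>a\<close> maps
  the nonzero squares into the non-squares, and the two sets have the same size, so every non-square
  is \<open>a\<close> times a square.\<close>

lemma quad_char_mult: "quad_char (a * b) = quad_char a * quad_char (b :: 'a)"
proof -
  have sq: "quad_char (s * s * x) = quad_char x" if "s \<noteq> 0" for s x :: 'a
  proof (cases "x = 0")
    case False
    have "(\<exists>b. s * s * x = b * b) \<longleftrightarrow> (\<exists>b. x = b * b)"
    proof
      assume "\<exists>b. s * s * x = b * b"
      then obtain b where "s * s * x = b * b" by blast
      then have "x = (b / s) * (b / s)" using that by (simp add: field_simps)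
      then show "\<exists>b. x = b * b" by blast
    next
      assume "\<exists>b. x = b * b"
      then obtain b where "x = b * b" by blast
      then have "s * s * x = (s * b) * (s * b)" by (simp add: mult_ac)
      then show "\<exists>b. s * s * x = b * b" by blast
    qed
    then show ?thesis using that False by (simp add: quad_char_def)
  qed simp
  consider "a = 0 \<or> b = 0" | s where "s \<noteq> 0" "a = s * s" | s where "s \<noteq> 0" "b = s * s"
    | "a \<noteq> 0" "b \<noteq> 0" "\<nexists>s. a = s * s" "\<nexists>s. b = s * s"
    by (metis mult_zero_left)
  then show ?thesis
  proof cases
    case 2
    then show ?thesis using sq[of s b] quad_char_square[of s] by simp
  next
    case 3
    then show ?thesis using sq[of s a] quad_char_square[of s] by (simp add: mult.commute)
  next
    case 4
    let ?S = "{x :: 'a. quad_char x = 1}" and ?N = "{x :: 'a. quad_char x = - 1}"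
    have "(\<Sum>x\<in>(UNIV :: 'a set). quad_char x) = (\<Sum>x\<in>(UNIV :: 'a set). (if x \<in> ?S then 1 else 0) - (if x \<in> ?N then 1 else 0))"
      by (rule sum.cong[OF refl]) (use quad_char_cases in force)
    also have "\<dots> = int (card ?S) - int (card ?N)"
      by (simp add: sum_subtractf sum.If_cases)
    finally have SN: "card ?S = card ?N" using sum_quad_char by simp
    have a: "quad_char a = - 1" "quad_char b = - 1" using 4 by (simp_all add: quad_char_def)
    have "(\<lambda>x. a * x) ` ?S \<subseteq> ?N"
    proof
      fix y assume "y \<in> (\<lambda>x. a * x) ` ?S"
      then obtain x where x: "y = a * x" "quad_char x = 1" by auto
      then obtain s where "x = s * s" "s \<noteq> 0" by (auto simp: quad_char_def split: if_splits)
      then show "y \<in> ?N" using sq[of s a] a(1) x(1) by (simp add: mult.commute)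
    qed
    moreover have "card ((\<lambda>x. a * x) ` ?S) = card ?N" using SN 4(1) by (subst card_image) (auto intro: inj_onI)
    ultimately have "(\<lambda>x. a * x) ` ?S = ?N" by (intro card_subset_eq) auto
    then obtain x where x: "b = a * x" "quad_char x = 1" using a(2) by (metis (mono_tags, lifting) imageE mem_Collect_eq)
    have "quad_char (a * b) = quad_char (a * a * x)" unfolding x(1) by (simp only: mult.assoc)
    then show ?thesis using sq[OF 4(1), of x] x(2) a by simp
  qed auto
qed

text \<open>This counts the points of the conic \<open>u^2 = c^2 - 4\<close>. The factorisation
  \<open>(c - u) * (c + u) = 4\<close> parametrises them by \<open>c - u\<close>, which is an
  arbitrary nonzero element.\<close>

lemma sum_quad_char_conic: "(\<Sum>c\<in>UNIV. quad_char ((2 - c) * (- 2 - c :: 'a))) = - 1"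
proof -
  have "(\<Sum>c\<in>(UNIV :: 'a set). 1 + quad_char ((2 - c) * (- 2 - c))) = (\<Sum>c\<in>(UNIV :: 'a set). int (card {u. u * u = (2 - c) * (- 2 - c)}))"
    by (simp only: card_square_roots)
  also have "\<dots> = int (card (SIGMA c:(UNIV :: 'a set). {u. u * u = (2 - c) * (- 2 - c)}))"
    by (simp add: card_SigmaI)
  also have "card (SIGMA c:(UNIV :: 'a set). {u. u * u = (2 - c) * (- 2 - c)}) = card (UNIV - {0::'a})"
  proof (rule bij_betw_same_card)
    show "bij_betw (\<lambda>(c, u). c - u) (SIGMA c:(UNIV :: 'a set). {u. u * u = (2 - c) * (- 2 - c)}) (UNIV - {0})"
    proof (rule bij_betwI[where g = "\<lambda>a. ((a + 4 / a) / 2, (4 / a - a) / 2)"])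
      have four: "(4::'a) \<noteq> 0" using two by (metis mult_2 mult_eq_0_iff numeral_Bit0 one_add_one distrib_left mult.right_neutral)
      have key: "(c - u) * (c + u) = 4" if "u * u = (2 - c) * (- 2 - c)" for c u :: 'a
        using that by (simp add: algebra_simps)
      show "(\<lambda>(c, u). c - u) \<in> (SIGMA c:(UNIV :: 'a set). {u. u * u = (2 - c) * (- 2 - c)}) \<rightarrow> UNIV - {0}"
      proof
        fix p assume "p \<in> (SIGMA c:(UNIV :: 'a set). {u. u * u = (2 - c) * (- 2 - c)})"
        then obtain c u where p: "p = (c, u)" "u * u = (2 - c) * (- 2 - c)" by auto
        then show "(case p of (c, u) \<Rightarrow> c - u) \<in> UNIV - {0}" using key[OF p(2)] four by auto
      qed
      show "(\<lambda>a. ((a + 4 / a) / 2, (4 / a - a) / 2)) \<in> UNIV - {0} \<rightarrow> (SIGMA c:(UNIV :: 'a set). {u. u * u = (2 - c) * (- 2 - c)})"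
      proof
        fix a :: 'a assume "a \<in> UNIV - {0}"
        then have a: "a \<noteq> 0" by simp
        have "(4 / a - a) / 2 * ((4 / a - a) / 2) = (2 - (a + 4 / a) / 2) * (- 2 - (a + 4 / a) / 2)"
          using a two four by (simp add: field_simps)
        then show "((a + 4 / a) / 2, (4 / a - a) / 2) \<in> (SIGMA c:(UNIV :: 'a set). {u. u * u = (2 - c) * (- 2 - c)})" by simp
      qed
      show "(\<lambda>a. ((a + 4 / a) / 2, (4 / a - a) / 2)) (case p of (c, u) \<Rightarrow> c - u) = p"
        if pin: "p \<in> (SIGMA c:(UNIV :: 'a set). {u. u * u = (2 - c) * (- 2 - c)})" for p
      proof -
        obtain c u where p: "p = (c, u)" "u * u = (2 - c) * (- 2 - c)" using pin by auto
        have nz: "c - u \<noteq> 0" using key[OF p(2)] four by auto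
        then have "4 / (c - u) = c + u" using key[OF p(2)] by (simp add: field_simps)
        moreover have "x + x = 2 * x" for x :: 'a by simp
        ultimately show ?thesis using two p(1) by (simp add: field_simps)
      qed
      show "(case (\<lambda>a. ((a + 4 / a) / 2, (4 / a - a) / 2)) a of (c, u) \<Rightarrow> c - u) = a" if "a \<in> UNIV - {0}" for a :: 'a
      proof -
        have "(a + 4 / a) / 2 - (4 / a - a) / 2 = (a + a) / 2" by (simp add: diff_divide_distrib add_divide_distrib)
        also have "\<dots> = a" using two by (simp flip: mult_2)
        finally show ?thesis by simp
      qed
    qed
  qed
  also have "int (card (UNIV - {0::'a})) = int (card (UNIV :: 'a set)) - 1"
  proof -
    have "card (UNIV :: 'a set) > 0" by (simp add: card_gt_0_iff)
    then show ?thesis by (simp add: card_Diff_singleton of_nat_diff)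
  qed
  finally show ?thesis by (simp add: sum.distrib)
qed

end

text \<open>For \<open>u = z + 1/z\<close>, \<open>z\<close> is a root of
  \<open>X^2 - u * X + 1\<close>, of discriminant \<open>(u - 2) * (u + 2)\<close>. This is the
  quadratic character of that extension in the form in which reciprocity would present it.\<close>

definition disc_char :: "'a::field poly \<Rightarrow> int" where
  "disc_char B = quad_char (poly B 2) * quad_char (poly B (- 2))"

definition norm_preimages :: "'a::field poly \<Rightarrow> 'a poly set" where
  "norm_preimages T = {t. lead_coeff t = 1 \<and> coeff t 0 \<noteq> 0 \<and> t * dual_poly t = recip_poly T}"

lemma poly_recip_poly_1: "poly (recip_poly Q) 1 = poly Q 2"
  unfolding recip_poly_def recip_hom_def by (simp add: poly_sum poly_monom poly_altdef[of Q])

lemma poly_recip_poly_minus_1: "poly (recip_poly Q) (- 1) = (- 1) ^ degree Q * poly Q (- 2)"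
proof -
  have "(- 1) ^ (degree Q - b) * 2 ^ b = (- 1) ^ degree Q * (- 2 :: 'a) ^ b" if "b \<le> degree Q" for b
  proof -
    have "(- 2 :: 'a) ^ b = (- 1) ^ b * 2 ^ b" by (simp flip: power_mult_distrib)
    moreover have "(- 1 :: 'a) ^ degree Q = (- 1) ^ (degree Q - b) * (- 1) ^ b" using that by (simp flip: power_add)
    moreover have "(- 1 :: 'a) ^ b * (- 1) ^ b = 1" by (simp flip: power_mult_distrib)
    ultimately show ?thesis by (simp add: mult.assoc)
  qed
  then show ?thesis
    unfolding recip_poly_def recip_hom_def
    by (auto simp: poly_sum poly_monom poly_altdef[of Q] sum_distrib_left mult_ac intro!: sum.cong)
qed

section \<open>Prime factors and the fibres of the norm\<close>

lemma power_factor_unique: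
  fixes P x y :: "'a::idom"
  assumes "P \<noteq> 0" "P ^ i * x = P ^ j * y" "\<not> P dvd x" "\<not> P dvd y"
  shows "i = j" "x = y"
proof -
  have no: False if "i < j" "P ^ i * x = P ^ j * y" "\<not> P dvd x" for i j and x y :: 'a
  proof -
    have "P ^ j = P ^ i * (P * P ^ (j - i - 1))" using that(1) by (simp flip: power_Suc power_add)
    then have "P ^ i * x = P ^ i * (P * P ^ (j - i - 1) * y)" using that(2) by (simp add: mult.assoc)
    then have "x = P * P ^ (j - i - 1) * y" using assms(1) by simp
    then show False using that(3) by (simp add: mult.assoc)
  qed
  show "i = j" using no[of i j x y] no[of j i y x] assms by (metis linorder_neqE_nat)
  then show "x = y" using assms by simp
qed

lemma power_factor_exists:
  fixes P t :: "'a::field poly"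
  assumes "degree P > 0" "t \<noteq> 0"
  shows "\<exists>b x. t = P ^ b * x \<and> \<not> P dvd x"
  using assms(2)
proof (induction "degree t" arbitrary: t rule: less_induct)
  case less
  show ?case
  proof (cases "P dvd t")
    case False
    then show ?thesis by (intro exI[of _ 0] exI[of _ t]) simp
  next
    case True
    then obtain u where u: "t = P * u" by (elim dvdE)
    have "u \<noteq> 0" "P \<noteq> 0" using less.prems u by auto
    then have "degree u < degree t" using u assms(1) by (simp add: degree_mult_eq)
    then obtain b x where "u = P ^ b * x" "\<not> P dvd x" using less.hyps \<open>u \<noteq> 0\<close> by blast
    then show ?thesis using u by (intro exI[of _ "Suc b"] exI[of _ x]) (simp add: mult.assoc)
  qed
qed

text \<open>A monic divisor of least positive degree is prime, by a Bezout relation from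
  \<open>poly_ideal_generator\<close>.\<close>

lemma prime_factor_exists:
  fixes p :: "'a::field poly"
  assumes "lead_coeff p = 1" "degree p > 0"
  obtains \<phi> where "lead_coeff \<phi> = 1" "degree \<phi> > 0" "prime_elem \<phi>" "\<phi> dvd p"
proof -
  obtain \<phi> where \<phi>: "lead_coeff \<phi> = 1" "degree \<phi> > 0" "\<phi> dvd p"
    and least: "\<And>s. lead_coeff s = 1 \<Longrightarrow> degree s > 0 \<Longrightarrow> s dvd p \<Longrightarrow> degree \<phi> \<le> degree s"
    using ex_has_least_nat[of "\<lambda>s. lead_coeff s = 1 \<and> degree s > 0 \<and> s dvd p" p degree] assms by auto
  have nz: "\<phi> \<noteq> 0" using \<phi>(1) by auto
  have "prime_elem \<phi>"
  proof (rule prime_elemI)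
    show "\<phi> \<noteq> 0" by (rule nz)
    show "\<not> \<phi> dvd 1" using \<phi>(2) by (metis is_unit_iff_degree nz not_less_zero)
    fix A B assume AB: "\<phi> dvd A * B"
    show "\<phi> dvd A \<or> \<phi> dvd B"
    proof (rule disjCI)
      assume nA: "\<not> \<phi> dvd B"
      let ?I = "{x * \<phi> + y * B | x y. True}"
      have "\<exists>s. s \<in> ?I \<and> lead_coeff s = 1 \<and> (\<forall>p\<in>?I. s dvd p)"
      proof (rule poly_ideal_generator)
        show "p + q \<in> ?I" if pq: "p \<in> ?I" "q \<in> ?I" for p q
        proof -
          obtain x y x' y' where "p = x * \<phi> + y * B" "q = x' * \<phi> + y' * B" using pq by auto
          then have "p + q = (x + x') * \<phi> + (y + y') * B" by (simp add: algebra_simps)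
          then show ?thesis by blast
        qed
        show "q * p \<in> ?I" if pI: "p \<in> ?I" for p q
        proof -
          obtain x y where "p = x * \<phi> + y * B" using pI by auto
          then have "q * p = (q * x) * \<phi> + (q * y) * B" by (simp add: algebra_simps)
          then show ?thesis by blast
        qed
        have "\<phi> = 1 * \<phi> + 0 * B" by simp
        then show "\<phi> \<in> ?I" by blast
      qed (rule nz)
      then obtain s where s: "s \<in> ?I" "lead_coeff s = 1" "\<forall>p\<in>?I. s dvd p" by blast
      have "\<phi> = 1 * \<phi> + 0 * B" "B = 0 * \<phi> + 1 * B" by simp_all
      then have sd: "s dvd \<phi>" "s dvd B" using s(3) by blast+
      have "degree s = 0"
      proof (rule ccontr)
        assume "degree s \<noteq> 0"
        then have "degree \<phi> \<le> degree s" using least[of s] s(2) sd(1) \<phi>(3) by (meson dvd_trans gr0I)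
        moreover obtain r where r: "\<phi> = s * r" using sd(1) by (elim dvdE)
        moreover have "s \<noteq> 0" "r \<noteq> 0" using nz r by auto
        ultimately have "degree r = 0" by (simp add: degree_mult_eq)
        moreover have "lead_coeff r = 1" using r \<phi>(1) s(2) by (simp add: lead_coeff_mult)
        ultimately have "\<phi> = s" using degree_0_monic[of r] r by simp
        then show False using sd(2) nA by simp
      qed
      then have "s = 1" using s(2) by (rule degree_0_monic)
      then obtain x y where "1 = x * \<phi> + y * B" using s(1) by auto
      then have "A = x * A * \<phi> + y * (A * B)" by (metis (no_types, lifting) distrib_right mult.assoc mult.commute mult_1)
      moreover have "\<phi> dvd x * A * \<phi> + y * (A * B)" using AB by simp
      ultimately show "\<phi> dvd A" by simp
    qed
  qed
  then show ?thesis using that \<phi> by blast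
qed

lemma prime_elem_root:
  fixes \<phi> :: "'a::field poly"
  assumes \<phi>: "lead_coeff \<phi> = 1" "prime_elem \<phi>" and root: "poly \<phi> b = 0"
  shows "\<phi> = [:- b, 1:]"
proof -
  have ld: "[:- b, 1:] dvd \<phi>" using root by (simp add: poly_eq_0_iff_dvd)
  then obtain r where r: "\<phi> = [:- b, 1:] * r" by (elim dvdE)
  have "\<phi> \<noteq> 0" using \<phi>(1) by auto
  then have rnz: "r \<noteq> 0" using r by auto
  have "degree \<phi> = Suc (degree r)" unfolding r using rnz by (subst degree_mult_eq) auto
  then have ndvd: "\<not> \<phi> dvd r" using dvd_imp_degree_le[OF _ rnz, of \<phi>] by auto
  have "\<phi> dvd [:- b, 1:] * r" unfolding r[symmetric] by (rule dvd_refl)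
  then have "\<phi> dvd [:- b, 1:]" using prime_elem_dvd_multD[OF \<phi>(2)] ndvd by blast
  then show ?thesis by (rule monic_dvd_antisym[OF _ ld \<phi>(1)]) simp
qed

lemma dual_poly_mult: "dual_poly (f * g) = dual_poly f * dual_poly g"
  by (simp add: dual_poly_def reflect_poly_mult coeff_mult mult.commute)

lemma dual_poly_1[simp]: "dual_poly 1 = 1"
  by (simp add: dual_poly_def)

lemma dual_poly_power: "dual_poly (f ^ n) = dual_poly f ^ n"
  by (induction n) (simp_all add: dual_poly_mult)

lemma dual_recip_poly: "lead_coeff T = 1 \<Longrightarrow> dual_poly (recip_poly T) = recip_poly T"
  by (simp add: dual_poly_def reflect_recip_poly coeff_0_recip_poly)

lemma dual_dvd:
  assumes "f dvd g"
  shows "dual_poly f dvd dual_poly g"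
  using assms by (elim dvdE) (simp add: dual_poly_mult)

lemma recip_poly_power:
  assumes "P \<noteq> 0"
  shows "recip_poly (P ^ n) = recip_poly P ^ n"
  by (induction n) (simp_all add: recip_poly_mult assms)

lemma monic_factor:
  fixes P x :: "'a::field poly"
  assumes "lead_coeff (P ^ b * x) = 1" "lead_coeff P = 1"
  shows "lead_coeff x = 1"
  using assms by (simp add: lead_coeff_mult lead_coeff_power)

lemma finite_norm_preimages: "finite (norm_preimages (T :: 'a::{finite,field} poly))"
proof (rule finite_subset[OF _ finite_degree_le[of "degree T"]])
  show "norm_preimages T \<subseteq> {p. degree p \<le> degree T}"
  proof
    fix t assume "t \<in> norm_preimages T"
    then have t: "lead_coeff t = 1" "coeff t 0 \<noteq> 0" "t * dual_poly t = recip_poly T" by (auto simp: norm_preimages_def)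
    have "t \<noteq> 0" "dual_poly t \<noteq> 0" using t(1) dual_poly_facts(1)[OF t(1,2)] by auto
    then have "degree (t * dual_poly t) = 2 * degree t" using dual_poly_facts(2)[OF t(1,2)] by (simp add: degree_mult_eq)
    then show "t \<in> {p. degree p \<le> degree T}" unfolding t(3) by simp
  qed
qed

text \<open>The exponent of a self-dual prime in \<open>t * dual_poly t\<close> is twice its
  exponent in \<open>t\<close>.\<close>

lemma norm_preimages_self_dual:
  fixes \<phi> :: "'a::{finite,field} poly"
  assumes \<phi>: "lead_coeff \<phi> = 1" "degree \<phi> > 0" "prime_elem \<phi>" "coeff \<phi> 0 \<noteq> 0" "dual_poly \<phi> = \<phi>"
    and T: "recip_poly T = \<phi> ^ n * recip_poly U" "\<not> \<phi> dvd recip_poly U"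
  shows "card (norm_preimages T) \<le> (if even n then card (norm_preimages U) else 0)"
proof -
  have fnz: "\<phi> \<noteq> 0" using \<phi>(1) by auto
  have key: "even n \<and> t \<in> (\<lambda>t'. \<phi> ^ (n div 2) * t') ` norm_preimages U" if "t \<in> norm_preimages T" for t
  proof -
    have t: "lead_coeff t = 1" "coeff t 0 \<noteq> 0" "t * dual_poly t = recip_poly T" using that by (auto simp: norm_preimages_def)
    have "t \<noteq> 0" using t(1) by auto
    then obtain b t' where b: "t = \<phi> ^ b * t'" "\<not> \<phi> dvd t'" using power_factor_exists[OF \<phi>(2)] by blast
    have lt': "lead_coeff t' = 1" using monic_factor[of \<phi> b t'] t(1) b(1) \<phi>(1) by simp
    have t'0: "coeff t' 0 \<noteq> 0" using t(2) b(1) by (auto simp: coeff_mult)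
    have nd: "\<not> \<phi> dvd dual_poly t'"
      using b(2) dual_dvd[of \<phi> "dual_poly t'"] \<phi>(5) dual_poly_facts(5)[OF lt' t'0] by auto
    have "\<phi> ^ (b + b) * (t' * dual_poly t') = \<phi> ^ n * recip_poly U"
      using t(3) T(1) unfolding b(1) dual_poly_mult dual_poly_power \<phi>(5) by (simp add: power_add mult_ac)
    moreover have "\<not> \<phi> dvd t' * dual_poly t'" using b(2) nd \<phi>(3) by (simp add: prime_elem_dvd_mult_iff)
    ultimately have "b + b = n" "t' * dual_poly t' = recip_poly U" using power_factor_unique[OF fnz _ _ T(2)] by blast+
    then have "n div 2 = b" "even n" "t' \<in> norm_preimages U" using lt' t'0 by (auto simp: norm_preimages_def)
    then show ?thesis using b(1) by auto
  qed
  show ?thesis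
  proof (cases "even n")
    case True
    then have "norm_preimages T \<subseteq> (\<lambda>t'. \<phi> ^ (n div 2) * t') ` norm_preimages U" using key by blast
    then show ?thesis using True surj_card_le[OF finite_norm_preimages] by simp
  next
    case False
    then have "norm_preimages T = {}" using key by blast
    then show ?thesis by simp
  qed
qed

text \<open>If \<open>t\<close> contains \<open>\<phi>\<close> and its dual with exponents
  \<open>b\<close> and \<open>b'\<close>, the norm contains each of them with exponent
  \<open>b + b' = a\<close>. This leaves \<open>a + 1\<close> choices and a solution for
  \<open>U\<close>.\<close>

lemma norm_preimages_split:
  fixes \<phi> :: "'a::{finite,field} poly"
  assumes \<phi>: "lead_coeff \<phi> = 1" "degree \<phi> > 0" "prime_elem \<phi>" "coeff \<phi> 0 \<noteq> 0" "dual_poly \<phi> \<noteq> \<phi>"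
    and T: "recip_poly T = (\<phi> * dual_poly \<phi>) ^ a * recip_poly U" "\<not> \<phi> dvd recip_poly U"
  shows "card (norm_preimages T) \<le> (a + 1) * card (norm_preimages U)"
proof -
  have fnz: "\<phi> \<noteq> 0" using \<phi>(1) by auto
  define \<psi> where "\<psi> = dual_poly \<phi>"
  note d = dual_poly_facts[OF \<phi>(1,4), folded \<psi>_def]
  have pnz: "\<psi> \<noteq> 0" using d(1) by auto
  have f_ndvd: "\<not> \<phi> dvd \<psi>"
  proof
    assume "\<phi> dvd \<psi>"
    then obtain r where r: "\<psi> = \<phi> * r" by (elim dvdE)
    then have "r \<noteq> 0" using pnz by auto
    then have "degree r = 0" using r fnz d(2) by (simp add: degree_mult_eq)
    moreover have "lead_coeff r = 1" using r d(1) \<phi>(1) by (simp add: lead_coeff_mult)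
    ultimately have "\<psi> = \<phi>" using degree_0_monic[of r] r by simp
    then show False using \<phi>(5) by (simp add: \<psi>_def)
  qed
  have key: "t \<in> (\<lambda>(b, t'). \<phi> ^ b * (\<psi> ^ (a - b) * t')) ` ({..a} \<times> norm_preimages U)" if "t \<in> norm_preimages T" for t
  proof -
    have t: "lead_coeff t = 1" "coeff t 0 \<noteq> 0" "t * dual_poly t = recip_poly T" using that by (auto simp: norm_preimages_def)
    have "t \<noteq> 0" using t(1) by auto
    then obtain b t1 where b: "t = \<phi> ^ b * t1" "\<not> \<phi> dvd t1" using power_factor_exists[OF \<phi>(2)] by blast
    then have "t1 \<noteq> 0" using \<open>t \<noteq> 0\<close> by auto
    moreover have "degree \<psi> > 0" using d(2) \<phi>(2) by simp
    ultimately obtain b' t' where b': "t1 = \<psi> ^ b' * t'" "\<not> \<psi> dvd t'" using power_factor_exists by blast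
    have lt': "lead_coeff t' = 1"
      using monic_factor[of \<phi> b t1] monic_factor[of \<psi> b' t'] t(1) b(1) b'(1) \<phi>(1) d(1) by simp
    have t'0: "coeff t' 0 \<noteq> 0" using t(2) b(1) b'(1) by (auto simp: coeff_mult)
    have nd1: "\<not> \<phi> dvd t'" using b(2) b'(1) by auto
    have nd2: "\<not> \<phi> dvd dual_poly t'"
      using b'(2) dual_dvd[of \<phi> "dual_poly t'"] dual_poly_facts(5)[OF lt' t'0] by (auto simp: \<psi>_def)
    have prod: "\<phi> ^ (b + b') * (\<psi> ^ (b + b') * (t' * dual_poly t')) = \<phi> ^ a * (\<psi> ^ a * recip_poly U)"
    proof -
      have "dual_poly t = \<psi> ^ b * (\<phi> ^ b' * dual_poly t')"
        unfolding b(1) b'(1) dual_poly_mult dual_poly_power d(5) by (simp add: \<psi>_def)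
      then have "t * dual_poly t = \<phi> ^ (b + b') * (\<psi> ^ (b + b') * (t' * dual_poly t'))"
        unfolding b(1) b'(1) by (simp add: power_add mult_ac)
      moreover have "recip_poly T = \<phi> ^ a * (\<psi> ^ a * recip_poly U)" using T(1) by (simp add: power_mult_distrib \<psi>_def mult_ac)
      ultimately show ?thesis using t(3) by simp
    qed
    have npow: "\<not> \<phi> dvd \<psi> ^ k" for k
      using f_ndvd \<phi>(3) prime_elem_dvd_power by blast
    have e1: "\<not> \<phi> dvd \<psi> ^ (b + b') * (t' * dual_poly t')" using npow nd1 nd2 \<phi>(3) by (simp add: prime_elem_dvd_mult_iff)
    have e2: "\<not> \<phi> dvd \<psi> ^ a * recip_poly U" using npow T(2) \<phi>(3) by (simp add: prime_elem_dvd_mult_iff)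
    have bb: "b + b' = a" by (rule power_factor_unique(1)[OF fnz prod e1 e2])
    have "\<psi> ^ (b + b') * (t' * dual_poly t') = \<psi> ^ a * recip_poly U" by (rule power_factor_unique(2)[OF fnz prod e1 e2])
    then have "t' * dual_poly t' = recip_poly U" using bb pnz by simp
    then have "t' \<in> norm_preimages U" using lt' t'0 by (simp add: norm_preimages_def)
    moreover have "t = \<phi> ^ b * (\<psi> ^ (a - b) * t')" using b(1) b'(1) bb by auto
    ultimately show ?thesis using bb by (intro image_eqI[of _ _ "(b, t')"]) auto
  qed
  then have "norm_preimages T \<subseteq> (\<lambda>(b, t'). \<phi> ^ b * (\<psi> ^ (a - b) * t')) ` ({..a} \<times> norm_preimages U)" by blast
  then have "card (norm_preimages T) \<le> card ({..a} \<times> norm_preimages U)"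
    by (intro surj_card_le) (auto simp: finite_norm_preimages)
  then show ?thesis by (simp add: card_cartesian_product)
qed

text \<open>The convolution of the constant 1 with \<open>disc_char\<close>, the analogue of the
  number of ideals of given norm in a quadratic ring.\<close>

definition divisor_char_sum :: "'a::field poly \<Rightarrow> int" where
  "divisor_char_sum T = (\<Sum>D | lead_coeff D = 1 \<and> D dvd T. disc_char D)"

lemma disc_char_cases: "disc_char B = 0 \<or> disc_char B = 1 \<or> disc_char B = - 1"
  using quad_char_cases[of "poly B 2"] quad_char_cases[of "poly B (- 2)"] by (auto simp: disc_char_def)

context
  assumes two: "(2::'a::{finite,field}) \<noteq> 0"
begin

lemma disc_char_mult: "disc_char (A * B :: 'a poly) = disc_char A * disc_char B"
  by (simp add: disc_char_def quad_char_mult[OF two] mult_ac)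

lemma disc_char_power: "disc_char (A ^ n :: 'a poly) = disc_char A ^ n"
proof (induction n)
  case 0
  show ?case using quad_char_square[of "1::'a"] by (simp add: disc_char_def)
next
  case (Suc n)
  then show ?case by (simp only: power_Suc disc_char_mult)
qed

text \<open>Monic divisors split uniquely into a power of \<open>P\<close> and a divisor of
  \<open>U\<close>, and \<open>disc_char\<close> is multiplicative. Primality of \<open>P\<close> is
  phrased for monic polynomials because it will be inherited from a prime factor of
  \<open>recip_poly P\<close>.\<close>

lemma divisor_char_sum_factor:
  fixes P U :: "'a poly"
  assumes P: "lead_coeff P = 1" "degree P > 0" and U: "lead_coeff U = 1" "\<not> P dvd U"
    and prime: "\<And>A B. lead_coeff A = 1 \<Longrightarrow> lead_coeff B = 1 \<Longrightarrow> P dvd A * B \<Longrightarrow> P dvd A \<or> P dvd B"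
  shows "divisor_char_sum (P ^ a * U) = (\<Sum>i\<le>a. disc_char P ^ i) * divisor_char_sum U"
proof -
  have pnz: "P \<noteq> 0" using P(1) by auto
  have "bij_betw (\<lambda>(i, D). P ^ i * D) ({..a} \<times> {D. lead_coeff D = 1 \<and> D dvd U}) {D. lead_coeff D = 1 \<and> D dvd P ^ a * U}"
    unfolding bij_betw_def
  proof (intro conjI equalityI subsetI)
    show "inj_on (\<lambda>(i, D). P ^ i * D) ({..a} \<times> {D. lead_coeff D = 1 \<and> D dvd U})"
    proof (rule inj_onI, clarify)
      fix i D i' D' assume D: "D dvd U" "D' dvd U" and eq: "P ^ i * D = P ^ i' * D'"
      have "\<not> P dvd D" "\<not> P dvd D'" using D U(2) dvd_trans by blast+
      then show "i = i' \<and> D = D'" using power_factor_unique[OF pnz eq] by simp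
    qed
  next
    fix x assume "x \<in> (\<lambda>(i, D). P ^ i * D) ` ({..a} \<times> {D. lead_coeff D = 1 \<and> D dvd U})"
    then obtain i D where x: "x = P ^ i * D" "i \<le> a" "lead_coeff D = 1" "D dvd U" by auto
    have "P ^ i dvd P ^ a" using x(2) by (rule le_imp_power_dvd)
    then show "x \<in> {D. lead_coeff D = 1 \<and> D dvd P ^ a * U}"
      using x P(1) by (simp add: lead_coeff_mult lead_coeff_power mult_dvd_mono)
  next
    fix x assume "x \<in> {D. lead_coeff D = 1 \<and> D dvd P ^ a * U}"
    then have lx: "lead_coeff x = 1" and xd: "x dvd P ^ a * U" by simp_all
    from xd obtain E where "P ^ a * U = x * E" by (elim dvdE)
    note x = lx this
    have unz: "U \<noteq> 0" using U(1) by auto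
    have "lead_coeff (P ^ a * U) = 1" using P(1) U(1) by (simp add: lead_coeff_mult lead_coeff_power)
    then have lE: "lead_coeff E = 1" using x by (simp add: lead_coeff_mult)
    have "x \<noteq> 0" "E \<noteq> 0" using x(1) lE by auto
    obtain i D where i: "x = P ^ i * D" "\<not> P dvd D" using power_factor_exists[OF P(2) \<open>x \<noteq> 0\<close>] by blast
    obtain e F where e: "E = P ^ e * F" "\<not> P dvd F" using power_factor_exists[OF P(2) \<open>E \<noteq> 0\<close>] by blast
    have lD: "lead_coeff D = 1" "lead_coeff F = 1" using monic_factor[of P] x(1) lE i(1) e(1) P(1) by auto
    have "P ^ a * U = P ^ (i + e) * (D * F)" using x(2) i(1) e(1) by (simp add: power_add mult_ac)
    moreover have "\<not> P dvd D * F" using prime[OF lD] i(2) e(2) by blast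
    ultimately have "a = i + e" "U = D * F" using power_factor_unique[OF pnz _ U(2)] by blast+
    then show "x \<in> (\<lambda>(i, D). P ^ i * D) ` ({..a} \<times> {D. lead_coeff D = 1 \<and> D dvd U})"
      using i(1) lD by (intro image_eqI[of _ _ "(i, D)"]) auto
  qed
  then have "divisor_char_sum (P ^ a * U) = (\<Sum>(i, D)\<in>{..a} \<times> {D. lead_coeff D = 1 \<and> D dvd U}. disc_char (P ^ i * D))"
    unfolding divisor_char_sum_def by (simp add: sum.reindex_bij_betw[symmetric] case_prod_beta')
  also have "\<dots> = (\<Sum>(i, D)\<in>{..a} \<times> {D. lead_coeff D = 1 \<and> D dvd U}. disc_char P ^ i * disc_char D)"
    by (simp add: disc_char_mult disc_char_power)
  also have "\<dots> = (\<Sum>i\<le>a. disc_char P ^ i) * divisor_char_sum U"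
    unfolding divisor_char_sum_def by (simp add: sum_product sum.cartesian_product)
  finally show ?thesis .
qed

text \<open>The sum is \<open>a + 1\<close>, 1, or the indicator that \<open>a\<close> is even,
  according as \<open>disc_char P\<close> is 1, 0 or \<open>-1\<close>.\<close>

lemma geometric_disc_char:
  "0 \<le> (\<Sum>i\<le>a. disc_char P ^ i)" "even a \<or> disc_char P = 0 \<Longrightarrow> 1 \<le> (\<Sum>i\<le>a. disc_char P ^ i)"
proof -
  have m1: "(\<Sum>i\<le>n. (- 1 :: int) ^ i) = (if even n then 1 else 0)" for n by (induction n) auto
  have z: "(\<Sum>i\<le>n. (0 :: int) ^ i) = 1" for n by (induction n) auto
  show "0 \<le> (\<Sum>i\<le>a. disc_char P ^ i)" "even a \<or> disc_char P = 0 \<Longrightarrow> 1 \<le> (\<Sum>i\<le>a. disc_char P ^ i)"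
    using disc_char_cases[of P] by (auto simp: m1 z)
qed

text \<open>Every prime factor of a palindromic polynomial is split (paired with a different dual), inert
  (itself palindromic of even degree) or ramified (\<open>z - 1\<close> or \<open>z + 1\<close>).\<close>
lemma self_dual_prime:
  fixes \<phi> :: "'a poly"
  assumes \<phi>: "lead_coeff \<phi> = 1" "degree \<phi> > 0" "prime_elem \<phi>" "coeff \<phi> 0 \<noteq> 0" "dual_poly \<phi> = \<phi>"
  shows "(\<exists>P. lead_coeff P = 1 \<and> recip_poly P = \<phi>) \<or> \<phi> = [:- 1, 1:] \<or> \<phi> = [:1, 1:]"
proof -
  note linear = prime_elem_root[OF \<phi>(1,3)]
  define a where "a = coeff \<phi> 0"
  have refl: "reflect_poly \<phi> = Polynomial.smult a \<phi>"
  proof -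
    have "Polynomial.smult a (dual_poly \<phi>) = reflect_poly \<phi>" using \<phi>(4) by (simp add: dual_poly_def a_def)
    then show ?thesis using \<phi>(5) by simp
  qed
  have "a * a = 1" using arg_cong[OF refl, of "\<lambda>p. coeff p 0"] \<phi>(1) by (simp add: coeff_reflect_poly a_def)
  then consider "a = 1" | "a = - 1" by (auto simp: square_eq_1_iff)
  then show ?thesis
  proof cases
    case 1
    then have pal: "reflect_poly \<phi> = \<phi>" using refl by simp
    show ?thesis
    proof (cases "even (degree \<phi>)")
      case True
      then show ?thesis using palindromic_is_recip_poly[OF \<phi>(1) pal] by metis
    next
      case False
      have "poly (reflect_poly \<phi>) (- 1) = (- 1) ^ degree \<phi> * poly \<phi> (inverse (- 1))"
        by (rule poly_reflect_poly_nz) simp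
      then have "poly \<phi> (- 1) = - poly \<phi> (- 1)" using pal False by simp
      then have "2 * poly \<phi> (- 1) = 0" by (simp only: mult_2 add_eq_0_iff2)
      then have "poly \<phi> (- 1) = 0" using two by simp
      then show ?thesis using linear[of "- 1"] by simp
    qed
  next
    case 2
    have "poly \<phi> 1 = - poly \<phi> 1" using poly_reflect_one[of \<phi>] refl 2 by simp
    then have "2 * poly \<phi> 1 = 0" by (simp only: mult_2 add_eq_0_iff2)
    then have "poly \<phi> 1 = 0" using two by simp
    then show ?thesis using linear[of 1] by simp
  qed
qed

text \<open>A prime \<open>\<phi>\<close> of \<open>recip_poly T\<close> lies over one factor
  \<open>P\<close> of \<open>T\<close>; its full power is removed and the rest is handled by
  induction. If \<open>\<phi>\<close> is itself \<open>recip_poly P\<close>, the value of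
  \<open>disc_char P\<close> is left open: an odd exponent admits no solution, an even one at most
  as many as \<open>U\<close>, and the geometric sum dominates for every value of the
  character.\<close>

lemma card_norm_preimages_le:
  fixes T :: "'a poly"
  assumes "lead_coeff T = 1"
  shows "int (card (norm_preimages T)) \<le> divisor_char_sum T"
  using assms
proof (induction "degree T" arbitrary: T rule: less_induct)
  case less
  show ?case
  proof (cases "degree T = 0")
    case True
    then have T1: "T = 1" using less.prems by (rule degree_0_monic)
    have "norm_preimages (1 :: 'a poly) \<subseteq> {1}"
    proof
      fix t :: "'a poly" assume "t \<in> norm_preimages 1"
      then have t: "lead_coeff t = 1" "t * dual_poly t = 1" by (auto simp: norm_preimages_def)
      then have "degree t = 0" by (metis degree_1 degree_mult_eq add_is_0 mult_zero_left mult_zero_right zero_neq_one)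
      then show "t \<in> {1}" using t(1) degree_0_monic by blast
    qed
    then have "card (norm_preimages (1 :: 'a poly)) \<le> 1" using card_mono[of "{1}" "norm_preimages (1 :: 'a poly)"] by simp
    moreover have "{D :: 'a poly. lead_coeff D = 1 \<and> D dvd 1} = {1}"
      using degree_0_monic by (auto simp: is_unit_iff_degree)
    then have "divisor_char_sum (1 :: 'a poly) = 1"
      using quad_char_square[of "1::'a"] by (simp add: divisor_char_sum_def disc_char_def)
    ultimately show ?thesis unfolding T1 by simp
  next
    case False
    have rT: "lead_coeff (recip_poly T) = 1" "degree (recip_poly T) > 0"
      using less.prems False lead_coeff_recip_poly[of T] by auto
    obtain \<phi> where \<phi>: "lead_coeff \<phi> = 1" "degree \<phi> > 0" "prime_elem \<phi>" "\<phi> dvd recip_poly T"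
      using prime_factor_exists[OF rT] .
    have \<phi>0: "coeff \<phi> 0 \<noteq> 0"
      using \<phi>(4) coeff_0_recip_poly[OF less.prems] by (auto simp: coeff_mult elim!: dvdE)
    note d = dual_poly_facts[OF \<phi>(1) \<phi>0]
    obtain P where P: "lead_coeff P = 1" "degree P > 0" and star: "\<And>A. lead_coeff A = 1 \<Longrightarrow> \<phi> dvd recip_poly A \<Longrightarrow> P dvd A"
      and div: "\<phi> dvd recip_poly P"
      and bound: "\<And>a U. recip_poly T = recip_poly P ^ a * recip_poly U \<Longrightarrow> \<not> \<phi> dvd recip_poly U \<Longrightarrow>
          int (card (norm_preimages T)) \<le> (\<Sum>i\<le>a. disc_char P ^ i) * int (card (norm_preimages U))"
    proof (cases "dual_poly \<phi> = \<phi>")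
      case False
      obtain P where P: "lead_coeff P = 1" "\<phi> * dual_poly \<phi> = recip_poly P" "degree P = degree \<phi>"
        using mult_dual_is_recip[OF \<phi>(1) \<phi>0] .
      have nd: "\<not> \<phi> dvd dual_poly \<phi>"
      proof
        assume "\<phi> dvd dual_poly \<phi>"
        then obtain r where r: "dual_poly \<phi> = \<phi> * r" by (elim dvdE)
        moreover have "r \<noteq> 0" "\<phi> \<noteq> 0" using r d(1) by auto
        ultimately have "degree r = 0" using d(2) by (simp add: degree_mult_eq)
        moreover have "lead_coeff r = 1" using r d(1) \<phi>(1) by (simp add: lead_coeff_mult)
        ultimately show False using degree_0_monic[of r] r False by simp
      qed
      show thesis
      proof (rule that[of P])
        show "lead_coeff P = 1" "degree P > 0" using P \<phi>(2) by auto
        show "P dvd A" if A: "lead_coeff A = 1" "\<phi> dvd recip_poly A" for A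
        proof -
          have "dual_poly \<phi> dvd recip_poly A" using dual_dvd[OF A(2)] dual_recip_poly[OF A(1)] by simp
          then obtain r where r: "recip_poly A = dual_poly \<phi> * r" by (elim dvdE)
          then have "\<phi> dvd r" using A(2) nd \<phi>(3) by (metis prime_elem_dvd_mult_iff)
          then have "recip_poly P dvd recip_poly A" unfolding P(2)[symmetric] r by (simp add: mult.commute mult_dvd_mono)
          then show ?thesis using recip_poly_dvd_iff[OF P(1) A(1)] by simp
        qed
        show "\<phi> dvd recip_poly P" unfolding P(2)[symmetric] by simp
        have nl: "\<phi> \<noteq> [:- b, 1:]" if "b = 1 \<or> b = - 1" for b
          using that False by (auto simp: dual_poly_def reflect_poly_def)
        have nz: "poly \<phi> b \<noteq> 0" if "b = 1 \<or> b = - 1" for b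
          using nl[OF that] prime_elem_root[OF \<phi>(1,3)] by blast
        \<comment> \<open>\<open>P\<close> has the value \<open>x * \<phi>(1)^2\<close> at
          \<open>2\<close> and \<open>x * \<phi>(-1)^2\<close> at \<open>-2\<close>. Both have the
          character of \<open>x\<close>, so \<open>disc_char P = 1\<close>: the split case.\<close>
        define x where "x = inverse (coeff \<phi> 0)"
        have v1: "poly P 2 = x * (poly \<phi> 1 * poly \<phi> 1)"
          using poly_recip_poly_1[of P] unfolding P(2)[symmetric] poly_mult
          by (simp add: dual_poly_def poly_reflect_one x_def mult_ac)
        have "poly (reflect_poly \<phi>) (- 1) = (- 1) ^ degree \<phi> * poly \<phi> (inverse (- 1))"
          by (rule poly_reflect_poly_nz) simp
        then have "(- 1) ^ degree \<phi> * poly P (- 2) = (- 1) ^ degree \<phi> * (x * (poly \<phi> (- 1) * poly \<phi> (- 1)))"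
          using poly_recip_poly_minus_1[of P] unfolding P(2)[symmetric] P(3) poly_mult
          by (simp add: dual_poly_def x_def mult_ac)
        then have v2: "poly P (- 2) = x * (poly \<phi> (- 1) * poly \<phi> (- 1))" by simp
        have "x \<noteq> 0" using \<phi>0 by (simp add: x_def)
        have "disc_char P = quad_char x * quad_char x"
          unfolding disc_char_def v1 v2 quad_char_mult[OF two, of x]
          using quad_char_square[of "poly \<phi> 1"] quad_char_square[of "poly \<phi> (- 1)"] nz[of 1] nz[of "- 1"] by simp
        also have "\<dots> = 1" using quad_char_cases[of x] \<open>x \<noteq> 0\<close> by auto
        finally have eta: "disc_char P = 1" .
        show "int (card (norm_preimages T)) \<le> (\<Sum>i\<le>a. disc_char P ^ i) * int (card (norm_preimages U))"
          if "recip_poly T = recip_poly P ^ a * recip_poly U" "\<not> \<phi> dvd recip_poly U" for a U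
        proof -
          have "card (norm_preimages T) \<le> (a + 1) * card (norm_preimages U)"
            by (rule norm_preimages_split[OF \<phi>(1-3) \<phi>0 False _ that(2)]) (use that(1) P(2) in simp)
          then have "int (card (norm_preimages T)) \<le> int ((a + 1) * card (norm_preimages U))" by (simp only: of_nat_le_iff)
          then show ?thesis by (simp add: eta distrib_right)
        qed
      qed
    next
      case True
      \<comment> \<open>\<open>\<kappa> = 2\<close> is the ramified case: the squares of
        \<open>z - 1\<close> and \<open>z + 1\<close> belong to \<open>u - 2\<close> and
        \<open>u + 2\<close>, on which \<open>disc_char\<close> vanishes.\<close>
      obtain P \<kappa> where P: "lead_coeff P = 1" "recip_poly P = \<phi> ^ \<kappa>" "\<kappa> = 1 \<or> (\<kappa> = 2 \<and> disc_char P = 0)" "\<kappa> > 0"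
        and star: "\<And>A. lead_coeff A = 1 \<Longrightarrow> \<phi> dvd recip_poly A \<Longrightarrow> P dvd A"
      proof -
        from self_dual_prime[OF \<phi>(1-3) \<phi>0 True] consider P where "lead_coeff P = 1" "recip_poly P = \<phi>"
          | "\<phi> = [:- 1, 1:]" | "\<phi> = [:1, 1:]" by blast
        then show thesis
        proof cases
          case 1
          show thesis
            by (rule that[of P 1]) (use 1 recip_poly_dvd_iff[OF 1(1)] in auto)
        next
          case 2
          have sq: "recip_poly [:- 2, 1:] = \<phi> ^ 2" by (simp add: 2 recip_poly_def recip_hom_def power2_eq_square monom_0 monom_Suc)
          show thesis
          proof (rule that[of "[:- 2, 1:]" 2])
            fix A :: "'a poly" assume "lead_coeff A = 1" "\<phi> dvd recip_poly A"
            then have "poly (recip_poly A) 1 = 0" unfolding 2 by (simp add: poly_eq_0_iff_dvd)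
            then show "[:- 2, 1:] dvd A" by (simp add: poly_recip_poly_1 poly_eq_0_iff_dvd)
          qed (use sq in \<open>auto simp: disc_char_def\<close>)
        next
          case 3
          have sq: "recip_poly [:2, 1:] = \<phi> ^ 2" by (simp add: 3 recip_poly_def recip_hom_def power2_eq_square monom_0 monom_Suc)
          show thesis
          proof (rule that[of "[:2, 1:]" 2])
            fix A :: "'a poly" assume "lead_coeff A = 1" "\<phi> dvd recip_poly A"
            then have "poly (recip_poly A) (- 1) = 0" unfolding 3 using poly_eq_0_iff_dvd[of "recip_poly A" "- 1"] by simp
            then have "poly A (- 2) = 0" by (simp add: poly_recip_poly_minus_1)
            then show "[:2, 1:] dvd A" using poly_eq_0_iff_dvd[of A "- 2"] by simp
          qed (use sq in \<open>auto simp: disc_char_def\<close>)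
        qed
      qed
      show thesis
      proof (rule that[of P])
        show "lead_coeff P = 1" by (rule P(1))
        have "degree (recip_poly P) > 0" unfolding P(2) using \<phi>(1,2) P(4) by (subst degree_power_eq) auto
        then show "degree P > 0" by simp
        show "P dvd A" if "lead_coeff A = 1" "\<phi> dvd recip_poly A" for A by (rule star[OF that])
        show "\<phi> dvd recip_poly P" unfolding P(2) using P(4) by (simp add: dvd_power)
        show "int (card (norm_preimages T)) \<le> (\<Sum>i\<le>a. disc_char P ^ i) * int (card (norm_preimages U))"
          if "recip_poly T = recip_poly P ^ a * recip_poly U" "\<not> \<phi> dvd recip_poly U" for a U
        proof -
          have le: "card (norm_preimages T) \<le> (if even (\<kappa> * a) then card (norm_preimages U) else 0)"
            by (rule norm_preimages_self_dual[OF \<phi>(1-3) \<phi>0 True _ that(2)]) (use that(1) P(2) in \<open>simp add: power_mult\<close>)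
          show ?thesis
          proof (cases "even (\<kappa> * a)")
            case True
            then have "even a \<or> disc_char P = 0" using P(3) by auto
            then have "1 * int (card (norm_preimages U)) \<le> (\<Sum>i\<le>a. disc_char P ^ i) * int (card (norm_preimages U))"
              by (intro mult_right_mono geometric_disc_char(2)) auto
            then show ?thesis using le True by simp
          next
            case False
            then show ?thesis using le geometric_disc_char(1)[of P a] by simp
          qed
        qed
      qed
    qed
    have pnz: "P \<noteq> 0" using P(1) by auto
    have Tnz: "T \<noteq> 0" using less.prems by auto
    obtain a U where aU: "T = P ^ a * U" "\<not> P dvd U" using power_factor_exists[OF P(2) Tnz] by blast
    have lU: "lead_coeff U = 1" using monic_factor[of P a U] less.prems aU(1) P(1) by simp
    have Unz: "U \<noteq> 0" using lU by auto
    have nU: "\<not> \<phi> dvd recip_poly U" using star[OF lU] aU(2) by blast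
    have "a \<noteq> 0"
    proof
      assume "a = 0"
      then show False using star[OF less.prems \<phi>(4)] aU by simp
    qed
    then have dU: "degree U < degree T" unfolding aU(1) using pnz Unz P(2) by (simp add: degree_mult_eq degree_power_eq)
    have "recip_poly T = recip_poly P ^ a * recip_poly U"
      unfolding aU(1) using pnz Unz by (simp add: recip_poly_mult recip_poly_power)
    then have "int (card (norm_preimages T)) \<le> (\<Sum>i\<le>a. disc_char P ^ i) * int (card (norm_preimages U))"
      by (rule bound[OF _ nU])
    also have "\<dots> \<le> (\<Sum>i\<le>a. disc_char P ^ i) * divisor_char_sum U"
      by (rule mult_left_mono[OF less.hyps[OF dU lU] geometric_disc_char(1)])
    also have "\<dots> = divisor_char_sum T" unfolding aU(1)
    proof (rule divisor_char_sum_factor[OF P lU aU(2), symmetric])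
      fix A B :: "'a poly" assume AB: "lead_coeff A = 1" "lead_coeff B = 1" "P dvd A * B"
      have nz: "A \<noteq> 0" "B \<noteq> 0" using AB(1,2) by auto
      have "lead_coeff (A * B) = 1" using AB(1,2) by (simp add: lead_coeff_mult)
      then have "recip_poly P dvd recip_poly A * recip_poly B"
        using recip_poly_dvd_iff[OF P(1), of "A * B"] AB(3) nz by (simp add: recip_poly_mult)
      then have "\<phi> dvd recip_poly A * recip_poly B" using div dvd_trans by blast
      then show "P dvd A \<or> P dvd B" using \<phi>(3) star AB(1,2) by (meson prime_elem_dvd_mult_iff)
    qed
    finally show ?thesis .
  qed
qed

end

section \<open>Monic polynomials of fixed degree and character sums\<close>

definition monics :: "nat \<Rightarrow> 'a::field poly set" where
  "monics d = {Q. lead_coeff Q = 1 \<and> degree Q = d}"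

definition low_polys :: "nat \<Rightarrow> 'a::field poly set" where
  "low_polys e = {r. \<forall>i\<ge>e. coeff r i = 0}"

lemma low_polys_bij: "bij_betw (\<lambda>r. vec e (coeff r)) (low_polys e) (carrier_vec e)"
proof (rule bij_betwI[where g = "\<lambda>v. vpoly e (\<lambda>i. v $ i)"])
  show "vpoly e (\<lambda>i. vec e (coeff r) $ i) = r" if "r \<in> low_polys e" for r :: "'a poly"
    using that by (intro poly_eqI) (auto simp: coeff_vpoly low_polys_def)
qed (auto simp: low_polys_def coeff_vpoly intro!: eq_vecI)

lemma card_low_polys: "card (low_polys e :: 'a::{finite,field} poly set) = card (UNIV :: 'a set) ^ e"
  using bij_betw_same_card[OF low_polys_bij[of e, where 'a='a]] by (simp add: card_carrier_vec)

lemma monics_shift_bij: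
  fixes A0 :: "'a::field poly"
  assumes "A0 \<in> monics d" "e \<le> d"
  shows "bij_betw (\<lambda>r. A0 + r) (low_polys e) {A \<in> monics d. A - A0 \<in> low_polys e}"
proof (rule bij_betwI[where g = "\<lambda>A. A - A0"])
  show "(\<lambda>r. A0 + r) \<in> low_polys e \<rightarrow> {A \<in> monics d. A - A0 \<in> low_polys e}"
  proof
    fix r :: "'a poly" assume r: "r \<in> low_polys e"
    have A0: "coeff A0 d = 1" "\<And>i. i > d \<Longrightarrow> coeff A0 i = 0" using assms(1) by (auto simp: monics_def coeff_eq_0)
    have c: "coeff (A0 + r) d = 1" using A0 r assms(2) by (simp add: low_polys_def)
    have "degree (A0 + r) \<le> d" using A0 r assms(2) by (intro degree_le) (auto simp: low_polys_def)
    moreover have "d \<le> degree (A0 + r)" using c by (intro le_degree) simp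
    ultimately have "degree (A0 + r) = d" by simp
    then show "A0 + r \<in> {A \<in> monics d. A - A0 \<in> low_polys e}" using c r by (simp add: monics_def)
  qed
qed auto

lemma monics_eq_shift:
  assumes "A0 \<in> monics d"
  shows "{A \<in> monics d. A - A0 \<in> low_polys d} = monics d"
  using assms by (auto simp: monics_def low_polys_def coeff_eq_0 le_less)

lemma monom_in_monics: "monom 1 d \<in> monics d"
  by (simp add: monics_def degree_monom_eq)

lemma sum_monics:
  fixes A0 :: "'a::field poly"
  assumes "A0 \<in> monics d"
  shows "(\<Sum>A\<in>monics d. f A) = (\<Sum>r\<in>low_polys d. f (A0 + r))"
  using sum.reindex_bij_betw[OF monics_shift_bij[OF assms order.refl], of f] unfolding monics_eq_shift[OF assms] by simp

lemma finite_monics: "finite (monics d :: 'a::{finite,field} poly set)"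
  by (rule finite_subset[OF _ finite_degree_le[of d]]) (auto simp: monics_def)

lemma card_monics: "card (monics d :: 'a::{finite,field} poly set) = card (UNIV :: 'a set) ^ d"
  using bij_betw_same_card[OF monics_shift_bij[OF monom_in_monics order.refl, of d, where 'a='a]]
  unfolding monics_eq_shift[OF monom_in_monics] by (simp add: card_low_polys)

context
  assumes two: "(2::'a::{finite,field}) \<noteq> 0"
begin

text \<open>The values at \<open>2\<close> and \<open>- 2\<close> of a polynomial with two free low coefficients are independent and
  uniform, so the quadratic character cancels.\<close>
lemma sum_disc_char_low:
  fixes A0 :: "'a poly"
  assumes "e \<ge> 2"
  shows "(\<Sum>r\<in>low_polys e. disc_char (A0 + r)) = 0"
proof -
  obtain k where "e = 2 + k" using le_Suc_ex[OF assms] by blast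
  \<comment> \<open>The two lowest coefficients \<open>\<alpha>\<close> and \<open>\<beta>\<close>
    are split off. They move the values at \<open>2\<close> and \<open>-2\<close> by
    \<open>\<alpha> + 2 * \<beta>\<close> and \<open>\<alpha> - 2 * \<beta>\<close>, a linear map of
    determinant \<open>-4\<close>, hence invertible.\<close>
  then have e: "e = Suc (Suc k)" by simp
  have four: "(4::'a) \<noteq> 0"
  proof
    assume "(4::'a) = 0"
    moreover have "(2::'a) * 2 = 4" by simp
    ultimately have "(2::'a) * 2 = 0" by (simp only:)
    then show False using two by (auto simp only: mult_eq_0_iff)
  qed
  have eight: "(8::'a) \<noteq> 0"
  proof
    assume "(8::'a) = 0"
    moreover have "(2::'a) * 4 = 8" by simp
    ultimately have "(2::'a) * 4 = 0" by (simp only:)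
    then show False using two four by (auto simp only: mult_eq_0_iff)
  qed
  have "bij_betw (\<lambda>(r, \<alpha>, \<beta>). pCons \<alpha> (pCons \<beta> r)) (low_polys k \<times> UNIV \<times> UNIV) (low_polys e :: 'a poly set)"
  proof (rule bij_betwI[where g = "\<lambda>r. (poly_shift 2 r, coeff r 0, coeff r 1)"])
    show "(\<lambda>(r, \<alpha>, \<beta>). pCons \<alpha> (pCons \<beta> r)) \<in> low_polys k \<times> UNIV \<times> UNIV \<rightarrow> (low_polys e :: 'a poly set)"
      by (auto simp: low_polys_def e coeff_pCons split: nat.splits)
    show "(\<lambda>r. (poly_shift 2 r, coeff r 0, coeff r 1)) \<in> low_polys e \<rightarrow> low_polys k \<times> UNIV \<times> (UNIV :: 'a set)"
      by (auto simp: low_polys_def e coeff_poly_shift)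
    show "(poly_shift 2 (case x of (r, \<alpha>, \<beta>) \<Rightarrow> pCons \<alpha> (pCons \<beta> r)), coeff (case x of (r, \<alpha>, \<beta>) \<Rightarrow> pCons \<alpha> (pCons \<beta> r)) 0,
        coeff (case x of (r, \<alpha>, \<beta>) \<Rightarrow> pCons \<alpha> (pCons \<beta> r)) 1) = x" for x :: "'a poly \<times> 'a \<times> 'a"
      by (cases x) (auto intro!: poly_eqI simp: coeff_poly_shift numeral_2_eq_2)
    show "(case (poly_shift 2 r, coeff r 0, coeff r 1) of (r, \<alpha>, \<beta>) \<Rightarrow> pCons \<alpha> (pCons \<beta> r)) = r" for r :: "'a poly"
      by (rule poly_eqI) (auto simp: coeff_pCons coeff_poly_shift numeral_2_eq_2 split: nat.splits)
  qed
  then have "(\<Sum>r\<in>low_polys e. disc_char (A0 + r))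
      = (\<Sum>(r, \<alpha>, \<beta>)\<in>low_polys k \<times> UNIV \<times> UNIV. disc_char (A0 + pCons \<alpha> (pCons \<beta> r)))"
    by (simp add: sum.reindex_bij_betw[symmetric] case_prod_beta')
  also have "\<dots> = (\<Sum>r\<in>low_polys k. \<Sum>(\<alpha>, \<beta>)\<in>UNIV \<times> UNIV. disc_char (A0 + pCons \<alpha> (pCons \<beta> r)))"
    by (simp add: sum.cartesian_product case_prod_beta')
  also have "\<dots> = (\<Sum>r\<in>(low_polys k :: 'a poly set). 0)"
  proof (rule sum.cong[OF refl])
    fix r :: "'a poly"
    define x where "x = poly A0 2 + 4 * poly r 2"
    define y where "y = poly A0 (- 2) + 4 * poly r (- 2)"
    have "(\<Sum>(\<alpha>, \<beta>)\<in>UNIV \<times> UNIV. disc_char (A0 + pCons \<alpha> (pCons \<beta> r)))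
        = (\<Sum>(\<alpha>, \<beta>)\<in>UNIV \<times> UNIV. quad_char (x + \<alpha> + 2 * \<beta>) * quad_char (y + \<alpha> - 2 * \<beta>))"
      by (rule sum.cong) (auto simp: disc_char_def x_def y_def algebra_simps)
    also have "\<dots> = (\<Sum>(u, v)\<in>UNIV \<times> (UNIV :: 'a set). quad_char (u :: 'a) * quad_char v)"
    proof (rule sum.reindex_bij_witness[where i = "\<lambda>(u, v). ((u - x + (v - y)) / 2, (u - x - (v - y)) / 4)"
          and j = "\<lambda>(\<alpha>, \<beta>). (x + \<alpha> + 2 * \<beta>, y + \<alpha> - 2 * \<beta>)"], goal_cases)
      case (1 a)
      then show ?case using two four eight by (cases a) (simp add: field_simps)
    next
      case (3 b)
      then show ?case using two four eight by (cases b) (simp add: field_simps)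
    qed auto
    also have "\<dots> = (\<Sum>u\<in>UNIV. quad_char (u :: 'a)) * (\<Sum>v\<in>UNIV. quad_char (v :: 'a))"
      by (simp add: sum_product sum.cartesian_product)
    finally show "(\<Sum>(\<alpha>, \<beta>)\<in>UNIV \<times> UNIV. disc_char (A0 + pCons \<alpha> (pCons \<beta> r))) = 0"
      by (simp add: sum_quad_char[OF two])
  qed
  finally show ?thesis by simp
qed

text \<open>In other words, the L-series of \<open>disc_char\<close> is the polynomial
  \<open>1 - X\<close>; its linear coefficient is the conic sum.\<close>

lemma sum_disc_char_monics:
  "(\<Sum>B\<in>(monics l :: 'a poly set). disc_char B) = (if l = 0 then 1 else if l = 1 then - 1 else 0)"
proof -
  consider "l = 0" | "l = 1" | "l \<ge> 2" by linarith
  then show ?thesis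
  proof cases
    case 1
    have "monics 0 = {1 :: 'a poly}" using degree_0_monic by (auto simp: monics_def)
    then show ?thesis using 1 quad_char_square[of "1::'a"] by (simp add: disc_char_def)
  next
    case 2
    have "bij_betw (\<lambda>c::'a. [:- c, 1:]) UNIV (monics 1)"
    proof (rule bij_betwI[where g = "\<lambda>p. - coeff p 0"])
      show "[:- (- coeff p 0), 1:] = p" if "p \<in> monics 1" for p :: "'a poly"
        using that by (intro poly_eqI) (auto simp: monics_def coeff_pCons coeff_eq_0 split: nat.splits)
    qed (auto simp: monics_def)
    then have "(\<Sum>B\<in>(monics 1 :: 'a poly set). disc_char B) = (\<Sum>c\<in>UNIV. disc_char [:- c::'a, 1:])"
      by (simp add: sum.reindex_bij_betw[symmetric])
    also have "\<dots> = (\<Sum>c\<in>UNIV. quad_char ((2 - c) * (- 2 - c :: 'a)))"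
    proof (rule sum.cong[OF refl])
      fix c :: 'a
      have p: "poly [:- c, 1:] (- 2) = - 2 - c" "poly [:- c, 1:] 2 = 2 - c" by simp_all
      show "disc_char [:- c, 1:] = quad_char ((2 - c) * (- 2 - c))" unfolding disc_char_def p quad_char_mult[OF two] ..
    qed
    finally show ?thesis using 2 by (simp add: sum_quad_char_conic[OF two])
  next
    case 3
    have "(\<Sum>B\<in>(monics l :: 'a poly set). disc_char B) = (\<Sum>r\<in>(low_polys l :: 'a poly set). disc_char (monom 1 l + r))"
      by (rule sum_monics[OF monom_in_monics])
    then show ?thesis using sum_disc_char_low[OF 3, of "monom (1::'a) l"] 3 by simp
  qed
qed

lemma sum_over_divisors:
  fixes g :: "'a poly \<Rightarrow> 'a poly \<Rightarrow> 'b::comm_monoid_add"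
  shows "(\<Sum>X\<in>monics d. \<Sum>Y | lead_coeff Y = 1 \<and> Y dvd X. g Y X) = (\<Sum>l\<le>d. \<Sum>Y\<in>monics l. \<Sum>Z\<in>monics (d - l). g Y (Y * Z))"
proof -
  have fin: "finite {Y. lead_coeff Y = 1 \<and> Y dvd X}" if "X \<in> monics d" for X :: "'a poly"
  proof (rule finite_subset[OF _ finite_degree_le[of d]])
    have "X \<noteq> 0" "degree X = d" using that by (auto simp: monics_def)
    then show "{Y. lead_coeff Y = 1 \<and> Y dvd X} \<subseteq> {p. degree p \<le> d}"
      using dvd_imp_degree_le[of _ X] by auto
  qed
  have nz: "Y \<noteq> 0" if "lead_coeff Y = 1" for Y :: "'a poly" using that by auto
  have "(\<Sum>X\<in>monics d. \<Sum>Y | lead_coeff Y = 1 \<and> Y dvd X. g Y X)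
      = (\<Sum>(X, Y)\<in>(SIGMA X:monics d. {Y. lead_coeff Y = 1 \<and> Y dvd X}). g Y X)"
    by (rule sum.Sigma) (use finite_monics fin in auto)
  also have "\<dots> = (\<Sum>(l, Y, Z)\<in>(SIGMA l:{..d}. monics l \<times> monics (d - l)). g Y (Y * Z))"
  proof (rule sum.reindex_bij_witness[where i = "\<lambda>(l, Y, Z). (Y * Z, Y)" and j = "\<lambda>(X, Y). (degree Y, Y, X div Y)"], goal_cases)
    case (1 a)
    then show ?case using nz by (auto elim!: dvdE)
  next
    case (2 a)
    then obtain X Y where a: "a = (X, Y)" "X \<in> monics d" "lead_coeff Y = 1" "Y dvd X" by auto
    then obtain Z where Z: "X = Y * Z" by (elim dvdE)
    have "X \<noteq> 0" using a(2) by (auto simp: monics_def)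
    then have "Y \<noteq> 0" "Z \<noteq> 0" unfolding Z by auto
    moreover have "lead_coeff Z = 1" using a(2,3) Z by (simp add: monics_def lead_coeff_mult)
    ultimately show ?case using a Z by (auto simp: monics_def degree_mult_eq)
  next
    case (3 b)
    then show ?case using nz by (auto simp: monics_def)
  next
    case (4 b)
    then obtain l Y Z where b: "b = (l, Y, Z)" "l \<le> d" "lead_coeff Y = 1" "degree Y = l" "lead_coeff Z = 1" "degree Z = d - l"
      by (auto simp: monics_def)
    have YZ: "degree (Y * Z) = d" using b(2,4,6) nz[OF b(3)] nz[OF b(5)] by (simp add: degree_mult_eq)
    have "lead_coeff (Y * Z) = 1" using b(3,5) by (simp only: lead_coeff_mult mult_1)
    then show ?case using YZ b by (simp add: monics_def)
  next
    case (5 a)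
    then show ?case using nz by (auto elim!: dvdE)
  qed
  also have "\<dots> = (\<Sum>l\<le>d. \<Sum>(Y, Z)\<in>monics l \<times> monics (d - l). g Y (Y * Z))"
    by (subst sum.Sigma) (auto simp: finite_monics)
  also have "\<dots> = (\<Sum>l\<le>d. \<Sum>Y\<in>monics l. \<Sum>Z\<in>monics (d - l). g Y (Y * Z))"
    by (simp add: sum.cartesian_product)
  finally show ?thesis .
qed

text \<open>Both sides of \<open>card_norm_preimages_le\<close> have the same sum over the monic polynomials of a
  given degree, so the inequality is an equality.\<close>
lemma card_norm_preimages:
  fixes T :: "'a poly"
  assumes T: "lead_coeff T = 1"
  shows "int (card (norm_preimages T)) = divisor_char_sum T"
proof -
  let ?q = "int (card (UNIV :: 'a set))"
  define d where "d = degree T"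
  \<comment> \<open>The total of the divisor sums is read off from the L-series:
    \<open>q^d - q^(d-1)\<close> for \<open>d > 0\<close>.\<close>
  have "(\<Sum>T\<in>(monics d :: 'a poly set). divisor_char_sum T) = (\<Sum>l\<le>d. (\<Sum>B\<in>(monics l :: 'a poly set). disc_char B) * ?q ^ (d - l))"
    unfolding divisor_char_sum_def sum_over_divisors by (simp add: card_monics sum_distrib_right mult.commute)
  also have "\<dots> = (if d = 0 then 1 else ?q ^ d - ?q ^ (d - 1))"
  proof (cases "d = 0")
    case False
    have "(\<Sum>l\<le>d. (\<Sum>B\<in>(monics l :: 'a poly set). disc_char B) * ?q ^ (d - l))
        = (\<Sum>l\<in>{0, 1}. (\<Sum>B\<in>(monics l :: 'a poly set). disc_char B) * ?q ^ (d - l))"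
      by (rule sum.mono_neutral_right) (use False in \<open>auto simp: sum_disc_char_monics\<close>)
    then show ?thesis using False by (simp add: sum_disc_char_monics)
  qed (simp add: sum_disc_char_monics)
  finally have right: "(\<Sum>T\<in>(monics d :: 'a poly set). divisor_char_sum T) = (if d = 0 then 1 else ?q ^ d - ?q ^ (d - 1))" .
  \<comment> \<open>Each monic \<open>t\<close> of degree \<open>d\<close> with nonzero constant
    coefficient has exactly one norm, again of degree \<open>d\<close>. The norm fibres thus
    partition these \<open>t\<close>, whose number is the same \<open>q^d - q^(d-1)\<close> for
    \<open>d > 0\<close>.\<close>
  have "{t \<in> monics d. coeff t 0 \<noteq> (0::'a)} = (\<Union>T\<in>monics d. norm_preimages T)"
  proof (intro equalityI subsetI)
    fix t :: "'a poly" assume "t \<in> {t \<in> monics d. coeff t 0 \<noteq> 0}"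
    then have t: "lead_coeff t = 1" "coeff t 0 \<noteq> 0" "degree t = d" by (auto simp: monics_def)
    obtain T where "lead_coeff T = 1" "t * dual_poly t = recip_poly T" "degree T = degree t"
      using mult_dual_is_recip[OF t(1,2)] .
    then show "t \<in> (\<Union>T\<in>monics d. norm_preimages T)" using t by (auto simp: monics_def norm_preimages_def)
  next
    fix t :: "'a poly" assume "t \<in> (\<Union>T\<in>monics d. norm_preimages T)"
    then obtain T where T: "T \<in> monics d" "lead_coeff t = 1" "coeff t 0 \<noteq> 0" "t * dual_poly t = recip_poly T"
      by (auto simp: norm_preimages_def)
    have "t \<noteq> 0" "dual_poly t \<noteq> 0" using T(2) dual_poly_facts(1)[OF T(2,3)] by auto
    then have "2 * degree t = degree (recip_poly T)" unfolding T(4)[symmetric] using dual_poly_facts(2)[OF T(2,3)] by (simp add: degree_mult_eq)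
    then show "t \<in> {t \<in> monics d. coeff t 0 \<noteq> 0}" using T by (simp add: monics_def)
  qed
  then have "card {t \<in> monics d. coeff t 0 \<noteq> (0::'a)} = card (\<Union>T\<in>(monics d :: 'a poly set). norm_preimages T)" by simp
  also have "\<dots> = (\<Sum>T\<in>(monics d :: 'a poly set). card (norm_preimages T))"
  proof (rule card_UN_disjoint[OF finite_monics])
    show "\<forall>T\<in>(monics d :: 'a poly set). finite (norm_preimages T)" using finite_norm_preimages by blast
    show "\<forall>T\<in>(monics d :: 'a poly set). \<forall>T'\<in>monics d. T \<noteq> T' \<longrightarrow> norm_preimages T \<inter> norm_preimages T' = {}"
    proof (intro ballI impI)
      fix T T' :: "'a poly" assume "T \<noteq> T'"
      then have "recip_poly T \<noteq> recip_poly T'" using recip_poly_inj by blast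
      then show "norm_preimages T \<inter> norm_preimages T' = {}" by (auto simp: norm_preimages_def)
    qed
  qed
  finally have left1: "(\<Sum>T\<in>(monics d :: 'a poly set). card (norm_preimages T)) = card {t \<in> monics d. coeff t 0 \<noteq> (0::'a)}" by simp
  have left2: "int (card {t \<in> monics d. coeff t 0 \<noteq> (0::'a)}) = (if d = 0 then 1 else ?q ^ d - ?q ^ (d - 1))"
  proof (cases d)
    case 0
    have "{t \<in> monics 0. coeff t 0 \<noteq> (0::'a)} = {1}" using degree_0_monic by (auto simp: monics_def)
    then show ?thesis using 0 by simp
  next
    case (Suc k)
    have "bij_betw (pCons 0) (monics k) {t \<in> monics d. coeff t 0 = (0::'a)}"
    proof (rule bij_betwI[where g = "poly_shift 1"])
      show "pCons 0 \<in> monics k \<rightarrow> {t \<in> monics d. coeff t 0 = (0::'a)}" by (auto simp: monics_def Suc)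
      have s: "pCons 0 (poly_shift 1 t) = t" if "coeff t 0 = 0" for t :: "'a poly"
        using that by (intro poly_eqI) (auto simp: coeff_pCons coeff_poly_shift split: nat.splits)
      then show "pCons 0 (poly_shift 1 t) = t" if "t \<in> {t \<in> monics d. coeff t 0 = (0::'a)}" for t using that by simp
      show "poly_shift 1 \<in> {t \<in> monics d. coeff t 0 = (0::'a)} \<rightarrow> monics k"
      proof
        fix t :: "'a poly" assume t: "t \<in> {t \<in> monics d. coeff t 0 = 0}"
        obtain u where u: "poly_shift 1 t = u" by simp
        then have "t = pCons 0 u" using s[of t] t by simp
        then show "poly_shift 1 t \<in> monics k" using t u by (cases "u = 0") (auto simp: monics_def Suc)
      qed
      show "poly_shift 1 (pCons 0 t) = t" for t :: "'a poly" by (rule poly_eqI) (simp add: coeff_poly_shift)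
    qed
    then have "card (monics k :: 'a poly set) = card {t \<in> monics d. coeff t 0 = (0::'a)}" by (rule bij_betw_same_card)
    then have z: "card {t \<in> monics d. coeff t 0 = (0::'a)} = card (UNIV :: 'a set) ^ k" by (simp only: card_monics)
    have "{t \<in> monics d. coeff t 0 \<noteq> (0::'a)} = monics d - {t \<in> monics d. coeff t 0 = 0}" by blast
    then have "card {t \<in> monics d. coeff t 0 \<noteq> (0::'a)} = card (UNIV :: 'a set) ^ d - card (UNIV :: 'a set) ^ k"
      by (simp add: card_Diff_subset finite_monics z card_monics)
    moreover have "card (UNIV :: 'a set) ^ k \<le> card (UNIV :: 'a set) ^ d"
      unfolding Suc by (intro power_increasing) (auto simp: Suc_le_eq card_gt_0_iff)
    ultimately show ?thesis using Suc by (simp add: of_nat_diff)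
  qed
  have "(\<Sum>T\<in>(monics d :: 'a poly set). int (card (norm_preimages T))) = (if d = 0 then 1 else ?q ^ d - ?q ^ (d - 1))"
    using left1 left2 by (simp flip: of_nat_sum)
  then have "(\<Sum>T\<in>(monics d :: 'a poly set). divisor_char_sum T - int (card (norm_preimages T))) = 0"
    using right by (simp add: sum_subtractf)
  moreover have nonneg: "0 \<le> divisor_char_sum T - int (card (norm_preimages T))" if "T \<in> monics d" for T :: "'a poly"
  proof -
    have "lead_coeff T = 1" using that by (auto simp: monics_def)
    from card_norm_preimages_le[OF two this] show ?thesis by simp
  qed
  ultimately have "\<forall>T\<in>monics d. divisor_char_sum T - int (card (norm_preimages (T :: 'a poly))) = 0"
    using sum_nonneg_eq_0_iff[OF finite_monics[of d, where 'a='a], of "\<lambda>T. divisor_char_sum T - int (card (norm_preimages T))"] by blast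
  moreover have "T \<in> monics d" using T by (simp add: monics_def d_def)
  ultimately show ?thesis by simp
qed

end

section \<open>Grouping the flag types by their palindromic factors\<close>

definition recip_inv :: "'a::field poly \<Rightarrow> 'a poly" where
  "recip_inv x = (THE Q. recip_poly Q = x)"

definition recip_mean :: "nat \<Rightarrow> 'a::{finite,field} mat \<Rightarrow> ('a poly \<Rightarrow> real) \<Rightarrow> real" where
  "recip_mean n J \<psi> = isometry_mean (2 * n) J (\<lambda>x. \<psi> (recip_inv x))"

lemma recip_inv[simp]: "recip_inv (recip_poly Q) = Q"
  unfolding recip_inv_def by (rule the_equality) (auto dest: recip_poly_inj)

definition monic_divisors :: "'a::field poly \<Rightarrow> 'a poly set" where
  "monic_divisors X = {Y. lead_coeff Y = 1 \<and> Y dvd X}"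

lemma finite_monic_divisors:
  assumes "X \<noteq> 0"
  shows "finite (monic_divisors (X :: 'a::{finite,field} poly))"
  by (rule finite_subset[OF _ finite_degree_le[of "degree X"]])
    (use assms dvd_imp_degree_le in \<open>auto simp: monic_divisors_def\<close>)

lemma monic_divisors_quotient:
  assumes "S \<in> monic_divisors X"
  shows "monic_divisors (X div S) = {B \<in> monic_divisors X. S * B dvd X}"
proof -
  have "lead_coeff S = 1" "S dvd X" using assms by (auto simp: monic_divisors_def)
  then obtain Y where Y: "X = S * Y" "lead_coeff S = 1" by (metis dvdE)
  have "S \<noteq> 0" using Y(2) by auto
  then show ?thesis using Y by (auto simp: monic_divisors_def)
qed

lemma sum_divisors_swap:
  fixes f g :: "'a::{finite,field} poly \<Rightarrow> 'b::comm_semiring_0"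
  assumes "X \<noteq> 0"
  shows "(\<Sum>S\<in>monic_divisors X. f S * (\<Sum>B\<in>monic_divisors (X div S). g B))
    = (\<Sum>B\<in>monic_divisors X. g B * (\<Sum>S\<in>monic_divisors (X div B). f S))"
proof -
  have "(\<Sum>S\<in>monic_divisors X. f S * (\<Sum>B\<in>monic_divisors (X div S). g B))
      = (\<Sum>S\<in>monic_divisors X. \<Sum>B | B \<in> monic_divisors X \<and> S * B dvd X. f S * g B)"
    by (rule sum.cong[OF refl]) (simp add: monic_divisors_quotient sum_distrib_left)
  also have "\<dots> = (\<Sum>B\<in>monic_divisors X. \<Sum>S | S \<in> monic_divisors X \<and> S * B dvd X. f S * g B)"
    by (rule sum.swap_restrict[OF finite_monic_divisors[OF assms] finite_monic_divisors[OF assms]])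
  also have "\<dots> = (\<Sum>B\<in>monic_divisors X. g B * (\<Sum>S\<in>monic_divisors (X div B). f S))"
    by (rule sum.cong[OF refl]) (simp add: monic_divisors_quotient sum_distrib_left mult.commute)
  finally show ?thesis .
qed

context
  assumes two: "(2::'a::{finite,field}) \<noteq> 0"
begin

lemma isometry_mean_flag:
  fixes \<psi> :: "'a poly \<Rightarrow> real"
  assumes ST: "lead_coeff S = 1" "lead_coeff T = 1" "degree S + degree T \<le> n" "x = recip_poly S * recip_poly T"
  shows "isometry_mean (2 * (n - degree S - degree T)) (std_form (n - degree S - degree T)) (\<lambda>y. \<psi> (recip_inv (x * y)))
    = recip_mean (n - degree (S * T)) (std_form (n - degree (S * T))) (\<lambda>Q. \<psi> (S * T * Q))"
proof -
  have nz: "S \<noteq> 0" "T \<noteq> 0" using ST by auto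
  define m where "m = n - degree S - degree T"
  have d: "n - degree (S * T) = m" using nz by (simp add: degree_mult_eq m_def)
  have "(\<Sum>M\<in>isometries (2 * m) (std_form m :: 'a mat). \<psi> (recip_inv (x * char_poly M)))
      = (\<Sum>M\<in>isometries (2 * m) (std_form m :: 'a mat). \<psi> (S * T * recip_inv (char_poly M)))"
  proof (rule sum.cong[OF refl])
    fix M :: "'a mat" assume M: "M \<in> isometries (2 * m) (std_form m)"
    obtain Q where Q: "lead_coeff Q = 1" "degree Q = m" "char_poly M = recip_poly Q"
      using char_poly_isometry_recip[OF two std_form_facts M] by blast
    have "Q \<noteq> 0" using Q(1) by auto
    then have "x * char_poly M = recip_poly (S * T * Q)" using nz by (simp add: recip_poly_mult ST(4) Q(3))
    then show "\<psi> (recip_inv (x * char_poly M)) = \<psi> (S * T * recip_inv (char_poly M))" by (simp add: Q(3))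
  qed
  then show ?thesis unfolding recip_mean_def isometry_mean_def d m_def[symmetric] by simp
qed

text \<open>The sequence and \<open>t\<close> are chosen independently once the two palindromic
  factors are fixed, and the degree condition on a type follows from the bound on
  \<open>degree S + degree T\<close>.\<close>

lemma card_flag_fibre:
  fixes S T :: "'a poly"
  assumes ST: "lead_coeff S = 1" "lead_coeff T = 1" "degree S + degree T \<le> n"
  shows "card {(c, s, t) \<in> flag_types n. s = recip_poly S \<and> t * dual_poly t = recip_poly T} = exact_count S * card (norm_preimages T)"
proof -
  let ?C = "{c. odd_seq c \<and> min_annihilator c (recip_poly S)}"
  have deg: "degree t = degree T" if t: "lead_coeff t = 1" "coeff t 0 \<noteq> 0" "t * dual_poly t = recip_poly T" for t :: "'a poly"
  proof -
    obtain T' where "t * dual_poly t = recip_poly T'" "degree T' = degree t" using mult_dual_is_recip[OF t(1,2)] .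
    then show ?thesis using t(3) recip_poly_inj[of T T'] by simp
  qed
  have "{(c, s, t) \<in> flag_types n. s = recip_poly S \<and> t * dual_poly t = recip_poly T}
      = (\<lambda>(c, t). (c, recip_poly S, t)) ` (?C \<times> norm_preimages T)"
  proof (intro equalityI subsetI)
    fix \<tau> assume "\<tau> \<in> {(c, s, t) \<in> flag_types n. s = recip_poly S \<and> t * dual_poly t = recip_poly T}"
    then obtain c s t where \<tau>: "\<tau> = (c, s, t)" "(c, s, t) \<in> flag_types n" "s = recip_poly S" "t * dual_poly t = recip_poly T" by auto
    then have "c \<in> ?C" "t \<in> norm_preimages T" by (auto simp: flag_types_def norm_preimages_def)
    then show "\<tau> \<in> (\<lambda>(c, t). (c, recip_poly S, t)) ` (?C \<times> norm_preimages T)" using \<tau> by (intro image_eqI[of _ _ "(c, t)"]) auto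
  next
    fix \<tau> assume "\<tau> \<in> (\<lambda>(c, t). (c, recip_poly S, t)) ` (?C \<times> norm_preimages T)"
    then obtain c t where \<tau>: "\<tau> = (c, recip_poly S, t)" "c \<in> ?C" "t \<in> norm_preimages T" by auto
    then have t: "lead_coeff t = 1" "coeff t 0 \<noteq> 0" "t * dual_poly t = recip_poly T" by (auto simp: norm_preimages_def)
    have "(c, recip_poly S, t) \<in> flag_types n"
      using \<tau>(2) t(1,2) deg[OF t] ST(3) unfolding flag_types_def by auto
    then show "\<tau> \<in> {(c, s, t) \<in> flag_types n. s = recip_poly S \<and> t * dual_poly t = recip_poly T}" using \<tau>(1) t(3) by simp
  qed
  then have "card {(c, s, t) \<in> flag_types n. s = recip_poly S \<and> t * dual_poly t = recip_poly T} = card (?C \<times> norm_preimages T)"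
    by (simp add: card_image inj_on_def)
  then show ?thesis by (simp add: card_cartesian_product exact_count_def)
qed

text \<open>In terms of Dirichlet convolution: \<open>exact_count\<close> convolved with 1 is
  \<open>q^degree\<close>, and the norm count is 1 convolved with \<open>disc_char\<close>. The
  factor 1 is moved from one side to the other.\<close>

lemma exact_count_convolution:
  fixes X :: "'a poly"
  assumes X: "lead_coeff X = 1"
  shows "(\<Sum>S\<in>monic_divisors X. real (exact_count S * card (norm_preimages (X div S))))
    = (\<Sum>B\<in>monic_divisors X. real_of_int (disc_char B) * real (card (UNIV :: 'a set)) ^ degree (X div B))"
proof -
  have nz: "X \<noteq> 0" using X by auto
  have lq: "lead_coeff (X div S) = 1" if "S \<in> monic_divisors X" for S
  proof -
    have S: "lead_coeff S = 1" and "S dvd X" using that by (auto simp: monic_divisors_def)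
    then obtain Y where Y: "X = S * Y" by (elim dvdE)
    have "S \<noteq> 0" using S by auto
    moreover have "lead_coeff Y = 1" using X S unfolding Y by (simp add: lead_coeff_mult)
    ultimately show ?thesis unfolding Y by simp
  qed
  have "(\<Sum>S\<in>monic_divisors X. real (exact_count S * card (norm_preimages (X div S))))
      = (\<Sum>S\<in>monic_divisors X. real (exact_count S) * (\<Sum>B\<in>monic_divisors (X div S). real_of_int (disc_char B)))"
  proof (rule sum.cong[OF refl])
    fix S assume S: "S \<in> monic_divisors X"
    have "real (card (norm_preimages (X div S))) = real_of_int (divisor_char_sum (X div S))"
      using card_norm_preimages[OF two lq[OF S], symmetric] by simp
    then show "real (exact_count S * card (norm_preimages (X div S)))
        = real (exact_count S) * (\<Sum>B\<in>monic_divisors (X div S). real_of_int (disc_char B))"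
      by (simp add: divisor_char_sum_def monic_divisors_def)
  qed
  also have "\<dots> = (\<Sum>B\<in>monic_divisors X. real_of_int (disc_char B) * (\<Sum>S\<in>monic_divisors (X div B). real (exact_count S)))"
    by (rule sum_divisors_swap[OF nz])
  also have "\<dots> = (\<Sum>B\<in>monic_divisors X. real_of_int (disc_char B) * real (card (UNIV :: 'a set)) ^ degree (X div B))"
  proof (rule sum.cong[OF refl])
    fix B assume B: "B \<in> monic_divisors X"
    have "(\<Sum>S\<in>monic_divisors (X div B). real (exact_count S)) = real (card (UNIV :: 'a set) ^ degree (X div B))"
      unfolding sum_exact_count[OF two lq[OF B], symmetric] monic_divisors_def by simp
    then show "real_of_int (disc_char B) * (\<Sum>S\<in>monic_divisors (X div B). real (exact_count S))
        = real_of_int (disc_char B) * real (card (UNIV :: 'a set)) ^ degree (X div B)" by simp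
  qed
  finally show ?thesis .
qed

text \<open>Grouping the flag types by the product of their two palindromic factors; the multiplicities form
  the Dirichlet convolution of \<open>q ^ degree\<close> with \<open>disc_char\<close>.\<close>
lemma recip_mean_recursion:
  fixes J :: "'a mat" and \<psi> :: "'a poly \<Rightarrow> real"
  assumes J: "J \<in> carrier_mat (2 * n) (2 * n)" "J\<^sup>T = - J" "det J \<noteq> 0"
  shows "real (card (UNIV :: 'a set)) ^ (2 * n) * recip_mean n J \<psi>
    = (\<Sum>d\<le>n. \<Sum>l\<le>d. \<Sum>B\<in>monics l. \<Sum>A\<in>monics (d - l). real_of_int (disc_char B) * real (card (UNIV :: 'a set)) ^ (d - l)
        * recip_mean (n - d) (std_form (n - d)) (\<lambda>Q. \<psi> (B * A * Q)))"
proof -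
  define H where "H X = recip_mean (n - degree X) (std_form (n - degree X)) (\<lambda>Q. \<psi> (X * Q))" for X
  define U where "U = (\<Union>d\<le>n. monics d :: 'a poly set)"
  define P where "P = (SIGMA X:U. monic_divisors X)"
  \<comment> \<open>The grouping key of a type: the product of its two monic factors together with
    the factor that belongs to \<open>s\<close>.\<close>
  define p where "p = (\<lambda>(c :: int \<Rightarrow> 'a, s :: 'a poly, t :: 'a poly). (recip_inv s * recip_inv (t * dual_poly t), recip_inv s))"
  have U: "X \<in> U \<longleftrightarrow> lead_coeff X = 1 \<and> degree X \<le> n" for X by (auto simp: U_def monics_def)
  have finU: "finite U" by (simp add: U_def finite_monics)
  have Unz: "X \<noteq> 0" if "X \<in> U" for X using that by (auto simp: U)
  have finP: "finite P" unfolding P_def using finU finite_monic_divisors Unz by (intro finite_SigmaI) auto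
  have ex: "\<exists>S T. lead_coeff S = 1 \<and> s = recip_poly S \<and> degree s = 2 * degree S \<and> lead_coeff T = 1
      \<and> t * dual_poly t = recip_poly T \<and> degree T = degree t \<and> degree S + degree T \<le> n" if fl: "(c, s, t) \<in> flag_types n" for c :: "int \<Rightarrow> 'a" and s t
  proof -
    obtain S T where ST: "lead_coeff S = 1" "s = recip_poly S" "degree s = 2 * degree S"
      "lead_coeff T = 1" "t * dual_poly t = recip_poly T" "degree T = degree t" using flag_type_recip[OF two fl] .
    moreover have "degree s + 2 * degree t \<le> 2 * n" using fl by (simp add: flag_types_def)
    ultimately have "degree S + degree T \<le> n" by simp
    then show ?thesis using ST by blast
  qed
  have "real (card (UNIV :: 'a set)) ^ (2 * n) * recip_mean n J \<psi>
      = (\<Sum>(c, s, t)\<in>flag_types n. isometry_mean (2 * (n - degree s div 2 - degree t)) (std_form (n - degree s div 2 - degree t))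
        (\<lambda>x. \<psi> (recip_inv (s * t * dual_poly t * x))))"
    unfolding recip_mean_def by (rule isometry_mean_recursion[OF two J])
  also have "\<dots> = (\<Sum>\<tau>\<in>flag_types n. H (fst (p \<tau>)))"
  proof (rule sum.cong[OF refl])
    fix \<tau> :: "(int \<Rightarrow> 'a) \<times> 'a poly \<times> 'a poly" assume fl: "\<tau> \<in> flag_types n"
    obtain c s t where \<tau>: "\<tau> = (c, s, t)" by (cases \<tau>)
    then obtain S T where ST: "lead_coeff S = 1" "s = recip_poly S" "degree s = 2 * degree S"
      "lead_coeff T = 1" "t * dual_poly t = recip_poly T" "degree T = degree t" "degree S + degree T \<le> n" using ex fl by blast
    have "s * t * dual_poly t = recip_poly S * recip_poly T" using ST(2,5) by (simp add: mult.assoc)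
    from isometry_mean_flag[OF ST(1,4,7) this, of \<psi>]
    show "(case \<tau> of (c, s, t) \<Rightarrow> isometry_mean (2 * (n - degree s div 2 - degree t)) (std_form (n - degree s div 2 - degree t))
        (\<lambda>x. \<psi> (recip_inv (s * t * dual_poly t * x)))) = H (fst (p \<tau>))"
      using ST(3,6) by (simp add: \<tau> H_def p_def ST(2,5))
  qed
  also have "\<dots> = (\<Sum>y\<in>P. \<Sum>\<tau> | \<tau> \<in> flag_types n \<and> p \<tau> = y. H (fst (p \<tau>)))"
  proof (rule sum.group[symmetric, OF finite_flag_types finP])
    show "p ` flag_types n \<subseteq> P"
    proof
      fix y assume "y \<in> p ` flag_types n"
      then obtain c s t where y: "y = p (c, s, t)" and "(c, s, t) \<in> flag_types n" by auto
      then obtain S T where ST: "lead_coeff S = 1" "s = recip_poly S"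
        "lead_coeff T = 1" "t * dual_poly t = recip_poly T" "degree S + degree T \<le> n" using ex by blast
      have nz: "S \<noteq> 0" "T \<noteq> 0" using ST(1,3) by auto
      have "lead_coeff (S * T) = 1" using ST(1,3) by (simp add: lead_coeff_mult)
      moreover have "degree (S * T) \<le> n" using nz ST(5) by (simp add: degree_mult_eq)
      moreover have "y = (S * T, S)" by (simp add: y p_def ST(2,4))
      ultimately show "y \<in> P" using ST(1) unfolding P_def by (simp add: U monic_divisors_def)
    qed
  qed
  also have "\<dots> = (\<Sum>(X, S)\<in>P. real (exact_count S * card (norm_preimages (X div S))) * H X)"
  proof (rule sum.cong[OF refl])
    fix y assume "y \<in> P"
    then obtain X S where y: "y = (X, S)" "lead_coeff X = 1" "degree X \<le> n" "lead_coeff S = 1" "S dvd X"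
      by (auto simp: P_def U monic_divisors_def)
    obtain T where T: "X = S * T" using y(5) by (elim dvdE)
    have "X \<noteq> 0" using y(2) by auto
    then have nz: "S \<noteq> 0" "T \<noteq> 0" using T by auto
    have lT: "lead_coeff T = 1" using y(2,4) unfolding T by (simp add: lead_coeff_mult)
    have dST: "degree S + degree T \<le> n" using y(3) nz unfolding T by (simp add: degree_mult_eq)
    have "{\<tau>. \<tau> \<in> flag_types n \<and> p \<tau> = y} = {(c, s, t) \<in> flag_types n. s = recip_poly S \<and> t * dual_poly t = recip_poly T}"
    proof (intro equalityI subsetI)
      fix \<tau> assume \<tau>': "\<tau> \<in> {\<tau>. \<tau> \<in> flag_types n \<and> p \<tau> = y}"
      obtain c s t where \<tau>: "\<tau> = (c, s, t)" by (cases \<tau>)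
      have \<tau>2: "(c, s, t) \<in> flag_types n" "p (c, s, t) = (S * T, S)" using \<tau>' \<tau> y(1) T by auto
      obtain S' T' where ST: "s = recip_poly S'" "t * dual_poly t = recip_poly T'" using ex[OF \<tau>2(1)] by blast
      have "S' = S" "T' = T" using \<tau>2(2) nz by (auto simp: p_def ST)
      then show "\<tau> \<in> {(c, s, t) \<in> flag_types n. s = recip_poly S \<and> t * dual_poly t = recip_poly T}" using \<tau> \<tau>2(1) ST by simp
    next
      fix \<tau> assume "\<tau> \<in> {(c, s, t) \<in> flag_types n. s = recip_poly S \<and> t * dual_poly t = recip_poly T}"
      then obtain c s t where "\<tau> = (c, s, t)" "(c, s, t) \<in> flag_types n" "s = recip_poly S" "t * dual_poly t = recip_poly T" by auto
      then show "\<tau> \<in> {\<tau>. \<tau> \<in> flag_types n \<and> p \<tau> = y}" by (simp add: p_def y(1) T)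
    qed
    then have "card {\<tau>. \<tau> \<in> flag_types n \<and> p \<tau> = y} = exact_count S * card (norm_preimages (X div S))"
      using card_flag_fibre[OF y(4) lT dST] nz T by simp
    moreover have "(\<Sum>\<tau> | \<tau> \<in> flag_types n \<and> p \<tau> = y. H (fst (p \<tau>))) = (\<Sum>\<tau> | \<tau> \<in> flag_types n \<and> p \<tau> = y. H X)"
      by (rule sum.cong[OF refl]) (auto simp: y(1))
    ultimately show "(\<Sum>\<tau> | \<tau> \<in> flag_types n \<and> p \<tau> = y. H (fst (p \<tau>)))
        = (case y of (X, S) \<Rightarrow> real (exact_count S * card (norm_preimages (X div S))) * H X)"
      by (simp add: y(1))
  qed
  also have "\<dots> = (\<Sum>X\<in>U. \<Sum>S\<in>monic_divisors X. real (exact_count S * card (norm_preimages (X div S))) * H X)"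
    unfolding P_def by (rule sum.Sigma[symmetric]) (use finU finite_monic_divisors Unz in auto)
  also have "\<dots> = (\<Sum>X\<in>U. \<Sum>B\<in>monic_divisors X. real_of_int (disc_char B) * real (card (UNIV :: 'a set)) ^ degree (X div B) * H X)"
  proof (rule sum.cong[OF refl])
    fix X assume "X \<in> U"
    then have "lead_coeff X = 1" by (simp add: U)
    then show "(\<Sum>S\<in>monic_divisors X. real (exact_count S * card (norm_preimages (X div S))) * H X)
        = (\<Sum>B\<in>monic_divisors X. real_of_int (disc_char B) * real (card (UNIV :: 'a set)) ^ degree (X div B) * H X)"
      unfolding sum_distrib_right[symmetric] using exact_count_convolution by simp
  qed
  also have "\<dots> = (\<Sum>d\<le>n. \<Sum>X\<in>monics d. \<Sum>B\<in>monic_divisors X. real_of_int (disc_char B) * real (card (UNIV :: 'a set)) ^ degree (X div B) * H X)"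
    unfolding U_def by (rule sum.UNION_disjoint, simp, simp add: finite_monics) (auto simp: monics_def)
  also have "\<dots> = (\<Sum>d\<le>n. \<Sum>l\<le>d. \<Sum>B\<in>monics l. \<Sum>A\<in>monics (d - l).
      real_of_int (disc_char B) * real (card (UNIV :: 'a set)) ^ degree (B * A div B) * H (B * A))"
    unfolding monic_divisors_def sum_over_divisors[OF two] ..
  also have "\<dots> = (\<Sum>d\<le>n. \<Sum>l\<le>d. \<Sum>B\<in>monics l. \<Sum>A\<in>monics (d - l). real_of_int (disc_char B) * real (card (UNIV :: 'a set)) ^ (d - l)
        * recip_mean (n - d) (std_form (n - d)) (\<lambda>Q. \<psi> (B * A * Q)))"
  proof (intro sum.cong refl)
    fix d l and A B :: "'a poly" assume l: "l \<in> {..d}" and B: "B \<in> monics l" and A: "A \<in> monics (d - l)"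
    have nz: "B \<noteq> 0" "A \<noteq> 0" using A B by (auto simp: monics_def)
    have dg: "degree B = l" "degree A = d - l" using A B by (auto simp: monics_def)
    have "degree (B * A) = d" using nz dg l by (simp add: degree_mult_eq)
    then show "real_of_int (disc_char B) * real (card (UNIV :: 'a set)) ^ degree (B * A div B) * H (B * A)
      = real_of_int (disc_char B) * real (card (UNIV :: 'a set)) ^ (d - l) * recip_mean (n - d) (std_form (n - d)) (\<lambda>Q. \<psi> (B * A * Q))"
      using nz dg by (simp add: H_def)
  qed
  finally show ?thesis .
qed

end

section \<open>The majorant power series\<close>

no_notation vec_index (infixl "$" 100)
unbundle fps_syntax

definition dilate :: "real \<Rightarrow> real fps \<Rightarrow> real fps" where
  "dilate c f = Abs_fps (\<lambda>n. c ^ n * f $ n)"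

lemma dilate_mult: "dilate c (f * g) = dilate c f * dilate c g"
proof (rule fps_ext)
  fix n
  have "(\<Sum>i=0..n. c ^ n * (f $ i * g $ (n - i))) = (\<Sum>i=0..n. (c ^ i * f $ i) * (c ^ (n - i) * g $ (n - i)))"
  proof (rule sum.cong[OF refl])
    fix i assume "i \<in> {0..n}"
    then have "c ^ n = c ^ i * c ^ (n - i)" by (simp flip: power_add)
    then show "c ^ n * (f $ i * g $ (n - i)) = (c ^ i * f $ i) * (c ^ (n - i) * g $ (n - i))" by (simp add: mult_ac)
  qed
  then show "dilate c (f * g) $ n = (dilate c f * dilate c g) $ n"
    by (simp add: dilate_def fps_mult_nth sum_distrib_left)
qed

lemma dilate_power: "dilate c (f ^ m) = dilate c f ^ m"
proof (induction m)
  case 0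
  show ?case by (rule fps_ext) (simp add: dilate_def)
qed (simp add: dilate_mult)

definition one_plus :: "real \<Rightarrow> real fps" where
  "one_plus a = 1 + fps_const a * fps_X"

lemma one_plus_mult_nth: "(one_plus a * f) $ n = f $ n + (if n = 0 then 0 else a * f $ (n - 1))"
  by (simp add: one_plus_def distrib_right mult.assoc)

lemma one_plus_nth_0[simp]: "one_plus a $ 0 = 1"
  by (simp add: one_plus_def)

text \<open>Binomial coefficients in range are at least 1, so the power dominates the truncated
  geometric series coefficientwise.\<close>

lemma one_plus_power_ge:
  assumes "a \<ge> 0"
  shows "0 \<le> (one_plus a ^ m) $ i \<and> (i \<le> m \<longrightarrow> a ^ i \<le> (one_plus a ^ m) $ i)"
proof (induction m arbitrary: i)
  case (Suc m)
  show ?case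
  proof (cases i)
    case 0
    then show ?thesis using Suc.IH[of 0] by (simp add: one_plus_mult_nth)
  next
    case (Suc j)
    have "0 \<le> (one_plus a ^ m) $ i" "0 \<le> a * (one_plus a ^ m) $ j" "j \<le> m \<Longrightarrow> a * a ^ j \<le> a * (one_plus a ^ m) $ j"
      using Suc.IH[of i] Suc.IH[of j] assms by (auto intro: mult_left_mono)
    then show ?thesis using Suc by (auto simp: one_plus_mult_nth)
  qed
qed simp

text \<open>By Euler's identity this is the product of \<open>1 + a * X / q^(2 * i)\<close> over
  \<open>i >= 1\<close>, which explains the functional equation
  \<open>dilate_euler_fps\<close>.\<close>

definition euler_fps :: "real \<Rightarrow> real \<Rightarrow> real fps" where
  "euler_fps q a = Abs_fps (\<lambda>m. \<Prod>i=1..m. a / (q ^ (2 * i) - 1))"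

lemma even_power_gt_1: "q > 1 \<Longrightarrow> i \<ge> 1 \<Longrightarrow> q ^ (2 * i) > (1::real)"
  by (rule one_less_power) auto

lemma dilate_euler_fps:
  assumes "q > 1"
  shows "dilate (q\<^sup>2) (euler_fps q a) = one_plus a * euler_fps q a"
proof (rule fps_ext)
  fix m
  show "dilate (q\<^sup>2) (euler_fps q a) $ m = (one_plus a * euler_fps q a) $ m"
  proof (cases m)
    case (Suc l)
    have "q ^ (2 * m) > 1" using even_power_gt_1[OF assms, of m] Suc by simp
    then have nz: "q ^ (2 * m) - 1 \<noteq> 0" by simp
    have e: "euler_fps q a $ m = euler_fps q a $ l * (a / (q ^ (2 * m) - 1))"
      by (simp add: Suc euler_fps_def)
    have "(q ^ (2 * m) - 1) * euler_fps q a $ m = a * euler_fps q a $ l"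
      unfolding e using nz by simp
    then have "q ^ (2 * m) * euler_fps q a $ m = euler_fps q a $ m + a * euler_fps q a $ l"
      by (simp add: algebra_simps)
    moreover have "m \<noteq> 0" "m - 1 = l" using Suc by simp_all
    ultimately show ?thesis by (simp add: one_plus_mult_nth dilate_def flip: power_mult)
  qed (simp add: dilate_def one_plus_mult_nth)
qed

text \<open>The exponents count degrees: \<open>A\<close> of degree at most \<open>k - 1\<close>
  enters with \<open>q^(deg A)\<close> polynomials of weight \<open>q^(deg A)\<close>, and
  \<open>B\<close> of degree at most \<open>k + 1\<close> with \<open>q^(deg B)\<close> polynomials
  of weight at most 1 in absolute value. Hence \<open>k - 1\<close> series with parameter
  \<open>q^2\<close> and \<open>k + 1\<close> with parameter \<open>q\<close>.\<close>

definition majorant :: "real \<Rightarrow> nat \<Rightarrow> real fps" where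
  "majorant q k = euler_fps q (q\<^sup>2) ^ (k - 1) * euler_fps q q ^ (k + 1)"

lemma fps_mult_nonneg: "(\<And>n. 0 \<le> f $ n) \<Longrightarrow> (\<And>n. 0 \<le> g $ n) \<Longrightarrow> 0 \<le> (f * g :: real fps) $ n"
  by (simp add: fps_mult_nth sum_nonneg)

lemma fps_power_nonneg: "(\<And>n. 0 \<le> f $ n) \<Longrightarrow> 0 \<le> (f ^ m :: real fps) $ n"
  by (induction m arbitrary: n) (auto intro: fps_mult_nonneg)

lemma euler_fps_nonneg:
  assumes "q > 1" "a \<ge> 0"
  shows "0 \<le> euler_fps q a $ n"
  using even_power_gt_1[OF assms(1)] assms(2) by (auto simp: euler_fps_def less_imp_le intro!: prod_nonneg)

lemma majorant_nonneg: "q > 1 \<Longrightarrow> 0 \<le> majorant q k $ n"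
  unfolding majorant_def by (intro fps_mult_nonneg fps_power_nonneg euler_fps_nonneg) auto

lemma fps_power_nth_0: "(f ^ m) $ 0 = ((f :: real fps) $ 0) ^ m"
  by (induction m) auto

lemma majorant_0: "majorant q k $ 0 = 1"
  by (simp add: majorant_def fps_power_nth_0 euler_fps_def)

text \<open>Replacing \<open>X\<close> by \<open>q^2 * X\<close> multiplies the series by the
  polynomial \<open>P\<close>, which makes its coefficients satisfy a recursion weighted by those of
  \<open>P\<close>; these dominate the truncated weights.\<close>

lemma majorant_recursion:
  assumes "q > 1"
  shows "(\<Sum>d=1..n. (\<Sum>l\<le>d. if l \<le> k + 1 \<and> d - l \<le> k - 1 then q ^ (2 * (d - l) + l) else 0) * majorant q k $ (n - d))
    \<le> (q ^ (2 * n) - 1) * majorant q k $ n"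
proof -
  let ?G = "majorant q k"
  define P where "P = one_plus q ^ (k + 1) * one_plus (q\<^sup>2) ^ (k - 1)"
  have "dilate (q\<^sup>2) ?G = P * ?G"
    by (simp only: majorant_def dilate_mult dilate_power dilate_euler_fps[OF assms] power_mult_distrib P_def mult_ac)
  then have "q ^ (2 * n) * ?G $ n = (P * ?G) $ n"
    by (simp add: dilate_def fps_eq_iff power_mult)
  also have "\<dots> = P $ 0 * ?G $ n + (\<Sum>d=1..n. P $ d * ?G $ (n - d))"
    by (simp add: fps_mult_nth sum.atLeast_Suc_atMost)
  also have "P $ 0 = 1" by (simp add: P_def fps_power_nth_0 one_plus_def)
  finally have eq: "(q ^ (2 * n) - 1) * ?G $ n = (\<Sum>d=1..n. P $ d * ?G $ (n - d))"
    by (simp add: algebra_simps)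
  show ?thesis unfolding eq
  proof (intro sum_mono mult_right_mono majorant_nonneg assms)
    fix d
    show "(\<Sum>l\<le>d. if l \<le> k + 1 \<and> d - l \<le> k - 1 then q ^ (2 * (d - l) + l) else 0) \<le> P $ d"
      unfolding P_def fps_mult_nth atLeast0AtMost
    proof (intro sum_mono)
      fix l assume "l \<in> {..d}"
      have g: "0 \<le> (one_plus q ^ (k + 1)) $ l \<and> (l \<le> k + 1 \<longrightarrow> q ^ l \<le> (one_plus q ^ (k + 1)) $ l)"
        "0 \<le> (one_plus (q\<^sup>2) ^ (k - 1)) $ (d - l) \<and> (d - l \<le> k - 1 \<longrightarrow> (q\<^sup>2) ^ (d - l) \<le> (one_plus (q\<^sup>2) ^ (k - 1)) $ (d - l))"
        using one_plus_power_ge[of q "k + 1" l] one_plus_power_ge[of "q\<^sup>2" "k - 1" "d - l"] assms by auto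
      show "(if l \<le> k + 1 \<and> d - l \<le> k - 1 then q ^ (2 * (d - l) + l) else 0)
          \<le> (one_plus q ^ (k + 1)) $ l * (one_plus (q\<^sup>2) ^ (k - 1)) $ (d - l)"
      proof (cases "l \<le> k + 1 \<and> d - l \<le> k - 1")
        case True
        have "q ^ (2 * (d - l) + l) = q ^ l * (q\<^sup>2) ^ (d - l)" by (simp add: power_add power_mult)
        also have "\<dots> \<le> (one_plus q ^ (k + 1)) $ l * (one_plus (q\<^sup>2) ^ (k - 1)) $ (d - l)"
          using g True assms by (intro mult_mono) auto
        finally show ?thesis using True by simp
      next
        case False
        then show ?thesis unfolding if_not_P[OF False] using g by (intro mult_nonneg_nonneg) auto
      qed
    qed
  qed
qed

section \<open>Explicit bound for the majorant\<close>

lemma sum_choose_multiset: "(\<Sum>i\<le>n. (i + r - 1) choose i) = (n + r) choose n"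
proof (cases r)
  case 0
  \<comment> \<open>Truncated subtraction makes the term at \<open>i = 0\<close> equal to
    \<open>0 choose 0 = 1\<close>; all others vanish.\<close>
  have "(\<Sum>i\<le>n. (i - 1) choose i) = (\<Sum>i\<in>{0::nat}. (i - 1) choose i)"
    by (rule sum.mono_neutral_right) (auto simp: binomial_eq_0)
  then show ?thesis using 0 by simp
next
  case (Suc s)
  then show ?thesis using sum_choose_lower[of s n] by (simp add: add.commute)
qed

text \<open>Everything is compared with geometric series: the binomials are the coefficients of a
  negative power of \<open>1 - X\<close>, and each factor \<open>g\<close> raises the order of that
  power by one.\<close>

lemma fps_mult_power_le:
  fixes f g :: "real fps"
  assumes g: "\<And>n. 0 \<le> g $ n" "\<And>n. g $ n \<le> B * x ^ n"
    and f: "\<And>n. 0 \<le> f $ n" "\<And>n. f $ n \<le> A * real ((n + r - 1) choose n) * x ^ n"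
    and pos: "0 \<le> A" "0 \<le> B" "0 \<le> x"
  shows "(f * g ^ j) $ n \<le> A * B ^ j * real ((n + (r + j) - 1) choose n) * x ^ n"
proof (induction j arbitrary: n)
  case 0
  show ?case using f(2)[of n] by simp
next
  case (Suc j)
  have "f * g ^ Suc j = (f * g ^ j) * g" by (simp add: mult_ac)
  then have "(f * g ^ Suc j) $ n = (\<Sum>i\<le>n. (f * g ^ j) $ i * g $ (n - i))"
    by (simp only: fps_mult_nth[of "f * g ^ j" g] atLeast0AtMost)
  also have "\<dots> \<le> (\<Sum>i\<le>n. (A * B ^ j * real ((i + (r + j) - 1) choose i) * x ^ i) * (B * x ^ (n - i)))"
    by (intro sum_mono mult_mono Suc.IH g) (use pos in \<open>auto intro: fps_mult_nonneg fps_power_nonneg f g\<close>)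
  also have "\<dots> = (\<Sum>i\<le>n. A * B ^ Suc j * x ^ n * real ((i + (r + j) - 1) choose i))"
  proof (rule sum.cong[OF refl])
    fix i assume "i \<in> {..n}"
    then have "x ^ n = x ^ i * x ^ (n - i)" by (simp flip: power_add)
    then show "(A * B ^ j * real ((i + (r + j) - 1) choose i) * x ^ i) * (B * x ^ (n - i))
        = A * B ^ Suc j * x ^ n * real ((i + (r + j) - 1) choose i)" by (simp add: mult_ac)
  qed
  also have "\<dots> = A * B ^ Suc j * x ^ n * real (\<Sum>i\<le>n. (i + (r + j) - 1) choose i)"
    by (simp only: sum_distrib_left of_nat_sum)
  also have "\<dots> = A * B ^ Suc j * real ((n + (r + Suc j) - 1) choose n) * x ^ n"
    by (simp only: sum_choose_multiset) (simp add: add.assoc)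
  finally show ?case .
qed

lemma inverse_minus_one_le:
  fixes p s :: real
  assumes "p > 1" "s > 1" "s \<le> p"
  shows "1 / (p - 1) \<le> s / (s - 1) / p"
proof -
  have "p * (s - 1) \<le> s * (p - 1)" using assms(3) by (simp add: algebra_simps)
  then show ?thesis using assms by (simp add: divide_simps mult_ac)
qed

text \<open>Each \<open>1 / (q^(2 * i) - 1)\<close> exceeds \<open>q^(- 2 * i)\<close> at most by
  the factor \<open>1 + 1 / (q^2 - 1)\<close>, attained at \<open>i = 1\<close>, and the powers
  multiply to \<open>q^(- m * (m + 1))\<close>. This is the origin of the constant raised to the
  power \<open>n\<close> in the final bound.\<close>

lemma euler_fps_le:
  assumes "q > 1"
  shows "euler_fps q (q powr s) $ m \<le> (1 + 1 / (q\<^sup>2 - 1)) ^ m * q powr (s * real m - real m * (real m + 1))"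
proof (induction m)
  case 0
  show ?case using assms by (simp add: euler_fps_def)
next
  case (Suc m)
  let ?K = "1 + 1 / (q\<^sup>2 - 1)" and ?M = "real (Suc m)"
  have q2: "q\<^sup>2 > 1" using assms by (simp add: one_less_power)
  have K: "?K = q\<^sup>2 / (q\<^sup>2 - 1)" using q2 by (simp add: field_simps)
  have p: "q ^ (2 * Suc m) > 1" using even_power_gt_1[OF assms, of "Suc m"] by simp
  have "q\<^sup>2 \<le> q ^ (2 * Suc m)" using assms by (intro power_increasing) auto
  then have "1 / (q ^ (2 * Suc m) - 1) \<le> ?K / q ^ (2 * Suc m)"
    unfolding K by (rule inverse_minus_one_le[OF p q2])
  moreover have "q powr (- 2 * ?M) = 1 / q ^ (2 * Suc m)"
  proof -
    have "q powr (- 2 * ?M) = q powr (- real (2 * Suc m))" by simp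
    also have "\<dots> = 1 / q powr (real (2 * Suc m))" by (rule powr_minus_divide)
    also have "q powr (real (2 * Suc m)) = q ^ (2 * Suc m)" using assms by (intro powr_realpow) simp
    finally show ?thesis .
  qed
  ultimately have le: "1 / (q ^ (2 * Suc m) - 1) \<le> ?K * q powr (- 2 * ?M)" by simp
  have "euler_fps q (q powr s) $ Suc m = euler_fps q (q powr s) $ m * (q powr s * (1 / (q ^ (2 * Suc m) - 1)))"
    by (simp add: euler_fps_def)
  also have "\<dots> \<le> (?K ^ m * q powr (s * real m - real m * (real m + 1))) * (q powr s * (?K * q powr (- 2 * ?M)))"
    using Suc.IH le p q2 by (intro mult_mono) auto
  also have "\<dots> = ?K ^ Suc m * (q powr (s * real m - real m * (real m + 1)) * q powr s * q powr (- 2 * ?M))"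
    by (simp add: mult_ac)
  also have "q powr (s * real m - real m * (real m + 1)) * q powr s * q powr (- 2 * ?M) = q powr (s * ?M - ?M * (?M + 1))"
    unfolding powr_add[symmetric] by (rule arg_cong[of _ _ "\<lambda>x. q powr x"]) (simp add: algebra_simps)
  finally show ?case .
qed

text \<open>The differences of the two sides are \<open>(m - c) * (m - c - 1)\<close> and
  \<open>(m - c)^2\<close>; the first is a product of consecutive integers.\<close>

lemma integer_parabola: "m * (2 * c + 1 - m) \<le> c * c + (c::int)" "m * (2 * c - m) \<le> c * (c::int)"
proof -
  have "0 \<le> (m - c) * (m - c - 1)"
    by (cases "m \<le> c") (auto intro: mult_nonneg_nonneg mult_nonpos_nonpos)
  then show "m * (2 * c + 1 - m) \<le> c * c + c" by (simp add: algebra_simps)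
  have "0 \<le> (m - c) * (m - c)" by simp
  then show "m * (2 * c - m) \<le> c * c" by (simp add: algebra_simps)
qed

text \<open>The quadratic exponents of the coefficients lie below lines of common slope
  \<open>- \<sigma>\<close>, with intercept \<open>\<alpha>\<close> for parameter \<open>q^2\<close>
  and \<open>\<beta>\<close> for parameter \<open>q\<close>. All \<open>2 * k\<close> factors are
  then dominated by geometric series of the same ratio, whose product has binomial
  coefficients.\<close>

lemma majorant_le_powr:
  fixes \<sigma> \<alpha> \<beta> :: real
  assumes "q > 1" "k \<ge> 1"
    and \<alpha>: "\<And>m. \<sigma> * real m - real m * (real m - 1) \<le> \<alpha>" and \<beta>: "\<And>m. \<sigma> * real m - real m * real m \<le> \<beta>"
  shows "majorant q k $ n \<le> q powr (real (k - 1) * \<alpha> + real (k + 1) * \<beta> - \<sigma> * real n)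
    * (1 + 1 / (q\<^sup>2 - 1)) ^ n * real ((n + 2 * k - 1) choose n)"
proof -
  let ?K = "1 + 1 / (q\<^sup>2 - 1)"
  define x where "x = ?K * q powr (- \<sigma>)"
  have q2: "q\<^sup>2 > 1" using assms by (simp add: one_less_power)
  then have K: "?K \<ge> 0" by simp
  then have x0: "x \<ge> 0" by (simp add: x_def)
  have xn: "x ^ m = ?K ^ m * q powr (- \<sigma> * real m)" for m
    unfolding x_def power_mult_distrib using assms(1) by (simp add: powr_power mult.commute)
  have e: "euler_fps q (q powr s) $ m \<le> q powr \<gamma> * x ^ m" if s: "s * real m - real m * (real m + 1) \<le> \<gamma> - \<sigma> * real m" for s \<gamma> m
  proof -
    have "euler_fps q (q powr s) $ m \<le> ?K ^ m * q powr (s * real m - real m * (real m + 1))" by (rule euler_fps_le[OF assms(1)])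
    also have "\<dots> \<le> ?K ^ m * q powr (\<gamma> - \<sigma> * real m)"
      by (intro mult_left_mono powr_mono s zero_le_power[OF K]) (use assms(1) in auto)
    also have "\<dots> = q powr \<gamma> * x ^ m" by (simp add: xn powr_diff powr_minus_divide)
    finally show ?thesis .
  qed
  have "q powr 2 = q\<^sup>2" using assms(1) powr_realpow[of q 2] by simp
  then have e1: "euler_fps q (q\<^sup>2) $ m \<le> q powr \<alpha> * x ^ m" for m
    using e[of 2 m \<alpha>] \<alpha>[of m] by (simp add: algebra_simps)
  have e2: "euler_fps q q $ m \<le> q powr \<beta> * x ^ m" for m
    using e[of 1 m \<beta>] \<beta>[of m] assms(1) by (simp add: algebra_simps)
  have n1: "0 \<le> euler_fps q (q\<^sup>2) $ m" and n2: "0 \<le> euler_fps q q $ m" for m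
    using assms(1) by (auto intro: euler_fps_nonneg)
  have b1: "(1 * euler_fps q (q\<^sup>2) ^ (k - 1)) $ m \<le> 1 * (q powr \<alpha>) ^ (k - 1) * real ((m + (0 + (k - 1)) - 1) choose m) * x ^ m" for m
    by (rule fps_mult_power_le[OF n1 e1]) (use x0 in \<open>auto simp: fps_one_nth binomial_eq_0\<close>)
  have "(euler_fps q (q\<^sup>2) ^ (k - 1) * euler_fps q q ^ (k + 1)) $ n
      \<le> (q powr \<alpha>) ^ (k - 1) * (q powr \<beta>) ^ (k + 1) * real ((n + ((k - 1) + (k + 1)) - 1) choose n) * x ^ n"
    by (rule fps_mult_power_le[OF n2 e2]) (use b1 x0 fps_power_nonneg[OF n1] in auto)
  also have "n + ((k - 1) + (k + 1)) - 1 = n + 2 * k - 1" using assms(2) by simp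
  also have "(q powr \<alpha>) ^ (k - 1) * (q powr \<beta>) ^ (k + 1) * real ((n + 2 * k - 1) choose n) * x ^ n
      = ((q powr \<alpha>) ^ (k - 1) * (q powr \<beta>) ^ (k + 1) * q powr (- \<sigma> * real n)) * ?K ^ n * real ((n + 2 * k - 1) choose n)"
    unfolding xn by (simp only: mult_ac)
  also have "(q powr \<alpha>) ^ (k - 1) = q powr (\<alpha> * real (k - 1))" using assms(1) powr_power[of q \<alpha> "k - 1"] by (simp add: mult.commute)
  also have "(q powr \<beta>) ^ (k + 1) = q powr (\<beta> * real (k + 1))" using assms(1) powr_power[of q \<beta> "k + 1"] by (simp add: mult.commute)
  also have "q powr (\<alpha> * real (k - 1)) * q powr (\<beta> * real (k + 1)) * q powr (- \<sigma> * real n)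
      = q powr (real (k - 1) * \<alpha> + real (k + 1) * \<beta> - \<sigma> * real n)"
    unfolding powr_add[symmetric] by (simp add: mult_ac)
  finally show ?thesis unfolding majorant_def .
qed

text \<open>The slope \<open>\<sigma>\<close> is the integer making the exponent smallest, namely \<open>n / k\<close> rounded suitably.\<close>
lemma majorant_le:
  assumes "q > 1" "k \<ge> 1"
  shows "majorant q k $ n \<le> q powr (real n / 2 - real n ^ 2 / (2 * real k))
    * (1 + 1 / (q\<^sup>2 - 1)) ^ n * real ((n + 2 * k - 1) choose n)"
proof -
  define c where "c = n div (2 * k)"
  define \<rho> where "\<rho> = n mod (2 * k)"
  have n: "real n = 2 * real k * real c + real \<rho>"
  proof -
    have "n = 2 * k * c + \<rho>" unfolding c_def \<rho>_def by (rule mult_div_mod_eq[symmetric])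
    then have "real n = real (2 * k * c + \<rho>)" by (rule arg_cong)
    then show ?thesis by simp
  qed
  have \<rho>: "\<rho> < 2 * k" using assms(2) by (simp add: \<rho>_def)
  have k: "real (k - 1) = real k - 1" "real (k + 1) = real k + 1" "real k > 0" using assms(2) by auto
  have par: "real_of_int (m * (2 * e + 1 - m)) \<le> real_of_int (e * e + e)" "real_of_int (m * (2 * e - m)) \<le> real_of_int (e * e)" for m e
    using integer_parabola[of m e] by (simp_all only: of_int_le_iff)
  obtain \<sigma> \<alpha> \<beta> :: real where bd: "\<And>m. \<sigma> * real m - real m * (real m - 1) \<le> \<alpha>" "\<And>m. \<sigma> * real m - real m * real m \<le> \<beta>"
    and ex: "2 * real k * (real (k - 1) * \<alpha> + real (k + 1) * \<beta> - \<sigma> * real n) \<le> real n * (real k - real n)"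
  proof (cases "\<rho> \<le> k")
    case True
    \<comment> \<open>Even slope \<open>2 * c\<close>; the intercepts are the integer maxima of the
      two parabolas. The slack in \<open>ex\<close> is
      \<open>\<rho> * (k - \<rho>) + 2 * k * c\<close>.\<close>
    show thesis
    proof (rule that[of "2 * real c" "real c * real c + real c" "real c * real c"])
      show "2 * real c * real m - real m * (real m - 1) \<le> real c * real c + real c" for m
        using par(1)[of "int m" "int c"] by (simp add: algebra_simps)
      show "2 * real c * real m - real m * real m \<le> real c * real c" for m
        using par(2)[of "int m" "int c"] by (simp add: algebra_simps)
      have "real n * (real k - real n) - 2 * real k * (real (k - 1) * (real c * real c + real c) + real (k + 1) * (real c * real c) - 2 * real c * real n)
          = real \<rho> * (real k - real \<rho>) + 2 * real k * real c"
        unfolding n k by (simp add: algebra_simps)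
      moreover have "0 \<le> real \<rho> * (real k - real \<rho>) + 2 * real k * real c" using True by (intro add_nonneg_nonneg mult_nonneg_nonneg) auto
      ultimately show "2 * real k * (real (k - 1) * (real c * real c + real c) + real (k + 1) * (real c * real c) - 2 * real c * real n)
          \<le> real n * (real k - real n)" by linarith
    qed
  next
    case False
    \<comment> \<open>The odd slope \<open>2 * c + 1\<close> interchanges the two kinds of parabola:
      now the one for \<open>\<alpha>\<close> has a single integer maximum, and the one for
      \<open>\<beta>\<close> has two adjacent ones.\<close>
    show thesis
    proof (rule that[of "2 * real c + 1" "(real c + 1) * (real c + 1)" "real c * real c + real c"])
      show "(2 * real c + 1) * real m - real m * (real m - 1) \<le> (real c + 1) * (real c + 1)" for m
        using par(2)[of "int m" "int c + 1"] by (simp add: algebra_simps)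
      show "(2 * real c + 1) * real m - real m * real m \<le> real c * real c + real c" for m
        using par(1)[of "int m" "int c"] by (simp add: algebra_simps)
      have "real n * (real k - real n) - 2 * real k * (real (k - 1) * ((real c + 1) * (real c + 1)) + real (k + 1) * (real c * real c + real c) - (2 * real c + 1) * real n)
          = (real \<rho> - real k) * (2 * real k - real \<rho>) + 2 * real k * (real c + 1)"
        unfolding n k by (simp add: algebra_simps)
      moreover have "0 \<le> (real \<rho> - real k) * (2 * real k - real \<rho>) + 2 * real k * (real c + 1)"
        using False \<rho> by (intro add_nonneg_nonneg mult_nonneg_nonneg) auto
      ultimately show "2 * real k * (real (k - 1) * ((real c + 1) * (real c + 1)) + real (k + 1) * (real c * real c + real c) - (2 * real c + 1) * real n)
          \<le> real n * (real k - real n)" by linarith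
    qed
  qed
  have "real (k - 1) * \<alpha> + real (k + 1) * \<beta> - \<sigma> * real n \<le> real n * (real k - real n) / (2 * real k)"
    using ex k(3) by (simp add: pos_le_divide_eq mult.commute)
  also have "\<dots> = real n / 2 - real n ^ 2 / (2 * real k)" using k(3) by (simp add: field_simps power2_eq_square)
  finally have pw: "q powr (real (k - 1) * \<alpha> + real (k + 1) * \<beta> - \<sigma> * real n) \<le> q powr (real n / 2 - real n ^ 2 / (2 * real k))"
    using assms(1) by (intro powr_mono) auto
  have "q\<^sup>2 > 1" using assms(1) by (simp add: one_less_power)
  then have K: "0 \<le> 1 + 1 / (q\<^sup>2 - 1)" by simp
  show ?thesis
    by (rule order.trans[OF majorant_le_powr[OF assms bd]])
      (intro mult_right_mono pw zero_le_power[OF K] of_nat_0_le_iff)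
qed

section \<open>Test functions and the short interval\<close>

text \<open>What the recursion needs from a test function, phrased so that it survives replacing
  \<open>\<psi>\<close> by \<open>\<psi> (B * Q)\<close>. The step from \<open>k\<close> to
  \<open>k + 2\<close> is the price of the two evaluation points of
  \<open>disc_char\<close>.\<close>

definition admissible :: "nat \<Rightarrow> nat \<Rightarrow> ('a::{finite,field} poly \<Rightarrow> real) \<Rightarrow> bool" where
  "admissible k n \<psi> \<longleftrightarrow> (\<forall>Q\<in>monics n. \<bar>\<psi> Q\<bar> \<le> 1)
    \<and> (\<forall>d Q. d \<le> n \<longrightarrow> Q \<in> monics (n - d) \<longrightarrow> k \<le> d \<longrightarrow> (\<Sum>A\<in>monics d. \<psi> (A * Q)) = 0)
    \<and> (\<forall>d Q. d \<le> n \<longrightarrow> Q \<in> monics (n - d) \<longrightarrow> k + 2 \<le> d \<longrightarrow> (\<Sum>B\<in>monics d. real_of_int (disc_char B) * \<psi> (B * Q)) = 0)"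

lemma monics_mult: "A \<in> monics a \<Longrightarrow> B \<in> monics b \<Longrightarrow> A * B \<in> monics (a + b)"
proof -
  assume "A \<in> monics a" "B \<in> monics b"
  then have l: "lead_coeff A = 1" "lead_coeff B = 1" and d: "degree A = a" "degree B = b" by (auto simp: monics_def)
  then have "A \<noteq> 0" "B \<noteq> 0" by auto
  then have "degree (A * B) = a + b" using d by (simp add: degree_mult_eq)
  moreover have "lead_coeff (A * B) = 1" unfolding lead_coeff_mult l by simp
  ultimately show ?thesis by (auto simp: monics_def)
qed

lemma monics_0: "monics 0 = {1}"
  using degree_0_monic by (auto simp: monics_def)

lemma admissible_shift:
  fixes \<psi> :: "'a::{finite,field} poly \<Rightarrow> real"
  assumes "admissible k n \<psi>" "B \<in> monics e" "e \<le> n"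
  shows "admissible k (n - e) (\<lambda>Q. \<psi> (B * Q))"
proof -
  have shift: "B * Q \<in> monics (n - d)" if "d \<le> n - e" "Q \<in> monics (n - e - d)" for d Q
  proof -
    have "e + (n - e - d) = n - d" using that(1) assms(3) by simp
    then show ?thesis using monics_mult[OF assms(2) that(2)] by (simp only:)
  qed
  show ?thesis unfolding admissible_def
  proof (intro conjI allI impI ballI)
    fix Q :: "'a poly" assume "Q \<in> monics (n - e)"
    then show "\<bar>\<psi> (B * Q)\<bar> \<le> 1" using assms(1) shift[of 0 Q] by (simp add: admissible_def)
  next
    fix d and Q :: "'a poly" assume h: "d \<le> n - e" "Q \<in> monics (n - e - d)"
    have e: "B * (A * Q) = A * (B * Q)" for A by (simp only: mult.left_commute)
    have d: "d \<le> n" using h(1) assms(3) by simp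
    show "(\<Sum>A\<in>monics d. \<psi> (B * (A * Q))) = 0" if "k \<le> d"
      unfolding e using assms(1) shift[OF h] d that unfolding admissible_def by blast
    show "(\<Sum>A\<in>monics d. real_of_int (disc_char A) * \<psi> (B * (A * Q))) = 0" if "k + 2 \<le> d"
      unfolding e using assms(1) shift[OF h] d that unfolding admissible_def by blast
  qed
qed

lemma low_polys_iff: "P \<in> low_polys e \<longleftrightarrow> P = 0 \<or> degree P < e"
proof
  assume P: "P \<in> low_polys e"
  show "P = 0 \<or> degree P < e"
  proof (rule disjCI)
    assume "\<not> degree P < e"
    then have "lead_coeff P = 0" using P by (simp add: low_polys_def)
    then show "P = 0" by simp
  qed
next
  assume "P = 0 \<or> degree P < e"
  then show "P \<in> low_polys e" by (auto simp: low_polys_def coeff_eq_0)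
qed

lemma low_polys_mono: "P \<in> low_polys d \<Longrightarrow> d \<le> e \<Longrightarrow> P \<in> low_polys e"
  by (simp add: low_polys_def)

lemma low_polys_diff_iff:
  assumes "R \<in> low_polys e"
  shows "P - R \<in> low_polys e \<longleftrightarrow> P \<in> low_polys e"
  using assms by (simp add: low_polys_def)

lemma card_field_gt_1: "real (card (UNIV :: 'a::{finite,field} set)) > 1"
proof -
  have "card {0, 1 :: 'a} \<le> card (UNIV :: 'a set)" by (rule card_mono) auto
  then show ?thesis by simp
qed

context
  assumes two: "(2::'a::{finite,field}) \<noteq> 0"
begin

lemma recip_inv_char_poly:
  fixes J :: "'a mat"
  assumes "J \<in> carrier_mat (2 * n) (2 * n)" "J\<^sup>T = - J" "det J \<noteq> 0" "M \<in> isometries (2 * n) J"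
  shows "recip_inv (char_poly M) \<in> monics n" "char_poly M = recip_poly (recip_inv (char_poly M))"
proof -
  obtain Q where Q: "lead_coeff Q = 1" "degree Q = n" "char_poly M = recip_poly Q"
    using char_poly_isometry_recip[OF two assms] by blast
  show "recip_inv (char_poly M) \<in> monics n" using Q(1,2) unfolding Q(3) by (auto simp: monics_def)
  show "char_poly M = recip_poly (recip_inv (char_poly M))" by (simp add: Q(3))
qed

lemma recip_mean_bounded:
  fixes J :: "'a mat"
  assumes J: "J \<in> carrier_mat (2 * n) (2 * n)" "J\<^sup>T = - J" "det J \<noteq> 0"
    and bd: "\<And>Q. Q \<in> monics n \<Longrightarrow> \<bar>\<psi> Q\<bar> \<le> b"
  shows "\<bar>recip_mean n J \<psi>\<bar> \<le> b"
proof -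
  have c: "real (card (isometries (2 * n) J)) > 0" using card_isometries_pos[OF J(1)] by simp
  have "\<bar>\<Sum>M\<in>isometries (2 * n) J. \<psi> (recip_inv (char_poly M))\<bar> \<le> (\<Sum>M\<in>isometries (2 * n) J. \<bar>\<psi> (recip_inv (char_poly M))\<bar>)"
    by (rule sum_abs)
  also have "\<dots> \<le> (\<Sum>M\<in>isometries (2 * n) J. b)"
    by (intro sum_mono bd recip_inv_char_poly[OF J])
  finally show ?thesis
    unfolding recip_mean_def isometry_mean_def using c by (simp add: pos_divide_le_eq mult.commute)
qed

lemma recip_mean_sum:
  "recip_mean n J (\<lambda>Q. \<Sum>x\<in>X. a x * f x Q) = (\<Sum>x\<in>X. a x * recip_mean n (J :: 'a mat) (f x))"
  unfolding recip_mean_def isometry_mean_def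
  by (subst sum.swap) (simp add: sum_distrib_left sum_divide_distrib)

text \<open>In the recursion only the terms with \<open>deg A < k\<close> and \<open>deg B < k + 2\<close> survive; the power series
  \<open>majorant q k\<close> solves the recursion in which all of these are as large as possible.\<close>
lemma recip_mean_le_majorant:
  fixes J :: "'a mat" and \<psi> :: "'a poly \<Rightarrow> real"
  assumes "k \<ge> 1" "J \<in> carrier_mat (2 * n) (2 * n)" "J\<^sup>T = - J" "det J \<noteq> 0" "admissible k n \<psi>"
  shows "\<bar>recip_mean n J \<psi>\<bar> \<le> fps_nth (majorant (real (card (UNIV :: 'a set))) k) n"
  using assms(2-)
proof (induction n arbitrary: J \<psi> rule: less_induct)
  case (less n)
  define q where "q = real (card (UNIV :: 'a set))"
  have q: "q > 1" unfolding q_def by (rule card_field_gt_1)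
  let ?G = "\<lambda>m. fps_nth (majorant q k) m"
  show ?case
  proof (cases "n = 0")
    case True
    have "\<bar>recip_mean n J \<psi>\<bar> \<le> 1"
      using less.prems(4) by (intro recip_mean_bounded less.prems) (auto simp: admissible_def)
    then show ?thesis using True by (simp add: majorant_0)
  next
    case False
    let ?W = "\<lambda>m. recip_mean m (std_form m :: 'a mat)"
    \<comment> \<open>The contribution of \<open>deg B = l\<close> and \<open>deg A = d - l\<close>.
      Only \<open>d = 0\<close> involves a mean of size \<open>n\<close> again.\<close>
    define u where "u d l = (\<Sum>B\<in>monics l. \<Sum>A\<in>monics (d - l). real_of_int (disc_char B) * q ^ (d - l)
        * ?W (n - d) (\<lambda>Q. \<psi> (B * A * Q)))" for d l
    have u: "\<bar>u d l\<bar> \<le> (if l \<le> k + 1 \<and> d - l \<le> k - 1 then q ^ (2 * (d - l) + l) else 0) * ?G (n - d)"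
      if d: "1 \<le> d" "d \<le> n" and l: "l \<le> d" for d l
    proof -
      consider "d - l \<ge> k" | "l \<ge> k + 2" | "d - l \<le> k - 1" "l \<le> k + 1" by linarith
      then show ?thesis
      proof cases
        case 1
        have "(\<Sum>A\<in>monics (d - l). real_of_int (disc_char B) * q ^ (d - l) * ?W (n - d) (\<lambda>Q. \<psi> (B * A * Q))) = 0"
          if B: "B \<in> monics l" for B
        proof -
          have "\<bar>?W (n - d) (\<lambda>Q. \<Sum>A\<in>monics (d - l). real_of_int (disc_char B) * q ^ (d - l) * \<psi> (B * A * Q))\<bar> \<le> 0"
          proof (rule recip_mean_bounded[OF std_form_facts])
            fix Q :: "'a poly" assume "Q \<in> monics (n - d)"
            then have "B * Q \<in> monics (l + (n - d))" by (rule monics_mult[OF B])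
            moreover have "l + (n - d) = n - (d - l)" using d l by simp
            ultimately have "B * Q \<in> monics (n - (d - l))" by (simp only:)
            moreover have "d - l \<le> n" using d by simp
            ultimately have z: "(\<Sum>A\<in>monics (d - l). \<psi> (A * (B * Q))) = 0"
              using less.prems(4) 1 unfolding admissible_def by blast
            have c: "B * A * Q = A * (B * Q)" for A by (simp only: mult_ac)
            show "\<bar>\<Sum>A\<in>monics (d - l). real_of_int (disc_char B) * q ^ (d - l) * \<psi> (B * A * Q)\<bar> \<le> 0"
              unfolding c sum_distrib_left[symmetric] z by simp
          qed
          then show ?thesis unfolding recip_mean_sum by simp
        qed
        then have "u d l = 0" unfolding u_def by (intro sum.neutral) blast
        moreover have "\<not> (l \<le> k + 1 \<and> d - l \<le> k - 1)" using 1 assms(1) by linarith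
        ultimately show ?thesis by (simp only: if_False abs_zero mult_zero_left order.refl)
      next
        case 2
        have "(\<Sum>B\<in>monics l. real_of_int (disc_char B) * q ^ (d - l) * ?W (n - d) (\<lambda>Q. \<psi> (B * A * Q))) = 0"
          if A: "A \<in> monics (d - l)" for A
        proof -
          have "\<bar>?W (n - d) (\<lambda>Q. \<Sum>B\<in>monics l. real_of_int (disc_char B) * q ^ (d - l) * \<psi> (B * A * Q))\<bar> \<le> 0"
          proof (rule recip_mean_bounded[OF std_form_facts])
            fix Q :: "'a poly" assume "Q \<in> monics (n - d)"
            then have "A * Q \<in> monics (d - l + (n - d))" by (rule monics_mult[OF A])
            moreover have "d - l + (n - d) = n - l" using d l by simp
            ultimately have "A * Q \<in> monics (n - l)" by (simp only:)
            moreover have "l \<le> n" using d l by simp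
            ultimately have z: "(\<Sum>B\<in>monics l. real_of_int (disc_char B) * \<psi> (B * (A * Q))) = 0"
              using less.prems(4) 2 unfolding admissible_def by blast
            have c: "real_of_int (disc_char B) * q ^ (d - l) * \<psi> (B * A * Q)
                = q ^ (d - l) * (real_of_int (disc_char B) * \<psi> (B * (A * Q)))" for B by (simp only: mult_ac)
            show "\<bar>\<Sum>B\<in>monics l. real_of_int (disc_char B) * q ^ (d - l) * \<psi> (B * A * Q)\<bar> \<le> 0"
              unfolding c sum_distrib_left[symmetric] z by simp
          qed
          then show ?thesis unfolding recip_mean_sum by simp
        qed
        then have "u d l = 0" unfolding u_def by (subst sum.swap, intro sum.neutral) blast
        moreover have "\<not> (l \<le> k + 1 \<and> d - l \<le> k - 1)" using 2 by linarith
        ultimately show ?thesis by (simp only: if_False abs_zero mult_zero_left order.refl)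
      next
        case 3
        have "\<bar>u d l\<bar> \<le> (\<Sum>B\<in>(monics l :: 'a poly set). \<Sum>A\<in>(monics (d - l) :: 'a poly set). q ^ (d - l) * ?G (n - d))"
          unfolding u_def
        proof (intro order.trans[OF sum_abs] sum_mono)
          fix A B :: "'a poly" assume B: "B \<in> monics l" and A: "A \<in> monics (d - l)"
          have "B * A \<in> monics d" using monics_mult[OF B A] l by simp
          then have "admissible k (n - d) (\<lambda>Q. \<psi> (B * A * Q))" by (rule admissible_shift[OF less.prems(4) _ d(2)])
          moreover have "n - d < n" using d False by simp
          ultimately have W: "\<bar>?W (n - d) (\<lambda>Q. \<psi> (B * A * Q))\<bar> \<le> ?G (n - d)"
            unfolding q_def using less.IH[OF _ std_form_facts] by blast
          have "\<bar>real_of_int (disc_char B)\<bar> \<le> 1" using disc_char_cases[of B] by auto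
          then have "\<bar>real_of_int (disc_char B)\<bar> * q ^ (d - l) * \<bar>?W (n - d) (\<lambda>Q. \<psi> (B * A * Q))\<bar> \<le> 1 * q ^ (d - l) * ?G (n - d)"
            using W q by (intro mult_mono) auto
          then show "\<bar>real_of_int (disc_char B) * q ^ (d - l) * ?W (n - d) (\<lambda>Q. \<psi> (B * A * Q))\<bar> \<le> q ^ (d - l) * ?G (n - d)"
            using q by (simp add: abs_mult)
        qed
        also have "\<dots> = q ^ (2 * (d - l) + l) * ?G (n - d)"
        proof -
          have p: "q ^ (2 * (d - l) + l) = q ^ l * (q ^ (d - l) * q ^ (d - l))" by (simp add: power_add mult_2)
          show ?thesis unfolding p by (simp add: card_monics flip: q_def)
        qed
        finally show ?thesis using 3 by simp
      qed
    qed
    \<comment> \<open>The term \<open>d = 0\<close> is the mean for the standard form, whatever the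
      form on the left is. The bound is therefore obtained first for \<open>std_form n\<close>,
      where the difference is \<open>q^(2 * n) - 1\<close> times the mean, and then transferred to
      \<open>J\<close>.\<close>
    have step: "\<bar>q ^ (2 * n) * recip_mean n J' \<psi> - ?W n \<psi>\<bar> \<le> (q ^ (2 * n) - 1) * ?G n"
      if J': "J' \<in> carrier_mat (2 * n) (2 * n)" "J'\<^sup>T = - J'" "det J' \<noteq> 0" for J' :: "'a mat"
    proof -
      have "q ^ (2 * n) * recip_mean n J' \<psi> = (\<Sum>d\<le>n. \<Sum>l\<le>d. u d l)"
        unfolding u_def q_def by (rule recip_mean_recursion[OF two J'])
      also have "\<dots> = (\<Sum>l\<le>0. u 0 l) + (\<Sum>d=1..n. \<Sum>l\<le>d. u d l)"
        by (simp add: sum.atLeast_Suc_atMost flip: atLeast0AtMost)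
      also have "(\<Sum>l\<le>0. u 0 l) = ?W n \<psi>"
        using quad_char_square[of "1::'a"] by (simp add: u_def monics_0 disc_char_def)
      finally have "\<bar>q ^ (2 * n) * recip_mean n J' \<psi> - ?W n \<psi>\<bar> = \<bar>\<Sum>d=1..n. \<Sum>l\<le>d. u d l\<bar>" by simp
      also have "\<dots> \<le> (\<Sum>d=1..n. \<Sum>l\<le>d. \<bar>u d l\<bar>)"
        by (rule order.trans[OF sum_abs], rule sum_mono, rule sum_abs)
      also have "\<dots> \<le> (\<Sum>d=1..n. \<Sum>l\<le>d. (if l \<le> k + 1 \<and> d - l \<le> k - 1 then q ^ (2 * (d - l) + l) else 0) * ?G (n - d))"
        by (intro sum_mono u) auto
      also have "\<dots> \<le> (q ^ (2 * n) - 1) * ?G n"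
        unfolding sum_distrib_right[symmetric] by (rule majorant_recursion[OF q])
      finally show ?thesis .
    qed
    have q1: "q ^ (2 * n) > 1" using even_power_gt_1[OF q, of n] False by simp
    have "(q ^ (2 * n) - 1) * \<bar>?W n \<psi>\<bar> = \<bar>(q ^ (2 * n) - 1) * ?W n \<psi>\<bar>" using q1 by (simp add: abs_mult)
    also have "\<dots> = \<bar>q ^ (2 * n) * ?W n \<psi> - ?W n \<psi>\<bar>" by (simp add: left_diff_distrib)
    also have "\<dots> \<le> (q ^ (2 * n) - 1) * ?G n" by (rule step[OF std_form_facts])
    finally have W: "\<bar>?W n \<psi>\<bar> \<le> ?G n" using q1 by simp
    have "q ^ (2 * n) * \<bar>recip_mean n J \<psi>\<bar> = \<bar>q ^ (2 * n) * recip_mean n J \<psi>\<bar>" using q1 by (simp add: abs_mult)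
    also have "\<dots> \<le> \<bar>?W n \<psi>\<bar> + \<bar>q ^ (2 * n) * recip_mean n J \<psi> - ?W n \<psi>\<bar>" by linarith
    also have "\<dots> \<le> ?G n + (q ^ (2 * n) - 1) * ?G n" by (rule add_mono[OF W step[OF less.prems(1-3)]])
    also have "\<dots> = q ^ (2 * n) * ?G n" by (simp add: algebra_simps)
    finally show ?thesis unfolding q_def[symmetric] using q1 by simp
  qed
qed

text \<open>Dividing \<open>Q0\<close> by \<open>Q\<close> shows that the multiples of \<open>Q\<close> close to \<open>Q0\<close> are \<open>Q\<close> times the polynomials
  close to the quotient.\<close>
lemma close_multiples:
  fixes Q Q0 :: "'a poly"
  assumes Q0: "Q0 \<in> monics n" and Q: "Q \<in> monics (n - d)" and d: "k \<le> d" "d \<le> n"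
  obtains A0 where "A0 \<in> monics d" "\<And>A. A * Q - Q0 \<in> low_polys (n - k) \<longleftrightarrow> A - A0 \<in> low_polys (d - k)"
proof -
  define A0 where "A0 = Q0 div Q"
  define r where "r = Q0 mod Q"
  have l: "lead_coeff Q0 = 1" "lead_coeff Q = 1" and dg: "degree Q0 = n" "degree Q = n - d"
    using Q0 Q by (auto simp: monics_def)
  have nz: "Q0 \<noteq> 0" "Q \<noteq> 0" using l by auto
  have eq: "Q0 = A0 * Q + r" by (simp add: A0_def r_def)
  have r: "r \<in> low_polys (n - d)" unfolding low_polys_iff r_def using degree_mod_less[OF nz(2), of Q0] dg(2) by simp
  have "A0 * Q \<noteq> 0"
  proof
    assume "A0 * Q = 0"
    then have "Q0 = r" using eq by (simp only: add_0)
    then have "Q0 \<in> low_polys (n - d)" using r by simp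
    then have "degree Q0 < n - d" using nz(1) by (simp add: low_polys_iff)
    then show False using dg(1) by simp
  qed
  then have A0: "A0 \<noteq> 0" by auto
  have cf: "coeff Q0 i = coeff (A0 * Q) i" if "i \<ge> n - d" for i
    unfolding eq using r that by (simp add: low_polys_def)
  have dA: "degree (A0 * Q) = degree A0 + (n - d)" using A0 nz dg(2) by (simp add: degree_mult_eq)
  have "degree (A0 * Q) = n"
  proof (rule antisym)
    show "degree (A0 * Q) \<le> n"
      using cf[of "degree (A0 * Q)"] \<open>A0 * Q \<noteq> 0\<close> dg(1) le_degree[of Q0 "degree (A0 * Q)"] unfolding dA by (metis dA le_add2 leading_coeff_0_iff)
    show "n \<le> degree (A0 * Q)"
      using cf[of n] l(1) dg(1) by (intro le_degree) simp
  qed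
  then have dA0: "degree A0 = d" using dA d by simp
  have "lead_coeff (A0 * Q) = lead_coeff Q0" using cf[of n] \<open>degree (A0 * Q) = n\<close> dg(1) by simp
  then have "lead_coeff A0 = 1" using l unfolding lead_coeff_mult by simp
  then have A0m: "A0 \<in> monics d" using dA0 by (auto simp: monics_def)
  have "A * Q - Q0 \<in> low_polys (n - k) \<longleftrightarrow> A - A0 \<in> low_polys (d - k)" for A
  proof -
    have "A * Q - Q0 = (A - A0) * Q - r" by (subst eq) (simp add: left_diff_distrib)
    moreover have "r \<in> low_polys (n - k)" by (rule low_polys_mono[OF r]) (use d in simp)
    ultimately have "A * Q - Q0 \<in> low_polys (n - k) \<longleftrightarrow> (A - A0) * Q \<in> low_polys (n - k)" by (simp only: low_polys_diff_iff)
    also have "\<dots> \<longleftrightarrow> A - A0 \<in> low_polys (d - k)"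
    proof (cases "A - A0 = 0")
      case False
      then have "degree ((A - A0) * Q) = degree (A - A0) + (n - d)" using nz dg(2) by (simp add: degree_mult_eq)
      then show ?thesis using False nz d by (auto simp: low_polys_iff)
    qed (simp add: low_polys_def)
    finally show ?thesis .
  qed
  then show ?thesis using that A0m by blast
qed

text \<open>In degree \<open>d >= k\<close> the cofactors that bring a multiple of \<open>Q\<close>
  close to \<open>Q0\<close> form a coset of \<open>low_polys (d - k)\<close>, a proportion
  \<open>q^(- k)\<close> of all, so the centred sum is zero. If \<open>d - k >= 2\<close>,
  \<open>disc_char\<close> cancels over this coset as well as over all monic polynomials.\<close>

lemma admissible_close:
  fixes Q0 :: "'a poly"
  assumes Q0: "Q0 \<in> monics n" and k: "k \<le> n"
  shows "admissible k n (\<lambda>Q. (if Q - Q0 \<in> low_polys (n - k) then 1 else 0) - 1 / real (card (UNIV :: 'a set)) ^ k)"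
proof -
  define q where "q = real (card (UNIV :: 'a set))"
  have q: "q > 1" unfolding q_def by (rule card_field_gt_1)
  \<comment> \<open>Both vanishing sums are instances of one weighted sum, with weight 1 or
    \<open>disc_char\<close>: the indicator restricts to a coset, and the constant
    \<open>1 / q^k\<close> is summed separately.\<close>
  have weighted: "(\<Sum>A\<in>monics d. w A * ((if A * Q - Q0 \<in> low_polys (n - k) then 1 else 0) - 1 / q ^ k))
      = (\<Sum>r\<in>low_polys (d - k). w (A0 + r)) - (\<Sum>A\<in>monics d. w A) / q ^ k"
    if d: "k \<le> d" and A0: "A0 \<in> monics d" and iff: "\<And>A. A * Q - Q0 \<in> low_polys (n - k) \<longleftrightarrow> A - A0 \<in> low_polys (d - k)"
    for d Q A0 and w :: "'a poly \<Rightarrow> real"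
  proof -
    have "(\<Sum>r\<in>low_polys (d - k). w (A0 + r)) = (\<Sum>A | A \<in> monics d \<and> A - A0 \<in> low_polys (d - k). w A)"
      by (rule sum.reindex_bij_betw[OF monics_shift_bij[OF A0], of "d - k" w]) simp
    also have "\<dots> = (\<Sum>A\<in>monics d. w A * (if A * Q - Q0 \<in> low_polys (n - k) then 1 else 0))"
      unfolding iff by (simp add: sum.inter_filter[OF finite_monics] if_distrib cong: if_cong)
    finally show ?thesis by (simp add: right_diff_distrib sum_subtractf sum_divide_distrib)
  qed
  show ?thesis unfolding admissible_def q_def[symmetric]
  proof (intro conjI allI impI ballI)
    fix Q :: "'a poly"
    have "0 < 1 / q ^ k" "1 / q ^ k \<le> 1" using q by (auto simp: one_le_power)
    then show "\<bar>(if Q - Q0 \<in> low_polys (n - k) then 1 else 0) - 1 / q ^ k\<bar> \<le> 1" by simp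
  next
    fix d and Q :: "'a poly" assume d: "d \<le> n" "Q \<in> monics (n - d)"
    show "(\<Sum>A\<in>monics d. (if A * Q - Q0 \<in> low_polys (n - k) then 1 else 0) - 1 / q ^ k) = 0" if kd: "k \<le> d"
    proof -
      obtain A0 where A0: "A0 \<in> monics d" "\<And>A. A * Q - Q0 \<in> low_polys (n - k) \<longleftrightarrow> A - A0 \<in> low_polys (d - k)"
        using close_multiples[OF Q0 d(2) kd d(1)] by blast
      have "q ^ d = q ^ (d - k) * q ^ k" using kd by (simp flip: power_add)
      then have "q ^ (d - k) - q ^ d / q ^ k = 0" using q by simp
      then show ?thesis
        using weighted[OF kd A0, of "\<lambda>A. 1"] by (simp add: card_monics card_low_polys flip: q_def)
    qed
    show "(\<Sum>B\<in>monics d. real_of_int (disc_char B) * ((if B * Q - Q0 \<in> low_polys (n - k) then 1 else 0) - 1 / q ^ k)) = 0"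
      if kd: "k + 2 \<le> d"
    proof -
      have kd': "k \<le> d" "2 \<le> d - k" using kd by auto
      obtain A0 where A0: "A0 \<in> monics d" "\<And>A. A * Q - Q0 \<in> low_polys (n - k) \<longleftrightarrow> A - A0 \<in> low_polys (d - k)"
        using close_multiples[OF Q0 d(2) kd'(1) d(1)] by blast
      have "(\<Sum>r\<in>low_polys (d - k). real_of_int (disc_char (A0 + r))) = 0"
        using sum_disc_char_low[OF two kd'(2), of A0] by (simp flip: of_int_sum)
      moreover have "(\<Sum>A\<in>(monics d :: 'a poly set). real_of_int (disc_char A)) = 0"
        using sum_disc_char_monics[OF two, of d] kd by (simp flip: of_int_sum)
      ultimately show ?thesis
        using weighted[OF kd'(1) A0, of "\<lambda>A. real_of_int (disc_char A)"] by simp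
    qed
  qed
qed

text \<open>The coefficients of \<open>f\<close> from the middle upwards are mirrored to a
  palindromic \<open>p\<close>. For \<open>n <= h + 1\<close> it differs from \<open>f\<close> only
  in degrees at most \<open>h\<close>, so it may replace \<open>f\<close> as the centre; and
  \<open>recip_hom n\<close> raises the degree of a nonzero difference by exactly
  \<open>n\<close>.\<close>

lemma short_interval_is_close:
  fixes f :: "'a poly"
  assumes f: "lead_coeff f = 1" "degree f = 2 * n" and h: "n \<le> h + 1"
  obtains Q0 where "Q0 \<in> monics n"
    "\<And>Q. Q \<in> monics n \<Longrightarrow> recip_poly Q \<in> I_int f h \<longleftrightarrow> Q - Q0 \<in> low_polys (h + 1 - n)"
proof -
  define p where "p = vpoly (2 * n + 1) (\<lambda>i. coeff f (max i (2 * n - i)))"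
  have cp: "coeff p i = (if i \<le> 2 * n then coeff f (max i (2 * n - i)) else 0)" for i
    by (simp add: p_def coeff_vpoly)
  have dp: "degree p \<le> 2 * n" by (rule degree_le) (simp add: cp)
  have "rev_poly (2 * n) p = p" by (rule poly_eqI) (auto simp: coeff_rev_poly cp max.commute)
  then obtain Q0 where Q0: "degree Q0 \<le> n" "p = recip_hom n Q0" using rev_poly_fixed_is_recip_hom[OF dp] by blast
  have top: "coeff p (2 * n) = 1" using f by (simp add: cp)
  then have "Q0 \<noteq> 0" using Q0(2) by auto
  moreover have "degree p = 2 * n" using dp top by (intro antisym le_degree) auto
  ultimately have dQ: "degree Q0 = n" using recip_hom_nonzero[OF _ Q0(1)] Q0(2) by simp
  then have pr: "p = recip_poly Q0" using Q0(2) by (simp add: recip_poly_def)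
  have "lead_coeff Q0 = 1" using lead_coeff_recip_poly[of Q0] top \<open>degree p = 2 * n\<close> unfolding pr by simp
  then have Q0m: "Q0 \<in> monics n" using dQ by (auto simp: monics_def)
  have fp: "p - f \<in> low_polys (h + 1)" unfolding low_polys_def
  proof (intro CollectI allI impI)
    fix i assume "h + 1 \<le> i"
    then have "max i (2 * n - i) = i" using h by simp
    then show "coeff (p - f) i = 0" by (simp add: cp coeff_eq_0 f)
  qed
  have "recip_poly Q \<in> I_int f h \<longleftrightarrow> Q - Q0 \<in> low_polys (h + 1 - n)" if Q: "Q \<in> monics n" for Q
  proof -
    have lQ: "lead_coeff (recip_poly Q) = 1" and dQ': "degree Q = n"
      using Q lead_coeff_recip_poly[of Q] by (auto simp: monics_def)
    have "recip_poly Q \<in> I_int f h \<longleftrightarrow> f - recip_poly Q \<in> low_polys (h + 1)"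
      using lQ unfolding I_int_def low_polys_iff by (simp add: less_Suc_eq_le)
    also have "f - recip_poly Q = recip_hom n (Q0 - Q) - (p - f)"
      unfolding recip_hom_diff Q0(2)[symmetric] using dQ' by (simp add: recip_poly_def)
    also have "recip_hom n (Q0 - Q) - (p - f) \<in> low_polys (h + 1) \<longleftrightarrow> recip_hom n (Q0 - Q) \<in> low_polys (h + 1)"
      by (rule low_polys_diff_iff[OF fp])
    also have "\<dots> \<longleftrightarrow> Q0 - Q \<in> low_polys (h + 1 - n)"
    proof (cases "Q0 - Q = 0")
      case False
      have le: "degree (Q0 - Q) \<le> n" using dQ dQ' by (intro degree_diff_le) auto
      have dr: "degree (recip_hom n (Q0 - Q)) = n + degree (Q0 - Q)" by (rule recip_hom_nonzero[OF False le])
      have "recip_hom n (Q0 - Q) \<noteq> 0" using recip_hom_eq_0[OF le] False by blast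
      then show ?thesis using False dr h by (auto simp: low_polys_iff)
    qed (simp add: low_polys_def)
    also have "\<dots> \<longleftrightarrow> Q - Q0 \<in> low_polys (h + 1 - n)" by (auto simp: low_polys_def)
    finally show ?thesis .
  qed
  then show ?thesis using that Q0m by blast
qed

lemma recip_mean_close:
  fixes J :: "'a mat"
  assumes J: "J \<in> carrier_mat (2 * n) (2 * n)" "J\<^sup>T = - J" "det J \<noteq> 0"
    and iff: "\<And>Q. Q \<in> monics n \<Longrightarrow> recip_poly Q \<in> I \<longleftrightarrow> Q - Q0 \<in> L"
  shows "recip_mean n J (\<lambda>Q. (if Q - Q0 \<in> L then 1 else 0) - b)
    = real (card {M \<in> isometries (2 * n) J. char_poly M \<in> I}) / real (card (isometries (2 * n) J)) - b"
proof -
  have c: "real (card (isometries (2 * n) J)) > 0" using card_isometries_pos[OF J(1)] by simp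
  have "(\<Sum>M\<in>isometries (2 * n) J. (if recip_inv (char_poly M) - Q0 \<in> L then 1 else 0))
      = (\<Sum>M\<in>isometries (2 * n) J. if char_poly M \<in> I then 1 else 0 :: real)"
  proof (rule sum.cong[OF refl])
    fix M assume M: "M \<in> isometries (2 * n) J"
    show "(if recip_inv (char_poly M) - Q0 \<in> L then 1 else 0) = (if char_poly M \<in> I then 1 else 0 :: real)"
      using iff[OF recip_inv_char_poly(1)[OF J M]] recip_inv_char_poly(2)[OF J M] by simp
  qed
  also have "\<dots> = real (card {M \<in> isometries (2 * n) J. char_poly M \<in> I})"
    by (simp add: finite_isometries sum.If_cases Int_def)
  finally show ?thesis
    unfolding recip_mean_def isometry_mean_def sum_subtractf using c by (simp add: diff_divide_distrib)
qed

end

theorem theorem6p21: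
  fixes J :: "'a::{finite,field} mat" and f :: "'a poly" and n h :: nat
  assumes "odd (card (UNIV::'a set))"
    and "n \<ge> 1"
    and "J \<in> carrier_mat (2*n) (2*n)" and "transpose_mat J = - J" and "det J \<noteq> 0"
    and "h < 2*n - 1"
    and "lead_coeff f = 1" and "degree f = 2*n"
  shows "\<bar> real (card {M \<in> Sp (2*n) J. char_poly M \<in> I_int f h}) / real (card (Sp (2*n) J))
            - real (card (UNIV::'a set)) ^ (h+1) / real (card (UNIV::'a set)) ^ (2*n) \<bar>
         \<le> real (card (UNIV::'a set)) powr (- (real n ^ 2 / (4 * real n - 2 * real h - 2)))
            * real (card (UNIV::'a set)) powr (real n / 2)
            * (1 + 1 / (real (card (UNIV::'a set)) ^ 2 - 1)) ^ n
            * real ((5*n - 2*h - 3) choose n)"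
proof -
  have two: "(2::'a) \<noteq> 0" by (rule two_nonzero_of_odd_card[OF assms(1)])
  define q where "q = real (card (UNIV :: 'a set))"
  have q: "q > 1" unfolding q_def by (rule card_field_gt_1)
  define k where "k = 2 * n - 1 - h"
  have k: "k \<ge> 1" "h + 1 = 2 * n - k" "k \<le> 2 * n" using assms(2,6) by (auto simp: k_def)
  have e1: "4 * real n - 2 * real h - 2 = 2 * real k" using assms(2,6) by (auto simp: k_def of_nat_diff)
  have e2: "5 * n - 2 * h - 3 = n + 2 * k - 1" using assms(2,6) by (auto simp: k_def)
  have "q ^ (2 * n) = q ^ (h + 1) * q ^ k" using k by (simp flip: power_add)
  then have e3: "q ^ (h + 1) / q ^ (2 * n) = 1 / q ^ k" using q by simp
  have e4: "q powr (- (real n ^ 2 / (2 * real k))) * q powr (real n / 2) = q powr (real n / 2 - real n ^ 2 / (2 * real k))"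
    unfolding powr_add[symmetric] by (rule arg_cong[of _ _ "\<lambda>x. q powr x"]) simp
  have Sp: "Sp (2 * n) J = isometries (2 * n) J"
    using isometry_det[OF assms(3,5)] by (auto simp: Sp_def isometries_def)
  let ?P = "real (card {M \<in> isometries (2 * n) J. char_poly M \<in> I_int f h}) / real (card (isometries (2 * n) J))"
  have "\<bar>?P - 1 / q ^ k\<bar> \<le> q powr (real n / 2 - real n ^ 2 / (2 * real k)) * (1 + 1 / (q\<^sup>2 - 1)) ^ n * real ((n + 2 * k - 1) choose n)"
  proof (cases "k < n")
    case True
    have "n \<le> h + 1" using True k by simp
    then obtain Q0 where Q0: "Q0 \<in> monics n"
      "\<And>Q. Q \<in> monics n \<Longrightarrow> recip_poly Q \<in> I_int f h \<longleftrightarrow> Q - Q0 \<in> low_polys (h + 1 - n)"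
      using short_interval_is_close[OF two assms(7,8)] by blast
    have hk: "h + 1 - n = n - k" using k True by simp
    have adm: "admissible k n (\<lambda>Q. (if Q - Q0 \<in> low_polys (n - k) then 1 else 0) - 1 / q ^ k)"
      unfolding q_def using admissible_close[OF two Q0(1)] True by simp
    have "\<bar>?P - 1 / q ^ k\<bar> \<le> fps_nth (majorant q k) n"
    proof -
      have "recip_mean n J (\<lambda>Q. (if Q - Q0 \<in> low_polys (n - k) then 1 else 0) - 1 / q ^ k) = ?P - 1 / q ^ k"
        by (rule recip_mean_close[OF two assms(3-5) Q0(2)[unfolded hk]])
      then show ?thesis using recip_mean_le_majorant[OF two k(1) assms(3-5) adm] unfolding q_def by (simp only:)
    qed
    then show ?thesis using majorant_le[OF q k(1), of n] by (rule order.trans)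
  next
    \<comment> \<open>For \<open>k >= n\<close> the exponent \<open>n / 2 - n^2 / (2 * k)\<close> is
      nonnegative, so each factor of the bound is at least 1, while the two numbers on the left lie
      between 0 and 1.\<close>
    case False
    have q2: "q\<^sup>2 > 1" using q by (simp add: one_less_power)
    have "card {M \<in> isometries (2 * n) J. char_poly M \<in> I_int f h} \<le> card (isometries (2 * n) J)"
      by (rule card_mono[OF finite_isometries]) auto
    then have "0 \<le> ?P" "?P \<le> 1" by (auto simp: divide_le_eq_1)
    moreover have "0 < 1 / q ^ k" "1 / q ^ k \<le> 1" using q by (auto simp: one_le_power)
    ultimately have "\<bar>?P - 1 / q ^ k\<bar> \<le> 1" by linarith
    also have "1 = 1 * 1 * (1::real)" by simp
    also have "\<dots> \<le> q powr (real n / 2 - real n ^ 2 / (2 * real k)) * (1 + 1 / (q\<^sup>2 - 1)) ^ n * real ((n + 2 * k - 1) choose n)"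
    proof (intro mult_mono)
      have "real n * real n \<le> real k * real n" using False by (intro mult_right_mono) auto
      then have "real n ^ 2 / (2 * real k) \<le> real n / 2" using k(1) by (simp add: field_simps power2_eq_square)
      then show "1 \<le> q powr (real n / 2 - real n ^ 2 / (2 * real k))" using q by (intro ge_one_powr_ge_zero) auto
      show "1 \<le> (1 + 1 / (q\<^sup>2 - 1)) ^ n" using q2 by (intro one_le_power) simp
      have "(n + 2 * k - 1) choose n > 0" using k(1) by (intro zero_less_binomial) simp
      then show "1 \<le> real ((n + 2 * k - 1) choose n)" by linarith
    qed (use q2 in \<open>auto intro!: mult_nonneg_nonneg zero_le_power\<close>)
    finally show ?thesis .
  qed
  then show ?thesis unfolding Sp e1 e2 q_def[symmetric] e3 e4 .
qed

end
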